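(* Let $2 \leq k \leq 4$ and $\Psi_0 \in X^k(\mathbb{R})$. Then the unique solution $\Psi$ in $\mathcal{C}^0(\mathbb{R}, X^k(\mathbb{R}))$ to the Gross-Pitaevskii equation $i \partial_t \Psi + \partial_{\mathrm{x}}^2 \Psi = \Psi (|\Psi|^2 - 1)$ with initial datum $\Psi_0$ satisfies $$P_k \big( \Psi(\cdot, t) \big) = P_k(\Psi_0) \quad \text{and} \quad E_k \big( \Psi(\cdot, t) \big) = E_k(\Psi_0)$$ for any $t \in \mathbb{R}$, where the functionals $E_k$ and $P_k$ are defined in the context.
   Context: For $u : \mathbb{R} \to \mathbb{C}$, $E(u) = \frac12 \int_{\mathbb{R}} |\partial_{\mathrm{x}} u|^2 + \frac14 \int_{\mathbb{R}} (1 - |u|^2)^2$, and $X^k(\mathbb{R}) = \{ u \in L^1_{\rm loc}(\mathbb{R}, \mathbb{C}) : E(u) < +\infty,\ \partial_{\mathrm{x}} u \in H^{k-1}(\mathbb{R}) \}$, with the distance $d(u,v) = \|u - v\|_{L^\infty} + \|\partial_{\mathrm{x}} (u-v)\|_{H^{k-1}} + \| |u|^2 - |v|^2 \|_{L^2}$. For $\Psi_0\in X^k(\mathbb{R})$ the Gross-Pitaevskii equation has a unique solution in $\mathcal{C}^0(\mathbb{R},X^k(\mathbb{R}))$ with initial datum $\Psi_0$. Write $\langle z_1, z_2 \rangle = \mathrm{Re}(z_1 \overline{z_2})$, $\eta = 1 - |\Psi|^2$, and $\partial = \partial_{\mathrm{x}}$. All integrals are over $\mathbb{R}$. $$E_2(\Psi)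 = \frac12 \int |\partial^2 \Psi|^2 - \frac32 \int \eta |\partial \Psi|^2 + \frac14 \int (\partial \eta)^2 - \frac14 \int \eta^3,$$ $$E_3(\Psi) = \frac12 \int |\partial^3 \Psi|^2 + \frac14 \int |\partial^2 \eta|^2 + \frac54 \int |\partial \Psi|^4 + \frac52 \int \partial^2 \eta |\partial \Psi|^2 - \frac52 \int \eta |\partial^2 \Psi|^2 - \frac54 \int \eta (\partial \eta)^2 + \frac{15}{4} \int \eta^2 |\partial \Psi|^2 + \frac{5}{16} \int \eta^4,$$ $$\begin{aligned} E_4(\Psi) = {} & \frac12 \int |\partial^4 \Psi|^2 + \frac14 \int |\partial^3 \eta|^2 - \frac74 \int \eta (\partial^2 \eta)^2 - \frac72 \int \eta |\partial^3 \Psi|^2 + \frac{35}{8} \int \eta^2 (\partial \eta)^2 + \frac{35}{4} \int \eta^2 |\partial^2 \Psi|^2 \\ & - \frac{35}{4} \int (\partial \eta)^2 |\partial \Psi|^2 - \frac72 \int |\partial \Psi|^2 |\partial^2 \Psi|^2 - 7 \int \partial^2 \eta \langle \partial \Psi, \partial^3 \Psi\rangle - 7 \int |\partial \Psi|^2 \langle \partial \Psi, \partial^3 \Psi \rangle \\ & - \frac{35}{2} \int \eta\, \partial^2 \eta |\partial \Psi|^2 - \frac{35}{4} \int \eta^3 |\partial \Psi|^2 - \frac{35}{4} \int \eta |\partial \Psi|^4 - \frac{7}{16} \int \eta^5, \end{aligned}$$ $$P_2(\Psi) = \frac12 \int \langle i \partial^2 \Psi, \partial \Psi \rangle - \frac34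 \int \eta \langle i \partial \Psi, \Psi \rangle,$$ $$P_3(\Psi) = \frac12 \int \langle i \partial^3 \Psi, \partial^2 \Psi \rangle - \frac52 \int \eta \langle i \partial^2 \Psi, \partial \Psi \rangle + \frac54 \int (\eta^2 + \eta) \langle i \partial \Psi, \Psi \rangle,$$ $$\begin{aligned} P_4(\Psi) = {} & \frac12 \int \langle i \partial^4 \Psi, \partial^3 \Psi \rangle - \frac72 \int \eta \langle i \partial^3 \Psi, \partial^2 \Psi \rangle + \frac72 \int \partial^2 \eta \langle i \partial^2 \Psi, \partial \Psi \rangle + \frac74 \int |\partial \Psi|^2 \langle i \partial^2 \Psi, \partial \Psi \rangle \\ & + \frac{35}{4} \int \eta^2 \langle i \partial^2 \Psi, \partial \Psi \rangle - \frac{35}{16} \int (\eta^3 + \eta^2 + \eta) \langle i \partial \Psi, \Psi \rangle. \end{aligned}$$ *)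

theory Defs
  imports "HOL-Probability.Essential_Supremum"
begin

primrec Ck :: "nat \<Rightarrow> ('a::euclidean_space \<Rightarrow> real) \<Rightarrow> bool" where
  "Ck 0 f \<longleftrightarrow> continuous_on UNIV f"
| "Ck (Suc n) f \<longleftrightarrow> (\<forall>x. f differentiable (at x)) \<and>
     (\<forall>b\<in>Basis. Ck n (\<lambda>x. frechet_derivative f (at x) b))"

definition test_function :: "('a::euclidean_space \<Rightarrow> real) \<Rightarrow> bool" where
  "test_function \<phi> \<longleftrightarrow> (\<forall>n. Ck n \<phi>) \<and> compact (closure {x. \<phi> x \<noteq> 0})"

definition L1_loc :: "(real \<Rightarrow> 'a::euclidean_space) set" where
  "L1_loc = {u. \<forall>K. compact K \<longrightarrow> u absolutely_integrable_on K}"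

definition has_weak_deriv ::
    "nat \<Rightarrow> (real \<Rightarrow> 'a::euclidean_space) \<Rightarrow> (real \<Rightarrow> 'a) \<Rightarrow> bool" where
  "has_weak_deriv j u v \<longleftrightarrow> u \<in> L1_loc \<and> v \<in> L1_loc \<and>
     (\<forall>\<phi>::real \<Rightarrow> real. test_function \<phi> \<longrightarrow>
        (LINT x|lebesgue. (deriv ^^ j) \<phi> x *\<^sub>R u x)
          = (-1) ^ j *\<^sub>R (LINT x|lebesgue. \<phi> x *\<^sub>R v x))"

text \<open>A representative of the weak derivative. It is determined up to a null set, and below it
  only occurs in ways that do not depend on its values on null sets.\<close>

definition weak_deriv ::
    "nat \<Rightarrow> (real \<Rightarrow> 'a::euclidean_space) \<Rightarrow> real \<Rightarrow> 'a"  ("\<partial>\<^bsup>_\<^esup>") where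
  "\<partial>\<^bsup>j\<^esup> u = (SOME v. has_weak_deriv j u v)"

definition in_L2 :: "(real \<Rightarrow> 'a::euclidean_space) \<Rightarrow> bool" where
  "in_L2 f \<longleftrightarrow> f \<in> borel_measurable lebesgue \<and> integrable lebesgue (\<lambda>x. (norm (f x))\<^sup>2)"

definition sobolev_H :: "nat \<Rightarrow> (real \<Rightarrow> 'a::euclidean_space) set" where
  "sobolev_H m = {f. in_L2 f \<and> (\<forall>j\<in>{1..m}. \<exists>g. has_weak_deriv j f g \<and> in_L2 g)}"

text \<open>The following norms are real-valued and only meaningful on functions for which they are
  finite; this is the case for all functions occurring in the distance of two elements of the
  energy space defined below.\<close>

definition L2_norm :: "(real \<Rightarrow> 'a::euclidean_space) \<Rightarrow> real" where
  "L2_norm f = sqrt (LINT x|lebesgue. (norm (f x))\<^sup>2)"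

definition Linf_norm :: "(real \<Rightarrow> 'a::euclidean_space) \<Rightarrow> real" where
  "Linf_norm f = real_of_ereal (esssup lebesgue (\<lambda>x. ereal (norm (f x))))"

definition sobolev_norm :: "nat \<Rightarrow> (real \<Rightarrow> 'a::euclidean_space) \<Rightarrow> real" where
  "sobolev_norm m f = sqrt ((L2_norm f)\<^sup>2 + (\<Sum>j=1..m. (L2_norm (\<partial>\<^bsup>j\<^esup> f))\<^sup>2))"

definition GL_energy :: "(real \<Rightarrow> complex) \<Rightarrow> ennreal" where
  "GL_energy u = (\<integral>\<^sup>+ x. ennreal ((cmod (\<partial>\<^bsup>1\<^esup> u x))\<^sup>2) \<partial>lebesgue) / 2
     + (\<integral>\<^sup>+ x. ennreal ((1 - (cmod (u x))\<^sup>2)\<^sup>2) \<partial>lebesgue) / 4"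

definition X :: "nat \<Rightarrow> (real \<Rightarrow> complex) set" where
  "X k = {u. u \<in> L1_loc \<and> (\<exists>v. has_weak_deriv 1 u v) \<and> GL_energy u < \<infinity>
             \<and> \<partial>\<^bsup>1\<^esup> u \<in> sobolev_H (k - 1)}"

definition X_dist :: "nat \<Rightarrow> (real \<Rightarrow> complex) \<Rightarrow> (real \<Rightarrow> complex) \<Rightarrow> real" where
  "X_dist k u v = Linf_norm (\<lambda>x. u x - v x)
     + sobolev_norm (k - 1) (\<partial>\<^bsup>1\<^esup> (\<lambda>x. u x - v x))
     + L2_norm (\<lambda>x. (cmod (u x))\<^sup>2 - (cmod (v x))\<^sup>2)"

definition X_continuous :: "nat \<Rightarrow> (real \<Rightarrow> real \<Rightarrow> complex) \<Rightarrow> bool" where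
  "X_continuous k \<Psi> \<longleftrightarrow> (\<forall>t. \<Psi> t \<in> X k) \<and>
     (\<forall>t. ((\<lambda>s. X_dist k (\<Psi> s) (\<Psi> t)) \<longlongrightarrow> 0) (at t))"

text \<open>The equation holds in the sense of distributions on space-time; a space-time function is
  written \<open>\<Psi> t x\<close>, a test function \<open>\<phi> (t, x)\<close>. Since \<open>\<Psi>\<close> is only
  given as a family of (classes of) functions of \<open>x\<close>, the integrals are iterated.\<close>

definition pd_t :: "(real \<times> real \<Rightarrow> real) \<Rightarrow> real \<times> real \<Rightarrow> real" where
  "pd_t \<phi> p = frechet_derivative \<phi> (at p) (1, 0)"

definition pd_x :: "(real \<times> real \<Rightarrow> real) \<Rightarrow> real \<times> real \<Rightarrow> real" where
  "pd_x \<phi> p = frechet_derivative \<phi> (at p) (0, 1)"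

definition GP_equation :: "(real \<Rightarrow> real \<Rightarrow> complex) \<Rightarrow> bool" where
  "GP_equation \<Psi> \<longleftrightarrow> (\<forall>\<phi>. test_function \<phi> \<longrightarrow>
     (LINT t|lebesgue. LINT x|lebesgue.
         - (\<i> * \<Psi> t x * of_real (pd_t \<phi> (t, x))) + \<Psi> t x * of_real (pd_x (pd_x \<phi>) (t, x)))
     = (LINT t|lebesgue. LINT x|lebesgue.
         \<Psi> t x * of_real ((cmod (\<Psi> t x))\<^sup>2 - 1) * of_real (\<phi> (t, x))))"

text \<open>Equality with the initial datum is equality in the space \<open>X k\<close>, that is, almost everywhere.\<close>

definition GP_solution ::
    "nat \<Rightarrow> (real \<Rightarrow> complex) \<Rightarrow> (real \<Rightarrow> real \<Rightarrow> complex) \<Rightarrow> bool" where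
  "GP_solution k \<Psi>\<^sub>0 \<Psi> \<longleftrightarrow> X_continuous k \<Psi> \<and> GP_equation \<Psi> \<and>
     (AE x in lebesgue. \<Psi> 0 x = \<Psi>\<^sub>0 x)"

definition cprod :: "complex \<Rightarrow> complex \<Rightarrow> real"  ("\<langle>_, _\<rangle>") where
  "\<langle>z, w\<rangle> = Re (z * cnj w)"

definition eta :: "(real \<Rightarrow> complex) \<Rightarrow> real \<Rightarrow> real" where
  "eta \<Psi> x = 1 - (cmod (\<Psi> x))\<^sup>2"

definition E2 :: "(real \<Rightarrow> complex) \<Rightarrow> real" where
  "E2 \<Psi> = (let \<eta> = eta \<Psi> in
     1/2 * (LINT x|lebesgue. (cmod (\<partial>\<^bsup>2\<^esup> \<Psi> x))\<^sup>2)
   - 3/2 * (LINT x|lebesgue. \<eta> x * (cmod (\<partial>\<^bsup>1\<^esup> \<Psi> x))\<^sup>2)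
   + 1/4 * (LINT x|lebesgue. (\<partial>\<^bsup>1\<^esup> \<eta> x)\<^sup>2)
   - 1/4 * (LINT x|lebesgue. \<eta> x ^ 3))"

definition E3 :: "(real \<Rightarrow> complex) \<Rightarrow> real" where
  "E3 \<Psi> = (let \<eta> = eta \<Psi> in
     1/2 * (LINT x|lebesgue. (cmod (\<partial>\<^bsup>3\<^esup> \<Psi> x))\<^sup>2)
   + 1/4 * (LINT x|lebesgue. \<bar>\<partial>\<^bsup>2\<^esup> \<eta> x\<bar>\<^sup>2)
   + 5/4 * (LINT x|lebesgue. cmod (\<partial>\<^bsup>1\<^esup> \<Psi> x) ^ 4)
   + 5/2 * (LINT x|lebesgue. \<partial>\<^bsup>2\<^esup> \<eta> x * (cmod (\<partial>\<^bsup>1\<^esup> \<Psi> x))\<^sup>2)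
   - 5/2 * (LINT x|lebesgue. \<eta> x * (cmod (\<partial>\<^bsup>2\<^esup> \<Psi> x))\<^sup>2)
   - 5/4 * (LINT x|lebesgue. \<eta> x * (\<partial>\<^bsup>1\<^esup> \<eta> x)\<^sup>2)
   + 15/4 * (LINT x|lebesgue. (\<eta> x)\<^sup>2 * (cmod (\<partial>\<^bsup>1\<^esup> \<Psi> x))\<^sup>2)
   + 5/16 * (LINT x|lebesgue. \<eta> x ^ 4))"

definition E4 :: "(real \<Rightarrow> complex) \<Rightarrow> real" where
  "E4 \<Psi> = (let \<eta> = eta \<Psi> in
     1/2 * (LINT x|lebesgue. (cmod (\<partial>\<^bsup>4\<^esup> \<Psi> x))\<^sup>2)
   + 1/4 * (LINT x|lebesgue. \<bar>\<partial>\<^bsup>3\<^esup> \<eta> x\<bar>\<^sup>2)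
   - 7/4 * (LINT x|lebesgue. \<eta> x * (\<partial>\<^bsup>2\<^esup> \<eta> x)\<^sup>2)
   - 7/2 * (LINT x|lebesgue. \<eta> x * (cmod (\<partial>\<^bsup>3\<^esup> \<Psi> x))\<^sup>2)
   + 35/8 * (LINT x|lebesgue. (\<eta> x)\<^sup>2 * (\<partial>\<^bsup>1\<^esup> \<eta> x)\<^sup>2)
   + 35/4 * (LINT x|lebesgue. (\<eta> x)\<^sup>2 * (cmod (\<partial>\<^bsup>2\<^esup> \<Psi> x))\<^sup>2)
   - 35/4 * (LINT x|lebesgue. (\<partial>\<^bsup>1\<^esup> \<eta> x)\<^sup>2 * (cmod (\<partial>\<^bsup>1\<^esup> \<Psi> x))\<^sup>2)
   - 7/2 * (LINT x|lebesgue. (cmod (\<partial>\<^bsup>1\<^esup> \<Psi> x))\<^sup>2 * (cmod (\<partial>\<^bsup>2\<^esup> \<Psi> x))\<^sup>2)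
   - 7 * (LINT x|lebesgue. \<partial>\<^bsup>2\<^esup> \<eta> x * \<langle>\<partial>\<^bsup>1\<^esup> \<Psi> x, \<partial>\<^bsup>3\<^esup> \<Psi> x\<rangle>)
   - 7 * (LINT x|lebesgue. (cmod (\<partial>\<^bsup>1\<^esup> \<Psi> x))\<^sup>2 * \<langle>\<partial>\<^bsup>1\<^esup> \<Psi> x, \<partial>\<^bsup>3\<^esup> \<Psi> x\<rangle>)
   - 35/2 * (LINT x|lebesgue. \<eta> x * \<partial>\<^bsup>2\<^esup> \<eta> x * (cmod (\<partial>\<^bsup>1\<^esup> \<Psi> x))\<^sup>2)
   - 35/4 * (LINT x|lebesgue. \<eta> x ^ 3 * (cmod (\<partial>\<^bsup>1\<^esup> \<Psi> x))\<^sup>2)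
   - 35/4 * (LINT x|lebesgue. \<eta> x * cmod (\<partial>\<^bsup>1\<^esup> \<Psi> x) ^ 4)
   - 7/16 * (LINT x|lebesgue. \<eta> x ^ 5))"

definition P2 :: "(real \<Rightarrow> complex) \<Rightarrow> real" where
  "P2 \<Psi> = (let \<eta> = eta \<Psi> in
     1/2 * (LINT x|lebesgue. \<langle>\<i> * \<partial>\<^bsup>2\<^esup> \<Psi> x, \<partial>\<^bsup>1\<^esup> \<Psi> x\<rangle>)
   - 3/4 * (LINT x|lebesgue. \<eta> x * \<langle>\<i> * \<partial>\<^bsup>1\<^esup> \<Psi> x, \<Psi> x\<rangle>))"

definition P3 :: "(real \<Rightarrow> complex) \<Rightarrow> real" where
  "P3 \<Psi> = (let \<eta> = eta \<Psi> in
     1/2 * (LINT x|lebesgue. \<langle>\<i> * \<partial>\<^bsup>3\<^esup> \<Psi> x, \<partial>\<^bsup>2\<^esup> \<Psi> x\<rangle>)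
   - 5/2 * (LINT x|lebesgue. \<eta> x * \<langle>\<i> * \<partial>\<^bsup>2\<^esup> \<Psi> x, \<partial>\<^bsup>1\<^esup> \<Psi> x\<rangle>)
   + 5/4 * (LINT x|lebesgue. ((\<eta> x)\<^sup>2 + \<eta> x) * \<langle>\<i> * \<partial>\<^bsup>1\<^esup> \<Psi> x, \<Psi> x\<rangle>))"

definition P4 :: "(real \<Rightarrow> complex) \<Rightarrow> real" where
  "P4 \<Psi> = (let \<eta> = eta \<Psi> in
     1/2 * (LINT x|lebesgue. \<langle>\<i> * \<partial>\<^bsup>4\<^esup> \<Psi> x, \<partial>\<^bsup>3\<^esup> \<Psi> x\<rangle>)
   - 7/2 * (LINT x|lebesgue. \<eta> x * \<langle>\<i> * \<partial>\<^bsup>3\<^esup> \<Psi> x, \<partial>\<^bsup>2\<^esup> \<Psi> x\<rangle>)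
   + 7/2 * (LINT x|lebesgue. \<partial>\<^bsup>2\<^esup> \<eta> x * \<langle>\<i> * \<partial>\<^bsup>2\<^esup> \<Psi> x, \<partial>\<^bsup>1\<^esup> \<Psi> x\<rangle>)
   + 7/4 * (LINT x|lebesgue. (cmod (\<partial>\<^bsup>1\<^esup> \<Psi> x))\<^sup>2 * \<langle>\<i> * \<partial>\<^bsup>2\<^esup> \<Psi> x, \<partial>\<^bsup>1\<^esup> \<Psi> x\<rangle>)
   + 35/4 * (LINT x|lebesgue. (\<eta> x)\<^sup>2 * \<langle>\<i> * \<partial>\<^bsup>2\<^esup> \<Psi> x, \<partial>\<^bsup>1\<^esup> \<Psi> x\<rangle>)
   - 35/16 * (LINT x|lebesgue. (\<eta> x ^ 3 + (\<eta> x)\<^sup>2 + \<eta> x) * \<langle>\<i> * \<partial>\<^bsup>1\<^esup> \<Psi> x, \<Psi> x\<rangle>))"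

text \<open>Only the indices 2, 3 and 4 are meaningful.\<close>

definition GP_E :: "nat \<Rightarrow> (real \<Rightarrow> complex) \<Rightarrow> real" where
  "GP_E k = (if k = 2 then E2 else if k = 3 then E3 else if k = 4 then E4 else undefined)"

definition GP_P :: "nat \<Rightarrow> (real \<Rightarrow> complex) \<Rightarrow> real" where
  "GP_P k = (if k = 2 then P2 else if k = 3 then P3 else if k = 4 then P4 else undefined)"

end

theory Submission
  imports Defs "HOL-Computational_Algebra.Polynomial"
begin

text \<open>Let \<open>\<Psi>\<^sub>\<epsilon>\<close> be the mollification of the solution \<open>\<Psi>\<close> in the space variable. It is smooth in \<open>x\<close>, differentiable
  in \<open>t\<close>, and solves the equation up to the commutator \<open>R\<^sub>\<epsilon> = F(\<Psi>)\<^sub>\<epsilon> - F(\<Psi>\<^sub>\<epsilon>)\<close> of the mollification with the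
  nonlinearity \<open>F\<close>. Each density \<open>e\<close> satisfies an algebraic identity \<open>\<partial>\<^sub>t e = \<partial>\<^sub>x J\<close> along smooth solutions, whose flux
  \<open>J\<close> vanishes at infinity, so that the time derivative of the integral of \<open>e\<close> at \<open>\<Psi>\<^sub>\<epsilon>\<close> is the variation of \<open>e\<close> in
  the direction \<open>- \<i> R\<^sub>\<epsilon>\<close>. This variation only involves \<open>k\<close> derivatives of \<open>R\<^sub>\<epsilon>\<close>, and \<open>R\<^sub>\<epsilon>\<close> tends to zero in \<open>H\<^sup>k\<close>
  because \<open>F\<close> maps \<open>X\<^sup>k\<close> to \<open>H\<^sup>k\<close>. Hence neither the regularity of the flow nor its continuous dependence on the
  initial datum is needed.\<close>


section \<open>Test functions and mollifiers\<close>

text \<open>The equation is only assumed in the sense of distributions, for a family of classes of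
  functions of \<open>x\<close> that is continuous in time. Mollification in \<open>x\<close> alone
  is enough: tested with products \<theta>(t) \<rho>(x - y), the equation says that a continuous
  function of time has a continuous weak derivative, and such a derivative is classical. The
  identity between density and flux is required for arbitrary jets, as an identity of polynomials in
  independent variables. The variation of a density is linear in its direction, so the commutator
  splits off exactly. The obstacle is that \<Psi> is bounded but does not decay; only \<eta> and the
  derivatives of \<Psi> are in L2. Boundedness, square integrability and integrability are therefore
  read off from the syntax of a polynomial in the jet. Moreover \<eta> of a mollification is not the
  mollification of \<eta>; its convergence in L2 comes from a rate for the mollification of \<Psi>
  that involves only \<partial>\<Psi>.\<close>

lemma Ck_mono_Suc: "Ck (Suc n) f \<Longrightarrow> Ck n f"
proof (induction n arbitrary: f)
  case 0
  then show ?case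
    by (auto intro!: continuous_at_imp_continuous_on differentiable_imp_continuous_within)
next
  case (Suc n)
  show ?case unfolding Ck.simps(2)[of n]
  proof (intro conjI ballI)
    show "\<forall>x. f differentiable at x" using Suc.prems by simp
    fix b :: 'a assume "b \<in> Basis"
    then show "Ck n (\<lambda>x. frechet_derivative f (at x) b)"
      using Suc.prems by (intro Suc.IH) (metis Ck.simps(2))
  qed
qed

lemma Ck_Suc_realI:
  fixes f :: "real \<Rightarrow> real"
  assumes "\<And>x. (f has_real_derivative f' x) (at x)" "Ck n f'"
  shows "Ck (Suc n) f"
proof -
  have "frechet_derivative f (at x) = (\<lambda>h. f' x * h)" for x
    using frechet_derivative_at[of f "\<lambda>h. f' x * h" x] assms(1)[of x]
    by (simp add: has_field_derivative_def)
  then show ?thesis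
    using assms by (auto simp: real_differentiable_def intro: differentiableI)
qed

lemma Ck_Suc_realD:
  fixes f :: "real \<Rightarrow> real"
  assumes "Ck (Suc n) f"
  shows "(f has_real_derivative deriv f x) (at x)" "Ck n (deriv f)"
proof -
  have d: "(f has_real_derivative deriv f x) (at x)" for x
    using assms by (auto simp: DERIV_deriv_iff_real_differentiable)
  then show "(f has_real_derivative deriv f x) (at x)" .
  have "frechet_derivative f (at x) = (\<lambda>h. deriv f x * h)" for x
    using frechet_derivative_at[of f "\<lambda>h. deriv f x * h" x] d[of x]
    by (simp add: has_field_derivative_def)
  then show "Ck n (deriv f)" using assms by simp
qed

declare Ck.simps(2) [simp del]

section \<open>Closure properties of smooth functions\<close>

lemma Ck_const: "Ck n (\<lambda>x::real. c)"
  by (induction n arbitrary: c) (auto intro!: Ck_Suc_realI derivative_eq_intros)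

lemma Ck_add: "Ck n f \<Longrightarrow> Ck n g \<Longrightarrow> Ck n (\<lambda>x::real. f x + g x)"
proof (induction n arbitrary: f g)
  case (Suc n)
  then show ?case
    by (intro Ck_Suc_realI[where f'="\<lambda>x. deriv f x + deriv g x"])
      (auto intro!: derivative_intros dest: Ck_Suc_realD)
qed (auto intro: continuous_intros)

lemma Ck_mult: "Ck n f \<Longrightarrow> Ck n g \<Longrightarrow> Ck n (\<lambda>x::real. f x * g x)"
proof (induction n arbitrary: f g)
  case (Suc n)
  have "((\<lambda>x. f x * g x) has_real_derivative deriv f x * g x + deriv g x * f x) (at x)" for x
    by (rule DERIV_mult[OF Ck_Suc_realD(1)[OF Suc.prems(1)] Ck_Suc_realD(1)[OF Suc.prems(2)]])
  moreover have "Ck n (\<lambda>x. deriv f x * g x + deriv g x * f x)"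
    using Suc.prems by (intro Ck_add Suc.IH) (auto dest: Ck_Suc_realD Ck_mono_Suc)
  ultimately show ?case by (rule Ck_Suc_realI)
qed (auto intro: continuous_intros)

lemma Ck_affine: "Ck n f \<Longrightarrow> Ck n (\<lambda>x::real. f (a + b * x))"
proof (induction n arbitrary: f)
  case 0
  then show ?case by (auto intro!: continuous_on_compose2[of UNIV f] continuous_intros)
next
  case (Suc n)
  have "((\<lambda>x. f (a + b * x)) has_real_derivative deriv f (a + b * x) * b) (at x)" for x
    by (rule DERIV_chain2[OF Ck_Suc_realD(1)[OF Suc.prems]]) (auto intro!: derivative_eq_intros)
  moreover have "Ck n (\<lambda>x. deriv f (a + b * x) * b)"
    using Suc by (intro Ck_mult Ck_const) (auto dest: Ck_Suc_realD)
  ultimately show ?case by (rule Ck_Suc_realI)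
qed

text \<open>The equation is tested on the plane, but only with products of a function of t and a
  function of x. Each partial derivative of such a product is again a product, which closes the
  induction.\<close>

lemma Ck_tensor:
  fixes \<theta> \<xi> :: "real \<Rightarrow> real"
  shows "Ck n \<theta> \<Longrightarrow> Ck n \<xi> \<Longrightarrow> Ck n (\<lambda>p. \<theta> (fst p) * \<xi> (snd p))"
proof (induction n arbitrary: \<theta> \<xi>)
  case 0
  then show ?case
    by (auto intro!: continuous_intros continuous_on_compose2[of UNIV \<theta>] continuous_on_compose2[of UNIV \<xi>])
next
  case (Suc n)
  note d = Ck_Suc_realD[OF Suc.prems(1)] Ck_Suc_realD[OF Suc.prems(2)]
  have D: "((\<lambda>p. \<theta> (fst p) * \<xi> (snd p)) has_derivative
      (\<lambda>h. \<theta> (fst p) * (deriv \<xi> (snd p) * snd h) + deriv \<theta> (fst p) * fst h * \<xi> (snd p))) (at p)" for p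
    by (intro has_derivative_mult has_derivative_compose[where g=\<theta> and f=fst] 
          has_derivative_compose[where g=\<xi> and f=snd] has_derivative_fst has_derivative_snd
          has_derivative_ident d[unfolded has_field_derivative_def])
  have fd: "frechet_derivative (\<lambda>p. \<theta> (fst p) * \<xi> (snd p)) (at p) =
      (\<lambda>h. \<theta> (fst p) * (deriv \<xi> (snd p) * snd h) + deriv \<theta> (fst p) * fst h * \<xi> (snd p))" for p
    by (rule frechet_derivative_at[OF D, symmetric])
  have "Ck n (\<lambda>p. deriv \<theta> (fst p) * \<xi> (snd p))" "Ck n (\<lambda>p. \<theta> (fst p) * deriv \<xi> (snd p))"
    using Suc.prems[THEN Ck_mono_Suc] d by (auto intro!: Suc.IH)
  then show ?case using D by (auto simp: Ck.simps(2) Basis_prod_def fd intro: differentiableI)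
qed

lemma pd_tensor:
  fixes \<theta> \<xi> :: "real \<Rightarrow> real"
  assumes "Ck 1 \<theta>" "Ck 1 \<xi>"
  shows "pd_t (\<lambda>p. \<theta> (fst p) * \<xi> (snd p)) = (\<lambda>p. deriv \<theta> (fst p) * \<xi> (snd p))"
    and "pd_x (\<lambda>p. \<theta> (fst p) * \<xi> (snd p)) = (\<lambda>p. \<theta> (fst p) * deriv \<xi> (snd p))"
proof -
  note d = Ck_Suc_realD(1)[OF assms(1)[unfolded One_nat_def]] Ck_Suc_realD(1)[OF assms(2)[unfolded One_nat_def]]
  have "((\<lambda>p. \<theta> (fst p) * \<xi> (snd p)) has_derivative
      (\<lambda>h. \<theta> (fst p) * (deriv \<xi> (snd p) * snd h) + deriv \<theta> (fst p) * fst h * \<xi> (snd p))) (at p)" for p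
    by (intro has_derivative_mult has_derivative_compose[where g=\<theta> and f=fst] 
          has_derivative_compose[where g=\<xi> and f=snd] has_derivative_fst has_derivative_snd
          has_derivative_ident d[unfolded has_field_derivative_def])
  from frechet_derivative_at[OF this, symmetric]
  show "pd_t (\<lambda>p. \<theta> (fst p) * \<xi> (snd p)) = (\<lambda>p. deriv \<theta> (fst p) * \<xi> (snd p))"
    and "pd_x (\<lambda>p. \<theta> (fst p) * \<xi> (snd p)) = (\<lambda>p. \<theta> (fst p) * deriv \<xi> (snd p))"
    by (auto simp: pd_t_def pd_x_def)
qed

section \<open>Test functions on the line\<close>

lemma compact_support_iff:
  "compact (closure {x. \<phi> x \<noteq> 0}) \<longleftrightarrow> (\<exists>R. \<forall>x::'a::euclidean_space. R < norm x \<longrightarrow> \<phi> x = 0)"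
  unfolding compact_closure bounded_iff by (simp add: not_less[symmetric]) blast

lemma test_functionE:
  assumes "test_function (\<phi>::real \<Rightarrow> real)"
  obtains R where "0 < R" "\<And>x. R < \<bar>x\<bar> \<Longrightarrow> \<phi> x = 0"
proof -
  obtain R where "\<forall>x. R < \<bar>x\<bar> \<longrightarrow> \<phi> x = 0"
    using assms unfolding test_function_def compact_support_iff real_norm_def by blast
  then show thesis by (intro that[of "max R 1"]) auto
qed

lemma test_functionI:
  assumes "\<And>n. Ck n \<phi>" "\<And>x. R < \<bar>x\<bar> \<Longrightarrow> \<phi> x = 0"
  shows "test_function (\<phi>::real \<Rightarrow> real)"
  using assms unfolding test_function_def compact_support_iff real_norm_def by blast

lemma test_Ck: "test_function \<phi> \<Longrightarrow> Ck n \<phi>"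
  by (simp add: test_function_def)

lemma test_has_deriv: "test_function \<phi> \<Longrightarrow> (\<phi> has_real_derivative deriv \<phi> x) (at x)"
  using Ck_Suc_realD(1) test_Ck by blast

lemma test_continuous: "test_function (\<phi>::real \<Rightarrow> real) \<Longrightarrow> continuous_on A \<phi>"
  by (intro continuous_at_imp_continuous_on ballI DERIV_isCont[OF test_has_deriv]) auto

lemma test_deriv:
  assumes "test_function (\<phi>::real \<Rightarrow> real)"
  shows "test_function (deriv \<phi>)"
proof -
  obtain R where R: "\<And>x. R < \<bar>x\<bar> \<Longrightarrow> \<phi> x = 0" using assms by (elim test_functionE) auto
  have "deriv \<phi> x = 0" if "R < \<bar>x\<bar>" for x
  proof -
    have "(\<phi> has_real_derivative 0) (at x)"
    proof (rule has_field_derivative_transform_within_open[where S="- {-R..R}" and f="\<lambda>_. 0"])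
      show "open (- {-R..R})" by (intro open_Compl) auto
    qed (use R that in auto)
    then show ?thesis by (rule DERIV_imp_deriv)
  qed
  then show ?thesis
    using assms by (intro test_functionI[where R=R] Ck_Suc_realD(2)) (auto intro: test_Ck)
qed

lemma test_derivs: "test_function (\<phi>::real \<Rightarrow> real) \<Longrightarrow> test_function ((deriv ^^ j) \<phi>)"
  by (induction j) (auto intro: test_deriv)

lemma test_affine:
  assumes "test_function (\<phi>::real \<Rightarrow> real)" "b \<noteq> 0"
  shows "test_function (\<lambda>x. \<phi> (a + b * x))"
proof -
  obtain R where R: "\<And>x. R < \<bar>x\<bar> \<Longrightarrow> \<phi> x = 0" using assms by (elim test_functionE) auto
  show ?thesis
  proof (rule test_functionI[where R="(R + \<bar>a\<bar>) / \<bar>b\<bar>"])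
    show "Ck n (\<lambda>x. \<phi> (a + b * x))" for n by (intro Ck_affine test_Ck assms)
    fix x assume "(R + \<bar>a\<bar>) / \<bar>b\<bar> < \<bar>x\<bar>"
    then have "R + \<bar>a\<bar> < \<bar>b * x\<bar>" using assms(2) by (simp add: field_simps abs_mult)
    then show "\<phi> (a + b * x) = 0" by (intro R) linarith
  qed
qed

lemma test_derivs_affine:
  assumes "test_function (\<phi>::real \<Rightarrow> real)"
  shows "(deriv ^^ j) (\<lambda>x. \<phi> (a + b * x)) = (\<lambda>x. b ^ j * (deriv ^^ j) \<phi> (a + b * x))"
proof (induction j)
  case (Suc j)
  have "deriv (\<lambda>x. b ^ j * (deriv ^^ j) \<phi> (a + b * x)) x = b ^ Suc j * deriv ((deriv ^^ j) \<phi>) (a + b * x)" for x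
    by (rule DERIV_imp_deriv)
      (auto intro!: derivative_eq_intros DERIV_chain2[OF test_has_deriv[OF test_derivs[OF assms]]])
  then show ?case by (simp add: Suc fun_eq_iff del: power_Suc)
qed simp

lemma test_tensor:
  fixes \<theta> \<xi> :: "real \<Rightarrow> real"
  assumes "test_function \<theta>" "test_function \<xi>"
  shows "test_function (\<lambda>p. \<theta> (fst p) * \<xi> (snd p))"
proof -
  obtain R S where R: "\<And>x. R < \<bar>x\<bar> \<Longrightarrow> \<theta> x = 0" and S: "\<And>x. S < \<bar>x\<bar> \<Longrightarrow> \<xi> x = 0"
    using assms by (metis test_functionE)
  have "\<theta> (fst p) * \<xi> (snd p) = 0" if "\<bar>R\<bar> + \<bar>S\<bar> < norm p" for p
    using that norm_Pair_le[of "fst p" "snd p"] R[of "fst p"] S[of "snd p"] by fastforce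
  then show ?thesis
    using assms unfolding test_function_def compact_support_iff by (blast intro: Ck_tensor)
qed

text \<open>The class of these functions is closed under differentiation, which gives smoothness by induction.\<close>

definition flat :: "real poly \<Rightarrow> real \<Rightarrow> real" where
  "flat p x = (if x > 0 then poly p (1 / x) * exp (- (1 / x)) else 0)"

lemma poly_exp_tendsto_0: "((\<lambda>t. poly p t * exp (- t)) \<longlongrightarrow> (0::real)) at_top"
proof -
  have "((\<lambda>t. \<Sum>i\<le>degree p. coeff p i * (t ^ i / exp t)) \<longlongrightarrow> (\<Sum>i\<le>degree p. coeff p i * 0)) at_top"
    by (intro tendsto_intros tendsto_power_div_exp_0)
  then show ?thesis
    by (simp add: poly_altdef sum_distrib_right exp_minus divide_inverse mult.assoc)
qed

text \<open>With s = 1 / x and ds/dx = - s^2, the derivative of p(s) exp(-s) is s^2 (p(s) - p'(s))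
  exp(-s); the factor \<open>[:0, 0, 1:]\<close> is s^2.\<close>

lemma flat_DERIV: "(flat p has_real_derivative flat ([:0, 0, 1:] * (p - pderiv p)) x) (at x)"
proof -
  consider "x > 0" | "x < 0" | "x = 0" by linarith
  then show ?thesis
  proof cases
    case 1
    have "((\<lambda>x. poly p (1 / x) * exp (- (1 / x))) has_real_derivative flat ([:0, 0, 1:] * (p - pderiv p)) x) (at x)"
      using 1 by (auto intro!: derivative_eq_intros DERIV_chain2[OF poly_DERIV] simp: flat_def power2_eq_square field_simps)
    then show ?thesis
      by (rule has_field_derivative_transform_within_open[where S="{0<..}"]) (use 1 in \<open>auto simp: flat_def\<close>)
  next
    case 2
    have "((\<lambda>x. 0) has_real_derivative flat ([:0, 0, 1:] * (p - pderiv p)) x) (at x)"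
      using 2 by (simp add: flat_def)
    then show ?thesis
      by (rule has_field_derivative_transform_within_open[where S="{..<0}"]) (use 2 in \<open>auto simp: flat_def\<close>)
  next
    case 3
    have "((\<lambda>y. flat p y / y) \<longlongrightarrow> 0) (at_right 0)"
    proof -
      \<comment> \<open>Dividing by y multiplies the polynomial in 1 / y by its variable, which is
        \<open>pCons 0 p\<close>; the exponential still dominates.\<close>
      have "((\<lambda>y. poly (pCons 0 p) (1 / y) * exp (- (1 / y))) \<longlongrightarrow> (0::real)) (at_right 0)"
        by (rule filterlim_compose[OF poly_exp_tendsto_0])
          (use filterlim_inverse_at_top_right in \<open>simp add: inverse_eq_divide\<close>)
      then show ?thesis
        by (rule Lim_transform_eventually) (auto simp: eventually_at_right_less flat_def eventually_at_filter)
    qed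
    moreover have "((\<lambda>y. flat p y / y) \<longlongrightarrow> 0) (at_left 0)"
      by (rule Lim_transform_eventually[of "\<lambda>_. 0"]) (auto simp: flat_def eventually_at_filter)
    ultimately have "((\<lambda>y. flat p y / y) \<longlongrightarrow> 0) (at 0)"
      by (simp add: filterlim_split_at)
    then show ?thesis using 3 by (simp add: has_field_derivative_iff flat_def)
  qed
qed

lemma flat_Ck: "Ck n (flat p)"
proof (induction n arbitrary: p)
  case 0
  show ?case by (auto intro!: continuous_at_imp_continuous_on DERIV_isCont[OF flat_DERIV])
next
  case (Suc n)
  show ?case by (rule Ck_Suc_realI[OF flat_DERIV Suc])
qed

definition is_mollifier :: "(real \<Rightarrow> real) \<Rightarrow> real \<Rightarrow> bool" where
  "is_mollifier \<rho> r \<longleftrightarrow> test_function \<rho> \<and> (\<forall>x. 0 \<le> \<rho> x) \<and> (\<forall>x. r < \<bar>x\<bar> \<longrightarrow> \<rho> x = 0) \<and> (LINT x|lborel. \<rho> x) = 1"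

lemma test_integrable: "test_function \<phi> \<Longrightarrow> integrable lborel (\<phi>::real \<Rightarrow> real)"
proof -
  assume *: "test_function \<phi>"
  then obtain R where R: "0 < R" "\<And>x. R < \<bar>x\<bar> \<Longrightarrow> \<phi> x = 0" by (elim test_functionE) auto
  have "set_integrable lborel {-R..R} \<phi>"
    by (intro borel_integrable_atLeastAtMost' test_continuous *)
  also have "set_integrable lborel {-R..R} \<phi> \<longleftrightarrow> integrable lborel \<phi>"
    unfolding set_integrable_def using R(2)
    by (intro Bochner_Integration.integrable_cong) (force simp: indicator_def)+
  finally show ?thesis .
qed

text \<open>The bump is exp (- 1 / (1 + x)) exp (- 1 / (1 - x)) on (-1, 1), divided by its
  integral.\<close>

lemma mollifier_exists: "\<exists>\<rho>. is_mollifier \<rho> 1"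
proof -
  define b where "b x = flat 1 (1 + 1 * x) * flat 1 (1 + (-1) * x)" for x
  have "Ck n b" for n unfolding b_def by (intro Ck_mult Ck_affine flat_Ck)
  moreover have supp: "b x = 0" if "1 < \<bar>x\<bar>" for x using that by (auto simp: b_def flat_def)
  ultimately have t: "test_function b" by (rule test_functionI)
  have nn: "0 \<le> b x" for x by (auto simp: b_def flat_def)
  \<comment> \<open>A non-negative function with integral 0 vanishes almost everywhere, but the set
    where \<open>b\<close> is non-zero is open and contains 0.\<close>
  have "(LINT x|lborel. b x) \<noteq> 0"
  proof
    assume "(LINT x|lborel. b x) = 0"
    then have "AE x in lborel. b x = 0"
      using integral_nonneg_eq_0_iff_AE[OF test_integrable[OF t]] nn by auto
    then have "AE x in lebesgue. b x = 0" by (rule AE_completion)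
    then have "negligible {x. b x \<noteq> 0}" by (simp add: negligible_iff_null_sets AE_iff_null_sets completion.complete2 eventually_ae_filter) (metis (no_types, lifting) AE_iff_null_sets Collect_mono completion.complete2)
    moreover have "open {x. b x \<noteq> 0}"
      by (rule open_Collect_neq) (auto intro: test_continuous t)
    moreover have "0 \<in> {x. b x \<noteq> 0}" by (simp add: b_def flat_def)
    ultimately show False using open_not_negligible by blast
  qed
  moreover define c where "c = (LINT x|lborel. b x)"
  ultimately have "c > 0" using nn by (simp add: less_le)
  have "is_mollifier (\<lambda>x. b x * inverse c) 1"
    unfolding is_mollifier_def
  proof (intro conjI allI impI)
    show "test_function (\<lambda>x. b x * inverse c)"
      using supp by (intro test_functionI[where R=1] Ck_mult[OF test_Ck[OF t]] Ck_const) auto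
  qed (use nn supp \<open>c > 0\<close> c_def in auto)
  then show ?thesis by blast
qed

text \<open>The scale is n + 1 instead of n, so that the index 0 is harmless and every kernel has
  its support in [-1, 1]. The summand \<open>0 +\<close> keeps the argument in the form a + b x of
  the lemmas on affine substitutions.\<close>

definition mol :: "nat \<Rightarrow> real \<Rightarrow> real" where
  "mol n = (\<lambda>x. (SOME \<rho>. is_mollifier \<rho> 1) (0 + (real n + 1) * x) * (real n + 1))"

lemma is_mollifier_mol: "is_mollifier (mol n) (1 / (real n + 1))"
proof -
  define \<rho> where "\<rho> = (SOME \<rho>. is_mollifier \<rho> 1)"
  have \<rho>: "is_mollifier \<rho> 1" unfolding \<rho>_def by (rule someI_ex[OF mollifier_exists])
  have "test_function (\<lambda>x. \<rho> (0 + (real n + 1) * x))"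
    using \<rho> by (intro test_affine) (auto simp: is_mollifier_def)
  then obtain R where R: "\<And>x. R < \<bar>x\<bar> \<Longrightarrow> \<rho> (0 + (real n + 1) * x) = 0" by (metis test_functionE)
  show ?thesis unfolding mol_def \<rho>_def[symmetric] unfolding is_mollifier_def
  proof (intro conjI allI impI)
    show "test_function (\<lambda>x. \<rho> (0 + (real n + 1) * x) * (real n + 1))"
      using \<open>test_function (\<lambda>x. \<rho> (0 + (real n + 1) * x))\<close> R
      by (intro test_functionI[where R=R] Ck_mult[OF test_Ck] Ck_const) (auto simp: test_Ck)
    show "0 \<le> \<rho> (0 + (real n + 1) * x) * (real n + 1)" for x
      using \<rho> by (auto simp: is_mollifier_def)
    show "\<rho> (0 + (real n + 1) * x) * (real n + 1) = 0" if "1 / (real n + 1) < \<bar>x\<bar>" for x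
      using \<rho> that by (auto simp: is_mollifier_def field_simps abs_mult)
    have "(LINT x|lborel. \<rho> x) = \<bar>real n + 1\<bar> *\<^sub>R (LINT x|lborel. \<rho> (0 + (real n + 1) * x))"
      by (rule lborel_integral_real_affine) auto
    then show "(LINT x|lborel. \<rho> (0 + (real n + 1) * x) * (real n + 1)) = 1"
      using \<rho> by (simp add: is_mollifier_def mult.commute)
  qed
qed

section \<open>Locally integrable functions and convolution\<close>

lemma has_vector_derivativeI_quotient:
  assumes "((\<lambda>h. (1 / h) *\<^sub>R (f (x + h) - f x)) \<longlongrightarrow> D) (at 0)"
  shows "(f has_vector_derivative D) (at x)"
proof -
  have "((\<lambda>h. norm ((1 / h) *\<^sub>R (f (x + h) - f x) - D)) \<longlongrightarrow> 0) (at 0)"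
    using assms by (intro tendsto_norm_zero LIM_zero)
  moreover have "\<forall>\<^sub>F h in at 0. norm ((1 / h) *\<^sub>R (f (x + h) - f x) - D) = norm (f (x + h) - f x - h *\<^sub>R D) / norm h"
  proof (rule eventually_at_filter[THEN iffD2], rule always_eventually, intro allI impI)
    fix h :: real assume h: "h \<noteq> 0"
    have "(1 / h) *\<^sub>R (f (x + h) - f x - h *\<^sub>R D) = (1 / h) *\<^sub>R (f (x + h) - f x) - D"
      using h by (simp add: algebra_simps)
    from arg_cong[OF this, of norm] show "norm ((1 / h) *\<^sub>R (f (x + h) - f x) - D) = norm (f (x + h) - f x - h *\<^sub>R D) / norm h"
      by simp
  qed
  ultimately show ?thesis
    unfolding has_vector_derivative_def has_derivative_at
    by (auto intro: bounded_linear_scaleR_left Lim_transform_eventually)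
qed

lemma L1_loc_measurable: "u \<in> L1_loc \<Longrightarrow> u \<in> borel_measurable lebesgue"
proof (rule borel_measurable_LIMSEQ_metric[where f="\<lambda>n x. indicator {- real n..real n} x *\<^sub>R u x"])
  show "(\<lambda>x. indicator {- real n..real n} x *\<^sub>R u x) \<in> borel_measurable lebesgue" if "u \<in> L1_loc" for n
    using that by (auto simp: L1_loc_def set_integrable_def intro: borel_measurable_integrable)
  fix x :: real
  obtain N :: nat where "\<bar>x\<bar> \<le> real N" using real_arch_simple by blast
  then show "(\<lambda>n. indicator {- real n..real n} x *\<^sub>R u x) \<longlonglongrightarrow> u x"
    by (intro tendsto_eventually eventually_sequentiallyI[of N]) (auto simp: indicator_def)
qed

lemma L1_loc_bounded_integrable:
  assumes "u \<in> L1_loc" "g \<in> borel_measurable lebesgue" "\<And>x. \<bar>g x\<bar> \<le> C" "\<And>x. R < \<bar>x\<bar> \<Longrightarrow> g x = 0"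
  shows "integrable lebesgue (\<lambda>x. g x *\<^sub>R u x)"
proof (rule Bochner_Integration.integrable_bound[where f="\<lambda>x. C *\<^sub>R (indicator {-R..R} x *\<^sub>R u x)"])
  show "integrable lebesgue (\<lambda>x. C *\<^sub>R (indicator {-R..R} x *\<^sub>R u x))"
    using assms(1) by (intro integrable_scaleR_right) (auto simp: L1_loc_def set_integrable_def)
  show "(\<lambda>x. g x *\<^sub>R u x) \<in> borel_measurable lebesgue"
    using assms L1_loc_measurable by measurable
  have "norm (g x *\<^sub>R u x) \<le> norm (C *\<^sub>R (indicator {-R..R} x *\<^sub>R u x))" for x
    using assms(3)[of x] assms(4)[of x] by (cases "R < \<bar>x\<bar>") (auto simp: indicator_def mult_right_mono)
  then show "AE x in lebesgue. norm (g x *\<^sub>R u x) \<le> norm (C *\<^sub>R (indicator {-R..R} x *\<^sub>R u x))" by simp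
qed

text \<open>The dominating function is C |u| on [-R, R]. Limits under a convolution integral with a
  merely locally integrable function are taken in this way.\<close>

lemma L1_loc_dominated_convergence:
  assumes "u \<in> L1_loc" "\<And>n. g n \<in> borel_measurable lebesgue" "h \<in> borel_measurable lebesgue"
    and "\<And>n x. \<bar>g n x\<bar> \<le> C" "\<And>n x. R < \<bar>x\<bar> \<Longrightarrow> g n x = 0" "AE x in lebesgue. (\<lambda>n. g n x) \<longlonglongrightarrow> h x"
  shows "(\<lambda>n. LINT x|lebesgue. g n x *\<^sub>R u x) \<longlonglongrightarrow> (LINT x|lebesgue. h x *\<^sub>R u x)"
proof (rule integral_dominated_convergence[where w="\<lambda>x. norm (C *\<^sub>R (indicator {-R..R} x *\<^sub>R u x))"])
  show "integrable lebesgue (\<lambda>x. norm (C *\<^sub>R (indicator {-R..R} x *\<^sub>R u x)))"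
    using assms(1) by (intro integrable_norm integrable_scaleR_right) (auto simp: L1_loc_def set_integrable_def)
  show "(\<lambda>x. h x *\<^sub>R u x) \<in> borel_measurable lebesgue" "(\<lambda>x. g n x *\<^sub>R u x) \<in> borel_measurable lebesgue" for n
    using assms L1_loc_measurable by measurable
  have "norm (g n x *\<^sub>R u x) \<le> norm (C *\<^sub>R (indicator {-R..R} x *\<^sub>R u x))" for n x
    using assms(4)[of n x] assms(5)[of x n] by (cases "R < \<bar>x\<bar>") (auto simp: indicator_def mult_right_mono)
  then show "AE x in lebesgue. norm (g n x *\<^sub>R u x) \<le> norm (C *\<^sub>R (indicator {-R..R} x *\<^sub>R u x))" for n by simp
  show "AE x in lebesgue. (\<lambda>n. g n x *\<^sub>R u x) \<longlonglongrightarrow> h x *\<^sub>R u x"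
    using assms(6) by eventually_elim (intro tendsto_intros)
qed

lemma borel_measurable_lebesgue_continuous:
  "continuous_on UNIV f \<Longrightarrow> (f :: real \<Rightarrow> 'a::topological_space) \<in> borel_measurable lebesgue"
  by (rule measurable_completion, simp, rule borel_measurable_continuous_onI)

lemma L1_loc_bounded:
  assumes "u \<in> borel_measurable lebesgue" "AE x in lebesgue. norm (u x) \<le> M"
  shows "u \<in> L1_loc"
  unfolding L1_loc_def
proof (intro CollectI allI impI)
  fix K :: "real set" assume K: "compact K"
  show "set_integrable lebesgue K u" unfolding set_integrable_def
  proof (rule Bochner_Integration.integrable_bound[where f="\<lambda>x. indicator K x *\<^sub>R M"])
    have "K \<in> sets lebesgue" "emeasure lebesgue K < \<infinity>"
      using fmeasurableD[OF lmeasurable_compact[OF K]] fmeasurableD2[OF lmeasurable_compact[OF K]]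
      by (simp_all add: less_top del: emeasure_completion)
    then show "integrable lebesgue (\<lambda>x. indicator K x *\<^sub>R M)" by (intro integrable_scaleR_left) auto
    show "(\<lambda>x. indicator K x *\<^sub>R u x) \<in> borel_measurable lebesgue"
      using assms(1) \<open>K \<in> sets lebesgue\<close> by measurable
    show "AE x in lebesgue. norm (indicator K x *\<^sub>R u x) \<le> norm (indicator K x *\<^sub>R M)"
      using assms(2) by eventually_elim (auto simp: indicator_def)
  qed
qed

lemma L1_loc_cong_AE:
  assumes "u \<in> L1_loc" "v \<in> borel_measurable lebesgue" "AE x in lebesgue. u x = v x"
  shows "v \<in> L1_loc"
  unfolding L1_loc_def
proof (intro CollectI allI impI)
  fix K :: "real set" assume K: "compact K"
  have [measurable]: "K \<in> sets lebesgue" using K by (auto simp: lmeasurable_compact fmeasurableD)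
  have [measurable]: "u \<in> borel_measurable lebesgue" "v \<in> borel_measurable lebesgue"
    using assms L1_loc_measurable by auto
  have "integrable lebesgue (\<lambda>x. indicator K x *\<^sub>R u x) \<longleftrightarrow> integrable lebesgue (\<lambda>x. indicator K x *\<^sub>R v x)"
    by (rule integrable_cong_AE) (use assms(3) in auto)
  then show "set_integrable lebesgue K v"
    using assms(1) K by (auto simp: L1_loc_def set_integrable_def)
qed

lemma L1_loc_diff: "u \<in> L1_loc \<Longrightarrow> v \<in> L1_loc \<Longrightarrow> (\<lambda>x. u x - v x) \<in> L1_loc"
  by (auto simp: L1_loc_def intro: set_integral_diff)

section \<open>Convolution with a test function\<close>

definition cnv :: "(real \<Rightarrow> 'a::euclidean_space) \<Rightarrow> (real \<Rightarrow> real) \<Rightarrow> real \<Rightarrow> 'a" where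
  "cnv u \<rho> x = (LINT y|lebesgue. \<rho> (x - y) *\<^sub>R u y)"

lemma test_bounded:
  assumes "test_function (\<phi>::real \<Rightarrow> real)"
  obtains C where "0 < C" "\<And>x. \<bar>\<phi> x\<bar> \<le> C"
proof -
  obtain R where R: "0 < R" "\<And>x. R < \<bar>x\<bar> \<Longrightarrow> \<phi> x = 0" using assms by (metis test_functionE)
  have "bounded (\<phi> ` {-R..R})"
    by (intro compact_imp_bounded compact_continuous_image test_continuous assms) auto
  then obtain C where "\<forall>y\<in>\<phi> ` {-R..R}. norm y \<le> C" unfolding bounded_iff by blast
  then have C: "\<And>x. x \<in> {-R..R} \<Longrightarrow> \<bar>\<phi> x\<bar> \<le> C" by auto
  have "\<bar>\<phi> x\<bar> \<le> max C 1" for x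
  proof (cases "R < \<bar>x\<bar>")
    case False
    then have "x \<in> {-R..R}" by auto
    then show ?thesis by (intro max.coboundedI1 C)
  qed (simp add: R)
  then show thesis by (intro that[of "max C 1"]) auto
qed

lemma test_measurable: "test_function (\<phi>::real \<Rightarrow> real) \<Longrightarrow> \<phi> \<in> borel_measurable lebesgue"
  by (intro borel_measurable_lebesgue_continuous test_continuous)

lemma L1_loc_test_integrable:
  assumes "u \<in> L1_loc" "test_function \<phi>"
  shows "integrable lebesgue (\<lambda>x. \<phi> x *\<^sub>R u x)"
proof -
  obtain R C where R: "\<And>x. R < \<bar>x\<bar> \<Longrightarrow> \<phi> x = 0" and C: "\<And>x. \<bar>\<phi> x\<bar> \<le> C"
    using assms(2) by (metis test_functionE test_bounded)
  show ?thesis by (rule L1_loc_bounded_integrable[OF assms(1) test_measurable[OF assms(2)] C R])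
qed

lemma test_reflect: "test_function \<rho> \<Longrightarrow> test_function (\<lambda>y::real. \<rho> (x - y))"
  using test_affine[of \<rho> "-1" x] by simp

lemma cnv_integrable: "u \<in> L1_loc \<Longrightarrow> test_function \<rho> \<Longrightarrow> integrable lebesgue (\<lambda>y. \<rho> (x - y) *\<^sub>R u y)"
  by (intro L1_loc_test_integrable test_reflect)

lemma cnv_diff: "u \<in> L1_loc \<Longrightarrow> v \<in> L1_loc \<Longrightarrow> test_function \<rho> \<Longrightarrow>
    cnv (\<lambda>x. u x - v x) \<rho> x = cnv u \<rho> x - cnv v \<rho> x"
  using cnv_integrable[of u \<rho> x] cnv_integrable[of v \<rho> x]
  by (simp add: cnv_def scaleR_diff_right)

lemma cnv_cong_AE: 
  assumes "u \<in> borel_measurable lebesgue" "v \<in> borel_measurable lebesgue" "AE x in lebesgue. u x = v x" "test_function \<rho>"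
  shows "cnv u \<rho> = cnv v \<rho>"
proof
  fix x
  note [measurable] = assms(1,2) test_measurable[OF test_reflect[OF assms(4)]]
  show "cnv u \<rho> x = cnv v \<rho> x"
    unfolding cnv_def using assms(3) by (intro integral_cong_AE) auto
qed

text \<open>Differentiation under the integral. The increments run through a sequence because
  dominated convergence is sequential; the mean value theorem bounds the quotients by the supremum
  of \<open>deriv \<rho>\<close>, and boundedness of the increments keeps their supports in one
  ball.\<close>

lemma cnv_has_derivative:
  assumes u: "u \<in> L1_loc" and \<rho>: "test_function \<rho>"
  shows "(cnv u \<rho> has_vector_derivative cnv u (deriv \<rho>) x) (at x)"
proof (rule has_vector_derivativeI_quotient, unfold tendsto_at_iff_sequentially, intro allI impI)
  fix H :: "nat \<Rightarrow> real" assume H: "\<forall>i. H i \<in> UNIV - {0}" "H \<longlonglongrightarrow> 0"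
  obtain B where B: "\<And>n. \<bar>H n\<bar> \<le> B"
    using convergent_imp_Bseq[OF convergentI[OF H(2)]] by (auto simp: Bseq_def)
  obtain R C where R: "\<And>x. R < \<bar>x\<bar> \<Longrightarrow> \<rho> x = 0" and C: "\<And>x. \<bar>deriv \<rho> x\<bar> \<le> C"
    using \<rho> by (metis test_functionE test_bounded test_deriv)
  define g where "g n y = (\<rho> (x + H n - y) - \<rho> (x - y)) / H n" for n y
  have "(\<lambda>n. LINT y|lebesgue. g n y *\<^sub>R u y) \<longlonglongrightarrow> (LINT y|lebesgue. deriv \<rho> (x - y) *\<^sub>R u y)"
  proof (rule L1_loc_dominated_convergence[OF u])
    show "g n \<in> borel_measurable lebesgue" for n
      unfolding g_def using test_measurable[OF test_reflect[OF \<rho>]] by measurable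
    show "(\<lambda>y. deriv \<rho> (x - y)) \<in> borel_measurable lebesgue"
      by (intro test_measurable test_reflect test_deriv \<rho>)
    show "\<bar>g n y\<bar> \<le> C" for n y
    proof -
      have "norm (\<rho> (x + H n - y) - \<rho> (x - y)) \<le> C * norm (x + H n - y - (x - y))"
        by (rule field_differentiable_bound[where S=UNIV and f'="deriv \<rho>"])
          (use C test_has_deriv[OF \<rho>] in \<open>auto\<close>)
      then show ?thesis using H(1) by (auto simp: g_def field_simps)
    qed
    show "g n y = 0" if "\<bar>x\<bar> + B + R < \<bar>y\<bar>" for n y
    proof -
      have "R < \<bar>x + H n - y\<bar>" "R < \<bar>x - y\<bar>" using that B[of n] abs_ge_zero[of "H n"] by linarith+
      then show ?thesis by (simp add: g_def R)
    qed
    have "(\<lambda>n. g n y) \<longlonglongrightarrow> deriv \<rho> (x - y)" for y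
    proof -
      have "((\<lambda>h. (\<rho> (x - y + h) - \<rho> (x - y)) / h) \<longlongrightarrow> deriv \<rho> (x - y)) (at 0)"
        using test_has_deriv[OF \<rho>, of "x - y"] by (simp add: DERIV_def)
      then have "((\<lambda>h. (\<rho> (x - y + h) - \<rho> (x - y)) / h) \<circ> H) \<longlonglongrightarrow> deriv \<rho> (x - y)"
        using H by (simp add: tendsto_at_iff_sequentially)
      then show ?thesis by (simp add: g_def o_def algebra_simps)
    qed
    then show "AE y in lebesgue. (\<lambda>n. g n y) \<longlonglongrightarrow> deriv \<rho> (x - y)" by simp
  qed
  moreover have "(1 / H n) *\<^sub>R (cnv u \<rho> (x + H n) - cnv u \<rho> x) = (LINT y|lebesgue. g n y *\<^sub>R u y)" for n
  proof -
    have "cnv u \<rho> (x + H n) - cnv u \<rho> x = (LINT y|lebesgue. \<rho> (x + H n - y) *\<^sub>R u y - \<rho> (x - y) *\<^sub>R u y)"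
      unfolding cnv_def by (intro Bochner_Integration.integral_diff[symmetric] cnv_integrable u \<rho>)
    also have "\<dots> = (LINT y|lebesgue. H n *\<^sub>R (g n y *\<^sub>R u y))"
      using H(1) by (intro Bochner_Integration.integral_cong) (auto simp: g_def scaleR_diff_left)
    also have "\<dots> = H n *\<^sub>R (LINT y|lebesgue. g n y *\<^sub>R u y)" by (rule integral_scaleR_right)
    finally show ?thesis using H(1) by simp
  qed
  ultimately show "((\<lambda>h. (1 / h) *\<^sub>R (cnv u \<rho> (x + h) - cnv u \<rho> x)) \<circ> H) \<longlonglongrightarrow> cnv u (deriv \<rho>) x"
    by (simp add: o_def cnv_def)
qed

lemma cnv_continuous: "u \<in> L1_loc \<Longrightarrow> test_function \<rho> \<Longrightarrow> continuous_on A (cnv u \<rho>)"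
  by (intro continuous_at_imp_continuous_on ballI has_vector_derivative_continuous[OF cnv_has_derivative])

lemma cnv_measurable: "u \<in> L1_loc \<Longrightarrow> test_function \<rho> \<Longrightarrow> cnv u \<rho> \<in> borel_measurable lebesgue"
  by (intro borel_measurable_lebesgue_continuous cnv_continuous)

lemma cnv_support:
  assumes "\<And>x. R < \<bar>x\<bar> \<Longrightarrow> u x = 0" "\<And>x. S < \<bar>x\<bar> \<Longrightarrow> \<rho> x = 0" "R + S < \<bar>x\<bar>"
  shows "cnv u \<rho> x = 0"
proof -
  have "\<rho> (x - y) *\<^sub>R u y = 0" for y
    using assms(1)[of y] assms(2)[of "x - y"] assms(3) by (cases "R < \<bar>y\<bar>") auto
  then have "cnv u \<rho> x = (LINT y::real|lebesgue. 0)" unfolding cnv_def by presburger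
  then show ?thesis by simp
qed

text \<open>All derivatives fall on the kernel, so \<open>u\<close> may be discontinuous. This makes
  a mollified sign function an admissible test function.\<close>

lemma cnv_test_function:
  assumes u: "(u :: real \<Rightarrow> real) \<in> L1_loc" "\<And>x. R < \<bar>x\<bar> \<Longrightarrow> u x = 0" and \<rho>: "test_function \<rho>"
  shows "test_function (cnv u \<rho>)"
proof -
  obtain S where "\<And>x. S < \<bar>x\<bar> \<Longrightarrow> \<rho> x = 0" using \<rho> by (metis test_functionE)
  moreover have "test_function \<rho> \<Longrightarrow> Ck n (cnv u \<rho>)" for n
  proof (induction n arbitrary: \<rho>)
    case 0
    then show ?case using cnv_continuous[OF u(1)] by simp
  next
    case (Suc n)
    show ?case
      by (rule Ck_Suc_realI[OF cnv_has_derivative[OF u(1), unfolded has_real_derivative_iff_has_vector_derivative[symmetric]]])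
        (use Suc in \<open>auto intro: test_deriv\<close>)
  qed
  ultimately show ?thesis
    using \<rho> u by (intro test_functionI[where R="R + S"] cnv_support) auto
qed

text \<open>The function y -> \<rho>(x - y) is itself a test function; the sign (-1)^j from
  differentiating the reflection cancels the one in the definition of a weak derivative.\<close>

lemma weak_deriv_cnv:
  assumes "has_weak_deriv j u v" "test_function \<rho>"
  shows "cnv u ((deriv ^^ j) \<rho>) x = cnv v \<rho> x"
proof -
  have "(deriv ^^ j) (\<lambda>y. \<rho> (x - y)) = (\<lambda>y. (- 1) ^ j * (deriv ^^ j) \<rho> (x - y))"
    using test_derivs_affine[OF assms(2), of j x "-1"] by simp
  then have "(LINT y|lebesgue. ((- 1) ^ j * (deriv ^^ j) \<rho> (x - y)) *\<^sub>R u y) = (-1) ^ j *\<^sub>R (LINT y|lebesgue. \<rho> (x - y) *\<^sub>R v y)"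
    using assms test_reflect[OF assms(2), of x] unfolding has_weak_deriv_def by metis
  then have "(-1) ^ j *\<^sub>R cnv u ((deriv ^^ j) \<rho>) x = (-1) ^ j *\<^sub>R cnv v \<rho> x"
    by (simp add: cnv_def flip: scaleR_scaleR)
  then show ?thesis by simp
qed

section \<open>Mollification in the space of square integrable functions\<close>

text \<open>The squared L2 norm with values in \<open>ennreal\<close>: estimates can be stated
  before finiteness is known, and no root of an extended number is taken. The price is a factor 2 in
  place of the triangle inequality, harmless for convergence.\<close>

definition N2 :: "(real \<Rightarrow> 'a::euclidean_space) \<Rightarrow> ennreal" where
  "N2 f = (\<integral>\<^sup>+x. ennreal ((norm (f x))\<^sup>2) \<partial>lebesgue)"

lemma in_L2_iff: "in_L2 f \<longleftrightarrow> f \<in> borel_measurable lebesgue \<and> N2 f < \<infinity>"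
proof -
  have "integrable lebesgue (\<lambda>x. (norm (f x))\<^sup>2) \<longleftrightarrow> N2 f < \<infinity>" if [measurable]: "f \<in> borel_measurable lebesgue"
    unfolding N2_def by (subst integrable_iff_bounded) auto
  then show ?thesis unfolding in_L2_def by auto
qed

lemma in_L2_measurable: "in_L2 f \<Longrightarrow> f \<in> borel_measurable lebesgue"
  by (simp add: in_L2_def)

lemma N2_mono:
  assumes "AE x in lebesgue. norm (f x) \<le> norm (g x)"
  shows "N2 f \<le> N2 g"
  unfolding N2_def by (rule nn_integral_mono_AE) (use assms in eventually_elim, simp add: ennreal_leI power_mono)

lemma N2_cong:
  assumes "AE x in lebesgue. f x = g x"
  shows "N2 f = N2 g"
  unfolding N2_def by (rule nn_integral_cong_AE) (use assms in eventually_elim, simp)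

lemma N2_0: "N2 (\<lambda>x. 0) = 0" by (simp add: N2_def)

lemma N2_minus: "N2 (\<lambda>x. - f x) = N2 f" by (simp add: N2_def)

lemma N2_commute: "N2 (\<lambda>x. f x - g x) = N2 (\<lambda>x. g x - f x)"
  by (simp add: N2_def norm_minus_commute)

lemma norm_add_sq_le: "(norm (a + b))\<^sup>2 \<le> 2 * (norm a)\<^sup>2 + 2 * (norm b :: real)\<^sup>2"
proof -
  have "(norm (a + b))\<^sup>2 \<le> (norm a + norm b)\<^sup>2" by (intro power_mono norm_triangle_ineq) auto
  also have "\<dots> \<le> 2 * (norm a)\<^sup>2 + 2 * (norm b)\<^sup>2"
    using sum_squares_bound[of "norm a" "norm b"] by (simp add: power2_eq_square algebra_simps)
  finally show ?thesis .
qed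

lemma N2_add:
  assumes [measurable]: "f \<in> borel_measurable lebesgue" "g \<in> borel_measurable lebesgue"
  shows "N2 (\<lambda>x. f x + g x) \<le> 2 * N2 f + 2 * N2 g"
proof -
  have "N2 (\<lambda>x. f x + g x) \<le> (\<integral>\<^sup>+x. 2 * ennreal ((norm (f x))\<^sup>2) + 2 * ennreal ((norm (g x))\<^sup>2) \<partial>lebesgue)"
    unfolding N2_def
    by (intro nn_integral_mono) (use norm_add_sq_le in \<open>simp add: ennreal_mult[symmetric] ennreal_plus[symmetric] ennreal_leI del: ennreal_plus flip: ennreal_numeral\<close>)
  also have "\<dots> = 2 * N2 f + 2 * N2 g"
    unfolding N2_def by (subst nn_integral_add) (auto simp: nn_integral_cmult)
  finally show ?thesis .
qed

lemma N2_diff: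
  assumes "f \<in> borel_measurable lebesgue" "g \<in> borel_measurable lebesgue"
  shows "N2 (\<lambda>x. f x - g x) \<le> 2 * N2 f + 2 * N2 g"
  using N2_add[of f "\<lambda>x. - g x"] assms by (simp add: N2_minus)

lemma N2_triangle:
  assumes "f \<in> borel_measurable lebesgue" "g \<in> borel_measurable lebesgue" "h \<in> borel_measurable lebesgue"
  shows "N2 (\<lambda>x. f x - h x) \<le> 2 * N2 (\<lambda>x. f x - g x) + 2 * N2 (\<lambda>x. g x - h x)"
  using N2_add[of "\<lambda>x. f x - g x" "\<lambda>x. g x - h x"] assms by simp

lemma N2_mult_le:
  fixes f :: "real \<Rightarrow> complex"
  assumes [measurable]: "f \<in> borel_measurable lebesgue" and b: "AE x in lebesgue. norm (b x) \<le> M"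
  shows "N2 (\<lambda>x. b x * f x) \<le> ennreal (M\<^sup>2) * N2 f"
proof -
  have "N2 (\<lambda>x. b x * f x) \<le> (\<integral>\<^sup>+x. ennreal (M\<^sup>2) * ennreal ((norm (f x))\<^sup>2) \<partial>lebesgue)"
    unfolding N2_def
    by (rule nn_integral_mono_AE) (use b in eventually_elim,
       auto simp: norm_mult power_mult_distrib power_mono mult_right_mono simp flip: ennreal_mult intro!: ennreal_leI)
  then show ?thesis unfolding N2_def by (simp add: nn_integral_cmult)
qed

lemma N2_cmult: 
  fixes f :: "real \<Rightarrow> complex"
  assumes [measurable]: "f \<in> borel_measurable lebesgue"
  shows "N2 (\<lambda>x. c * f x) = ennreal ((norm c)\<^sup>2) * N2 f"
  unfolding N2_def by (simp add: norm_mult power_mult_distrib ennreal_mult nn_integral_cmult)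

lemma in_L2_add: "in_L2 f \<Longrightarrow> in_L2 g \<Longrightarrow> in_L2 (\<lambda>x. f x + g x)"
  using N2_add[of f g] by (auto simp: in_L2_iff ennreal_mult_less_top elim!: order.strict_trans1)

lemma in_L2_diff: "in_L2 f \<Longrightarrow> in_L2 g \<Longrightarrow> in_L2 (\<lambda>x. f x - g x)"
  using N2_diff[of f g] by (auto simp: in_L2_iff ennreal_mult_less_top elim!: order.strict_trans1)

lemma N2_limit_trans:
  assumes "\<And>n. f n \<in> borel_measurable lebesgue" "\<And>n. g n \<in> borel_measurable lebesgue" "h \<in> borel_measurable lebesgue"
    and "(\<lambda>n. N2 (\<lambda>x. f n x - g n x)) \<longlonglongrightarrow> 0" "(\<lambda>n. N2 (\<lambda>x. g n x - h x)) \<longlonglongrightarrow> 0"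
  shows "(\<lambda>n. N2 (\<lambda>x. f n x - h x)) \<longlonglongrightarrow> 0"
proof (rule tendsto_sandwich[of "\<lambda>_. 0"])
  have "(\<lambda>n. 2 * N2 (\<lambda>x. f n x - g n x) + 2 * N2 (\<lambda>x. g n x - h x)) \<longlonglongrightarrow> 2 * 0 + 2 * 0"
    by (intro tendsto_add ennreal_tendsto_cmult assms) auto
  then show "(\<lambda>n. 2 * N2 (\<lambda>x. f n x - g n x) + 2 * N2 (\<lambda>x. g n x - h x)) \<longlonglongrightarrow> 0" by simp
qed (auto intro!: always_eventually N2_triangle assms)

section \<open>Averaging against a mollifier\<close>

lemma mollifierD:
  assumes "is_mollifier \<rho> r"
  shows "test_function \<rho>" "0 \<le> \<rho> x" "r < \<bar>x\<bar> \<Longrightarrow> \<rho> x = 0"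
    "(\<integral>\<^sup>+y. ennreal (\<rho> (x - y)) \<partial>lebesgue) = 1" "(LINT y|lebesgue. \<rho> (x - y)) = 1"
    "integrable lebesgue (\<lambda>y. \<rho> (x - y))"
proof -
  show t: "test_function \<rho>" "0 \<le> \<rho> x" "r < \<bar>x\<bar> \<Longrightarrow> \<rho> x = 0" for x
    using assms by (auto simp: is_mollifier_def)
  have [measurable]: "(\<lambda>y. \<rho> (x - y)) \<in> borel_measurable borel" "\<rho> \<in> borel_measurable borel" for x
    using test_continuous[OF test_reflect[OF t(1)]] test_continuous[OF t(1)] by (auto intro: borel_measurable_continuous_onI)
  have i: "integrable lborel (\<lambda>y. \<rho> (x - y))" for x by (intro test_integrable test_reflect t)
  then show "integrable lebesgue (\<lambda>y. \<rho> (x - y))" by (subst integrable_completion) auto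
  have "(LINT y|lborel. \<rho> y) = (LINT y|lborel. \<rho> (x + (-1) * y))"
    using lborel_integral_real_affine[of "-1" \<rho> x] by simp
  then have l: "(LINT y|lborel. \<rho> (x - y)) = 1" using assms by (simp add: is_mollifier_def)
  then show "(LINT y|lebesgue. \<rho> (x - y)) = 1" by (subst integral_completion) auto
  show "(\<integral>\<^sup>+y. ennreal (\<rho> (x - y)) \<partial>lebesgue) = 1"
    using i t(2) l by (subst nn_integral_completion, subst nn_integral_eq_integral) auto
qed

text \<open>A mollifier is a probability density, so averaging commutes with subtracting a constant,
  and Cauchy-Schwarz is applied after writing \<rho> as the square of sqrt \<rho>. The choice c = 0
  gives the contraction in L2, c = u x the approximation at x.\<close>

lemma mollifier_Jensen:
  assumes u: "u \<in> L1_loc" and \<rho>: "is_mollifier \<rho> r"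
  shows "ennreal ((norm (cnv u \<rho> x - c))\<^sup>2) \<le> (\<integral>\<^sup>+y. ennreal ((norm (u y - c))\<^sup>2) * ennreal (\<rho> (x - y)) \<partial>lebesgue)"
proof -
  note \<rho>' = mollifierD[OF \<rho>]
  have [measurable]: "u \<in> borel_measurable lebesgue" by (rule L1_loc_measurable[OF u])
  have [measurable]: "(\<lambda>y. \<rho> (x - y)) \<in> borel_measurable lebesgue" by (intro test_measurable test_reflect \<rho>')
  have i: "integrable lebesgue (\<lambda>y. \<rho> (x - y) *\<^sub>R (u y - c))"
    using cnv_integrable[OF u \<rho>'(1), of x] \<rho>'(6)[of x] by (simp add: scaleR_diff_right)
  have "cnv u \<rho> x - c = (LINT y|lebesgue. \<rho> (x - y) *\<^sub>R (u y - c))"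
    using cnv_integrable[OF u \<rho>'(1), of x] \<rho>'(5)[of x] \<rho>'(6)[of x]
    by (simp add: cnv_def scaleR_diff_right)
  then have "ennreal (norm (cnv u \<rho> x - c)) \<le> (\<integral>\<^sup>+y. ennreal (norm (\<rho> (x - y) *\<^sub>R (u y - c))) \<partial>lebesgue)"
    using integral_norm_bound_ennreal[OF i] by simp
  also have "\<dots> = (\<integral>\<^sup>+y. ennreal (norm (u y - c) * sqrt (\<rho> (x - y))) * ennreal (sqrt (\<rho> (x - y))) \<partial>lebesgue)"
    using \<rho>'(2) by (intro nn_integral_cong) (simp flip: ennreal_mult add: mult.assoc mult.commute)
  finally have "(ennreal (norm (cnv u \<rho> x - c)))\<^sup>2 \<le> (\<integral>\<^sup>+y. ennreal (norm (u y - c) * sqrt (\<rho> (x - y))) * ennreal (sqrt (\<rho> (x - y))) \<partial>lebesgue)\<^sup>2"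
    by (rule power_mono) simp
  also have "\<dots> \<le> (\<integral>\<^sup>+y. (ennreal (norm (u y - c) * sqrt (\<rho> (x - y))))\<^sup>2 \<partial>lebesgue) * (\<integral>\<^sup>+y. (ennreal (sqrt (\<rho> (x - y))))\<^sup>2 \<partial>lebesgue)"
    by (rule Cauchy_Schwarz_nn_integral) measurable
  also have "(\<integral>\<^sup>+y. (ennreal (sqrt (\<rho> (x - y))))\<^sup>2 \<partial>lebesgue) = 1"
    using \<rho>'(2,4) by (simp add: ennreal_power)
  also have "(\<integral>\<^sup>+y. (ennreal (norm (u y - c) * sqrt (\<rho> (x - y))))\<^sup>2 \<partial>lebesgue) = (\<integral>\<^sup>+y. ennreal ((norm (u y - c))\<^sup>2) * ennreal (\<rho> (x - y)) \<partial>lebesgue)"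
    using \<rho>'(2) by (intro nn_integral_cong) (simp add: ennreal_power power_mult_distrib ennreal_mult)
  finally show ?thesis by (simp add: ennreal_power)
qed

lemma nn_integral_convolution_le:
  fixes h :: "real \<Rightarrow> real" and f :: "real \<Rightarrow> ennreal"
  assumes f: "f \<in> borel_measurable lebesgue" and h[measurable]: "h \<in> borel_measurable borel"
  shows "(\<integral>\<^sup>+x. (\<integral>\<^sup>+y. f y * ennreal (h (x - y)) \<partial>lebesgue) \<partial>lebesgue) = (\<integral>\<^sup>+y. f y \<partial>lebesgue) * (\<integral>\<^sup>+x. ennreal (h x) \<partial>lborel)"
proof -
  \<comment> \<open>The order of integration is exchanged on \<open>lborel\<close>, so the Lebesgue
    measurable \<open>f\<close> is replaced by a Borel function equal to it almost
    everywhere.\<close>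
  obtain f' where f'[measurable]: "f' \<in> borel_measurable borel" and ae: "AE x in lborel. f x = f' x"
    using completion_ex_borel_measurable[OF f] by auto
  then have ae': "AE x in lebesgue. f x = f' x" by (auto intro: AE_completion)
  have "(\<integral>\<^sup>+y. f y * ennreal (h (x - y)) \<partial>lebesgue) = (\<integral>\<^sup>+y. f' y * ennreal (h (x - y)) \<partial>lborel)" for x
    by (subst nn_integral_completion[symmetric], rule nn_integral_cong_AE) (use ae' in eventually_elim, simp)
  then have "(\<integral>\<^sup>+x. (\<integral>\<^sup>+y. f y * ennreal (h (x - y)) \<partial>lebesgue) \<partial>lebesgue) = (\<integral>\<^sup>+x. (\<integral>\<^sup>+y. f' y * ennreal (h (x - y)) \<partial>lborel) \<partial>lborel)"
    by (simp add: nn_integral_completion)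
  also have "\<dots> = (\<integral>\<^sup>+y. (\<integral>\<^sup>+x. f' y * ennreal (h (x - y)) \<partial>lborel) \<partial>lborel)"
    by (rule lborel_pair.Fubini') measurable
  also have "\<dots> = (\<integral>\<^sup>+y. f' y * (\<integral>\<^sup>+x. ennreal (h x) \<partial>lborel) \<partial>lborel)"
  proof (rule nn_integral_cong)
    fix y :: real
    have "(\<integral>\<^sup>+x. ennreal (h x) \<partial>lborel) = (\<integral>\<^sup>+x. ennreal (h (x - y)) \<partial>lborel)"
      using nn_integral_real_affine[of "\<lambda>x. ennreal (h x)" 1 "-y"] by simp
    then show "(\<integral>\<^sup>+x. f' y * ennreal (h (x - y)) \<partial>lborel) = f' y * (\<integral>\<^sup>+x. ennreal (h x) \<partial>lborel)"
      by (simp add: nn_integral_cmult)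
  qed
  also have "\<dots> = (\<integral>\<^sup>+y. f' y \<partial>lborel) * (\<integral>\<^sup>+x. ennreal (h x) \<partial>lborel)"
    by (rule nn_integral_multc) simp
  also have "(\<integral>\<^sup>+y. f' y \<partial>lborel) = (\<integral>\<^sup>+y. f y \<partial>lebesgue)"
    by (subst nn_integral_completion[symmetric], rule nn_integral_cong_AE) (use ae' in eventually_elim, simp)
  finally show ?thesis .
qed

lemma N2_cnv_le:
  assumes u: "u \<in> L1_loc" and \<rho>: "is_mollifier \<rho> r"
  shows "N2 (cnv u \<rho>) \<le> N2 u"
proof -
  note \<rho>' = mollifierD[OF \<rho>]
  have [measurable]: "u \<in> borel_measurable lebesgue" by (rule L1_loc_measurable[OF u])
  have "N2 (cnv u \<rho>) \<le> (\<integral>\<^sup>+x. (\<integral>\<^sup>+y. ennreal ((norm (u y))\<^sup>2) * ennreal (\<rho> (x - y)) \<partial>lebesgue) \<partial>lebesgue)"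
    unfolding N2_def using mollifier_Jensen[OF u \<rho>, where c=0] by (intro nn_integral_mono) simp
  also have "\<dots> = N2 u * (\<integral>\<^sup>+x. ennreal (\<rho> x) \<partial>lborel)"
    unfolding N2_def
    by (rule nn_integral_convolution_le) (auto intro!: borel_measurable_continuous_onI test_continuous \<rho>')
  also have "(\<integral>\<^sup>+x. ennreal (\<rho> x) \<partial>lborel) = 1"
    using test_integrable[OF \<rho>'(1)] \<rho>'(2) \<rho> by (subst nn_integral_eq_integral) (auto simp: is_mollifier_def)
  finally show ?thesis by simp
qed

text \<open>Lebesgue measure is not zero. This extracts facts without \<open>x\<close> from almost
  everywhere statements, such as the non-negativity of an essential bound.\<close>

lemma AE_lebesgue_const: "(AE x::real in lebesgue. P) \<Longrightarrow> P"
  using ae_filter_eq_bot_iff[of "lebesgue :: real measure"] by (cases P) (auto simp: trivial_limit_def)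

lemma norm_cnv_le:
  assumes u: "u \<in> borel_measurable lebesgue" "AE y in lebesgue. norm (u y - c) \<le> M" and \<rho>: "is_mollifier \<rho> r"
  shows "norm (cnv u \<rho> x - c) \<le> M"
proof -
  have "AE y::real in lebesgue. 0 \<le> M"
    using u(2) by eventually_elim (use norm_ge_zero order_trans in blast)
  then have "M \<ge> 0" by (rule AE_lebesgue_const)
  note \<rho>' = mollifierD[OF \<rho>]
  have "AE y in lebesgue. norm (u y) \<le> M + norm c"
    using u(2) by eventually_elim (use norm_triangle_sub in \<open>smt (verit)\<close>)
  then have "u \<in> L1_loc" using L1_loc_bounded u(1) by blast
  from mollifier_Jensen[OF this \<rho>, of x c]
  have "ennreal ((norm (cnv u \<rho> x - c))\<^sup>2) \<le> (\<integral>\<^sup>+y. ennreal ((norm (u y - c))\<^sup>2) * ennreal (\<rho> (x - y)) \<partial>lebesgue)" .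
  also have "\<dots> \<le> (\<integral>\<^sup>+y. ennreal (M\<^sup>2) * ennreal (\<rho> (x - y)) \<partial>lebesgue)"
    by (rule nn_integral_mono_AE) (use u(2) in eventually_elim, auto intro!: mult_right_mono ennreal_leI power_mono)
  also have "\<dots> = ennreal (M\<^sup>2)"
    using \<rho>'(4) test_measurable[OF test_reflect[OF \<rho>'(1), of x]] by (subst nn_integral_cmult) auto
  finally have "(norm (cnv u \<rho> x - c))\<^sup>2 \<le> M\<^sup>2" by simp
  then show ?thesis using \<open>M \<ge> 0\<close> power2_le_imp_le by blast
qed

text \<open>On a compact set, |f| is dominated by 1 + |f|^2.\<close>

lemma in_L2_imp_L1_loc:
  assumes "in_L2 f"
  shows "f \<in> L1_loc"
  unfolding L1_loc_def
proof (intro CollectI allI impI)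
  fix K :: "real set" assume K: "compact K"
  have [measurable]: "f \<in> borel_measurable lebesgue" using assms by (simp add: in_L2_def)
  have K': "K \<in> sets lebesgue" "emeasure lebesgue K < \<infinity>"
    using fmeasurableD[OF lmeasurable_compact[OF K]] fmeasurableD2[OF lmeasurable_compact[OF K]]
    by (simp_all add: less_top del: emeasure_completion)
  note [measurable] = K'(1)
  show "set_integrable lebesgue K f" unfolding set_integrable_def
  proof (rule Bochner_Integration.integrable_bound)
    show "integrable lebesgue (\<lambda>x. indicator K x *\<^sub>R 1 + (norm (f x))\<^sup>2 :: real)"
      using assms K' by (intro Bochner_Integration.integrable_add integrable_scaleR_left) (auto simp: in_L2_def)
    have "norm (indicator K x *\<^sub>R f x) \<le> norm (indicator K x *\<^sub>R 1 + (norm (f x))\<^sup>2 :: real)" for x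
    proof -
      have "norm (f x) \<le> 1 + (norm (f x))\<^sup>2"
        using sum_squares_bound[of "norm (f x)" 1] norm_ge_zero[of "f x"] zero_le_power2[of "norm (f x)"]
        unfolding power_one by linarith
      then show ?thesis by (auto simp: indicator_def)
    qed
    then show "AE x in lebesgue. norm (indicator K x *\<^sub>R f x) \<le> norm (indicator K x *\<^sub>R 1 + (norm (f x))\<^sup>2 :: real)" by simp
  qed measurable
qed

lemma borel_measurable_lebesgue_id [measurable]: "(\<lambda>x::real. x) \<in> borel_measurable lebesgue"
  by (rule borel_measurable_lebesgue_continuous) simp

lemma is_mollifier_mono: "is_mollifier \<rho> r \<Longrightarrow> r \<le> s \<Longrightarrow> is_mollifier \<rho> s"
  by (auto simp: is_mollifier_def)

lemma mol_support: "1 < \<bar>x\<bar> \<Longrightarrow> mol n x = 0"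
  by (rule mollifierD(3)[OF is_mollifier_mono[OF is_mollifier_mol[of n], of 1]]) auto

lemma N2_dominated_convergence:
  assumes [measurable]: "\<And>n. f n \<in> borel_measurable lebesgue" "f' \<in> borel_measurable lebesgue"
    and g: "in_L2 g" and b: "\<And>n. AE x in lebesgue. norm (f n x - f' x) \<le> norm (g x)"
    and l: "AE x in lebesgue. (\<lambda>n. f n x) \<longlonglongrightarrow> f' x"
  shows "(\<lambda>n. N2 (\<lambda>x. f n x - f' x)) \<longlonglongrightarrow> 0"
proof -
  have [measurable]: "g \<in> borel_measurable lebesgue" using g by (simp add: in_L2_def)
  have "(\<lambda>n. \<integral>\<^sup>+x. ennreal ((norm (f n x - f' x))\<^sup>2) \<partial>lebesgue) \<longlonglongrightarrow> nn_integral lebesgue (\<lambda>x::real. 0)"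
  proof (rule nn_integral_dominated_convergence[where w="\<lambda>x. ennreal ((norm (g x))\<^sup>2)"])
    show "(\<integral>\<^sup>+x. ennreal ((norm (g x))\<^sup>2) \<partial>lebesgue) < \<infinity>" using g by (simp add: in_L2_iff N2_def)
    show "AE x in lebesgue. ennreal ((norm (f n x - f' x))\<^sup>2) \<le> ennreal ((norm (g x))\<^sup>2)" for n
      using b[of n] by eventually_elim (simp add: power_mono ennreal_leI)
    show "AE x in lebesgue. (\<lambda>n. ennreal ((norm (f n x - f' x))\<^sup>2)) \<longlonglongrightarrow> 0"
      using l
    proof eventually_elim
      case (elim x)
      then have "(\<lambda>n. (norm (f n x - f' x))\<^sup>2) \<longlonglongrightarrow> 0\<^sup>2"
        by (intro tendsto_power tendsto_norm_zero LIM_zero)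
      then show ?case using tendsto_ennrealI by fastforce
    qed
  qed measurable
  then show ?thesis by (simp add: N2_def)
qed

lemma cnv_mol_tendsto_at:
  assumes u: "u \<in> L1_loc" and c: "isCont u x"
  shows "(\<lambda>n. cnv u (mol n) x) \<longlonglongrightarrow> u x"
proof (rule metric_LIMSEQ_I)
  fix e :: real assume e: "0 < e"
  obtain d where d: "0 < d" "\<And>y. \<bar>y - x\<bar> < d \<Longrightarrow> norm (u y - u x) < e / 2"
    using c e unfolding continuous_at_eps_delta dist_norm by (metis half_gt_zero real_norm_def)
  obtain N :: nat where N: "1 / d < real N" using reals_Archimedean2 by blast
  have "dist (cnv u (mol n) x) (u x) < e" if "N \<le> n" for n
  proof -
    note \<rho> = mollifierD[OF is_mollifier_mol[of n]]
    have r: "1 / (real n + 1) < d" using N that d(1) by (simp add: field_simps) (smt (verit) mult_left_mono of_nat_mono)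
    have "ennreal ((norm (cnv u (mol n) x - u x))\<^sup>2) \<le> (\<integral>\<^sup>+y. ennreal ((norm (u y - u x))\<^sup>2) * ennreal (mol n (x - y)) \<partial>lebesgue)"
      by (rule mollifier_Jensen[OF u is_mollifier_mol])
    also have "\<dots> \<le> (\<integral>\<^sup>+y. ennreal ((e / 2)\<^sup>2) * ennreal (mol n (x - y)) \<partial>lebesgue)"
    proof (rule nn_integral_mono)
      fix y
      show "ennreal ((norm (u y - u x))\<^sup>2) * ennreal (mol n (x - y)) \<le> ennreal ((e / 2)\<^sup>2) * ennreal (mol n (x - y))"
      proof (cases "1 / (real n + 1) < \<bar>x - y\<bar>")
        case True then show ?thesis using \<rho>(3) by simp
      next
        case False
        then have "norm (u y - u x) < e / 2" using r by (intro d) linarith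
        then show ?thesis by (intro mult_right_mono ennreal_leI power_mono) auto
      qed
    qed
    also have "\<dots> = ennreal ((e / 2)\<^sup>2)"
      using \<rho>(4) test_measurable[OF test_reflect[OF \<rho>(1), of x]] by (subst nn_integral_cmult) auto
    finally have "(norm (cnv u (mol n) x - u x))\<^sup>2 \<le> (e / 2)\<^sup>2" by simp
    then have "norm (cnv u (mol n) x - u x) \<le> e / 2" using e power2_le_imp_le by fastforce
    then show ?thesis using e by (simp add: dist_norm)
  qed
  then show "\<exists>N. \<forall>n\<ge>N. dist (cnv u (mol n) x) (u x) < e" by blast
qed

section \<open>Convergence of mollifications in L2\<close>

definition molconv :: "(real \<Rightarrow> 'a::euclidean_space) \<Rightarrow> bool" where
  "molconv f \<longleftrightarrow> (\<lambda>n. N2 (\<lambda>x. cnv f (mol n) x - f x)) \<longlonglongrightarrow> 0"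

lemma in_L2_bounded_support:
  assumes "f \<in> borel_measurable lebesgue" "\<And>x. norm (f x) \<le> C" "\<And>x. R < \<bar>x\<bar> \<Longrightarrow> f x = 0"
  shows "in_L2 f"
proof -
  have "integrable lebesgue (\<lambda>x. indicator {-R..R} x *\<^sub>R C\<^sup>2)"
    using fmeasurableD2[OF lmeasurable_compact[of "{-R..R}"]]
    by (intro integrable_scaleR_left integrable_real_indicator) (auto simp: less_top)
  then have "integrable lebesgue (\<lambda>x. (norm (f x))\<^sup>2)"
  proof (rule Bochner_Integration.integrable_bound)
    show "(\<lambda>x. (norm (f x))\<^sup>2) \<in> borel_measurable lebesgue" using assms(1) by measurable
    have "(norm (f x))\<^sup>2 \<le> indicator {-R..R} x *\<^sub>R C\<^sup>2" for x
      using assms(2)[of x] assms(3)[of x] by (cases "R < \<bar>x\<bar>") (auto simp: indicator_def intro!: power_mono)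
    then show "AE x in lebesgue. norm ((norm (f x))\<^sup>2) \<le> norm (indicator {-R..R} x *\<^sub>R C\<^sup>2)" by simp
  qed
  then show ?thesis using assms(1) by (simp add: in_L2_def)
qed

text \<open>The cut at -R and R creates at most two jumps. At every other point the function is
  continuous, so its mollifications converge almost everywhere.\<close>

lemma molconv_continuous_support:
  fixes h :: "real \<Rightarrow> 'a::euclidean_space"
  assumes h: "continuous_on UNIV h" "\<And>x. norm (h x) \<le> C"
  shows "molconv (\<lambda>x. if x \<in> {-R..R} then h x else 0)" (is "molconv ?f")
proof -
  have C: "0 \<le> C" using h(2) norm_ge_zero order_trans by blast
  have [measurable]: "h \<in> borel_measurable lebesgue" by (rule borel_measurable_lebesgue_continuous[OF h(1)])
  have m[measurable]: "?f \<in> borel_measurable lebesgue" by measurable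
  have b: "norm (?f x) \<le> C" for x using h(2) C by simp
  have l: "?f \<in> L1_loc" by (rule L1_loc_bounded[OF m, of C]) (rule AE_I2, rule b)
  have m': "cnv ?f (mol n) \<in> borel_measurable lebesgue" for n
    by (rule cnv_measurable[OF l mollifierD(1)[OF is_mollifier_mol]])
  \<comment> \<open>The kernels have support in [-1, 1], so the mollifications vanish outside
    [-R - 1, R + 1]; both they and the function are bounded by C.\<close>
  define g :: "real \<Rightarrow> real" where "g x = (if x \<in> {-(R+1)..R+1} then 2 * C else 0)" for x
  show ?thesis unfolding molconv_def
  proof (rule N2_dominated_convergence[OF m' m])
    show "in_L2 g"
    proof (rule in_L2_bounded_support[where C="2*C" and R="R+1"])
      show "g \<in> borel_measurable lebesgue" unfolding g_def by measurable
    qed (use C in \<open>auto simp: g_def\<close>)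
    show "AE x in lebesgue. norm (cnv ?f (mol n) x - ?f x) \<le> norm (g x)" for n
    proof (rule AE_I2)
      fix x :: real
      show "norm (cnv ?f (mol n) x - ?f x) \<le> norm (g x)"
      proof (cases "R + 1 < \<bar>x\<bar>")
        case True
        have "cnv ?f (mol n) x = 0"
          by (rule cnv_support[where R=R and S="1"]) (use mol_support True in auto)
        moreover have "?f x = 0" using True by auto
        ultimately show ?thesis by (simp only:) simp
      next
        case False
        have "norm (cnv ?f (mol n) x - 0) \<le> C"
          by (rule norm_cnv_le[OF m _ is_mollifier_mol]) (rule AE_I2, use b in \<open>simp only: diff_0_right\<close>)
        then have "norm (cnv ?f (mol n) x) \<le> C" by (simp only: diff_0_right)
        then have "norm (cnv ?f (mol n) x - ?f x) \<le> C + C"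
          by (rule order_trans[OF norm_triangle_ineq4 add_mono[OF _ b]])
        moreover have "g x = 2 * C" using False by (auto simp: g_def)
        ultimately show ?thesis using C by (simp only: real_norm_def)
      qed
    qed
    have "AE x in lebesgue. x \<noteq> R \<and> x \<noteq> -R"
      using AE_completion[OF AE_lborel_singleton[of R]] AE_completion[OF AE_lborel_singleton[of "-R"]]
      by eventually_elim simp
    then show "AE x in lebesgue. (\<lambda>n. cnv ?f (mol n) x) \<longlonglongrightarrow> ?f x"
    proof eventually_elim
      case (elim x)
      have "isCont ?f x"
      proof (cases "x \<in> {-R<..<R}")
        case True
        have "isCont h x" using h(1) by (simp add: continuous_on_eq_continuous_at)
        moreover have "\<forall>\<^sub>F y in nhds x. y \<in> {-R<..<R}"
          by (rule eventually_nhds_in_open) (use True in auto)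
        then have "\<forall>\<^sub>F y in nhds x. h y = ?f y" by eventually_elim auto
        ultimately show ?thesis by (rule isCont_cong[THEN iffD1, rotated])
      next
        case False
        have "\<forall>\<^sub>F y in nhds x. y \<in> - {-R..R}"
          by (rule eventually_nhds_in_open) (use False elim in auto)
        then have "\<forall>\<^sub>F y in nhds x. 0 = ?f y" by eventually_elim auto
        then show ?thesis by (rule isCont_cong[THEN iffD1]) (rule continuous_const)
      qed
      then show ?case by (rule cnv_mol_tendsto_at[OF l])
    qed
  qed
qed

lemma ennreal_tendsto_0I:
  fixes f :: "nat \<Rightarrow> ennreal"
  assumes "\<And>e::real. 0 < e \<Longrightarrow> \<forall>\<^sub>F n in sequentially. f n \<le> ennreal e"
  shows "f \<longlonglongrightarrow> 0"
proof (rule order_tendstoI)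
  fix a :: ennreal assume "0 < a"
  then obtain e where e: "0 < e" "ennreal e < a"
  proof (cases a)
    case (real b)
    with \<open>0 < a\<close> show ?thesis by (intro that[of "b / 2"]) (auto simp: ennreal_less_iff)
  qed (auto intro: that[of 1])
  show "\<forall>\<^sub>F n in sequentially. f n < a"
    using assms[OF e(1)] by eventually_elim (use e(2) in order)
qed simp

text \<open>Mollification is a contraction with the same constant for every kernel, so convergence
  passes to limits in L2.\<close>

lemma molconv_closed:
  assumes f: "in_L2 f" and F: "\<And>k. in_L2 (F k)" "\<And>k. molconv (F k)" "(\<lambda>k. N2 (\<lambda>x. F k x - f x)) \<longlonglongrightarrow> 0"
  shows "molconv f"
  unfolding molconv_def
proof (rule ennreal_tendsto_0I)
  fix e :: real assume e: "0 < e"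
  note lf = in_L2_imp_L1_loc[OF f] and lF = in_L2_imp_L1_loc[OF F(1)]
  note t = mollifierD(1)[OF is_mollifier_mol]
  have m: "f \<in> borel_measurable lebesgue" "F k \<in> borel_measurable lebesgue"
      "cnv f (mol n) \<in> borel_measurable lebesgue" "cnv (F k) (mol n) \<in> borel_measurable lebesgue" for n k
    using f F(1) by (auto simp: in_L2_def intro!: cnv_measurable lf lF t)
  \<comment> \<open>Two uses of the inequality with factor 2 weight the three small terms by 2, 4
    and 4, and 10 / 12 is at most 1.\<close>
  obtain k where k: "N2 (\<lambda>x. F k x - f x) < ennreal (e / 12)"
    using order_tendstoD(2)[OF F(3), of "ennreal (e / 12)"] e by (auto dest: eventually_happens)
  have "\<forall>\<^sub>F n in sequentially. N2 (\<lambda>x. cnv (F k) (mol n) x - F k x) < ennreal (e / 12)"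
    using F(2)[of k] e unfolding molconv_def by (intro order_tendstoD) auto
  then show "\<forall>\<^sub>F n in sequentially. N2 (\<lambda>x. cnv f (mol n) x - f x) \<le> ennreal e"
  proof eventually_elim
    case (elim n)
    have "N2 (\<lambda>x. cnv f (mol n) x - f x) \<le> 2 * N2 (\<lambda>x. cnv f (mol n) x - cnv (F k) (mol n) x) + 2 * N2 (\<lambda>x. cnv (F k) (mol n) x - f x)"
      by (intro N2_triangle m)
    also have "N2 (\<lambda>x. cnv f (mol n) x - cnv (F k) (mol n) x) \<le> N2 (\<lambda>x. f x - F k x)"
      using N2_cnv_le[OF L1_loc_diff[OF lf lF[of k]] is_mollifier_mol[of n]] unfolding cnv_diff[OF lf lF t, abs_def] .
    also have "\<dots> = N2 (\<lambda>x. F k x - f x)" by (rule N2_commute)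
    also have "\<dots> \<le> ennreal (e / 12)" using k by simp
    also have "N2 (\<lambda>x. cnv (F k) (mol n) x - f x) \<le> 2 * N2 (\<lambda>x. cnv (F k) (mol n) x - F k x) + 2 * N2 (\<lambda>x. F k x - f x)"
      by (intro N2_triangle m)
    also have "N2 (\<lambda>x. cnv (F k) (mol n) x - F k x) \<le> ennreal (e / 12)" using elim by simp
    also have "N2 (\<lambda>x. F k x - f x) \<le> ennreal (e / 12)" using k by simp
    also have "2 * ennreal (e / 12) + 2 * (2 * ennreal (e / 12) + 2 * ennreal (e / 12)) = ennreal (10 * (e / 12))"
      using e by (simp add: ennreal_mult'[symmetric] ennreal_plus[symmetric] del: ennreal_plus flip: ennreal_numeral)
    also have "\<dots> \<le> ennreal e" using e by (intro ennreal_leI) auto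
    finally show ?case by (simp add: add_left_mono add_right_mono mult_left_mono)
  qed
qed

text \<open>The radial retraction onto the ball of radius M. Being continuous, it preserves both the
  continuity of the approximating functions and their pointwise convergence.\<close>

definition clip :: "real \<Rightarrow> 'a::real_normed_vector \<Rightarrow> 'a" where
  "clip M z = (M / max M (norm z)) *\<^sub>R z"

lemma clip: assumes "0 < M" shows "norm (clip M z) \<le> M" "norm (clip M z) \<le> norm z" "norm z \<le> M \<Longrightarrow> clip M z = z"
proof -
  have m: "0 < max M (norm z)" "M \<le> max M (norm z)" "norm z \<le> max M (norm z)" using assms by auto
  show "norm (clip M z) \<le> M" "norm (clip M z) \<le> norm z"
    using m assms mult_left_mono[OF m(2), of "norm z"] by (simp_all add: clip_def divide_le_eq mult.commute mult_left_mono)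
  show "norm z \<le> M \<Longrightarrow> clip M z = z" using assms by (simp add: clip_def max_def)
qed

lemma continuous_on_clip: "0 < M \<Longrightarrow> continuous_on A (clip M)"
  unfolding clip_def by (intro continuous_intros) (auto simp: max_def)

text \<open>Lebesgue measurable functions are almost everywhere limits of continuous functions; truncating
  both the values and the domain makes these limits dominated.\<close>

lemma molconv_L2:
  fixes f :: "real \<Rightarrow> 'a::euclidean_space"
  assumes f: "in_L2 f"
  shows "molconv f"
proof -
  have m[measurable]: "f \<in> borel_measurable lebesgue" using f by (simp add: in_L2_def)
  have "f measurable_on UNIV" by (rule lebesgue_measurable_imp_measurable_on[OF m]) simp
  then obtain N g where N: "negligible N" and g: "\<And>n. continuous_on UNIV (g n)" 
      and l: "\<And>x. x \<notin> N \<Longrightarrow> (\<lambda>n. g n x) \<longlonglongrightarrow> f x"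
    unfolding measurable_on_def by auto
  have aeN: "AE x in lebesgue. x \<notin> N" using N by (simp add: AE_not_in negligible_iff_null_sets)
  have [measurable]: "clip M \<in> borel_measurable borel" if "0 < M" for M
    by (intro borel_measurable_continuous_onI continuous_on_clip that)
  define fM where "fM k x = (if x \<in> {-real (Suc k)..real (Suc k)} then clip (real (Suc k)) (f x) else 0)" for k x
  have mf: "(\<lambda>x. clip (real (Suc k)) (f x)) \<in> borel_measurable lebesgue" for k
    using borel_measurable_continuous_onI[OF continuous_on_clip[of "real (Suc k)" UNIV]] m by (simp add: measurable_compose[OF m])
  then have mfM: "fM k \<in> borel_measurable lebesgue" for k unfolding fM_def by measurable
  have fM_le: "norm (fM k x) \<le> norm (f x)" for k x
    using clip(2)[of "real (Suc k)" "f x"] by (auto simp: fM_def simp del: of_nat_Suc)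
  have fM_bd: "norm (fM k x) \<le> real (Suc k)" for k x
    using clip(1)[of "real (Suc k)" "f x"] by (auto simp: fM_def simp del: of_nat_Suc)
  have fM_L2: "in_L2 (fM k)" for k
    by (rule in_L2_bounded_support[OF mfM fM_bd, where R="real (Suc k)"]) (auto simp: fM_def)
  have "molconv (fM k)" for k
  proof (rule molconv_closed[OF fM_L2])
    define F where "F n x = (if x \<in> {-real (Suc k)..real (Suc k)} then clip (real (Suc k)) (g n x) else 0)" for n x
    have c: "continuous_on UNIV (\<lambda>x. clip (real (Suc k)) (g n x))" for n
      by (rule continuous_on_compose2[OF continuous_on_clip[where A=UNIV] g]) auto
    have bd: "norm (clip (real (Suc k)) (g n x)) \<le> real (Suc k)" for n x by (rule clip) simp
    have mF: "F n \<in> borel_measurable lebesgue" for n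
      unfolding F_def using borel_measurable_lebesgue_continuous[OF c] by measurable
    show FL: "in_L2 (F n)" for n
      by (rule in_L2_bounded_support[OF mF, where R="real (Suc k)" and C="real (Suc k)"]) (use bd in \<open>auto simp: F_def simp del: of_nat_Suc\<close>)
    show "molconv (F n)" for n
      unfolding F_def by (rule molconv_continuous_support[OF c bd])
    show "(\<lambda>n. N2 (\<lambda>x. F n x - fM k x)) \<longlonglongrightarrow> 0"
    proof (rule N2_dominated_convergence[OF mF mfM])
      show "in_L2 (\<lambda>x. if x \<in> {-real (Suc k)..real (Suc k)} then 2 * real (Suc k) else 0)"
        by (rule in_L2_bounded_support[where C="2 * real (Suc k)" and R="real (Suc k)"]) auto
      show "AE x in lebesgue. norm (F n x - fM k x) \<le> norm (if x \<in> {-real (Suc k)..real (Suc k)} then 2 * real (Suc k) else 0)" for n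
      proof (rule AE_I2)
        fix x
        show "norm (F n x - fM k x) \<le> norm (if x \<in> {-real (Suc k)..real (Suc k)} then 2 * real (Suc k) else 0)"
        proof (cases "x \<in> {-real (Suc k)..real (Suc k)}")
          case True
          have "norm (F n x) \<le> real (Suc k)" using True bd[of n x] by (simp add: F_def)
          then have "norm (F n x - fM k x) \<le> real (Suc k) + real (Suc k)"
            by (rule order_trans[OF norm_triangle_ineq4 add_mono[OF _ fM_bd]])
          then show ?thesis using True by simp
        next
          case False
          then show ?thesis by (simp only: F_def fM_def) simp
        qed
      qed
      show "AE x in lebesgue. (\<lambda>n. F n x) \<longlonglongrightarrow> fM k x" using aeN
      proof eventually_elim
        case (elim x)
        have "isCont (clip (real (Suc k))) (f x)"
          using continuous_on_clip[of "real (Suc k)" UNIV] continuous_on_eq_continuous_at[of UNIV "clip (real (Suc k))"]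
          by (simp only: open_UNIV of_nat_0_less_iff zero_less_Suc simp_thms) blast
        from isCont_tendsto_compose[OF this l[OF elim]] show ?case by (auto simp: F_def fM_def simp del: of_nat_Suc)
      qed
    qed
  qed
  then show ?thesis
  proof (rule molconv_closed[OF f fM_L2])
    show "(\<lambda>k. N2 (\<lambda>x. fM k x - f x)) \<longlonglongrightarrow> 0"
    proof (rule N2_dominated_convergence[OF mfM m])
      show "in_L2 (\<lambda>x. 2 *\<^sub>R norm (f x))"
        using f by (auto simp: in_L2_def power_mult_distrib)
      show "AE x in lebesgue. norm (fM n x - f x) \<le> norm (2 *\<^sub>R norm (f x))" for n
      proof (rule AE_I2)
        fix x show "norm (fM n x - f x) \<le> norm (2 *\<^sub>R norm (f x))"
          using norm_triangle_ineq4[of "fM n x" "f x"] fM_le[of n x] by simp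
      qed
      have "(\<lambda>k. fM k x) \<longlonglongrightarrow> f x" for x
      proof -
        obtain K :: nat where K: "max \<bar>x\<bar> (norm (f x)) \<le> real K" using real_arch_simple by blast
        have "fM k x = f x" if "K \<le> k" for k
        proof -
          have "\<bar>x\<bar> \<le> real (Suc k)" "norm (f x) \<le> real (Suc k)" using K that by auto
          then show ?thesis using clip(3)[of "real (Suc k)" "f x"] by (auto simp: fM_def simp del: of_nat_Suc)
        qed
        then show ?thesis by (intro tendsto_eventually eventually_sequentiallyI[of K]) auto
      qed
      then show "AE x in lebesgue. (\<lambda>k. fM k x) \<longlonglongrightarrow> f x" by simp
    qed
  qed
qed

lemma N2_AE_subseq:
  assumes m: "\<And>n. f n \<in> borel_measurable lebesgue" and fin: "\<And>n. N2 (f n) < \<infinity>" and l: "(\<lambda>n. N2 (f n)) \<longlonglongrightarrow> 0"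
  shows "\<exists>r. strict_mono r \<and> (AE x in lebesgue. (\<lambda>n. f (r n) x) \<longlonglongrightarrow> 0)"
proof -
  have i: "integrable lebesgue (\<lambda>x. (norm (f n x))\<^sup>2)" for n
    using m[of n] fin[of n] in_L2_iff[of "f n"] by (simp add: in_L2_def)
  have "(\<lambda>n. enn2real (N2 (f n))) \<longlonglongrightarrow> enn2real 0" using l by (intro tendsto_enn2real) auto
  moreover have "enn2real (N2 (f n)) = (LINT x|lebesgue. norm ((norm (f n x))\<^sup>2))" for n
    unfolding N2_def using m[of n] by (simp add: integral_eq_nn_integral)
  ultimately have "(\<lambda>n. LINT x|lebesgue. norm ((norm (f n x))\<^sup>2)) \<longlonglongrightarrow> 0" by simp
  from tendsto_L1_AE_subseq[OF i this] obtain r :: "nat \<Rightarrow> nat" where r: "strict_mono r"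
    "AE x in lebesgue. (\<lambda>n. (norm (f (r n) x))\<^sup>2) \<longlonglongrightarrow> 0" by auto
  have "AE x in lebesgue. (\<lambda>n. f (r n) x) \<longlonglongrightarrow> 0"
    using r(2)
  proof eventually_elim
    case (elim x)
    then have "(\<lambda>n. sqrt ((norm (f (r n) x))\<^sup>2)) \<longlonglongrightarrow> sqrt 0" by (intro tendsto_real_sqrt)
    then show ?case by (simp add: tendsto_norm_zero_iff)
  qed
  then show ?thesis using r(1) by blast
qed

text \<open>Testing with the mollified sign of \<open>w\<close> avoids an approximation of \<open>w\<close> itself, which is only
  locally integrable.\<close>

lemma weak_null_real:
  fixes w :: "real \<Rightarrow> real"
  assumes w: "w \<in> L1_loc" and z: "\<And>\<phi>. test_function \<phi> \<Longrightarrow> (LINT x|lebesgue. \<phi> x * w x) = 0"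
  shows "AE x in lebesgue. w x = 0"
proof -
  have [measurable]: "w \<in> borel_measurable lebesgue" by (rule L1_loc_measurable[OF w])
  have "AE x in lebesgue. \<bar>x\<bar> \<le> real R \<longrightarrow> w x = 0" for R :: nat
  proof -
    \<comment> \<open>On [-R, R] the product s w is |w|. The mollifications of s are test functions
      bounded by 1 with supports in one interval, so they may be inserted into the hypothesis, and
      dominated convergence applies along a subsequence.\<close>
    define s where "s x = (if x \<in> {-real R..real R} then sgn (w x) else 0)" for x
    have sm[measurable]: "s \<in> borel_measurable lebesgue" unfolding s_def by measurable
    have sb: "norm (s x) \<le> 1" for x by (simp add: s_def sgn_if)
    have s0: "s x = 0" if "real R < \<bar>x\<bar>" for x using that by (auto simp: s_def)
    have sL: "in_L2 s" by (rule in_L2_bounded_support[OF sm sb s0])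
    note sl = in_L2_imp_L1_loc[OF sL] and t = mollifierD(1)[OF is_mollifier_mol]
    have mc: "cnv s (mol n) \<in> borel_measurable lebesgue" for n by (rule cnv_measurable[OF sl t])
    have "N2 (\<lambda>x. cnv s (mol n) x - s x) < \<infinity>" for n
    proof -
      have "in_L2 (cnv s (mol n))" 
        using N2_cnv_le[OF sl is_mollifier_mol[of n]] sL mc by (auto simp: in_L2_iff elim: order.strict_trans1)
      from in_L2_diff[OF this sL] show ?thesis by (simp add: in_L2_iff)
    qed
    from N2_AE_subseq[OF _ this molconv_L2[OF sL, unfolded molconv_def]] mc sm obtain r where
      "AE x in lebesgue. (\<lambda>n. cnv s (mol (r n)) x - s x) \<longlonglongrightarrow> 0" by (auto intro: borel_measurable_diff)
    then have ae: "AE x in lebesgue. (\<lambda>n. cnv s (mol (r n)) x) \<longlonglongrightarrow> s x" by (simp add: LIM_zero_iff)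
    have "(\<lambda>n. LINT x|lebesgue. cnv s (mol (r n)) x *\<^sub>R w x) \<longlonglongrightarrow> (LINT x|lebesgue. s x *\<^sub>R w x)"
    proof (rule L1_loc_dominated_convergence[OF w mc sm _ _ ae, where C=1 and R="real R + 1"])
      show "\<bar>cnv s (mol (r n)) x\<bar> \<le> 1" for n x
        using norm_cnv_le[OF sm _ is_mollifier_mol, of 0 1 "r n" x] sb by simp
      show "cnv s (mol (r n)) x = 0" if "real R + 1 < \<bar>x\<bar>" for n x
        by (rule cnv_support[OF s0 mol_support that])
    qed
    moreover have "(LINT x|lebesgue. cnv s (mol (r n)) x *\<^sub>R w x) = 0" for n
      using z[OF cnv_test_function[OF sl s0 t]] by simp
    ultimately have "(LINT x|lebesgue. s x * w x) = 0" by (simp add: LIMSEQ_const_iff)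
    moreover have "integrable lebesgue (\<lambda>x. s x * w x)"
      using L1_loc_bounded_integrable[OF w sm, of 1 "real R"] sb s0 by simp
    moreover have "0 \<le> s x * w x" for x by (auto simp: s_def sgn_if)
    ultimately have "AE x in lebesgue. s x * w x = 0" using integral_nonneg_eq_0_iff_AE by blast
    then show ?thesis by eventually_elim (auto simp: s_def sgn_if split: if_splits)
  qed
  then have "AE x in lebesgue. \<forall>R::nat. \<bar>x\<bar> \<le> real R \<longrightarrow> w x = 0" unfolding AE_all_countable by blast
  then show ?thesis by eventually_elim (use real_arch_simple in blast)
qed

lemma weak_null:
  fixes w :: "real \<Rightarrow> 'a::euclidean_space"
  assumes w: "w \<in> L1_loc" and z: "\<And>\<phi>. test_function \<phi> \<Longrightarrow> (LINT x|lebesgue. \<phi> x *\<^sub>R w x) = 0"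
  shows "AE x in lebesgue. w x = 0"
proof -
  have "AE x in lebesgue. w x \<bullet> b = 0" if "b \<in> Basis" for b
  proof (rule weak_null_real)
    show "(\<lambda>x. w x \<bullet> b) \<in> L1_loc"
      using w unfolding L1_loc_def set_integrable_def by (auto simp flip: inner_scaleR_left intro: integrable_inner_left)
    fix \<phi> :: "real \<Rightarrow> real" assume t: "test_function \<phi>"
    have "(LINT x|lebesgue. (\<phi> x *\<^sub>R w x) \<bullet> b) = (LINT x|lebesgue. \<phi> x *\<^sub>R w x) \<bullet> b"
      by (intro integral_inner_left L1_loc_test_integrable w t)
    then show "(LINT x|lebesgue. \<phi> x * (w x \<bullet> b)) = 0" using z[OF t] by simp
  qed
  then have "AE x in lebesgue. \<forall>b\<in>Basis. w x \<bullet> b = 0" by (intro AE_finite_allI) auto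
  then show ?thesis by eventually_elim (rule euclidean_eqI, simp)
qed

lemma weak_deriv_unique:
  assumes "has_weak_deriv j u v" "has_weak_deriv j u v'"
  shows "AE x in lebesgue. v x = v' x"
proof -
  have l: "v \<in> L1_loc" "v' \<in> L1_loc" using assms by (auto simp: has_weak_deriv_def)
  have "AE x in lebesgue. v x - v' x = 0"
  proof (rule weak_null[OF L1_loc_diff[OF l]])
    fix \<phi> :: "real \<Rightarrow> real" assume t: "test_function \<phi>"
    have "(-1) ^ j *\<^sub>R (LINT x|lebesgue. \<phi> x *\<^sub>R v x) = (-1::real) ^ j *\<^sub>R (LINT x|lebesgue. \<phi> x *\<^sub>R v' x)"
      using assms t unfolding has_weak_deriv_def by simp
    then show "(LINT x|lebesgue. \<phi> x *\<^sub>R (v x - v' x)) = 0"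
      using L1_loc_test_integrable[OF l(1) t] L1_loc_test_integrable[OF l(2) t] by (simp add: scaleR_diff_right)
  qed
  then show ?thesis by simp
qed

text \<open>\<open>weak_deriv\<close> is a choice. It is a weak derivative as soon as any function
  is one, and uniqueness then compares the two.\<close>

lemma weak_deriv_eq:
  assumes "has_weak_deriv j u v"
  shows "has_weak_deriv j u (\<partial>\<^bsup>j\<^esup> u)" "AE x in lebesgue. \<partial>\<^bsup>j\<^esup> u x = v x"
proof -
  show "has_weak_deriv j u (\<partial>\<^bsup>j\<^esup> u)" unfolding weak_deriv_def by (rule someI[of "has_weak_deriv j u", OF assms])
  then show "AE x in lebesgue. \<partial>\<^bsup>j\<^esup> u x = v x" using weak_deriv_unique assms by blast
qed

section \<open>Weak derivatives and absolutely continuous representatives\<close>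

definition N2I :: "(real \<Rightarrow> 'a::euclidean_space) \<Rightarrow> real \<Rightarrow> real \<Rightarrow> ennreal" where
  "N2I f a b = (\<integral>\<^sup>+x. ennreal ((norm (f x))\<^sup>2) * indicator {a..b} x \<partial>lebesgue)"

lemma N2I_le_N2: "N2I f a b \<le> N2 f"
  unfolding N2I_def N2_def by (intro nn_integral_mono) (auto simp: indicator_def)

lemma N2I_mono: "a' \<le> a \<Longrightarrow> b \<le> b' \<Longrightarrow> N2I f a b \<le> N2I f a' b'"
  unfolding N2I_def by (intro nn_integral_mono mult_left_mono) (auto simp: indicator_def)

lemma N2I_cong: "AE x in lebesgue. f x = g x \<Longrightarrow> N2I f a b = N2I g a b"
  unfolding N2I_def by (rule nn_integral_cong_AE) (auto elim!: eventually_mono)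

lemma N2I_add:
  assumes [measurable]: "f \<in> borel_measurable lebesgue" "g \<in> borel_measurable lebesgue"
  shows "N2I (\<lambda>x. f x + g x) a b \<le> 2 * N2I f a b + 2 * N2I g a b"
proof -
  have "N2I (\<lambda>x. f x + g x) a b \<le> (\<integral>\<^sup>+x. 2 * (ennreal ((norm (f x))\<^sup>2) * indicator {a..b} x) + 2 * (ennreal ((norm (g x))\<^sup>2) * indicator {a..b} x) \<partial>lebesgue)"
    unfolding N2I_def
    by (intro nn_integral_mono) (use norm_add_sq_le in \<open>auto simp: indicator_def ennreal_mult[symmetric] ennreal_plus[symmetric] ennreal_leI simp del: ennreal_plus simp flip: ennreal_numeral\<close>)
  also have "\<dots> = 2 * N2I f a b + 2 * N2I g a b"
    unfolding N2I_def by (subst nn_integral_add) (auto simp: nn_integral_cmult)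
  finally show ?thesis .
qed

lemma emeasure_lebesgue_Icc: "a \<le> b \<Longrightarrow> emeasure lebesgue {a..b} = ennreal (b - a)"
  by (simp)

lemma L1_loc_set_integrable: "u \<in> L1_loc \<Longrightarrow> set_integrable lebesgue {a..b} u"
  by (simp add: L1_loc_def)

lemma L1_loc_integrable_on: "u \<in> L1_loc \<Longrightarrow> u integrable_on {a..b}"
  using set_lebesgue_integral_eq_integral(1) L1_loc_set_integrable by blast

text \<open>Cauchy-Schwarz against the indicator of [a, b]. Applied to a derivative in L2, it is the
  Hoelder estimate with exponent 1/2 from which the pointwise bounds are derived.\<close>

lemma integral_Cauchy_Schwarz:
  assumes h: "h \<in> L1_loc" and ab: "a \<le> b"
  shows "ennreal ((norm (integral {a..b} h))\<^sup>2) \<le> ennreal (b - a) * N2I h a b"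
proof -
  have [measurable]: "h \<in> borel_measurable lebesgue" by (rule L1_loc_measurable[OF h])
  note s = L1_loc_set_integrable[OF h, of a b]
  have "integral {a..b} h = (LINT x|lebesgue. indicator {a..b} x *\<^sub>R h x)"
    using set_lebesgue_integral_eq_integral(2)[OF s] by (simp add: set_lebesgue_integral_def)
  then have "ennreal (norm (integral {a..b} h)) \<le> (\<integral>\<^sup>+x. ennreal (norm (indicator {a..b} x *\<^sub>R h x)) \<partial>lebesgue)"
    using integral_norm_bound_ennreal[OF s[unfolded set_integrable_def]] by simp
  also have "\<dots> = (\<integral>\<^sup>+x. ennreal (norm (h x) * indicator {a..b} x) * indicator {a..b} x \<partial>lebesgue)"
    by (intro nn_integral_cong) (auto simp: indicator_def)
  finally have "(ennreal (norm (integral {a..b} h)))\<^sup>2 \<le> (\<integral>\<^sup>+x. ennreal (norm (h x) * indicator {a..b} x) * indicator {a..b} x \<partial>lebesgue)\<^sup>2"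
    by (rule power_mono) simp
  also have "\<dots> \<le> (\<integral>\<^sup>+x. (ennreal (norm (h x) * indicator {a..b} x))\<^sup>2 \<partial>lebesgue) * (\<integral>\<^sup>+x. (indicator {a..b} x)\<^sup>2 \<partial>lebesgue)"
    by (rule Cauchy_Schwarz_nn_integral) measurable
  also have "(\<integral>\<^sup>+x. (ennreal (norm (h x) * indicator {a..b} x))\<^sup>2 \<partial>lebesgue) = N2I h a b"
    unfolding N2I_def by (intro nn_integral_cong) (auto simp: indicator_def ennreal_power)
  also have "(\<integral>\<^sup>+x. (indicator {a..b} x)\<^sup>2 \<partial>lebesgue) = (\<integral>\<^sup>+x. indicator {a..b} x \<partial>lebesgue)"
    by (intro nn_integral_cong) (auto simp: indicator_def)
  also have "\<dots> = ennreal (b - a)" using emeasure_lebesgue_Icc[OF ab] by (simp del: emeasure_completion)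
  finally show ?thesis by (simp add: ennreal_power mult.commute)
qed

text \<open>Every kernel has its support in [-1, 1]. This reduces locally square integrable
  functions to their restrictions, which are in L2.\<close>

lemma cnv_mol_local:
  assumes "\<And>y. \<bar>x - y\<bar> \<le> 1 \<Longrightarrow> u y = v y"
  shows "cnv u (mol n) x = cnv v (mol n) x"
  unfolding cnv_def
proof (intro Bochner_Integration.integral_cong refl)
  fix y
  show "mol n (x - y) *\<^sub>R u y = mol n (x - y) *\<^sub>R v y"
    using assms[of y] mol_support[of "x - y" n] by (cases "1 < \<bar>x - y\<bar>") auto
qed

abbreviation restr :: "real \<Rightarrow> (real \<Rightarrow> 'a::zero) \<Rightarrow> real \<Rightarrow> 'a" where
  "restr R f \<equiv> \<lambda>x. if x \<in> {-R..R} then f x else 0"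

lemma weak_deriv_FTC:
  assumes w: "has_weak_deriv 1 f g" and \<rho>: "test_function \<rho>" and ab: "a \<le> b"
  shows "cnv f \<rho> b - cnv f \<rho> a = integral {a..b} (cnv g \<rho>)"
proof -
  have f: "f \<in> L1_loc" using w by (simp add: has_weak_deriv_def)
  have "(cnv f \<rho> has_vector_derivative cnv g \<rho> x) (at x)" for x
    using cnv_has_derivative[OF f \<rho>] weak_deriv_cnv[OF w \<rho>] by simp
  then have "((cnv g \<rho>) has_integral (cnv f \<rho> b - cnv f \<rho> a)) {a..b}"
    by (intro fundamental_theorem_of_calculus ab) (simp add: has_vector_derivative_at_within)
  then show ?thesis by (simp add: integral_unique)
qed

lemma tendsto_integral_cnv_mol:
  fixes g :: "real \<Rightarrow> 'a::euclidean_space"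
  assumes g: "g \<in> L1_loc" "\<And>R. in_L2 (restr R g)" and ab: "a \<le> b"
  shows "(\<lambda>n. integral {a..b} (cnv g (mol n))) \<longlonglongrightarrow> integral {a..b} g"
proof -
  \<comment> \<open>The additional 1 is the distance by which a convolution on [a, b] reaches beyond
    this interval.\<close>
  define R where "R = \<bar>a\<bar> + \<bar>b\<bar> + 1"
  note t = mollifierD(1)[OF is_mollifier_mol]
  define gR where "gR = restr R g"
  have gR: "gR \<in> L1_loc" using in_L2_imp_L1_loc[OF g(2)] by (simp add: gR_def)
  have c: "cnv g (mol n) x = cnv gR (mol n) x" if "x \<in> {a..b}" for n x
    by (rule cnv_mol_local) (use that in \<open>auto simp: gR_def R_def\<close>)
  have e: "g x = gR x" if "x \<in> {a..b}" for x using that by (auto simp: gR_def R_def)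
  have cl: "cnv gR (mol n) \<in> L1_loc" for n
  proof -
    have "N2 (cnv gR (mol n)) \<le> N2 gR" by (rule N2_cnv_le[OF gR is_mollifier_mol])
    then have "in_L2 (cnv gR (mol n))"
      using g(2)[of R] cnv_measurable[OF gR t] by (auto simp: in_L2_iff gR_def elim: order.strict_trans1)
    then show ?thesis by (rule in_L2_imp_L1_loc)
  qed
  have "(\<lambda>n. norm (integral {a..b} (cnv g (mol n)) - integral {a..b} g)) \<longlonglongrightarrow> 0"
  proof -
    have "(\<lambda>n. ennreal ((norm (integral {a..b} (cnv g (mol n)) - integral {a..b} g))\<^sup>2)) \<longlonglongrightarrow> 0"
    proof (rule tendsto_sandwich[of "\<lambda>_. 0" _ _ "\<lambda>n. ennreal (b - a) * N2 (\<lambda>x. cnv gR (mol n) x - gR x)"])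
      have "integral {a..b} (cnv g (mol n)) - integral {a..b} g = integral {a..b} (\<lambda>x. cnv gR (mol n) x - gR x)" for n
        using Henstock_Kurzweil_Integration.integral_diff[OF L1_loc_integrable_on[OF cl[of n], of a b] L1_loc_integrable_on[OF gR, of a b]]
          integral_cong[of "{a..b}", OF c[of _ n]] integral_cong[of "{a..b}", OF e] by simp
      then show "\<forall>\<^sub>F n in sequentially. ennreal ((norm (integral {a..b} (cnv g (mol n)) - integral {a..b} g))\<^sup>2) \<le> ennreal (b - a) * N2 (\<lambda>x. cnv gR (mol n) x - gR x)"
        using order_trans[OF integral_Cauchy_Schwarz[OF L1_loc_diff[OF cl gR] ab] mult_left_mono[OF N2I_le_N2]]
        by (intro always_eventually allI) simp
      have "(\<lambda>n. ennreal (b - a) * N2 (\<lambda>x. cnv gR (mol n) x - gR x)) \<longlonglongrightarrow> ennreal (b - a) * 0"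
        using molconv_L2[OF g(2)[of R]] by (intro ennreal_tendsto_cmult) (auto simp: molconv_def gR_def)
      then show "(\<lambda>n. ennreal (b - a) * N2 (\<lambda>x. cnv gR (mol n) x - gR x)) \<longlonglongrightarrow> 0" by simp
    qed auto
    then have "(\<lambda>n. (norm (integral {a..b} (cnv g (mol n)) - integral {a..b} g))\<^sup>2) \<longlonglongrightarrow> 0"
      using tendsto_ennreal_iff[of "\<lambda>n. (norm (integral {a..b} (cnv g (mol n)) - integral {a..b} g))\<^sup>2" sequentially 0] by simp
    then show ?thesis by simp
  qed
  then show ?thesis using LIM_zero_cancel tendsto_norm_zero_iff by blast
qed

lemma in_L2_restr_continuous:
  assumes "continuous_on UNIV f"
  shows "in_L2 (restr R f)"
proof -
  have "bounded (f ` {-R..R})"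
    by (intro compact_imp_bounded compact_continuous_image continuous_on_subset[OF assms]) auto
  then obtain C where "\<forall>y\<in>f ` {-R..R}. norm y \<le> C" unfolding bounded_iff by blast
  then have C: "norm (f x) \<le> max C 0" if "x \<in> {-R..R}" for x using that by force
  have [measurable]: "f \<in> borel_measurable lebesgue" by (rule borel_measurable_lebesgue_continuous[OF assms])
  show ?thesis
    by (rule in_L2_bounded_support[where R=R and C="max C 0"]) (measurable, use C in auto)
qed

text \<open>Integrated over [a, b], the relation between G and L holds for mollifications and passes
  to the limit; the classical fundamental theorem does the rest. In the application the variable is
  time: this is how the distributional equation becomes a differential equation.\<close>

lemma weak_deriv_continuous:
  fixes G L :: "real \<Rightarrow> 'a::euclidean_space"
  assumes w: "has_weak_deriv 1 G L" and c: "continuous_on UNIV G" "continuous_on UNIV L"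
  shows "(G has_vector_derivative L x) (at x)"
proof -
  have l: "G \<in> L1_loc" "L \<in> L1_loc" using w by (auto simp: has_weak_deriv_def)
  note t = mollifierD(1)[OF is_mollifier_mol]
  have FTC: "G b - G a = integral {a..b} L" if "a \<le> b" for a b
  proof (rule LIMSEQ_unique)
    show "(\<lambda>n. cnv G (mol n) b - cnv G (mol n) a) \<longlonglongrightarrow> G b - G a"
      using c(1) by (intro tendsto_diff cnv_mol_tendsto_at l) (simp_all add: continuous_on_eq_continuous_at)
    show "(\<lambda>n. cnv G (mol n) b - cnv G (mol n) a) \<longlonglongrightarrow> integral {a..b} L"
      unfolding weak_deriv_FTC[OF w t that]
      by (rule tendsto_integral_cnv_mol[OF l(2) in_L2_restr_continuous[OF c(2)] that])
  qed
  have "((\<lambda>y. integral {x - 1..y} L) has_vector_derivative L x) (at x within {x - 1..x + 1})"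
    by (rule integral_has_vector_derivative) (auto intro: continuous_on_subset[OF c(2)])
  then have "((\<lambda>y. G (x - 1) + integral {x - 1..y} L) has_vector_derivative 0 + L x) (at x within {x - 1..x + 1})"
    by (intro derivative_intros)
  then have "(G has_vector_derivative L x) (at x within {x - 1..x + 1})"
    using FTC by (auto intro: has_vector_derivative_transform[where f="\<lambda>y. G (x - 1) + integral {x - 1..y} L", rotated 2]
        simp: algebra_simps)
  then show ?thesis
    by (subst (asm) at_within_interior) (auto simp: interior_atLeastAtMost_real)
qed

section \<open>Absolutely continuous representatives and Sobolev estimates\<close>

definition ac :: "(real \<Rightarrow> 'a::euclidean_space) \<Rightarrow> (real \<Rightarrow> 'a) \<Rightarrow> bool" where
  "ac F g \<longleftrightarrow> g \<in> L1_loc \<and> (\<forall>a b. a \<le> b \<longrightarrow> F b - F a = integral {a..b} g)"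

text \<open>Mollifications satisfy the fundamental theorem of calculus exactly, but they are only
  known to converge almost everywhere and along subsequences, so the identity is first obtained
  between good points. Integrating \<open>g\<close> from one good point then defines
  \<open>F\<close> everywhere. The assumptions are local because \<Psi> itself is not in L2.\<close>

lemma weak_deriv_ac:
  fixes f g :: "real \<Rightarrow> 'a::euclidean_space"
  assumes w: "has_weak_deriv 1 f g" and f: "\<And>R. in_L2 (restr R f)" and g: "\<And>R. in_L2 (restr R g)"
  shows "\<exists>F. (AE x in lebesgue. f x = F x) \<and> ac F g"
proof -
  have l: "f \<in> L1_loc" "g \<in> L1_loc" using w by (auto simp: has_weak_deriv_def)
  note t = mollifierD(1)[OF is_mollifier_mol]
  define good where "good r R x \<longleftrightarrow> (\<bar>x\<bar> + 1 \<le> real R \<longrightarrow> (\<lambda>n. cnv f (mol (r n)) x) \<longlonglongrightarrow> f x)" for r :: "nat \<Rightarrow> nat" and R :: nat and x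
  \<comment> \<open>The subsequence comes from convergence in L2 of the restriction to [-R, R] and
    depends on R. Points closer than 1 to the ends are left out, because the kernels see the cut
    from there.\<close>
  have "\<exists>r. strict_mono r \<and> (AE x in lebesgue. good r R x)" for R
  proof -
    note fl = in_L2_imp_L1_loc[OF f[of "real R"]]
    have mc: "cnv (restr R f) (mol n) \<in> borel_measurable lebesgue" for n by (rule cnv_measurable[OF fl t])
    have 1: "in_L2 (\<lambda>x. cnv (restr R f) (mol n) x - restr R f x)" for n
    proof -
      have "in_L2 (cnv (restr R f) (mol n))" 
        using N2_cnv_le[OF fl is_mollifier_mol[of n]] f[of R] mc by (auto simp only: in_L2_iff intro: order.strict_trans1)
      from in_L2_diff[OF this f] show ?thesis .
    qed
    obtain r where r: "strict_mono r" "AE x in lebesgue. (\<lambda>n. cnv (restr R f) (mol (r n)) x - restr R f x) \<longlonglongrightarrow> 0"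
      using N2_AE_subseq[OF in_L2_measurable[OF 1] _ molconv_L2[OF f[of R], unfolded molconv_def]] 1 unfolding in_L2_iff by blast
    have "AE x in lebesgue. good r R x"
      using r(2)
    proof eventually_elim
      case (elim x)
      show "good r R x" unfolding good_def
      proof
        assume x: "\<bar>x\<bar> + 1 \<le> real R"
        have "cnv f (mol n) x = cnv (restr R f) (mol n) x" for n
          by (rule cnv_mol_local) (use x in auto)
        moreover have "f x = restr R f x" using x by auto
        ultimately show "(\<lambda>n. cnv f (mol (r n)) x) \<longlonglongrightarrow> f x" using LIM_zero_cancel[OF elim] by (simp only:)
      qed
    qed
    then show ?thesis using r(1) by blast
  qed
  then obtain r where r: "\<And>R. strict_mono (r R)" "\<And>R. AE x in lebesgue. good (r R) R x" by metis
  have ae: "AE x in lebesgue. \<forall>R. good (r R) R x" using r(2) unfolding AE_all_countable by blast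
  have key: "f b - f a = integral {a..b} g" if ab: "a \<le> b" and "\<forall>R. good (r R) R a" "\<forall>R. good (r R) R b" for a b
  proof -
    obtain R :: nat where R: "\<bar>a\<bar> + \<bar>b\<bar> + 1 \<le> real R" using real_arch_simple by blast
    show ?thesis
    proof (rule LIMSEQ_unique)
      have "\<bar>a\<bar> + 1 \<le> real R" "\<bar>b\<bar> + 1 \<le> real R" using R by auto
      then show "(\<lambda>n. cnv f (mol (r R n)) b - cnv f (mol (r R n)) a) \<longlonglongrightarrow> f b - f a"
        using that(2,3) unfolding good_def by (intro tendsto_diff) blast+
      show "(\<lambda>n. cnv f (mol (r R n)) b - cnv f (mol (r R n)) a) \<longlonglongrightarrow> integral {a..b} g"
        unfolding weak_deriv_FTC[OF w t ab]
        using LIMSEQ_subseq_LIMSEQ[OF tendsto_integral_cnv_mol[OF l(2) g ab] r(1)[of R]] by (simp add: o_def)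
    qed
  qed
  have "\<exists>c. \<forall>R. good (r R) R c"
  proof (rule ccontr)
    assume "\<not> ?thesis"
    then have "AE x::real in lebesgue. False" by (intro eventually_mono[OF ae]) blast
    then show False by (rule AE_lebesgue_const)
  qed
  then obtain c where c: "\<forall>R. good (r R) R c" by blast
  define F where "F x = (if c \<le> x then f c + integral {c..x} g else f c - integral {x..c} g)" for x
  have "AE x in lebesgue. f x = F x"
    using ae
  proof eventually_elim
    case (elim x)
    show ?case
    proof (cases "c \<le> x")
      case True then show ?thesis using key[OF True c elim] by (simp add: F_def algebra_simps)
    next
      case False then show ?thesis using key[OF _ elim c] by (simp add: F_def algebra_simps)
    qed
  qed
  moreover have "F b - F a = integral {a..b} g" if ab: "a \<le> b" for a b
  proof -
    note cmb = Henstock_Kurzweil_Integration.integral_combine[OF _ _ L1_loc_integrable_on[OF l(2)]]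
    consider "c \<le> a" | "a < c" "c \<le> b" | "b < c" using ab by linarith
    then show ?thesis
    proof cases
      case 1 then show ?thesis using ab cmb[of c a b] by (simp add: F_def algebra_simps)
    next
      case 2 then show ?thesis using ab cmb[of a c b] by (simp add: F_def algebra_simps)
    next
      case 3 then show ?thesis using ab cmb[of a b c] by (simp add: F_def algebra_simps)
    qed
  qed
  ultimately show ?thesis using l(2) unfolding ac_def by blast
qed

lemma ac_bound:
  assumes "ac F g" "\<bar>y - x\<bar> \<le> r"
  shows "ennreal ((norm (F y - F x))\<^sup>2) \<le> ennreal r * N2I g (x - r) (x + r)"
proof -
  have *: "ennreal ((norm (F b - F a))\<^sup>2) \<le> ennreal r * N2I g (x - r) (x + r)"
    if "a \<le> b" "b - a \<le> r" "x - r \<le> a" "b \<le> x + r" for a b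
  proof -
    have "ennreal ((norm (F b - F a))\<^sup>2) \<le> ennreal (b - a) * N2I g a b"
      using assms(1) that(1) integral_Cauchy_Schwarz[of g a b] by (simp add: ac_def)
    also have "\<dots> \<le> ennreal r * N2I g (x - r) (x + r)"
      using that by (intro mult_mono ennreal_leI N2I_mono) auto
    finally show ?thesis .
  qed
  show ?thesis
  proof (cases "x \<le> y")
    case True then show ?thesis using assms(2) by (intro *) auto
  next
    case False then show ?thesis using assms(2) *[of y x] by (simp add: norm_minus_commute)
  qed
qed

lemma ac_cnv_pointwise:
  assumes ac: "ac F g" and F: "F \<in> L1_loc" and \<rho>: "is_mollifier \<rho> r"
  shows "ennreal ((norm (cnv F \<rho> x - F x))\<^sup>2) \<le> ennreal r * N2I g (x - r) (x + r)"
proof -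
  note \<rho>' = mollifierD[OF \<rho>]
  have "ennreal ((norm (cnv F \<rho> x - F x))\<^sup>2) \<le> (\<integral>\<^sup>+y. ennreal ((norm (F y - F x))\<^sup>2) * ennreal (\<rho> (x - y)) \<partial>lebesgue)"
    by (rule mollifier_Jensen[OF F \<rho>])
  also have "\<dots> \<le> (\<integral>\<^sup>+y. (ennreal r * N2I g (x - r) (x + r)) * ennreal (\<rho> (x - y)) \<partial>lebesgue)"
  proof (rule nn_integral_mono)
    fix y
    show "ennreal ((norm (F y - F x))\<^sup>2) * ennreal (\<rho> (x - y)) \<le> (ennreal r * N2I g (x - r) (x + r)) * ennreal (\<rho> (x - y))"
    proof (cases "r < \<bar>x - y\<bar>")
      case True then show ?thesis using \<rho>'(3) by simp
    next
      case False then show ?thesis by (intro mult_right_mono ac_bound[OF ac]) (auto simp: abs_minus_commute)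
    qed
  qed
  also have "\<dots> = ennreal r * N2I g (x - r) (x + r)"
    using \<rho>'(4) test_measurable[OF test_reflect[OF \<rho>'(1), of x]] by (subst nn_integral_cmult) auto
  finally show ?thesis .
qed

text \<open>Integrating the pointwise estimate in x spreads each value of |g|^2 over an interval of
  length 2 r, which gives the rate r^2. Only the derivative enters on the right, so the estimate
  serves \<Psi>, which does not decay.\<close>

lemma ac_cnv_N2:
  assumes ac: "ac F g" and F: "F \<in> L1_loc" and \<rho>: "is_mollifier \<rho> r"
  shows "N2 (\<lambda>x. cnv F \<rho> x - F x) \<le> ennreal r * (N2 g * ennreal (2 * r))"
proof (cases "0 \<le> r")
  case True
  have [measurable]: "g \<in> borel_measurable lebesgue" using ac L1_loc_measurable by (auto simp: ac_def)
  define h :: "real \<Rightarrow> real" where "h = indicator {-r..r}"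
  have h[measurable]: "h \<in> borel_measurable borel" unfolding h_def by measurable
  have "N2 (\<lambda>x. cnv F \<rho> x - F x) \<le> (\<integral>\<^sup>+x. (\<integral>\<^sup>+y. (ennreal r * ennreal ((norm (g y))\<^sup>2)) * ennreal (h (x - y)) \<partial>lebesgue) \<partial>lebesgue)"
    unfolding N2_def
  proof (rule nn_integral_mono)
    fix x
    have "ennreal ((norm (cnv F \<rho> x - F x))\<^sup>2) \<le> ennreal r * N2I g (x - r) (x + r)"
      by (rule ac_cnv_pointwise[OF assms])
    also have "\<dots> = (\<integral>\<^sup>+y. ennreal r * (ennreal ((norm (g y))\<^sup>2) * indicator {x-r..x+r} y) \<partial>lebesgue)"
      unfolding N2I_def by (subst nn_integral_cmult) auto
    also have "\<dots> = (\<integral>\<^sup>+y. (ennreal r * ennreal ((norm (g y))\<^sup>2)) * ennreal (h (x - y)) \<partial>lebesgue)"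
      by (intro nn_integral_cong) (auto simp: h_def indicator_def)
    finally show "ennreal ((norm (cnv F \<rho> x - F x))\<^sup>2) \<le> (\<integral>\<^sup>+y. (ennreal r * ennreal ((norm (g y))\<^sup>2)) * ennreal (h (x - y)) \<partial>lebesgue)" .
  qed
  also have "\<dots> = (\<integral>\<^sup>+y. ennreal r * ennreal ((norm (g y))\<^sup>2) \<partial>lebesgue) * (\<integral>\<^sup>+x. ennreal (h x) \<partial>lborel)"
    by (rule nn_integral_convolution_le) measurable
  also have "(\<integral>\<^sup>+x. ennreal (h x) \<partial>lborel) = ennreal (2 * r)"
    using True by (simp add: h_def ennreal_indicator)
  also have "(\<integral>\<^sup>+y. ennreal r * ennreal ((norm (g y))\<^sup>2) \<partial>lebesgue) = ennreal r * N2 g"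
    unfolding N2_def by (rule nn_integral_cmult) measurable
  finally show ?thesis by (simp add: mult.assoc)
next
  case False
  \<comment> \<open>With a negative radius the kernel would vanish identically, contrary to its
    integral 1.\<close>
  have "\<rho> x = 0" for x using mollifierD(3)[OF \<rho>, of x] False by auto
  then have "(LINT y|lebesgue. \<rho> (0 - y)) = 0" by simp
  then show ?thesis using mollifierD(5)[OF \<rho>, of 0] by simp
qed

text \<open>The Sobolev embedding on a unit interval: F x is compared with F y, and the result is
  averaged over y in [x, x + 1]. The local form matters for \<Psi>, which is square integrable only
  on bounded intervals.\<close>

lemma ac_sup:
  assumes ac: "ac F g" and [measurable]: "F \<in> borel_measurable lebesgue"
  shows "ennreal ((norm (F x))\<^sup>2) \<le> 2 * N2I F x (x + 1) + 2 * N2I g x (x + 1)"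
proof -
  have 1: "(\<integral>\<^sup>+y. c * indicator {x..x+1} y \<partial>lebesgue) = c" for c :: ennreal
    using emeasure_lebesgue_Icc[of x "x+1"] by (subst nn_integral_cmult) (auto simp del: emeasure_completion)
  have "ennreal ((norm (F x))\<^sup>2) = (\<integral>\<^sup>+y. ennreal ((norm (F x))\<^sup>2) * indicator {x..x+1} y \<partial>lebesgue)"
    by (rule 1[symmetric])
  also have "\<dots> \<le> (\<integral>\<^sup>+y. 2 * (ennreal ((norm (F y))\<^sup>2) * indicator {x..x+1} y) + (2 * N2I g x (x + 1)) * indicator {x..x+1} y \<partial>lebesgue)"
  proof (rule nn_integral_mono)
    fix y
    show "ennreal ((norm (F x))\<^sup>2) * indicator {x..x+1} y \<le> 2 * (ennreal ((norm (F y))\<^sup>2) * indicator {x..x+1} y) + (2 * N2I g x (x + 1)) * indicator {x..x+1} y"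
    proof (cases "y \<in> {x..x+1}")
      case True
      have "ennreal ((norm (F x))\<^sup>2) \<le> ennreal (2 * (norm (F y))\<^sup>2 + 2 * (norm (F y - F x))\<^sup>2)"
        using norm_add_sq_le[of "F y" "F x - F y"] by (intro ennreal_leI) (simp add: norm_minus_commute)
      also have "\<dots> = 2 * ennreal ((norm (F y))\<^sup>2) + 2 * ennreal ((norm (F y - F x))\<^sup>2)"
        by (simp add: ennreal_plus ennreal_mult')
      also have "ennreal ((norm (F y - F x))\<^sup>2) \<le> ennreal (y - x) * N2I g x y"
        using ac True integral_Cauchy_Schwarz[of g x y] by (simp add: ac_def)
      also have "\<dots> \<le> 1 * N2I g x (x + 1)"
        using True by (intro mult_mono N2I_mono) (auto simp: ennreal_le_1)
      finally show ?thesis using True by (simp add: add_left_mono mult_left_mono)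
    qed simp
  qed
  also have "\<dots> = 2 * N2I F x (x + 1) + 2 * N2I g x (x + 1)"
    by (subst nn_integral_add) (auto simp: 1 nn_integral_cmult N2I_def[of F])
  finally show ?thesis .
qed

section \<open>Modes of convergence and jet polynomials\<close>

definition N1 :: "(real \<Rightarrow> complex) \<Rightarrow> ennreal" where
  "N1 f = (\<integral>\<^sup>+x. ennreal (norm (f x)) \<partial>lebesgue)"

lemma N1_add:
  assumes [measurable]: "f \<in> borel_measurable lebesgue" "g \<in> borel_measurable lebesgue"
  shows "N1 (\<lambda>x. f x + g x) \<le> N1 f + N1 g"
proof -
  have "N1 (\<lambda>x. f x + g x) \<le> (\<integral>\<^sup>+x. ennreal (norm (f x)) + ennreal (norm (g x)) \<partial>lebesgue)"
    unfolding N1_def by (intro nn_integral_mono) (simp add: ennreal_leI norm_triangle_ineq flip: ennreal_plus)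
  also have "\<dots> = N1 f + N1 g" unfolding N1_def by (rule nn_integral_add) auto
  finally show ?thesis .
qed

lemma N1_mult:
  assumes [measurable]: "f \<in> borel_measurable lebesgue" "g \<in> borel_measurable lebesgue"
  shows "(N1 (\<lambda>x. f x * g x))\<^sup>2 \<le> N2 f * N2 g"
  using Cauchy_Schwarz_nn_integral[of "\<lambda>x. ennreal (norm (f x))" lebesgue "\<lambda>x. ennreal (norm (g x))"]
  by (simp add: N1_def N2_def norm_mult ennreal_mult ennreal_power)

lemma N1_mult_le:
  assumes [measurable]: "f \<in> borel_measurable lebesgue" and b: "AE x in lebesgue. norm (b x) \<le> M"
  shows "N1 (\<lambda>x. b x * f x) \<le> ennreal M * N1 f"
proof -
  have "N1 (\<lambda>x. b x * f x) \<le> (\<integral>\<^sup>+x. ennreal M * ennreal (norm (f x)) \<partial>lebesgue)"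
    unfolding N1_def
    by (rule nn_integral_mono_AE) (use b in eventually_elim,
       auto simp: norm_mult mult_right_mono simp flip: ennreal_mult'' intro!: ennreal_leI)
  then show ?thesis unfolding N1_def by (simp add: nn_integral_cmult)
qed

lemma integrable_iff_N1: "integrable lebesgue f \<longleftrightarrow> f \<in> borel_measurable lebesgue \<and> N1 f < \<infinity>"
  by (simp add: N1_def integrable_iff_bounded)

text \<open>Cauchy-Schwarz bounds the square of \<open>N1\<close>; this removes the square from the
  limit.\<close>

lemma ennreal_square_tendsto_0:
  fixes f :: "nat \<Rightarrow> ennreal"
  assumes "(\<lambda>n. (f n)\<^sup>2) \<longlonglongrightarrow> 0"
  shows "f \<longlonglongrightarrow> 0"
proof (rule ennreal_tendsto_0I)
  fix e :: real assume "0 < e"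
  then have "\<forall>\<^sub>F n in sequentially. (f n)\<^sup>2 < (ennreal e)\<^sup>2"
    by (intro order_tendstoD(2)[OF assms]) (simp add: ennreal_power)
  then show "\<forall>\<^sub>F n in sequentially. f n \<le> ennreal e"
    by eventually_elim (meson linorder_not_le order_less_imp_le power_mono zero_le)
qed

text \<open>Convergence in \<open>L\<^sup>2\<close>, in the essential supremum and in \<open>L\<^sup>1\<close>, for sequences of functions
  of \<open>x\<close>. In \<open>cT\<close> and \<open>cI\<close> only the limit and the difference to the limit are required to be in the
  space.\<close>

definition cT :: "(nat \<Rightarrow> real \<Rightarrow> complex) \<Rightarrow> (real \<Rightarrow> complex) \<Rightarrow> bool" where
  "cT f F \<longleftrightarrow> (\<forall>n. f n \<in> borel_measurable lebesgue) \<and> in_L2 F \<and> (\<lambda>n. N2 (\<lambda>x. f n x - F x)) \<longlonglongrightarrow> 0"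

definition cB :: "(nat \<Rightarrow> real \<Rightarrow> complex) \<Rightarrow> (real \<Rightarrow> complex) \<Rightarrow> bool" where
  "cB f F \<longleftrightarrow> (\<forall>n. f n \<in> borel_measurable lebesgue) \<and> F \<in> borel_measurable lebesgue
     \<and> (\<exists>M. AE x in lebesgue. norm (F x) \<le> M)
     \<and> (\<exists>\<delta>. \<delta> \<longlonglongrightarrow> 0 \<and> (\<forall>n. AE x in lebesgue. norm (f n x - F x) \<le> \<delta> n))"

definition cI :: "(nat \<Rightarrow> real \<Rightarrow> complex) \<Rightarrow> (real \<Rightarrow> complex) \<Rightarrow> bool" where
  "cI f F \<longleftrightarrow> (\<forall>n. f n \<in> borel_measurable lebesgue) \<and> integrable lebesgue F \<and> (\<lambda>n. N1 (\<lambda>x. f n x - F x)) \<longlonglongrightarrow> 0"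

section \<open>Calculus of the three modes of convergence\<close>

lemma cB_measurable: "cB f F \<Longrightarrow> f n \<in> borel_measurable lebesgue" "cB f F \<Longrightarrow> F \<in> borel_measurable lebesgue"
  by (auto simp: cB_def)

lemma cT_measurable: "cT f F \<Longrightarrow> f n \<in> borel_measurable lebesgue" "cT f F \<Longrightarrow> F \<in> borel_measurable lebesgue"
  by (auto simp: cT_def in_L2_def)

lemma cI_measurable: "cI f F \<Longrightarrow> f n \<in> borel_measurable lebesgue" "cI f F \<Longrightarrow> F \<in> borel_measurable lebesgue"
  by (auto simp: cI_def intro: borel_measurable_integrable)

text \<open>The definition bounds only the limit. Adding a bound of the convergent sequence \<delta>
  gives one constant for the whole sequence and its limit.\<close>

lemma cB_E:
  assumes "cB f F"
  obtains M \<delta> where "0 \<le> M" "\<And>n. AE x in lebesgue. norm (f n x) \<le> M" "AE x in lebesgue. norm (F x) \<le> M"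
    "\<delta> \<longlonglongrightarrow> 0" "\<And>n. 0 \<le> \<delta> n" "\<And>n. AE x in lebesgue. norm (f n x - F x) \<le> \<delta> n"
proof -
  obtain M \<delta> where M: "AE x in lebesgue. norm (F x) \<le> M" and d: "\<delta> \<longlonglongrightarrow> 0" "\<And>n. AE x in lebesgue. norm (f n x - F x) \<le> \<delta> n"
    using assms unfolding cB_def by blast
  have "AE x::real in lebesgue. 0 \<le> M" using M by eventually_elim (use norm_ge_zero order_trans in blast)
  then have M0: "0 \<le> M" by (rule AE_lebesgue_const)
  have "AE x::real in lebesgue. 0 \<le> \<delta> n" for n
    using d(2)[of n] by eventually_elim (use norm_ge_zero order_trans in blast)
  then have d0: "0 \<le> \<delta> n" for n using AE_lebesgue_const by blast
  obtain D where D: "\<And>n. \<bar>\<delta> n\<bar> \<le> D"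
    using convergent_imp_Bseq[OF convergentI[OF d(1)]] by (auto simp: Bseq_def)
  have D0: "0 \<le> D" using D[of 0] by linarith
  show thesis
  proof (rule that[of "M + D" \<delta>])
    show "AE x in lebesgue. norm (f n x) \<le> M + D" for n
      using M d(2)[of n]
    proof eventually_elim
      case (elim x)
      have "norm (f n x) \<le> norm (F x) + norm (f n x - F x)" by (rule norm_triangle_sub)
      then show ?case using elim D[of n] by linarith
    qed
    show "AE x in lebesgue. norm (F x) \<le> M + D" using M by eventually_elim (use D0 in simp)
  qed (use d d0 D0 M0 in auto)
qed

lemma cB_const: "cB (\<lambda>_ _. c) (\<lambda>_. c)"
  unfolding cB_def by (intro conjI exI[of _ "norm c"] exI[of _ "\<lambda>_. 0"]) auto

lemma cB_cnj:
  assumes "cB f F"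
  shows "cB (\<lambda>n x. cnj (f n x)) (\<lambda>x. cnj (F x))"
proof -
  have "norm (cnj a - cnj b) = norm (a - b)" for a b by (metis complex_cnj_diff complex_mod_cnj)
  then show ?thesis using assms unfolding cB_def by (simp add: borel_measurable_continuous_onI[THEN measurable_compose_rev] continuous_on_cnj)
qed

lemma cB_add:
  assumes "cB f F" "cB g G"
  shows "cB (\<lambda>n x. f n x + g n x) (\<lambda>x. F x + G x)"
proof -
  obtain M d M' d' where 1: "AE x in lebesgue. norm (F x) \<le> M" "d \<longlonglongrightarrow> 0" "\<And>n. AE x in lebesgue. norm (f n x - F x) \<le> d n"
    and 2: "AE x in lebesgue. norm (G x) \<le> M'" "d' \<longlonglongrightarrow> 0" "\<And>n. AE x in lebesgue. norm (g n x - G x) \<le> d' n"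
    using assms unfolding cB_def by blast
  show ?thesis unfolding cB_def
  proof (intro conjI exI allI)
    show "AE x in lebesgue. norm (F x + G x) \<le> M + M'"
      using 1(1) 2(1) by eventually_elim (rule norm_triangle_mono)
    show "(\<lambda>n. d n + d' n) \<longlonglongrightarrow> 0" using tendsto_add[OF 1(2) 2(2)] by simp
    show "AE x in lebesgue. norm (f n x + g n x - (F x + G x)) \<le> d n + d' n" for n
      using 1(3)[of n] 2(3)[of n]
      by eventually_elim (use norm_triangle_mono in \<open>fastforce simp: add_diff_add\<close>)
  qed (use assms in \<open>auto intro!: borel_measurable_add dest: cB_measurable\<close>)
qed

lemma cB_mult:
  assumes "cB f F" "cB g G"
  shows "cB (\<lambda>n x. f n x * g n x) (\<lambda>x. F x * G x)"
proof -
  obtain M d where 1: "0 \<le> M" "\<And>n. AE x in lebesgue. norm (f n x) \<le> M" "AE x in lebesgue. norm (F x) \<le> M" "d \<longlonglongrightarrow> 0" "\<And>n. 0 \<le> d n" "\<And>n. AE x in lebesgue. norm (f n x - F x) \<le> d n"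
    by (rule cB_E[OF assms(1)], rule that)
  obtain M' d' where 2: "0 \<le> M'" "\<And>n. AE x in lebesgue. norm (g n x) \<le> M'" "AE x in lebesgue. norm (G x) \<le> M'" "d' \<longlonglongrightarrow> 0" "\<And>n. 0 \<le> d' n" "\<And>n. AE x in lebesgue. norm (g n x - G x) \<le> d' n"
    by (rule cB_E[OF assms(2)], rule that)
  show ?thesis unfolding cB_def
  proof (intro conjI exI allI)
    show "AE x in lebesgue. norm (F x * G x) \<le> M * M'"
      using 1(3) 2(3) by eventually_elim (use 1 2 in \<open>simp add: norm_mult mult_mono\<close>)
    show "(\<lambda>n. M * d' n + d n * M') \<longlonglongrightarrow> 0"
      using tendsto_add[OF tendsto_mult_left[OF 2(4), of M] tendsto_mult_right[OF 1(4), of M']] by simp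
    show "AE x in lebesgue. norm (f n x * g n x - (F x * G x)) \<le> M * d' n + d n * M'" for n
      using 1(2)[of n] 1(6)[of n] 2(6)[of n] 2(3)
    proof eventually_elim
      case (elim x)
      have "f n x * g n x - F x * G x = f n x * (g n x - G x) + (f n x - F x) * G x" by (simp add: algebra_simps)
      also have "norm \<dots> \<le> M * d' n + d n * M'"
        using elim 1(1,5) 2(1,5) by (intro norm_triangle_mono) (auto simp: norm_mult intro!: mult_mono)
      finally show ?case .
    qed
  qed (use assms in \<open>auto intro!: borel_measurable_times dest: cB_measurable\<close>)
qed

lemma cT_cnj:
  assumes "cT f F"
  shows "cT (\<lambda>n x. cnj (f n x)) (\<lambda>x. cnj (F x))"
proof -
  have "norm (cnj a - cnj b) = norm (a - b)" for a b by (metis complex_cnj_diff complex_mod_cnj)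
  then show ?thesis using assms unfolding cT_def in_L2_def N2_def by (simp add: borel_measurable_continuous_onI[THEN measurable_compose_rev] continuous_on_cnj)
qed

lemma ennreal_tendsto_0_le:
  fixes f g :: "nat \<Rightarrow> ennreal"
  assumes "g \<longlonglongrightarrow> 0" "\<And>n. f n \<le> g n"
  shows "f \<longlonglongrightarrow> 0"
  by (rule tendsto_sandwich[OF _ _ tendsto_const assms(1)]) (auto simp: assms)

lemma cT_add:
  assumes "cT f F" "cT g G"
  shows "cT (\<lambda>n x. f n x + g n x) (\<lambda>x. F x + G x)"
proof -
  note [measurable] = cT_measurable[OF assms(1)] cT_measurable[OF assms(2)]
  have "(\<lambda>n. 2 * N2 (\<lambda>x. f n x - F x) + 2 * N2 (\<lambda>x. g n x - G x)) \<longlonglongrightarrow> 2 * 0 + 2 * 0"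
    using assms unfolding cT_def by (intro tendsto_add ennreal_tendsto_cmult) auto
  then have *: "(\<lambda>n. 2 * N2 (\<lambda>x. f n x - F x) + 2 * N2 (\<lambda>x. g n x - G x)) \<longlonglongrightarrow> 0" by simp
  have "(\<lambda>n. N2 (\<lambda>x. f n x + g n x - (F x + G x))) \<longlonglongrightarrow> 0"
    by (rule ennreal_tendsto_0_le[OF *]) (unfold add_diff_add, rule N2_add, measurable)
  then show ?thesis using assms in_L2_add unfolding cT_def by auto
qed

text \<open>In b f - B F = b (f - F) + (b - B) F, the first term uses a uniform bound of b, the
  second the uniform convergence of b together with F in L2.\<close>

lemma cT_mult:
  assumes "cB b B" "cT f F"
  shows "cT (\<lambda>n x. b n x * f n x) (\<lambda>x. B x * F x)"
proof -
  note [measurable] = cB_measurable[OF assms(1)] cT_measurable[OF assms(2)]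
  obtain M d where 1: "0 \<le> M" "\<And>n. AE x in lebesgue. norm (b n x) \<le> M" "AE x in lebesgue. norm (B x) \<le> M" "d \<longlonglongrightarrow> 0" "\<And>n. 0 \<le> d n" "\<And>n. AE x in lebesgue. norm (b n x - B x) \<le> d n"
    by (rule cB_E[OF assms(1)], rule that)
  have F: "N2 F < \<infinity>" using assms(2) by (simp add: cT_def in_L2_iff)
  have "N2 (\<lambda>x. B x * F x) \<le> ennreal (M\<^sup>2) * N2 F" by (rule N2_mult_le[OF _ 1(3)]) measurable
  then have "in_L2 (\<lambda>x. B x * F x)"
    using F by (auto simp: in_L2_iff ennreal_mult_less_top elim!: order.strict_trans1)
  moreover have "(\<lambda>n. N2 (\<lambda>x. b n x * f n x - B x * F x)) \<longlonglongrightarrow> 0"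
  proof (rule ennreal_tendsto_0_le)
    have "(\<lambda>n. (d n)\<^sup>2) \<longlonglongrightarrow> 0\<^sup>2" by (intro tendsto_intros 1)
    then have "(\<lambda>n. ennreal ((d n)\<^sup>2)) \<longlonglongrightarrow> 0" using tendsto_ennrealI by fastforce
    then have "(\<lambda>n. 2 * (ennreal (M\<^sup>2) * N2 (\<lambda>x. f n x - F x)) + 2 * (N2 F * ennreal ((d n)\<^sup>2))) \<longlonglongrightarrow> 2 * (ennreal (M\<^sup>2) * 0) + 2 * (N2 F * 0)"
      using assms(2) F unfolding cT_def by (intro tendsto_add ennreal_tendsto_cmult) (auto simp: ennreal_mult_less_top)
    then show "(\<lambda>n. 2 * (ennreal (M\<^sup>2) * N2 (\<lambda>x. f n x - F x)) + 2 * (N2 F * ennreal ((d n)\<^sup>2))) \<longlonglongrightarrow> 0" by simp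
    fix n
    have "N2 (\<lambda>x. b n x * f n x - B x * F x) = N2 (\<lambda>x. b n x * (f n x - F x) + (b n x - B x) * F x)"
      by (simp add: algebra_simps)
    also have "\<dots> \<le> 2 * N2 (\<lambda>x. b n x * (f n x - F x)) + 2 * N2 (\<lambda>x. (b n x - B x) * F x)"
      by (rule N2_add) measurable
    also have "\<dots> \<le> 2 * (ennreal (M\<^sup>2) * N2 (\<lambda>x. f n x - F x)) + 2 * (ennreal ((d n)\<^sup>2) * N2 F)"
      by (intro add_mono mult_left_mono N2_mult_le 1) auto
    finally show "N2 (\<lambda>x. b n x * f n x - B x * F x) \<le> 2 * (ennreal (M\<^sup>2) * N2 (\<lambda>x. f n x - F x)) + 2 * (N2 F * ennreal ((d n)\<^sup>2))"
      by (simp add: mult.commute)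
  qed
  ultimately show ?thesis unfolding cT_def by auto
qed

lemma cI_add:
  assumes "cI f F" "cI g G"
  shows "cI (\<lambda>n x. f n x + g n x) (\<lambda>x. F x + G x)"
proof -
  note [measurable] = cI_measurable[OF assms(1)] cI_measurable[OF assms(2)]
  have "(\<lambda>n. N1 (\<lambda>x. f n x - F x) + N1 (\<lambda>x. g n x - G x)) \<longlonglongrightarrow> 0 + 0"
    using assms unfolding cI_def by (intro tendsto_add) auto
  then have *: "(\<lambda>n. N1 (\<lambda>x. f n x - F x) + N1 (\<lambda>x. g n x - G x)) \<longlonglongrightarrow> 0" by simp
  have "(\<lambda>n. N1 (\<lambda>x. f n x + g n x - (F x + G x))) \<longlonglongrightarrow> 0"
    by (rule ennreal_tendsto_0_le[OF *]) (unfold add_diff_add, rule N1_add, measurable)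
  then show ?thesis using assms unfolding cI_def by auto
qed

lemma cI_mult:
  assumes "cB b B" "cI f F"
  shows "cI (\<lambda>n x. b n x * f n x) (\<lambda>x. B x * F x)"
proof -
  note [measurable] = cB_measurable[OF assms(1)] cI_measurable[OF assms(2)]
  obtain M d where 1: "0 \<le> M" "\<And>n. AE x in lebesgue. norm (b n x) \<le> M" "AE x in lebesgue. norm (B x) \<le> M" "d \<longlonglongrightarrow> 0" "\<And>n. 0 \<le> d n" "\<And>n. AE x in lebesgue. norm (b n x - B x) \<le> d n"
    by (rule cB_E[OF assms(1)], rule that)
  have F: "N1 F < \<infinity>" using assms(2) by (simp add: cI_def integrable_iff_N1)
  have "N1 (\<lambda>x. B x * F x) \<le> ennreal M * N1 F" by (rule N1_mult_le[OF _ 1(3)]) measurable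
  then have "integrable lebesgue (\<lambda>x. B x * F x)"
    using F by (auto simp: integrable_iff_N1 ennreal_mult_less_top elim!: order.strict_trans1)
  moreover have "(\<lambda>n. N1 (\<lambda>x. b n x * f n x - B x * F x)) \<longlonglongrightarrow> 0"
  proof (rule ennreal_tendsto_0_le)
    have "(\<lambda>n. ennreal (d n)) \<longlonglongrightarrow> 0" using tendsto_ennrealI[OF 1(4)] by simp
    then have "(\<lambda>n. ennreal M * N1 (\<lambda>x. f n x - F x) + N1 F * ennreal (d n)) \<longlonglongrightarrow> ennreal M * 0 + N1 F * 0"
      using assms(2) F unfolding cI_def by (intro tendsto_add ennreal_tendsto_cmult) (auto simp: ennreal_mult_less_top)
    then show "(\<lambda>n. ennreal M * N1 (\<lambda>x. f n x - F x) + N1 F * ennreal (d n)) \<longlonglongrightarrow> 0" by simp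
    fix n
    have "N1 (\<lambda>x. b n x * f n x - B x * F x) = N1 (\<lambda>x. b n x * (f n x - F x) + (b n x - B x) * F x)"
      by (simp add: algebra_simps)
    also have "\<dots> \<le> N1 (\<lambda>x. b n x * (f n x - F x)) + N1 (\<lambda>x. (b n x - B x) * F x)"
      by (rule N1_add) measurable
    also have "\<dots> \<le> ennreal M * N1 (\<lambda>x. f n x - F x) + ennreal (d n) * N1 F"
      by (intro add_mono N1_mult_le 1) auto
    finally show "N1 (\<lambda>x. b n x * f n x - B x * F x) \<le> ennreal M * N1 (\<lambda>x. f n x - F x) + N1 F * ennreal (d n)"
      by (simp add: mult.commute)
  qed
  ultimately show ?thesis unfolding cI_def by auto
qed

text \<open>Only the limits and the differences to them are controlled in L2. The splitting into (f
  - F) (g - G), G (f - F) and F (g - G) contains nothing else, and Cauchy-Schwarz applies to each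
  part.\<close>

lemma cI_TT:
  assumes "cT f F" "cT g G"
  shows "cI (\<lambda>n x. f n x * g n x) (\<lambda>x. F x * G x)"
proof -
  note [measurable] = cT_measurable[OF assms(1)] cT_measurable[OF assms(2)]
  have fin: "N2 F < \<infinity>" "N2 G < \<infinity>" using assms by (auto simp: cT_def in_L2_iff)
  have l: "(\<lambda>n. N2 (\<lambda>x. f n x - F x)) \<longlonglongrightarrow> 0" "(\<lambda>n. N2 (\<lambda>x. g n x - G x)) \<longlonglongrightarrow> 0"
    using assms by (auto simp: cT_def)
  have "(N1 (\<lambda>x. F x * G x))\<^sup>2 < \<infinity>"
    using fin by (intro order.strict_trans1[OF N1_mult]) (auto simp: ennreal_mult_less_top)
  then have "integrable lebesgue (\<lambda>x. F x * G x)"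
    by (simp add: integrable_iff_N1 power_less_top_ennreal)
  moreover have "(\<lambda>n. N1 (\<lambda>x. f n x * g n x - F x * G x)) \<longlonglongrightarrow> 0"
  proof (rule ennreal_tendsto_0_le)
    have "(\<lambda>n. N2 (\<lambda>x. f n x - F x) * N2 (\<lambda>x. g n x - G x)) \<longlonglongrightarrow> 0"
      using tendsto_mult_ennreal[OF l] by simp
    then have 1: "(\<lambda>n. N1 (\<lambda>x. (f n x - F x) * (g n x - G x))) \<longlonglongrightarrow> 0"
      by (elim ennreal_square_tendsto_0[OF ennreal_tendsto_0_le]) (rule N1_mult, measurable)
    have "(\<lambda>n. N2 G * N2 (\<lambda>x. f n x - F x)) \<longlonglongrightarrow> 0" using ennreal_tendsto_cmult[OF _ l(1), of "N2 G"] fin by simp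
    then have 2: "(\<lambda>n. N1 (\<lambda>x. G x * (f n x - F x))) \<longlonglongrightarrow> 0"
      by (elim ennreal_square_tendsto_0[OF ennreal_tendsto_0_le]) (rule N1_mult, measurable)
    have "(\<lambda>n. N2 F * N2 (\<lambda>x. g n x - G x)) \<longlonglongrightarrow> 0" using ennreal_tendsto_cmult[OF _ l(2), of "N2 F"] fin by simp
    then have 3: "(\<lambda>n. N1 (\<lambda>x. F x * (g n x - G x))) \<longlonglongrightarrow> 0"
      by (elim ennreal_square_tendsto_0[OF ennreal_tendsto_0_le]) (rule N1_mult, measurable)
    show "(\<lambda>n. N1 (\<lambda>x. (f n x - F x) * (g n x - G x)) + (N1 (\<lambda>x. G x * (f n x - F x)) + N1 (\<lambda>x. F x * (g n x - G x)))) \<longlonglongrightarrow> 0"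
      using tendsto_add[OF 1 tendsto_add[OF 2 3]] by simp
    fix n
    have "(\<lambda>x. f n x * g n x - F x * G x) = (\<lambda>x. (f n x - F x) * (g n x - G x) + (G x * (f n x - F x) + F x * (g n x - G x)))"
      by (simp add: algebra_simps)
    then have "N1 (\<lambda>x. f n x * g n x - F x * G x) \<le> N1 (\<lambda>x. (f n x - F x) * (g n x - G x)) + N1 (\<lambda>x. G x * (f n x - F x) + F x * (g n x - G x))"
      using N1_add[of "\<lambda>x. (f n x - F x) * (g n x - G x)" "\<lambda>x. G x * (f n x - F x) + F x * (g n x - G x)"] by simp
    also have "\<dots> \<le> N1 (\<lambda>x. (f n x - F x) * (g n x - G x)) + (N1 (\<lambda>x. G x * (f n x - F x)) + N1 (\<lambda>x. F x * (g n x - G x)))"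
      by (intro add_mono order_refl N1_add) measurable
    finally show "N1 (\<lambda>x. f n x * g n x - F x * G x) \<le> N1 (\<lambda>x. (f n x - F x) * (g n x - G x)) + (N1 (\<lambda>x. G x * (f n x - F x)) + N1 (\<lambda>x. F x * (g n x - G x)))" .
  qed
  ultimately show ?thesis unfolding cI_def by auto
qed

lemma cI_tendsto_integral: "cI f F \<Longrightarrow> (\<lambda>n. LINT x|lebesgue. f n x) \<longlonglongrightarrow> (LINT x|lebesgue. F x)"
proof -
  assume *: "cI f F"
  note [measurable] = cI_measurable[OF *]
  have "\<forall>\<^sub>F n in sequentially. N1 (\<lambda>x. f n x - F x) < 1"
    using * unfolding cI_def by (intro order_tendstoD(2)[of _ 0]) auto
  then obtain N where N: "\<And>n. N \<le> n \<Longrightarrow> N1 (\<lambda>x. f n x - F x) < 1" by (auto simp: eventually_sequentially)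
  \<comment> \<open>Finitely many terms may fail to be integrable, hence the shift by N.\<close>
  have "integrable lebesgue (f (n + N))" for n
  proof -
    have "integrable lebesgue (\<lambda>x. f (n + N) x - F x)"
      using N[of "n + N"] by (auto simp: integrable_iff_N1 intro: order.strict_trans)
    from Bochner_Integration.integrable_add[OF this, of F] * show ?thesis by (simp add: cI_def)
  qed
  moreover have "(\<lambda>n. N1 (\<lambda>x. f (n + N) x - F x)) \<longlonglongrightarrow> 0"
    using * LIMSEQ_ignore_initial_segment[of "\<lambda>n. N1 (\<lambda>x. f n x - F x)" 0 N] by (simp add: cI_def)
  ultimately have "(\<lambda>n. LINT x|lebesgue. f (n + N) x) \<longlonglongrightarrow> (LINT x|lebesgue. F x)"
    using * unfolding cI_def N1_def by (intro tendsto_L1_int) auto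
  then show ?thesis by (rule LIMSEQ_offset)
qed

text \<open>Polynomials in a jet \<open>z\<close>: \<open>U j\<close> stands for \<open>\<partial>\<^sup>j\<Psi>\<close>, \<open>V j\<close> for its conjugate, \<open>Eta\<close> for \<open>\<eta>\<close>. The last is kept
  as an atom, because \<open>\<eta>\<close> is square integrable whereas \<open>\<bar>\<Psi>\<bar>\<^sup>2\<close> is not. In \<open>vr\<close> the jet is varied in the
  direction \<open>c\<close>.\<close>

datatype jp = U nat | V nat | Eta | K complex
  | Add jp jp (infixl "\<oplus>" 65) | Mul jp jp (infixl "\<otimes>" 70)

primrec ev :: "jp \<Rightarrow> (nat \<Rightarrow> complex) \<Rightarrow> complex" where
  "ev (U j) z = z j"
| "ev (V j) z = cnj (z j)"
| "ev Eta z = 1 - z 0 * cnj (z 0)"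
| "ev (K c) z = c"
| "ev (p \<oplus> q) z = ev p z + ev q z"
| "ev (p \<otimes> q) z = ev p z * ev q z"

primrec vr :: "jp \<Rightarrow> (nat \<Rightarrow> complex) \<Rightarrow> (nat \<Rightarrow> complex) \<Rightarrow> complex" where
  "vr (U j) z c = c j"
| "vr (V j) z c = cnj (c j)"
| "vr Eta z c = - (c 0 * cnj (z 0) + z 0 * cnj (c 0))"
| "vr (K a) z c = 0"
| "vr (p \<oplus> q) z c = vr p z c + vr q z c"
| "vr (p \<otimes> q) z c = vr p z c * ev q z + ev p z * vr q z c"

primrec Dx :: "jp \<Rightarrow> jp" where
  "Dx (U j) = U (Suc j)"
| "Dx (V j) = V (Suc j)"
| "Dx Eta = K (-1) \<otimes> (U 1 \<otimes> V 0 \<oplus> U 0 \<otimes> V 1)"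
| "Dx (K a) = K 0"
| "Dx (p \<oplus> q) = Dx p \<oplus> Dx q"
| "Dx (p \<otimes> q) = Dx p \<otimes> q \<oplus> p \<otimes> Dx q"

text \<open>The nonlinearity \<Psi> (|\<Psi>|^2 - 1), factored through \<open>Eta\<close>: expanded
  in powers of \<Psi> and its conjugate, it would not be recognised as square integrable.\<close>

definition nlin :: jp where "nlin = K (-1) \<otimes> (U 0 \<otimes> Eta)"

text \<open>The time derivative of the jet of a smooth solution of the Gross-Pitaevskii equation.\<close>

definition flow :: "(nat \<Rightarrow> complex) \<Rightarrow> nat \<Rightarrow> complex" where
  "flow z j = \<i> * (z (j + 2) - ev ((Dx ^^ j) nlin) z)"


text \<open>For a jet of an element of \<open>X\<^sup>k\<close>, \<open>isB\<close>, \<open>isT\<close> and \<open>isI\<close> are sufficient for a polynomial to be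
  bounded, square integrable and integrable, respectively.\<close>

primrec isB :: "nat \<Rightarrow> jp \<Rightarrow> bool" where
  "isB k (U j) = (j < k)"
| "isB k (V j) = (j < k)"
| "isB k Eta = True"
| "isB k (K c) = True"
| "isB k (p \<oplus> q) = (isB k p \<and> isB k q)"
| "isB k (p \<otimes> q) = (isB k p \<and> isB k q)"

primrec isT :: "nat \<Rightarrow> jp \<Rightarrow> bool" where
  "isT k (U j) = (1 \<le> j \<and> j \<le> k)"
| "isT k (V j) = (1 \<le> j \<and> j \<le> k)"
| "isT k Eta = True"
| "isT k (K c) = False"
| "isT k (p \<oplus> q) = (isT k p \<and> isT k q)"
| "isT k (p \<otimes> q) = (isB k p \<and> isT k q \<or> isT k p \<and> isB k q)"

primrec isI :: "nat \<Rightarrow> jp \<Rightarrow> bool" where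
  "isI k (U j) = False"
| "isI k (V j) = False"
| "isI k Eta = False"
| "isI k (K c) = False"
| "isI k (p \<oplus> q) = (isI k p \<and> isI k q)"
| "isI k (p \<otimes> q) = (isT k p \<and> isT k q \<or> isB k p \<and> isI k q \<or> isI k p \<and> isB k q)"

text \<open>Convergence in \<open>X k\<close>, read off from the jets. Entry 0 is missing from the
  L2 part because \<Psi> does not decay; \<open>Eta\<close> stands in for it.\<close>

definition jconv :: "nat \<Rightarrow> (nat \<Rightarrow> real \<Rightarrow> nat \<Rightarrow> complex) \<Rightarrow> (real \<Rightarrow> nat \<Rightarrow> complex) \<Rightarrow> bool" where
  "jconv k z Z \<longleftrightarrow> (\<forall>j<k. cB (\<lambda>n x. z n x j) (\<lambda>x. Z x j)) \<and> (\<forall>j. 1 \<le> j \<longrightarrow> j \<le> k \<longrightarrow> cT (\<lambda>n x. z n x j) (\<lambda>x. Z x j))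
     \<and> cT (\<lambda>n x. ev Eta (z n x)) (\<lambda>x. ev Eta (Z x))"

text \<open>Directions, unlike jets, converge in H^k with entry 0 included, which makes the
  variation of \<open>Eta\<close> converge in L2.\<close>

definition vconv :: "nat \<Rightarrow> (nat \<Rightarrow> real \<Rightarrow> nat \<Rightarrow> complex) \<Rightarrow> (real \<Rightarrow> nat \<Rightarrow> complex) \<Rightarrow> bool" where
  "vconv k c C \<longleftrightarrow> (\<forall>j<k. cB (\<lambda>n x. c n x j) (\<lambda>x. C x j)) \<and> (\<forall>j\<le>k. cT (\<lambda>n x. c n x j) (\<lambda>x. C x j))"

lemma cT_mult': "cT f F \<Longrightarrow> cB b B \<Longrightarrow> cT (\<lambda>n x. f n x * b n x) (\<lambda>x. F x * B x)"
  using cT_mult[of b B f F] by (simp add: mult.commute)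

lemma cI_mult': "cI f F \<Longrightarrow> cB b B \<Longrightarrow> cI (\<lambda>n x. f n x * b n x) (\<lambda>x. F x * B x)"
  using cI_mult[of b B f F] by (simp add: mult.commute)

lemma cB_minus: "cB f F \<Longrightarrow> cB (\<lambda>n x. - f n x) (\<lambda>x. - F x)"
  using cB_mult[OF cB_const[of "-1"], of f F] by simp

lemma cT_minus: "cT f F \<Longrightarrow> cT (\<lambda>n x. - f n x) (\<lambda>x. - F x)"
  using cT_mult[OF cB_const[of "-1"], of f F] by simp

text \<open>Bounded times bounded is bounded, bounded times L2 is L2, L2 times L2 is integrable, and
  bounded times integrable is integrable. The syntactic classes follow these rules, and each product
  is continuous for the corresponding modes.\<close>

lemma ev_conv:
  assumes z: "jconv k z Z" and k: "1 \<le> k"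
  shows "(isB k p \<longrightarrow> cB (\<lambda>n x. ev p (z n x)) (\<lambda>x. ev p (Z x)))
    \<and> (isT k p \<longrightarrow> cT (\<lambda>n x. ev p (z n x)) (\<lambda>x. ev p (Z x)))
    \<and> (isI k p \<longrightarrow> cI (\<lambda>n x. ev p (z n x)) (\<lambda>x. ev p (Z x)))"
proof (induction p)
  case Eta
  have "cB (\<lambda>n x. z n x 0) (\<lambda>x. Z x 0)" using z k by (simp add: jconv_def)
  then have "cB (\<lambda>n x. 1 + - (z n x 0 * cnj (z n x 0))) (\<lambda>x. 1 + - (Z x 0 * cnj (Z x 0)))"
    by (intro cB_add cB_const cB_minus cB_mult cB_cnj)
  then show ?case using z by (simp add: jconv_def)
next
  case (Add p q)
  then show ?case by (auto intro: cB_add cT_add cI_add)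
next
  case (Mul p q)
  then show ?case unfolding ev.simps isB.simps isT.simps isI.simps
    by (intro conjI impI; (elim disjE conjE)?)
      (simp_all only: simp_thms cB_mult cT_mult cT_mult' cI_TT cI_mult cI_mult')
qed (use z in \<open>auto simp: jconv_def intro: cB_const cB_cnj cT_cnj\<close>)

text \<open>By the product rule every term of the variation has one factor replaced by its own
  variation, and this stays in the class of the factor when the direction converges in H^k. Hence
  the variation of an integrable density converges in L1.\<close>

lemma vr_conv:
  assumes z: "jconv k z Z" and c: "vconv k c W" and k: "1 \<le> k"
  shows "(isB k p \<longrightarrow> cB (\<lambda>n x. vr p (z n x) (c n x)) (\<lambda>x. vr p (Z x) (W x)))
    \<and> (isT k p \<longrightarrow> cT (\<lambda>n x. vr p (z n x) (c n x)) (\<lambda>x. vr p (Z x) (W x)))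
    \<and> (isI k p \<longrightarrow> cI (\<lambda>n x. vr p (z n x) (c n x)) (\<lambda>x. vr p (Z x) (W x)))"
proof (induction p)
  case Eta
  have z0: "cB (\<lambda>n x. z n x 0) (\<lambda>x. Z x 0)" using z k by (simp add: jconv_def)
  have c0: "cB (\<lambda>n x. c n x 0) (\<lambda>x. W x 0)" "cT (\<lambda>n x. c n x 0) (\<lambda>x. W x 0)" using c k by (auto simp: vconv_def)
  show ?case unfolding vr.simps
    by (intro conjI impI cB_minus cT_minus cB_add cT_add cB_mult cT_mult cB_cnj cT_mult' cT_cnj z0 c0) auto
next
  case (Add p q)
  then show ?case by (auto intro: cB_add cT_add cI_add)
next
  case (Mul p q)
  have e: "isB k r \<Longrightarrow> cB (\<lambda>n x. ev r (z n x)) (\<lambda>x. ev r (Z x))" "isT k r \<Longrightarrow> cT (\<lambda>n x. ev r (z n x)) (\<lambda>x. ev r (Z x))"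
     "isI k r \<Longrightarrow> cI (\<lambda>n x. ev r (z n x)) (\<lambda>x. ev r (Z x))" for r
    using ev_conv[OF z k] by auto
  show ?case using Mul e[of p] e[of q] unfolding vr.simps isB.simps isT.simps isI.simps
    by (intro conjI impI; (elim disjE conjE)?)
      (simp_all only: simp_thms cB_mult cT_mult cT_mult' cI_TT cI_mult cI_mult' cB_add cT_add cI_add)
next
  case (K a)
  then show ?case using cB_const[of 0] by simp
qed (use c in \<open>auto simp: vconv_def intro: cB_cnj cT_cnj\<close>)

text \<open>Linearity in the direction is what separates the exact flow from the commutator.\<close>

lemma vr_add: "vr p z (\<lambda>j. c j + d j) = vr p z c + vr p z d"
  by (induction p) (auto simp: algebra_simps)

lemma vr_0: "vr p z (\<lambda>j. 0) = 0"
  by (induction p) auto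

text \<open>Differentiation in x is the variation in the direction of the shifted jet, so one chain
  rule covers both variables.\<close>

lemma vr_Dx: "vr p z (\<lambda>j. z (Suc j)) = ev (Dx p) z"
  by (induction p) (auto simp: algebra_simps)

lemma ev_has_vector_derivative:
  assumes "\<And>j. ((\<lambda>t. z t j) has_vector_derivative c j) (at t within S)"
  shows "((\<lambda>t. ev p (z t)) has_vector_derivative vr p (z t) c) (at t within S)"
proof (induction p)
  case Eta
  show ?case unfolding ev.simps vr.simps
    by (rule has_vector_derivative_eq_rhs, (rule derivative_intros assms)+) (simp add: algebra_simps)
next
  case (Mul p q)
  show ?case unfolding ev.simps vr.simps
    by (rule has_vector_derivative_eq_rhs, (rule derivative_intros Mul)+) (simp add: algebra_simps)
qed (use assms in \<open>auto intro!: derivative_intros\<close>)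

lemma continuous_on_ev:
  assumes "\<And>j. continuous_on S (\<lambda>x. z x j)"
  shows "continuous_on S (\<lambda>x. ev p (z x))"
  by (induction p) (use assms in \<open>auto intro!: continuous_intros\<close>)

lemma continuous_on_vr:
  assumes "\<And>j. continuous_on S (\<lambda>x. z x j)" "\<And>j. continuous_on S (\<lambda>x. c x j)"
  shows "continuous_on S (\<lambda>x. vr p (z x) (c x))"
  by (induction p) (use assms continuous_on_ev[of S z, OF assms(1)] in \<open>auto intro!: continuous_intros\<close>)

text \<open>At spatial infinity, the derivatives of the jet and \<open>\<eta>\<close> vanish, while \<open>\<Psi>\<close> is only bounded.\<close>

primrec van :: "jp \<Rightarrow> bool" where
  "van (U j) = (1 \<le> j)"
| "van (V j) = (1 \<le> j)"
| "van Eta = True"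
| "van (K c) = False"
| "van (p \<oplus> q) = (van p \<and> van q)"
| "van (p \<otimes> q) = (van p \<or> van q)"

lemma ev_van:
  fixes z :: "nat \<Rightarrow> nat \<Rightarrow> complex"
  assumes "\<And>j. Bseq (\<lambda>n. z n j)" "\<And>j. 1 \<le> j \<Longrightarrow> (\<lambda>n. z n j) \<longlonglongrightarrow> 0" "(\<lambda>n. ev Eta (z n)) \<longlonglongrightarrow> 0"
  shows "Bseq (\<lambda>n. ev p (z n)) \<and> (van p \<longrightarrow> (\<lambda>n. ev p (z n)) \<longlonglongrightarrow> 0)"
proof (induction p)
  case (V j)
  have "Bseq (\<lambda>n. cnj (z n j))" using assms(1)[of j] by (simp add: Bseq_def)
  then show ?case using assms(2)[of j] by (auto intro: tendsto_eq_intros)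
next
  case Eta
  then show ?case using assms(3) convergent_imp_Bseq convergentI by blast
next
  case (Add p q)
  then obtain M M' where "\<And>n. norm (ev p (z n)) \<le> M" "\<And>n. norm (ev q (z n)) \<le> M'"
    unfolding Bseq_def by blast
  then have "\<And>n. norm (ev (p \<oplus> q) (z n)) \<le> M + M'" by (simp add: norm_triangle_mono)
  then have "Bseq (\<lambda>n. ev (p \<oplus> q) (z n))" by (rule BseqI')
  then show ?case using Add by (auto intro: tendsto_add_zero)
next
  case (Mul p q)
  then have b: "Bseq (\<lambda>n. ev p (z n))" "Bseq (\<lambda>n. ev q (z n))" by auto
  have m: "(\<lambda>n. f n * g n) \<longlonglongrightarrow> 0" if f: "f \<longlonglongrightarrow> 0" and g: "Bseq g" for f g :: "nat \<Rightarrow> complex"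
  proof -
    obtain M where M: "\<And>n. norm (g n) \<le> M" using g unfolding Bseq_def by blast
    have "(\<lambda>n. norm (f n) * M) \<longlonglongrightarrow> 0" using tendsto_mult_right[OF tendsto_norm[OF f], of M] by simp
    then show ?thesis
      by (rule Lim_null_comparison[rotated]) (auto simp: norm_mult intro!: always_eventually mult_left_mono M)
  qed
  show ?case using Mul Bseq_mult[OF b] m[OF _ b(2)] m[OF _ b(1), of "\<lambda>n. ev q (z n)"]
    by (auto simp: mult.commute)
qed (use assms in auto)

section \<open>Mollified jets and the commutator\<close>

lemma test_in_L2: "test_function \<phi> \<Longrightarrow> in_L2 (\<lambda>x. complex_of_real (\<phi> x))"
  and test_integrable_complex: "test_function \<phi> \<Longrightarrow> integrable lebesgue (\<lambda>x. complex_of_real (\<phi> x))"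
proof -
  assume t: "test_function \<phi>"
  obtain R C where R: "\<And>x. R < \<bar>x\<bar> \<Longrightarrow> \<phi> x = 0" and C: "\<And>x. \<bar>\<phi> x\<bar> \<le> C"
    using t by (metis test_functionE test_bounded)
  show "in_L2 (\<lambda>x. complex_of_real (\<phi> x))"
    by (rule in_L2_bounded_support[where R=R and C=C]) (use test_measurable[OF t] R C in auto)
  have [measurable]: "\<phi> \<in> borel_measurable borel"
    by (intro borel_measurable_continuous_onI test_continuous t)
  show "integrable lebesgue (\<lambda>x. complex_of_real (\<phi> x))"
    using test_integrable[OF t] by (subst integrable_completion) auto
qed

lemma conv_test:
  assumes f: "cB f F \<or> cT f F" and t: "test_function \<phi>"
  shows "(\<lambda>n. LINT x|lebesgue. \<phi> x *\<^sub>R f n x) \<longlonglongrightarrow> (LINT x|lebesgue. \<phi> x *\<^sub>R F x)"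
proof -
  have T: "cT (\<lambda>n x. complex_of_real (\<phi> x)) (\<lambda>x. complex_of_real (\<phi> x))"
    using test_in_L2[OF t] by (simp add: cT_def N2_0 in_L2_def)
  have I: "cI (\<lambda>n x. complex_of_real (\<phi> x)) (\<lambda>x. complex_of_real (\<phi> x))"
    using test_integrable_complex[OF t] by (simp add: cI_def N1_def borel_measurable_integrable)
  have "cI (\<lambda>n x. complex_of_real (\<phi> x) * f n x) (\<lambda>x. complex_of_real (\<phi> x) * F x)"
    using f cI_TT[OF T] cI_mult'[OF I] by blast
  from cI_tendsto_integral[OF this] show ?thesis by (simp add: scaleR_conv_of_real)
qed

lemma conv_L1_loc: "cB f F \<or> cT f F \<Longrightarrow> F \<in> L1_loc"
  by (auto simp: cB_def cT_def intro: L1_loc_bounded in_L2_imp_L1_loc)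

text \<open>A test function is integrable and square integrable, so both sides of the defining
  identity pass to the limit in either mode.\<close>

lemma weak_deriv_limit:
  assumes w: "\<And>n. has_weak_deriv 1 (f n) (g n)" and f: "cB f F \<or> cT f F" and g: "cB g G \<or> cT g G"
  shows "has_weak_deriv 1 F G"
  unfolding has_weak_deriv_def
proof (intro conjI allI impI conv_L1_loc[OF f] conv_L1_loc[OF g])
  fix \<phi> :: "real \<Rightarrow> real" assume t: "test_function \<phi>"
  have "(\<lambda>n. LINT x|lebesgue. (deriv ^^ 1) \<phi> x *\<^sub>R f n x) \<longlonglongrightarrow> (LINT x|lebesgue. (deriv ^^ 1) \<phi> x *\<^sub>R F x)"
    by (rule conv_test[OF f test_derivs[OF t]])
  moreover have "(\<lambda>n. (-1) ^ 1 *\<^sub>R (LINT x|lebesgue. \<phi> x *\<^sub>R g n x)) \<longlonglongrightarrow> (-1) ^ 1 *\<^sub>R (LINT x|lebesgue. \<phi> x *\<^sub>R G x)"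
    by (intro tendsto_scaleR tendsto_const conv_test[OF g t])
  moreover have "(LINT x|lebesgue. (deriv ^^ 1) \<phi> x *\<^sub>R f n x) = (-1) ^ 1 *\<^sub>R (LINT x|lebesgue. \<phi> x *\<^sub>R g n x)" for n
    using w[of n] t unfolding has_weak_deriv_def by blast
  ultimately show "(LINT x|lebesgue. (deriv ^^ 1) \<phi> x *\<^sub>R F x) = (-1) ^ 1 *\<^sub>R (LINT x|lebesgue. \<phi> x *\<^sub>R G x)"
    using LIMSEQ_unique by (simp only:) blast
qed

lemma L1_loc_continuous: "continuous_on UNIV f \<Longrightarrow> f \<in> L1_loc"
  unfolding L1_loc_def set_integrable_def
proof (intro CollectI allI impI)
  fix A :: "real set" assume *: "continuous_on UNIV f" "compact A"
  have "integrable lborel (\<lambda>x. indicator A x *\<^sub>R f x)"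
    by (intro borel_integrable_compact * continuous_on_subset[OF *(1)]) auto
  then show "integrable lebesgue (\<lambda>x. indicator A x *\<^sub>R f x)"
    by (subst integrable_completion) (auto dest: borel_measurable_integrable)
qed

lemma classical_weak_deriv:
  fixes f g :: "real \<Rightarrow> complex"
  assumes d: "\<And>x. (f has_vector_derivative g x) (at x)" and c: "continuous_on UNIV g"
  shows "has_weak_deriv 1 f g"
proof -
  have cf: "continuous_on UNIV f"
    by (intro continuous_at_imp_continuous_on ballI has_vector_derivative_continuous[OF d])
  note l = L1_loc_continuous[OF cf] L1_loc_continuous[OF c]
  show ?thesis unfolding has_weak_deriv_def
  proof (intro conjI allI impI l)
    fix \<phi> :: "real \<Rightarrow> real" assume t: "test_function \<phi>"
    obtain R where R: "0 < R" "\<And>x. R < \<bar>x\<bar> \<Longrightarrow> \<phi> x = 0" using t by (metis test_functionE)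
    obtain S where S: "0 < S" "\<And>x. S < \<bar>x\<bar> \<Longrightarrow> deriv \<phi> x = 0" using test_deriv[OF t] by (metis test_functionE)
    define T where "T = R + S"
    let ?h = "\<lambda>x. \<phi> x *\<^sub>R g x + deriv \<phi> x *\<^sub>R f x"
    have ch: "continuous_on UNIV ?h"
      by (intro continuous_intros c cf test_continuous test_deriv t)
    have "((\<lambda>x. \<phi> x *\<^sub>R f x) has_vector_derivative ?h x) (at x)" for x
      using has_vector_derivative_scaleR[OF test_has_deriv[OF t] d, of x] by simp
    then have "(?h has_integral (\<phi> T *\<^sub>R f T - \<phi> (-T) *\<^sub>R f (-T))) {-T..T}"
      using R(1) S(1) by (intro fundamental_theorem_of_calculus) (auto simp: T_def has_vector_derivative_at_within)
    moreover have "\<phi> T = 0" "\<phi> (-T) = 0" using R(1) S(1) by (auto intro!: R(2) simp: T_def)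
    ultimately have "integral {-T..T} ?h = 0" by (simp add: integral_unique)
    then have "(LINT x:{-T..T}|lebesgue. ?h x) = 0"
      using set_lebesgue_integral_eq_integral(2)[OF L1_loc_set_integrable[OF L1_loc_continuous[OF ch]], of "-T" T] by simp
    moreover have "(\<lambda>x. indicator {-T..T} x *\<^sub>R ?h x) = ?h"
    proof
      fix x show "indicator {-T..T} x *\<^sub>R ?h x = ?h x"
        using R S by (cases "T < \<bar>x\<bar>") (auto simp: T_def indicator_def)
    qed
    ultimately have "(LINT x|lebesgue. ?h x) = 0" unfolding set_lebesgue_integral_def by (simp only:)
    then show "(LINT x|lebesgue. (deriv ^^ 1) \<phi> x *\<^sub>R f x) = (-1) ^ 1 *\<^sub>R (LINT x|lebesgue. \<phi> x *\<^sub>R g x)"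
      using L1_loc_test_integrable[OF l(2) t] L1_loc_test_integrable[OF l(1) test_deriv[OF t]]
      by (simp add: add_eq_0_iff)
  qed
qed

section \<open>Mollification along convergent sequences\<close>

lemma cnv_iterated_weak_deriv:
  assumes "\<And>i. i < j \<Longrightarrow> has_weak_deriv 1 (f i) (f (Suc i))" "test_function \<rho>"
  shows "cnv (f 0) ((deriv ^^ j) \<rho>) x = cnv (f j) \<rho> x"
  using assms
proof (induction j arbitrary: \<rho>)
  case (Suc j)
  have "cnv (f 0) ((deriv ^^ Suc j) \<rho>) x = cnv (f 0) ((deriv ^^ j) (deriv \<rho>)) x"
    by (simp add: funpow_swap1)
  also have "\<dots> = cnv (f j) (deriv \<rho>) x" using Suc.prems by (intro Suc.IH test_deriv) auto
  also have "\<dots> = cnv (f (Suc j)) \<rho> x" using weak_deriv_cnv[OF Suc.prems(1) Suc.prems(2), of j x] by simp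
  finally show ?case .
qed simp

text \<open>Function and kernel vary together. Since mollification contracts for every kernel, the
  sequence may be replaced by its limit before the kernel shrinks.\<close>

lemma moll_cT:
  assumes f: "cT f F" "\<And>n. f n \<in> L1_loc"
  shows "cT (\<lambda>n. cnv (f n) (mol n)) F"
proof -
  note t = mollifierD(1)[OF is_mollifier_mol]
  have F: "in_L2 F" and l: "F \<in> L1_loc" using f(1) by (auto simp: cT_def in_L2_imp_L1_loc)
  have m: "cnv (f n) (mol n) \<in> borel_measurable lebesgue" "cnv F (mol n) \<in> borel_measurable lebesgue" for n
    by (intro cnv_measurable f l t)+
  have "(\<lambda>n. N2 (\<lambda>x. cnv (f n) (mol n) x - F x)) \<longlonglongrightarrow> 0"
  proof (rule N2_limit_trans[OF m in_L2_measurable[OF F]])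
    show "(\<lambda>n. N2 (\<lambda>x. cnv F (mol n) x - F x)) \<longlonglongrightarrow> 0" using molconv_L2[OF F] by (simp add: molconv_def)
    show "(\<lambda>n. N2 (\<lambda>x. cnv (f n) (mol n) x - cnv F (mol n) x)) \<longlonglongrightarrow> 0"
    proof (rule ennreal_tendsto_0_le)
      show "(\<lambda>n. N2 (\<lambda>x. f n x - F x)) \<longlonglongrightarrow> 0" using f by (simp add: cT_def)
      show "N2 (\<lambda>x. cnv (f n) (mol n) x - cnv F (mol n) x) \<le> N2 (\<lambda>x. f n x - F x)" for n
        using N2_cnv_le[OF L1_loc_diff[OF f(2) l] is_mollifier_mol[of n]] unfolding cnv_diff[OF f(2) l t, abs_def] .
    qed
  qed
  then show ?thesis using F m by (simp add: cT_def)
qed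

lemma in_L2_restr: "in_L2 f \<Longrightarrow> in_L2 (restr R f)"
proof -
  assume f: "in_L2 f"
  have "N2 (restr R f) \<le> N2 f" by (rule N2_mono) auto
  moreover have "restr R f \<in> borel_measurable lebesgue" using in_L2_measurable[OF f] by measurable
  ultimately show ?thesis using f by (auto simp: in_L2_iff elim: order.strict_trans1)
qed

lemma in_L2_restr_bounded:
  assumes [measurable]: "f \<in> borel_measurable lebesgue" and b: "AE x in lebesgue. norm (f x) \<le> M"
  shows "in_L2 (restr R f)"
proof -
  have "in_L2 (restr R (\<lambda>_. M))" by (rule in_L2_restr_continuous) simp
  moreover have "N2 (restr R f) \<le> N2 (restr R (\<lambda>_. M))"
    by (rule N2_mono) (use b in eventually_elim, auto)
  moreover have "restr R f \<in> borel_measurable lebesgue" by measurable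
  ultimately show ?thesis unfolding in_L2_iff using order.strict_trans1 by blast
qed

lemma is_mollifier_mol_tendsto: "(\<lambda>n. 1 / (real n + 1)) \<longlonglongrightarrow> 0"
  using LIMSEQ_inverse_real_of_nat by (simp add: inverse_eq_divide add.commute)

text \<open>Uniform convergence rests on a modulus of continuity of the limit. The derivative
  \<open>g\<close> in L2 provides it, with error sqrt (N2 g / (n + 1)) for the limit
  function.\<close>

lemma moll_cB:
  assumes f: "cB f F" and w: "has_weak_deriv 1 F g" and g: "in_L2 g"
  shows "cB (\<lambda>n. cnv (f n) (mol n)) F"
proof -
  note t = mollifierD(1)[OF is_mollifier_mol]
  obtain M d where M: "0 \<le> M" "\<And>n. AE x in lebesgue. norm (f n x) \<le> M" "AE x in lebesgue. norm (F x) \<le> M"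
    "d \<longlonglongrightarrow> 0" "\<And>n. 0 \<le> d n" "\<And>n. AE x in lebesgue. norm (f n x - F x) \<le> d n"
    by (rule cB_E[OF f], rule that)
  note m[measurable] = cB_measurable[OF f]
  have l: "F \<in> L1_loc" "f n \<in> L1_loc" for n by (rule L1_loc_bounded[OF m(2) M(3)]) (rule L1_loc_bounded[OF m(1) M(2)])
  obtain F' where F': "AE x in lebesgue. F x = F' x" and ac: "ac F' g"
    using weak_deriv_ac[OF w in_L2_restr_bounded[OF m(2) M(3)] in_L2_restr[OF g]] by blast
  have mF': "F' \<in> borel_measurable lebesgue" using borel_measurable_AE[OF m(2) F'] .
  have lF': "F' \<in> L1_loc" by (rule L1_loc_cong_AE[OF l(1) mF' F'])
  define s where "s n = sqrt (1 / (real n + 1) * enn2real (N2 g))" for n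
  have s: "norm (cnv F' (mol n) x - F' x) \<le> s n" for n x
  proof -
    have "ennreal ((norm (cnv F' (mol n) x - F' x))\<^sup>2) \<le> ennreal (1 / (real n + 1)) * N2 g"
      by (rule order_trans[OF ac_cnv_pointwise[OF ac lF' is_mollifier_mol] mult_left_mono[OF N2I_le_N2]]) simp
    also have "\<dots> = ennreal (1 / (real n + 1)) * ennreal (enn2real (N2 g))"
      using g by (simp add: in_L2_iff)
    also have "\<dots> = ennreal (1 / (real n + 1) * enn2real (N2 g))" by (rule ennreal_mult[symmetric]) auto
    finally have "(norm (cnv F' (mol n) x - F' x))\<^sup>2 \<le> 1 / (real n + 1) * enn2real (N2 g)" by simp
    then show ?thesis unfolding s_def by (rule real_le_rsqrt)
  qed
  have "(\<lambda>n. sqrt (1 / (real n + 1) * enn2real (N2 g))) \<longlonglongrightarrow> sqrt (0 * enn2real (N2 g))"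
    by (intro tendsto_intros is_mollifier_mol_tendsto)
  then have s0: "s \<longlonglongrightarrow> 0" unfolding s_def by simp
  show ?thesis unfolding cB_def
  proof (intro conjI exI allI)
    show "cnv (f n) (mol n) \<in> borel_measurable lebesgue" for n by (intro cnv_measurable l t)
    show "F \<in> borel_measurable lebesgue" by (rule m)
    show "AE x in lebesgue. norm (F x) \<le> M" by (rule M)
    show "(\<lambda>n. d n + s n) \<longlonglongrightarrow> 0" using tendsto_add[OF M(4) s0] by simp
    fix n
    have "norm (cnv (\<lambda>x. f n x - F x) (mol n) x - 0) \<le> d n" for x
      by (rule norm_cnv_le[OF _ _ is_mollifier_mol]) (use M(6)[of n] in simp_all)
    then have 1: "norm (cnv (f n) (mol n) x - cnv F (mol n) x) \<le> d n" for x
      by (simp add: cnv_diff[OF l(2) l(1) t])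
    show "AE x in lebesgue. norm (cnv (f n) (mol n) x - F x) \<le> d n + s n"
      using F'
    proof eventually_elim
      case (elim x)
      have "norm (cnv F (mol n) x - F x) \<le> s n"
        using s[of n x] elim cnv_cong_AE[OF m(2) mF' F' t] by simp
      then show ?case using norm_triangle_mono[OF 1[of x]] by (metis diff_add_cancel add_diff_eq)
    qed
  qed
qed

text \<open>The jets \<open>Z x = (\<Psi> x, \<partial>\<Psi> x, \<dots>, \<partial>\<^sup>k\<Psi> x, \<dots>)\<close> of the elements \<open>\<Psi>\<close> of \<open>X\<^sup>k\<close>. The entries beyond \<open>k\<close> are
  arbitrary.\<close>

definition XJ :: "nat \<Rightarrow> (real \<Rightarrow> nat \<Rightarrow> complex) \<Rightarrow> bool" where
  "XJ k Z \<longleftrightarrow> (\<forall>j<k. has_weak_deriv 1 (\<lambda>x. Z x j) (\<lambda>x. Z x (Suc j)))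
     \<and> (\<forall>j. 1 \<le> j \<longrightarrow> j \<le> k \<longrightarrow> in_L2 (\<lambda>x. Z x j)) \<and> in_L2 (\<lambda>x. ev Eta (Z x))"

lemma XJ_L1_loc: "XJ k Z \<Longrightarrow> j \<le> k \<Longrightarrow> 1 \<le> k \<Longrightarrow> (\<lambda>x. Z x j) \<in> L1_loc"
  by (cases "j = 0") (auto simp: XJ_def has_weak_deriv_def in_L2_imp_L1_loc)

section \<open>Bounds from finite energy\<close>

lemma norm_sq_le_eta: "(norm (a::complex))\<^sup>2 \<le> 2 + (norm (1 - a * cnj a))\<^sup>2"
proof -
  have e: "1 - a * cnj a = of_real (1 - (norm a)\<^sup>2)" by (simp only: of_real_diff of_real_1 complex_norm_square)
  have "(norm (1 - a * cnj a))\<^sup>2 = (1 - (norm a)\<^sup>2)\<^sup>2" by (simp only: e norm_of_real power2_abs)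
  moreover have "s \<le> 2 + (1 - s)\<^sup>2" for s :: real
    using zero_le_power2[of "s - 3 / 2"] by (simp add: power2_eq_square algebra_simps)
  ultimately show ?thesis by simp
qed

text \<open>The function itself is not in L2; its square is controlled on bounded intervals through
  |a|^2 <= 2 + (1 - |a|^2)^2.\<close>

lemma N2I_eta_le:
  assumes a: "a \<in> borel_measurable lebesgue" and "x \<le> y"
  shows "N2I a x y \<le> ennreal (2 * (y - x)) + N2 (\<lambda>x. 1 - a x * cnj (a x) :: complex)"
proof -
  have [measurable]: "cnj \<in> borel_measurable borel" by (intro borel_measurable_continuous_onI continuous_intros)
  note [measurable] = a
  have "N2I a x y \<le> (\<integral>\<^sup>+t. ennreal 2 * indicator {x..y} t + ennreal ((norm (1 - a t * cnj (a t)))\<^sup>2) \<partial>lebesgue)"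
    unfolding N2I_def
  proof (rule nn_integral_mono)
    fix t
    have "ennreal ((norm (a t))\<^sup>2) \<le> ennreal 2 + ennreal ((norm (1 - a t * cnj (a t)))\<^sup>2)"
      using ennreal_leI[OF norm_sq_le_eta[of "a t"]] by (subst ennreal_plus[symmetric]) auto
    then show "ennreal ((norm (a t))\<^sup>2) * indicator {x..y} t \<le> ennreal 2 * indicator {x..y} t + ennreal ((norm (1 - a t * cnj (a t)))\<^sup>2)"
      by (auto simp: indicator_def)
  qed
  also have "\<dots> = ennreal (2 * (y - x)) + N2 (\<lambda>x. 1 - a x * cnj (a x))"
  proof -
    have "ennreal (2 * (y - x)) = ennreal 2 * ennreal (y - x)" using assms(2) by (intro ennreal_mult) auto
    also have "\<dots> = (\<integral>\<^sup>+t. ennreal 2 * indicator {x..y} t \<partial>lebesgue)"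
      using emeasure_lebesgue_Icc[OF assms(2)] by (subst nn_integral_cmult) (auto simp del: emeasure_completion)
    finally show ?thesis unfolding N2_def by (subst nn_integral_add) auto
  qed
  finally show ?thesis .
qed

lemma XJ_restr:
  assumes Z: "XJ k Z" and j: "j \<le> k" "1 \<le> k"
  shows "in_L2 (restr R (\<lambda>x. Z x j))"
proof (cases "j = 0")
  case True
  note [measurable] = L1_loc_measurable[OF XJ_L1_loc[OF Z j]]
  have "N2 (restr R (\<lambda>x. Z x j)) = N2I (\<lambda>x. Z x j) (-R) R"
    unfolding N2_def N2I_def by (intro nn_integral_cong) (auto simp: indicator_def)
  also have "\<dots> \<le> N2I (\<lambda>x. Z x j) (-\<bar>R\<bar>) \<bar>R\<bar>" by (rule N2I_mono) auto
  also have "\<dots> \<le> ennreal (2 * (\<bar>R\<bar> - - \<bar>R\<bar>)) + N2 (\<lambda>x. ev Eta (Z x))"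
    using N2I_eta_le[of "\<lambda>x. Z x 0" "-\<bar>R\<bar>" "\<bar>R\<bar>"] L1_loc_measurable[OF XJ_L1_loc[OF Z j]] True by simp
  also have "\<dots> < \<infinity>" using Z by (simp add: XJ_def in_L2_iff)
  finally show ?thesis unfolding in_L2_iff by (intro conjI) measurable
next
  case False
  then have "in_L2 (\<lambda>x. Z x j)" using Z j by (simp add: XJ_def)
  then show ?thesis by (rule in_L2_restr)
qed

lemma XJ_ac:
  assumes Z: "XJ k Z" and j: "j < k"
  shows "\<exists>F. (AE x in lebesgue. Z x j = F x) \<and> ac F (\<lambda>x. Z x (Suc j))"
proof (rule weak_deriv_ac)
  show "has_weak_deriv 1 (\<lambda>x. Z x j) (\<lambda>x. Z x (Suc j))" using Z j by (simp add: XJ_def)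
  show "in_L2 (restr R (\<lambda>x. Z x j))" for R by (rule XJ_restr[OF Z]) (use j in auto)
  show "in_L2 (restr R (\<lambda>x. Z x (Suc j)))" for R by (rule XJ_restr[OF Z]) (use j in auto)
qed

text \<open>The local Sobolev estimate, with a bound independent of the interval. For j = 0 the
  integral of |\<Psi>|^2 over a unit interval is at most 2 plus the squared norm of \<eta>; for j >=
  1 the entry is in L2.\<close>

lemma XJ_bounded:
  assumes Z: "XJ k Z" and j: "j < k"
  shows "\<exists>M. AE x in lebesgue. norm (Z x j) \<le> M"
proof -
  have mZ: "(\<lambda>x. Z x j) \<in> borel_measurable lebesgue"
    using j by (intro L1_loc_measurable[OF XJ_L1_loc[OF Z]]) auto
  obtain F where F: "AE x in lebesgue. Z x j = F x" and ac: "ac F (\<lambda>x. Z x (Suc j))"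
    using XJ_ac[OF Z j] by blast
  have mF: "F \<in> borel_measurable lebesgue" by (rule borel_measurable_AE[OF mZ F])
  define A where "A = 2 * (ennreal 2 + N2 (\<lambda>x. ev Eta (Z x)) + (if j = 0 then 0 else N2 (\<lambda>x. Z x j))) + 2 * N2 (\<lambda>x. Z x (Suc j))"
  have A: "A < \<infinity>" using Z j by (auto simp: A_def XJ_def in_L2_iff ennreal_mult_less_top)
  have "ennreal ((norm (F x))\<^sup>2) \<le> A" for x
  proof -
    have "N2I F x (x + 1) \<le> ennreal 2 + N2 (\<lambda>x. ev Eta (Z x)) + (if j = 0 then 0 else N2 (\<lambda>x. Z x j))"
    proof (cases "j = 0")
      case True
      then show ?thesis using N2I_eta_le[OF mZ, of x "x + 1"] N2I_cong[OF F, of x "x + 1"] by simp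
    next
      case False
      have "N2I F x (x + 1) \<le> N2 (\<lambda>x. Z x j)" using N2I_cong[OF F, of x "x + 1"] N2I_le_N2 by metis
      then show ?thesis using False by (simp add: add_increasing)
    qed
    then show ?thesis
      unfolding A_def by (intro order_trans[OF ac_sup[OF ac mF]] add_mono mult_left_mono N2I_le_N2) auto
  qed
  then have "ennreal ((norm (F x))\<^sup>2) \<le> ennreal (enn2real A)" for x using A by simp
  then have "(norm (F x))\<^sup>2 \<le> enn2real A" for x by (simp add: ennreal_le_iff)
  then have "norm (F x) \<le> sqrt (enn2real A)" for x by (intro real_le_rsqrt)
  then show ?thesis using F by (intro exI[of _ "sqrt (enn2real A)"]) (auto elim!: eventually_mono)
qed

lemma XJ_measurable: "XJ k Z \<Longrightarrow> j \<le> k \<Longrightarrow> 1 \<le> k \<Longrightarrow> (\<lambda>x. Z x j) \<in> borel_measurable lebesgue"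
  by (intro L1_loc_measurable[OF XJ_L1_loc])

text \<open>Constant sequences turn the lemmas on convergence into statements of boundedness, square
  integrability and integrability.\<close>

lemma XJ_jconv_const:
  assumes Z: "XJ k Z" and k: "1 \<le> k"
  shows "jconv k (\<lambda>n. Z) Z"
  unfolding jconv_def
proof (intro conjI allI impI)
  fix j assume "j < k"
  then show "cB (\<lambda>n x. Z x j) (\<lambda>x. Z x j)"
    using XJ_bounded[OF Z] XJ_measurable[OF Z, of j] by (auto simp: cB_def intro!: exI[of _ "\<lambda>_. 0"])
next
  fix j assume "1 \<le> j" "j \<le> k"
  then show "cT (\<lambda>n x. Z x j) (\<lambda>x. Z x j)" using Z by (auto simp: XJ_def cT_def N2_0 in_L2_def)
next
  show "cT (\<lambda>n x. ev Eta (Z x)) (\<lambda>x. ev Eta (Z x))"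
    using Z unfolding XJ_def cT_def by (auto simp: N2_0 in_L2_def)
qed

text \<open>All derivatives are put on the kernel: entries of every order exist, and changing
  \<open>u\<close> on a null set does not affect them.\<close>

definition jetm :: "(real \<Rightarrow> complex) \<Rightarrow> nat \<Rightarrow> real \<Rightarrow> nat \<Rightarrow> complex" where
  "jetm u n x j = cnv u ((deriv ^^ j) (mol n)) x"

lemma jetm_XJ:
  assumes "XJ k Z" "j \<le> k"
  shows "(\<lambda>x. jetm (\<lambda>y. Z y 0) n x j) = cnv (\<lambda>y. Z y j) (mol n)"
  unfolding jetm_def
  by (rule ext, rule cnv_iterated_weak_deriv[where f="\<lambda>i y. Z y i"])
    (use assms mollifierD(1)[OF is_mollifier_mol] in \<open>auto simp: XJ_def\<close>)

lemma eta_diff_le: "norm ((1 - a * cnj a) - (1 - b * cnj b)) \<le> (norm a + norm b) * norm (a - b)"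
proof -
  have "(1 - a * cnj a) - (1 - b * cnj b) = (b - a) * cnj b + a * cnj (b - a)" by (simp add: algebra_simps)
  also have "norm \<dots> \<le> norm ((b - a) * cnj b) + norm (a * cnj (b - a))" by (rule norm_triangle_ineq)
  also have "\<dots> = (norm a + norm b) * norm (a - b)"
    by (simp only: norm_mult complex_mod_cnj norm_minus_commute[of b a]) (simp add: algebra_simps)
  finally show ?thesis .
qed

text \<open>The entries follow from mollification along sequences. \<open>Eta\<close> is the
  delicate part, since \<eta> does not commute with mollification. Its error is at most a bounded
  factor times the difference between the mollification and the function, and this difference is
  small in L2 by the rate that involves only the first derivative.\<close>

lemma jconv_jetm:
  assumes W: "\<And>n. XJ k (W n)" and Z: "XJ k Z" and c: "jconv k W Z" and k: "1 \<le> k"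
  shows "jconv k (\<lambda>n. jetm (\<lambda>y. W n y 0) n) Z"
proof -
  note t = mollifierD(1)[OF is_mollifier_mol]
  have B: "cB (\<lambda>n x. jetm (\<lambda>y. W n y 0) n x j) (\<lambda>x. Z x j)" if "j < k" for j
  proof -
    have "cB (\<lambda>n. cnv (\<lambda>y. W n y j) (mol n)) (\<lambda>x. Z x j)"
      by (rule moll_cB[where g="\<lambda>x. Z x (Suc j)"]) (use c Z that in \<open>auto simp: jconv_def XJ_def\<close>)
    then show ?thesis using jetm_XJ[OF W, of j] that by simp
  qed
  have "cT (\<lambda>n x. jetm (\<lambda>y. W n y 0) n x j) (\<lambda>x. Z x j)" if "1 \<le> j" "j \<le> k" for j
  proof -
    have "cT (\<lambda>n. cnv (\<lambda>y. W n y j) (mol n)) (\<lambda>x. Z x j)"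
      by (rule moll_cT) (use c that XJ_L1_loc[OF W] in \<open>auto simp: jconv_def\<close>)
    then show ?thesis using jetm_XJ[OF W, of j] that by simp
  qed
  moreover have "cT (\<lambda>n x. ev Eta (jetm (\<lambda>y. W n y 0) n x)) (\<lambda>x. ev Eta (Z x))"
  proof -
    have [measurable]: "cnj \<in> borel_measurable borel" by (intro borel_measurable_continuous_onI continuous_intros)
    have B0: "cB (\<lambda>n x. W n x 0) (\<lambda>x. Z x 0)" "cB (\<lambda>n x. jetm (\<lambda>y. W n y 0) n x 0) (\<lambda>x. Z x 0)"
      using c B k by (auto simp: jconv_def)
    have T1: "cT (\<lambda>n x. W n x 1) (\<lambda>x. Z x 1)" "cT (\<lambda>n x. ev Eta (W n x)) (\<lambda>x. ev Eta (Z x))"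
      using c k by (auto simp: jconv_def)
    obtain M where M: "0 \<le> M" "\<And>n. AE x in lebesgue. norm (W n x 0) \<le> M" using cB_E[OF B0(1)] by metis
    obtain M' where M': "0 \<le> M'" "\<And>n. AE x in lebesgue. norm (jetm (\<lambda>y. W n y 0) n x 0) \<le> M'" using cB_E[OF B0(2)] by metis
    note m[measurable] = cB_measurable[OF B0(1)] cB_measurable[OF B0(2)] cT_measurable[OF T1(1)]
    have me: "(\<lambda>x. ev Eta (W n x)) \<in> borel_measurable lebesgue" "(\<lambda>x. ev Eta (jetm (\<lambda>y. W n y 0) n x)) \<in> borel_measurable lebesgue"
       "(\<lambda>x. ev Eta (Z x)) \<in> borel_measurable lebesgue" for n
      unfolding ev.simps by measurable
    have d: "N2 (\<lambda>x. jetm (\<lambda>y. W n y 0) n x 0 - W n x 0) \<le> ennreal (1 / (real n + 1)) * (N2 (\<lambda>x. W n x 1) * ennreal (2 * (1 / (real n + 1))))" for n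
    proof -
      obtain F where F: "AE x in lebesgue. W n x 0 = F x" and ac: "ac F (\<lambda>x. W n x 1)"
        using XJ_ac[OF W, of 0] k by auto
      have mF: "F \<in> borel_measurable lebesgue" by (rule borel_measurable_AE[OF m(1) F])
      have lF: "F \<in> L1_loc" by (rule L1_loc_cong_AE[OF XJ_L1_loc[OF W] mF F]) (use k in auto)
      have "N2 (\<lambda>x. jetm (\<lambda>y. W n y 0) n x 0 - W n x 0) = N2 (\<lambda>x. cnv F (mol n) x - F x)"
        by (rule N2_cong) (use F in eventually_elim, simp add: jetm_def cnv_cong_AE[OF m(1) mF F t])
      then show ?thesis using ac_cnv_N2[OF ac lF is_mollifier_mol[of n]] by simp
    qed
    have "(\<lambda>n. N2 (\<lambda>x. ev Eta (jetm (\<lambda>y. W n y 0) n x) - ev Eta (Z x))) \<longlonglongrightarrow> 0"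
    proof (rule N2_limit_trans[OF me(2,1,3)])
      show "(\<lambda>n. N2 (\<lambda>x. ev Eta (W n x) - ev Eta (Z x))) \<longlonglongrightarrow> 0" using T1(2) by (simp add: cT_def)
      have r: "(\<lambda>n. ennreal (1 / (real n + 1))) \<longlonglongrightarrow> 0" using tendsto_ennrealI[OF is_mollifier_mol_tendsto] by simp
      have r2: "(\<lambda>n. ennreal (2 * (1 / (real n + 1)))) \<longlonglongrightarrow> 0"
        using tendsto_ennrealI[OF tendsto_mult_left[OF is_mollifier_mol_tendsto, of 2]] by simp
      have Z1: "N2 (\<lambda>x. Z x 1) < \<infinity>" using T1(1) by (simp add: cT_def in_L2_iff)
      \<comment> \<open>The first derivatives of \<open>W n\<close> vary with n; the difference to
        their limit plus the limit bounds them by a convergent sequence.\<close>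
      have L0: "(\<lambda>n. 2 * N2 (\<lambda>x. W n x 1 - Z x 1) + 2 * N2 (\<lambda>x. Z x 1)) \<longlonglongrightarrow> 2 * 0 + 2 * N2 (\<lambda>x. Z x 1)"
        using T1(1) by (intro tendsto_add ennreal_tendsto_cmult tendsto_const) (auto simp: cT_def)
      have "(\<lambda>n. (2 * N2 (\<lambda>x. W n x 1 - Z x 1) + 2 * N2 (\<lambda>x. Z x 1)) * ennreal (2 * (1 / (real n + 1)))) \<longlonglongrightarrow> (2 * 0 + 2 * N2 (\<lambda>x. Z x 1)) * 0"
        by (rule tendsto_mult_ennreal[OF L0 r2]) (use Z1 in \<open>auto simp: ennreal_mult_eq_top_iff\<close>)
      then have "(\<lambda>n. ennreal (1 / (real n + 1)) * ((2 * N2 (\<lambda>x. W n x 1 - Z x 1) + 2 * N2 (\<lambda>x. Z x 1)) * ennreal (2 * (1 / (real n + 1))))) \<longlonglongrightarrow> 0 * ((2 * 0 + 2 * N2 (\<lambda>x. Z x 1)) * 0)"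
        by (rule tendsto_mult_ennreal[OF r]) auto
      then have "(\<lambda>n. ennreal ((M' + M)\<^sup>2) * (ennreal (1 / (real n + 1)) * ((2 * N2 (\<lambda>x. W n x 1 - Z x 1) + 2 * N2 (\<lambda>x. Z x 1)) * ennreal (2 * (1 / (real n + 1)))))) \<longlonglongrightarrow> ennreal ((M' + M)\<^sup>2) * 0"
        by (intro ennreal_tendsto_cmult) auto
      then show "(\<lambda>n. N2 (\<lambda>x. ev Eta (jetm (\<lambda>y. W n y 0) n x) - ev Eta (W n x))) \<longlonglongrightarrow> 0"
      proof (rule ennreal_tendsto_0_le[OF tendsto_eq_rhs])
        fix n
        have "N2 (\<lambda>x. ev Eta (jetm (\<lambda>y. W n y 0) n x) - ev Eta (W n x)) \<le> N2 (\<lambda>x. complex_of_real (M' + M) * (jetm (\<lambda>y. W n y 0) n x 0 - W n x 0))"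
        proof (rule N2_mono)
          show "AE x in lebesgue. norm (ev Eta (jetm (\<lambda>y. W n y 0) n x) - ev Eta (W n x)) \<le> norm (complex_of_real (M' + M) * (jetm (\<lambda>y. W n y 0) n x 0 - W n x 0))"
            using M(2)[of n] M'(2)[of n]
          proof eventually_elim
            case (elim x)
            have "norm (ev Eta (jetm (\<lambda>y. W n y 0) n x) - ev Eta (W n x)) \<le> (norm (jetm (\<lambda>y. W n y 0) n x 0) + norm (W n x 0)) * norm (jetm (\<lambda>y. W n y 0) n x 0 - W n x 0)"
              unfolding ev.simps by (rule eta_diff_le)
            also have "\<dots> \<le> (M' + M) * norm (jetm (\<lambda>y. W n y 0) n x 0 - W n x 0)"
              using elim by (intro mult_right_mono) auto
            also have "\<dots> = norm (complex_of_real (M' + M) * (jetm (\<lambda>y. W n y 0) n x 0 - W n x 0))"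
              using M(1) M'(1) by (simp add: norm_mult del: of_real_add)
            finally show ?case .
          qed
        qed
        also have "\<dots> = ennreal ((M' + M)\<^sup>2) * N2 (\<lambda>x. jetm (\<lambda>y. W n y 0) n x 0 - W n x 0)"
          using M(1) M'(1) by (subst N2_cmult) (measurable, simp only: norm_of_real power2_abs)
        also have "\<dots> \<le> ennreal ((M' + M)\<^sup>2) * (ennreal (1 / (real n + 1)) * ((2 * N2 (\<lambda>x. W n x 1 - Z x 1) + 2 * N2 (\<lambda>x. Z x 1)) * ennreal (2 * (1 / (real n + 1)))))"
          using N2_add[of "\<lambda>x. W n x 1 - Z x 1" "\<lambda>x. Z x 1"] m
          by (intro mult_left_mono order_trans[OF d] mult_right_mono) auto
        finally show "N2 (\<lambda>x. ev Eta (jetm (\<lambda>y. W n y 0) n x) - ev Eta (W n x)) \<le> ennreal ((M' + M)\<^sup>2) * (ennreal (1 / (real n + 1)) * ((2 * N2 (\<lambda>x. W n x 1 - Z x 1) + 2 * N2 (\<lambda>x. Z x 1)) * ennreal (2 * (1 / (real n + 1)))))" .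
      qed simp
    qed
    then show ?thesis using T1(2) me unfolding cT_def by blast
  qed
  ultimately show ?thesis using B unfolding jconv_def by blast
qed

lemma jetm_has_derivative:
  assumes "u \<in> L1_loc"
  shows "((\<lambda>x. jetm u n x j) has_vector_derivative jetm u n x (Suc j)) (at x)"
  unfolding jetm_def using cnv_has_derivative[OF assms test_derivs[OF mollifierD(1)[OF is_mollifier_mol]], of j n x] by simp

lemma jetm_continuous: "u \<in> L1_loc \<Longrightarrow> continuous_on A (\<lambda>x. jetm u n x j)"
  unfolding jetm_def by (intro cnv_continuous test_derivs mollifierD(1)[OF is_mollifier_mol])

text \<open>The chain rule for weak derivatives. It is classical for mollified jets, and both sides
  converge because \<open>p\<close> and \<open>Dx p\<close> belong to classes on which evaluation is
  continuous.\<close>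

lemma XJ_poly:
  assumes Z: "XJ k Z" and k: "1 \<le> k" and p: "isB k p \<or> isT k p" "isB k (Dx p) \<or> isT k (Dx p)"
  shows "has_weak_deriv 1 (\<lambda>x. ev p (Z x)) (\<lambda>x. ev (Dx p) (Z x))"
proof (rule weak_deriv_limit)
  have l: "(\<lambda>y. Z y 0) \<in> L1_loc" using XJ_L1_loc[OF Z] k by auto
  have "((\<lambda>x. ev p (jetm (\<lambda>y. Z y 0) n x)) has_vector_derivative ev (Dx p) (jetm (\<lambda>y. Z y 0) n x)) (at x)" for n x
    unfolding vr_Dx[symmetric] by (rule ev_has_vector_derivative[OF jetm_has_derivative[OF l]])
  then show "has_weak_deriv 1 (\<lambda>x. ev p (jetm (\<lambda>y. Z y 0) n x)) (\<lambda>x. ev (Dx p) (jetm (\<lambda>y. Z y 0) n x))" for n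
    by (intro classical_weak_deriv continuous_on_ev jetm_continuous l)
  note j = jconv_jetm[OF Z Z XJ_jconv_const[OF Z k] k]
  show "cB (\<lambda>n x. ev p (jetm (\<lambda>y. Z y 0) n x)) (\<lambda>x. ev p (Z x)) \<or> cT (\<lambda>n x. ev p (jetm (\<lambda>y. Z y 0) n x)) (\<lambda>x. ev p (Z x))"
    using ev_conv[OF j k, of p] p(1) by blast
  show "cB (\<lambda>n x. ev (Dx p) (jetm (\<lambda>y. Z y 0) n x)) (\<lambda>x. ev (Dx p) (Z x)) \<or> cT (\<lambda>n x. ev (Dx p) (jetm (\<lambda>y. Z y 0) n x)) (\<lambda>x. ev (Dx p) (Z x))"
    using ev_conv[OF j k, of "Dx p"] p(2) by blast
qed

text \<open>In each term of a derivative of the product of \<Psi> and \<eta>, one factor is \<eta>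
  or carries derivatives and is in L2, while the others have order below k and are bounded. For the
  three values of k this is decided by evaluation.\<close>

lemma nlin_class:
  assumes "2 \<le> k" "k \<le> 4" "j \<le> k"
  shows "isT k ((Dx ^^ j) nlin)" "j < k \<Longrightarrow> isB k ((Dx ^^ j) nlin)"
proof -
  have "k = 2 \<or> k = 3 \<or> k = 4" "j = 0 \<or> j = 1 \<or> j = 2 \<or> j = 3 \<or> j = 4" using assms by auto
  then show "isT k ((Dx ^^ j) nlin)" "j < k \<Longrightarrow> isB k ((Dx ^^ j) nlin)"
    using assms(3) by (elim disjE; simp add: nlin_def numeral_eq_Suc)+
qed

definition nl :: "(real \<Rightarrow> complex) \<Rightarrow> real \<Rightarrow> complex" where
  "nl u y = - u y * (1 - u y * cnj (u y))"

text \<open>With the factor - \<i> this is the error in the time derivative of the mollified jet: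
  the jet moves in the direction \<open>flow\<close> plus this one.\<close>

definition commutator :: "(real \<Rightarrow> complex) \<Rightarrow> nat \<Rightarrow> real \<Rightarrow> nat \<Rightarrow> complex" where
  "commutator u n x j = - \<i> * (jetm (nl u) n x j - ev ((Dx ^^ j) nlin) (jetm u n x))"

text \<open>There is no loss of derivatives here, since the nonlinearity maps \<open>X\<^sup>k\<close> to \<open>H\<^sup>k\<close>: this is
  what makes the mollified conservation laws exact in the limit.\<close>

lemma vconv_commutator:
  assumes W: "\<And>n. XJ k (W n)" and Z: "XJ k Z" and c: "jconv k W Z" and k: "2 \<le> k" "k \<le> 4"
  shows "vconv k (\<lambda>n. commutator (\<lambda>y. W n y 0) n) (\<lambda>x j. 0)"
proof -
  have k1: "1 \<le> k" using k by simp
  note t = mollifierD(1)[OF is_mollifier_mol]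
  note jm = jconv_jetm[OF W Z c k1]
  have wd: "has_weak_deriv 1 (\<lambda>x. ev ((Dx ^^ i) nlin) (Y x)) (\<lambda>x. ev ((Dx ^^ Suc i) nlin) (Y x))" if "i < k" "XJ k Y" for i Y
    using XJ_poly[OF that(2) k1, of "(Dx ^^ i) nlin"] nlin_class[OF k, of i] nlin_class[OF k, of "Suc i"] that by simp
  \<comment> \<open>Up to order k the derivatives pass from the kernel to the nonlinearity of the
    function before mollification. Both terms of the commutator then have the same limit.\<close>
  have e: "commutator (\<lambda>y. W n y 0) n x j = - \<i> * (cnv (\<lambda>y. ev ((Dx ^^ j) nlin) (W n y)) (mol n) x
      + - ev ((Dx ^^ j) nlin) (jetm (\<lambda>y. W n y 0) n x))" if "j \<le> k" for n x j
  proof -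
    have "cnv (\<lambda>y. ev ((Dx ^^ 0) nlin) (W n y)) ((deriv ^^ j) (mol n)) x = cnv (\<lambda>y. ev ((Dx ^^ j) nlin) (W n y)) (mol n) x"
      by (rule cnv_iterated_weak_deriv[where f="\<lambda>i y. ev ((Dx ^^ i) nlin) (W n y)"]) (use that wd W t in auto)
    then show ?thesis by (simp add: commutator_def jetm_def nlin_def nl_def[abs_def])
  qed
  have T: "cT (\<lambda>n x. commutator (\<lambda>y. W n y 0) n x j) (\<lambda>x. 0)" if j: "j \<le> k" for j
  proof -
    note cl = nlin_class[OF k j]
    have 1: "cT (\<lambda>n x. ev ((Dx ^^ j) nlin) (W n x)) (\<lambda>x. ev ((Dx ^^ j) nlin) (Z x))" using ev_conv[OF c k1] cl(1) by blast
    have 2: "cT (\<lambda>n x. ev ((Dx ^^ j) nlin) (jetm (\<lambda>y. W n y 0) n x)) (\<lambda>x. ev ((Dx ^^ j) nlin) (Z x))" using ev_conv[OF jm k1] cl(1) by blast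
    have l: "(\<lambda>x. ev ((Dx ^^ j) nlin) (W n x)) \<in> L1_loc" for n
      using ev_conv[OF XJ_jconv_const[OF W k1] k1, of "(Dx ^^ j) nlin"] cl(1) conv_L1_loc by blast
    have "cT (\<lambda>n x. - \<i> * (cnv (\<lambda>y. ev ((Dx ^^ j) nlin) (W n y)) (mol n) x + - ev ((Dx ^^ j) nlin) (jetm (\<lambda>y. W n y 0) n x)))
       (\<lambda>x. - \<i> * (ev ((Dx ^^ j) nlin) (Z x) + - ev ((Dx ^^ j) nlin) (Z x)))"
      by (intro cT_mult cB_const cT_add cT_minus moll_cT 1 2 l)
    then show ?thesis using e[OF j] by simp
  qed
  have B: "cB (\<lambda>n x. commutator (\<lambda>y. W n y 0) n x j) (\<lambda>x. 0)" if j: "j < k" for j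
  proof -
    have j': "j \<le> k" using j by simp
    note cl = nlin_class[OF k j']
    have 1: "cB (\<lambda>n x. ev ((Dx ^^ j) nlin) (W n x)) (\<lambda>x. ev ((Dx ^^ j) nlin) (Z x))" using ev_conv[OF c k1] cl(2)[OF j] by blast
    have 2: "cB (\<lambda>n x. ev ((Dx ^^ j) nlin) (jetm (\<lambda>y. W n y 0) n x)) (\<lambda>x. ev ((Dx ^^ j) nlin) (Z x))" using ev_conv[OF jm k1] cl(2)[OF j] by blast
    \<comment> \<open>Uniform convergence of the mollified term draws on one more derivative in L2,
      whence j < k.\<close>
    have g: "in_L2 (\<lambda>x. ev ((Dx ^^ Suc j) nlin) (Z x))"
      using ev_conv[OF XJ_jconv_const[OF Z k1] k1, of "(Dx ^^ Suc j) nlin"] nlin_class(1)[OF k, of "Suc j"] j by (auto simp: cT_def)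
    have "cB (\<lambda>n x. - \<i> * (cnv (\<lambda>y. ev ((Dx ^^ j) nlin) (W n y)) (mol n) x + - ev ((Dx ^^ j) nlin) (jetm (\<lambda>y. W n y 0) n x)))
       (\<lambda>x. - \<i> * (ev ((Dx ^^ j) nlin) (Z x) + - ev ((Dx ^^ j) nlin) (Z x)))"
      by (intro cB_mult cB_const cB_add cB_minus moll_cB[OF 1 wd[OF j Z] g] 2)
    then show ?thesis using e[OF j'] by simp
  qed
  show ?thesis unfolding vconv_def using T B by blast
qed

section \<open>The energy space and the equation\<close>

text \<open>The energy space is defined by the derivatives of \<partial>\<Psi> of each order
  separately, whereas jets are chains of first derivatives. This lemma and the next one convert
  between the two.\<close>

lemma weak_deriv_shift:
  assumes a: "has_weak_deriv i u a" and b: "has_weak_deriv (i + j) u b"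
  shows "has_weak_deriv j a b"
  unfolding has_weak_deriv_def
proof (intro conjI allI impI)
  show "a \<in> L1_loc" "b \<in> L1_loc" using a b by (auto simp: has_weak_deriv_def)
  fix \<phi> :: "real \<Rightarrow> real" assume t: "test_function \<phi>"
  have "(-1) ^ i *\<^sub>R (LINT x|lebesgue. (deriv ^^ j) \<phi> x *\<^sub>R a x) = (LINT x|lebesgue. (deriv ^^ i) ((deriv ^^ j) \<phi>) x *\<^sub>R u x)"
    using a test_derivs[OF t, of j] by (simp add: has_weak_deriv_def)
  also have "\<dots> = (LINT x|lebesgue. (deriv ^^ (i + j)) \<phi> x *\<^sub>R u x)" by (simp add: funpow_add)
  also have "\<dots> = (-1) ^ (i + j) *\<^sub>R (LINT x|lebesgue. \<phi> x *\<^sub>R b x)"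
    using b t unfolding has_weak_deriv_def by blast
  also have "\<dots> = (-1) ^ i *\<^sub>R ((-1) ^ j *\<^sub>R (LINT x|lebesgue. \<phi> x *\<^sub>R b x))"
    by (simp add: power_add)
  finally show "(LINT x|lebesgue. (deriv ^^ j) \<phi> x *\<^sub>R a x) = (-1) ^ j *\<^sub>R (LINT x|lebesgue. \<phi> x *\<^sub>R b x)"
    by (rule scaleR_left_imp_eq[rotated]) simp
qed

lemma weak_deriv_comp:
  assumes a: "has_weak_deriv i u a" and b: "has_weak_deriv j a b"
  shows "has_weak_deriv (i + j) u b"
  unfolding has_weak_deriv_def
proof (intro conjI allI impI)
  show "u \<in> L1_loc" "b \<in> L1_loc" using a b by (auto simp: has_weak_deriv_def)
  fix \<phi> :: "real \<Rightarrow> real" assume t: "test_function \<phi>"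
  have "(LINT x|lebesgue. (deriv ^^ (i + j)) \<phi> x *\<^sub>R u x) = (LINT x|lebesgue. (deriv ^^ i) ((deriv ^^ j) \<phi>) x *\<^sub>R u x)"
    by (simp add: funpow_add)
  also have "\<dots> = (-1) ^ i *\<^sub>R (LINT x|lebesgue. (deriv ^^ j) \<phi> x *\<^sub>R a x)"
    using a test_derivs[OF t, of j] by (simp add: has_weak_deriv_def)
  also have "(LINT x|lebesgue. (deriv ^^ j) \<phi> x *\<^sub>R a x) = (-1) ^ j *\<^sub>R (LINT x|lebesgue. \<phi> x *\<^sub>R b x)"
    using b t unfolding has_weak_deriv_def by blast
  finally show "(LINT x|lebesgue. (deriv ^^ (i + j)) \<phi> x *\<^sub>R u x) = (-1) ^ (i + j) *\<^sub>R (LINT x|lebesgue. \<phi> x *\<^sub>R b x)"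
    by (simp add: power_add)
qed

lemma weak_deriv_diff:
  assumes u: "has_weak_deriv j u a" and v: "has_weak_deriv j v b"
  shows "has_weak_deriv j (\<lambda>x. u x - v x) (\<lambda>x. a x - b x)"
  unfolding has_weak_deriv_def
proof (intro conjI allI impI)
  have l: "u \<in> L1_loc" "v \<in> L1_loc" "a \<in> L1_loc" "b \<in> L1_loc" using u v by (auto simp: has_weak_deriv_def)
  then show "(\<lambda>x. u x - v x) \<in> L1_loc" "(\<lambda>x. a x - b x) \<in> L1_loc" by (auto intro: L1_loc_diff)
  fix \<phi> :: "real \<Rightarrow> real" assume t: "test_function \<phi>"
  note i = l(1,2)[THEN L1_loc_test_integrable, OF test_derivs[OF t, of j]] l(3,4)[THEN L1_loc_test_integrable, OF t]
  have "(LINT x|lebesgue. (deriv ^^ j) \<phi> x *\<^sub>R u x) = (-1) ^ j *\<^sub>R (LINT x|lebesgue. \<phi> x *\<^sub>R a x)"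
    "(LINT x|lebesgue. (deriv ^^ j) \<phi> x *\<^sub>R v x) = (-1) ^ j *\<^sub>R (LINT x|lebesgue. \<phi> x *\<^sub>R b x)"
    using u v t unfolding has_weak_deriv_def by blast+
  then show "(LINT x|lebesgue. (deriv ^^ j) \<phi> x *\<^sub>R (u x - v x)) = (-1) ^ j *\<^sub>R (LINT x|lebesgue. \<phi> x *\<^sub>R (a x - b x))"
    using i by (simp add: scaleR_diff_right)
qed

lemma weak_deriv_0: "has_weak_deriv j (\<lambda>_. 0) (\<lambda>_. 0 :: 'a::euclidean_space)"
  using L1_loc_bounded[of "\<lambda>_. 0::'a" 0] by (simp add: has_weak_deriv_def)

lemma in_L2_cong:
  assumes "in_L2 f" "g \<in> borel_measurable lebesgue" "AE x in lebesgue. g x = f x"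
  shows "in_L2 g"
  using assms N2_cong[OF assms(3)] by (simp add: in_L2_iff)

text \<open>Order 0 is set apart: the weak derivative of order 0 would only be some function equal
  to \<open>u\<close> almost everywhere.\<close>

definition jet :: "(real \<Rightarrow> complex) \<Rightarrow> real \<Rightarrow> nat \<Rightarrow> complex" where
  "jet u x j = (if j = 0 then u x else \<partial>\<^bsup>j\<^esup> u x)"

lemma X_weak_deriv:
  assumes u: "u \<in> X k" and j: "1 \<le> j" "j \<le> k"
  shows "has_weak_deriv j u (\<partial>\<^bsup>j\<^esup> u)" "in_L2 (\<partial>\<^bsup>j\<^esup> u)"
proof -
  have 1: "has_weak_deriv 1 u (\<partial>\<^bsup>1\<^esup> u)" using u by (auto simp: X_def dest: weak_deriv_eq(1))
  have "\<exists>g. has_weak_deriv j u g \<and> in_L2 g"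
  proof (cases "j = 1")
    case True
    then show ?thesis using u 1 by (auto simp: X_def sobolev_H_def)
  next
    case False
    then have "j - 1 \<in> {1..k - 1}" using j by auto
    then obtain g where "has_weak_deriv (j - 1) (\<partial>\<^bsup>1\<^esup> u) g" "in_L2 g"
      using u unfolding X_def sobolev_H_def by blast
    then show ?thesis using weak_deriv_comp[OF 1, of "j - 1" g] j by auto
  qed
  then obtain g where g: "has_weak_deriv j u g" "in_L2 g" by blast
  show *: "has_weak_deriv j u (\<partial>\<^bsup>j\<^esup> u)" by (rule weak_deriv_eq(1)[OF g(1)])
  show "in_L2 (\<partial>\<^bsup>j\<^esup> u)"
    by (rule in_L2_cong[OF g(2) _ weak_deriv_eq(2)[OF g(1)]])
      (use * in \<open>auto simp: has_weak_deriv_def intro: L1_loc_measurable\<close>)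
qed

lemma ev_Eta: "ev Eta (jet u x) = complex_of_real (eta u x)"
  by (simp only: ev.simps jet_def refl if_True eta_def of_real_diff of_real_1 complex_norm_square)

lemma X_XJ:
  assumes u: "u \<in> X k" and k: "1 \<le> k"
  shows "XJ k (jet u)"
  unfolding XJ_def
proof (intro conjI allI impI)
  fix j assume "j < k"
  show "has_weak_deriv 1 (\<lambda>x. jet u x j) (\<lambda>x. jet u x (Suc j))"
  proof (cases "j = 0")
    case True
    then show ?thesis using X_weak_deriv(1)[OF u, of 1] k by (simp add: jet_def[abs_def])
  next
    case False
    then have a: "has_weak_deriv j u (\<partial>\<^bsup>j\<^esup> u)" using X_weak_deriv(1)[OF u, of j] \<open>j < k\<close> by simp
    have "has_weak_deriv (j + 1) u (\<partial>\<^bsup>Suc j\<^esup> u)" using X_weak_deriv(1)[OF u, of "Suc j"] \<open>j < k\<close> by simp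
    from weak_deriv_shift[OF a this] show ?thesis using False by (simp add: jet_def[abs_def])
  qed
next
  fix j assume "1 \<le> j" "j \<le> k"
  then show "in_L2 (\<lambda>x. jet u x j)" using X_weak_deriv(2)[OF u, of j] by (simp add: jet_def[abs_def])
next
  have [measurable]: "u \<in> borel_measurable lebesgue" using u by (auto simp: X_def intro: L1_loc_measurable)
  have "N2 (\<lambda>x. complex_of_real (eta u x)) / 4 < \<infinity>"
    using u unfolding X_def GL_energy_def N2_def norm_of_real power2_abs eta_def by simp
  then have "N2 (\<lambda>x. complex_of_real (eta u x)) < \<infinity>"
    by (cases "N2 (\<lambda>x. complex_of_real (eta u x))") (auto simp: ennreal_top_divide)
  moreover have "(\<lambda>x. complex_of_real (eta u x)) \<in> borel_measurable lebesgue"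
    unfolding eta_def by measurable
  ultimately show "in_L2 (\<lambda>x. ev Eta (jet u x))" unfolding ev_Eta in_L2_iff by blast
qed

section \<open>From the distance to convergence of jets\<close>

lemma L2_norm_N2: "in_L2 f \<Longrightarrow> N2 f = ennreal ((L2_norm f)\<^sup>2)"
  unfolding N2_def L2_norm_def in_L2_def by (subst nn_integral_eq_integral) auto

lemma L2_norm_cong:
  assumes "f \<in> borel_measurable lebesgue" "g \<in> borel_measurable lebesgue" "AE x in lebesgue. f x = g x"
  shows "L2_norm f = L2_norm g"
proof -
  note [measurable] = assms(1,2)
  have "(LINT x|lebesgue. (norm (f x))\<^sup>2) = (LINT x|lebesgue. (norm (g x))\<^sup>2)"
    by (rule integral_cong_AE) (use assms(3) in auto)
  then show ?thesis by (simp add: L2_norm_def)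
qed

lemma L2_norm_nonneg: "0 \<le> L2_norm f"
  by (simp add: L2_norm_def)

lemma Linf_norm_nonneg: "0 \<le> Linf_norm f"
proof (cases "(\<lambda>x. ereal (norm (f x))) \<in> borel_measurable lebesgue")
  case True
  have "0 \<le> esssup lebesgue (\<lambda>x. ereal (norm (f x)))"
  proof (rule ccontr)
    assume "\<not> ?thesis"
    then have "AE x::real in lebesgue. False"
      using esssup_AE[of "\<lambda>x. ereal (norm (f x))" lebesgue]
      by (elim eventually_mono) (metis ereal_less_eq(5) norm_ge_zero order_trans)
    then show False by (rule AE_lebesgue_const)
  qed
  then show ?thesis unfolding Linf_norm_def by (rule real_of_ereal_pos)
next
  case False
  \<comment> \<open>The essential supremum of a non-measurable function is infinite, and
    \<open>real_of_ereal\<close> maps it to 0.\<close>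
  then show ?thesis by (simp add: Linf_norm_def esssup_non_measurable top_ereal_def)
qed

text \<open>Some essential bound has to be known beforehand, because an infinite essential supremum
  would become 0 under \<open>real_of_ereal\<close>.\<close>

lemma AE_Linf_norm:
  assumes [measurable]: "f \<in> borel_measurable lebesgue" and b: "AE x in lebesgue. norm (f x) \<le> M"
  shows "AE x in lebesgue. norm (f x) \<le> Linf_norm f"
proof -
  let ?e = "esssup lebesgue (\<lambda>x. ereal (norm (f x)))"
  have "?e \<le> ereal M"
    by (rule esssup_I) (use b in auto)
  then have top: "?e \<noteq> \<infinity>" by auto
  have "AE x in lebesgue. ereal (norm (f x)) \<le> ?e" by (rule esssup_AE)
  then show ?thesis
  proof eventually_elim
    case (elim x)
    with top have "?e = ereal (Linf_norm f)" unfolding Linf_norm_def by (cases ?e) auto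
    then show ?case using elim by simp
  qed
qed

lemma sobolev_norm_ge: "L2_norm f \<le> sobolev_norm m f" "1 \<le> j \<Longrightarrow> j \<le> m \<Longrightarrow> L2_norm (\<partial>\<^bsup>j\<^esup> f) \<le> sobolev_norm m f"
proof -
  have s: "0 \<le> (\<Sum>j=1..m. (L2_norm (\<partial>\<^bsup>j\<^esup> f))\<^sup>2)" by (intro sum_nonneg) auto
  then show "L2_norm f \<le> sobolev_norm m f" unfolding sobolev_norm_def by (intro real_le_rsqrt) simp
  assume "1 \<le> j" "j \<le> m"
  then have "(L2_norm (\<partial>\<^bsup>j\<^esup> f))\<^sup>2 \<le> (\<Sum>j=1..m. (L2_norm (\<partial>\<^bsup>j\<^esup> f))\<^sup>2)"
    by (intro member_le_sum[of j _ "\<lambda>j. (L2_norm (\<partial>\<^bsup>j\<^esup> f))\<^sup>2"]) auto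
  then show "L2_norm (\<partial>\<^bsup>j\<^esup> f) \<le> sobolev_norm m f" unfolding sobolev_norm_def
    by (intro real_le_rsqrt) (simp add: add_increasing)
qed

text \<open>The distance contains the chosen derivatives of the difference; uniqueness of weak
  derivatives identifies them with differences of the chosen derivatives. Uniform convergence is
  part of the distance for order 0 and follows from the Sobolev estimate applied to differences for
  the orders 1 to k - 1.\<close>

lemma X_dist_conv:
  assumes u: "\<And>n. u n \<in> X k" and w: "w \<in> X k" and k: "1 \<le> k" and d: "(\<lambda>n. X_dist k (u n) w) \<longlonglongrightarrow> 0"
  shows "jconv k (\<lambda>n. jet (u n)) (jet w)"
proof -
  note U = X_XJ[OF u k] and W = X_XJ[OF w k]
  define D where "D n = X_dist k (u n) w" for n
  have D0: "D \<longlonglongrightarrow> 0" using d by (simp add: D_def[abs_def])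
  have wd: "has_weak_deriv j (\<lambda>x. u n x - w x) (\<lambda>x. \<partial>\<^bsup>j\<^esup> (u n) x - \<partial>\<^bsup>j\<^esup> w x)" if "1 \<le> j" "j \<le> k" for n j
    by (intro weak_deriv_diff X_weak_deriv[OF u that] X_weak_deriv[OF w that])
  have parts: "Linf_norm (\<lambda>x. u n x - w x) \<le> D n" "sobolev_norm (k - 1) (\<partial>\<^bsup>1\<^esup> (\<lambda>x. u n x - w x)) \<le> D n"
    "L2_norm (\<lambda>x. (cmod (u n x))\<^sup>2 - (cmod (w x))\<^sup>2) \<le> D n" for n
    using Linf_norm_nonneg[of "\<lambda>x. u n x - w x"] L2_norm_nonneg[of "\<lambda>x. (cmod (u n x))\<^sup>2 - (cmod (w x))\<^sup>2"]
      order_trans[OF L2_norm_nonneg sobolev_norm_ge(1)[of "\<partial>\<^bsup>1\<^esup> (\<lambda>x. u n x - w x)" "k - 1"]]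
    unfolding D_def X_dist_def by linarith+
  have T: "cT (\<lambda>n x. jet (u n) x j) (\<lambda>x. jet w x j)" if j: "1 \<le> j" "j \<le> k" for j
  proof -
    have L: "in_L2 (\<lambda>x. \<partial>\<^bsup>j\<^esup> (u n) x - \<partial>\<^bsup>j\<^esup> w x)" for n
      by (intro in_L2_diff X_weak_deriv(2)[OF u j] X_weak_deriv(2)[OF w j])
    have le: "L2_norm (\<lambda>x. \<partial>\<^bsup>j\<^esup> (u n) x - \<partial>\<^bsup>j\<^esup> w x) \<le> D n" for n
    proof -
      note e1 = weak_deriv_eq[OF wd[of 1, OF _ k], of n]
      show ?thesis
      proof (cases "j = 1")
        case True
        have "L2_norm (\<partial>\<^bsup>1\<^esup> (\<lambda>x. u n x - w x)) = L2_norm (\<lambda>x. \<partial>\<^bsup>j\<^esup> (u n) x - \<partial>\<^bsup>j\<^esup> w x)"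
          using e1 L True by (intro L2_norm_cong) (auto simp: has_weak_deriv_def in_L2_def intro: L1_loc_measurable)
        then show ?thesis
          using order_trans[OF sobolev_norm_ge(1)[of "\<partial>\<^bsup>1\<^esup> (\<lambda>x. u n x - w x)"] parts(2)[of n]] by (simp only:)
      next
        case False
        then have j1: "1 \<le> j - 1" "j - 1 \<le> k - 1" using j by auto
        have "has_weak_deriv (1 + (j - 1)) (\<lambda>x. u n x - w x) (\<lambda>x. \<partial>\<^bsup>j\<^esup> (u n) x - \<partial>\<^bsup>j\<^esup> w x)"
          using wd[OF j, of n] j by simp
        note e2 = weak_deriv_eq[OF weak_deriv_shift[OF e1(1) this]]
        have "L2_norm (\<partial>\<^bsup>j - 1\<^esup> (\<partial>\<^bsup>1\<^esup> (\<lambda>x. u n x - w x))) = L2_norm (\<lambda>x. \<partial>\<^bsup>j\<^esup> (u n) x - \<partial>\<^bsup>j\<^esup> w x)"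
          using e2 L by (intro L2_norm_cong) (auto simp: has_weak_deriv_def in_L2_def intro: L1_loc_measurable)
        then show ?thesis
          using order_trans[OF sobolev_norm_ge(2)[OF j1, of "\<partial>\<^bsup>1\<^esup> (\<lambda>x. u n x - w x)"] parts(2)[of n]] by (simp only:)
      qed
    qed
    have "(\<lambda>n. L2_norm (\<lambda>x. \<partial>\<^bsup>j\<^esup> (u n) x - \<partial>\<^bsup>j\<^esup> w x)) \<longlonglongrightarrow> 0"
      by (rule tendsto_sandwich[OF _ _ tendsto_const D0]) (auto simp: L2_norm_nonneg le)
    then have "(\<lambda>n. ennreal ((L2_norm (\<lambda>x. \<partial>\<^bsup>j\<^esup> (u n) x - \<partial>\<^bsup>j\<^esup> w x))\<^sup>2)) \<longlonglongrightarrow> ennreal (0\<^sup>2)"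
      by (intro tendsto_ennrealI tendsto_power)
    then have "(\<lambda>n. N2 (\<lambda>x. \<partial>\<^bsup>j\<^esup> (u n) x - \<partial>\<^bsup>j\<^esup> w x)) \<longlonglongrightarrow> 0" by (simp add: L2_norm_N2[OF L])
    then show ?thesis using j X_weak_deriv(2)[OF u j] X_weak_deriv(2)[OF w j] by (simp add: cT_def jet_def in_L2_def)
  qed
  moreover have "cB (\<lambda>n x. jet (u n) x j) (\<lambda>x. jet w x j)" if j: "j < k" for j
  proof (cases "j = 0")
    case True
    obtain M where M: "AE x in lebesgue. norm (w x) \<le> M" using XJ_bounded[OF W, of 0] k by (auto simp: jet_def)
    have m[measurable]: "u n \<in> borel_measurable lebesgue" "w \<in> borel_measurable lebesgue" for n
      using XJ_measurable[OF U, of 0 n] XJ_measurable[OF W, of 0] k by (auto simp: jet_def)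
    have "AE x in lebesgue. norm (u n x - w x) \<le> D n" for n
    proof -
      obtain M' where M': "AE x in lebesgue. norm (u n x) \<le> M'" using XJ_bounded[OF U, of 0 n] k by (auto simp: jet_def)
      have "AE x in lebesgue. norm (u n x - w x) \<le> M' + M"
        using M M' by eventually_elim (intro order_trans[OF norm_triangle_ineq4 add_mono])
      from AE_Linf_norm[OF _ this] have "AE x in lebesgue. norm (u n x - w x) \<le> Linf_norm (\<lambda>x. u n x - w x)" by auto
      then show ?thesis by eventually_elim (use parts(1)[of n] in linarith)
    qed
    then show ?thesis using True m M D0 by (auto simp: cB_def jet_def)
  next
    case False
    have "\<exists>\<delta>. \<delta> \<longlonglongrightarrow> 0 \<and> (\<forall>n. AE x in lebesgue. norm (jet (u n) x j - jet w x j) \<le> \<delta> n)"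
    proof (intro exI conjI allI)
      let ?a = "\<lambda>i n. N2 (\<lambda>x. jet (u n) x i - jet w x i)"
      have L: "in_L2 (\<lambda>x. jet (u n) x i - jet w x i)" if "1 \<le> i" "i \<le> k" for i n
        using U[of n] W that unfolding XJ_def by (intro in_L2_diff) auto
      have fin: "2 * ?a j n + 2 * ?a (Suc j) n < \<infinity>" for n
        using L[of j n] L[of "Suc j" n] j False by (auto simp: in_L2_iff ennreal_mult_less_top)
      have "(\<lambda>n. 2 * ?a j n + 2 * ?a (Suc j) n) \<longlonglongrightarrow> 2 * 0 + 2 * 0"
        using T[of j] T[of "Suc j"] j False by (intro tendsto_add ennreal_tendsto_cmult) (auto simp: cT_def)
      then have "(\<lambda>n. enn2real (2 * ?a j n + 2 * ?a (Suc j) n)) \<longlonglongrightarrow> enn2real (2 * 0 + 2 * 0)"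
        by (intro tendsto_enn2real) auto
      then have "(\<lambda>n. sqrt (enn2real (2 * ?a j n + 2 * ?a (Suc j) n))) \<longlonglongrightarrow> sqrt (enn2real (2 * 0 + 2 * 0))"
        by (intro tendsto_real_sqrt)
      then show "(\<lambda>n. sqrt (enn2real (2 * ?a j n + 2 * ?a (Suc j) n))) \<longlonglongrightarrow> 0" by simp
      fix n
      have wd1: "has_weak_deriv 1 (\<lambda>x. jet (u n) x j - jet w x j) (\<lambda>x. jet (u n) x (Suc j) - jet w x (Suc j))"
        using U[of n] W j unfolding XJ_def by (intro weak_deriv_diff) auto
      have j1: "1 \<le> j" "j \<le> k" "1 \<le> Suc j" "Suc j \<le> k" using False j by auto
      obtain G where G: "AE x in lebesgue. jet (u n) x j - jet w x j = G x" and ac: "ac G (\<lambda>x. jet (u n) x (Suc j) - jet w x (Suc j))"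
        using weak_deriv_ac[OF wd1 in_L2_restr[OF L[OF j1(1,2)]] in_L2_restr[OF L[OF j1(3,4)]]] by blast
      have mG: "G \<in> borel_measurable lebesgue" by (rule borel_measurable_AE[OF in_L2_measurable[OF L[OF j1(1,2)]] G])
      have "ennreal ((norm (G x))\<^sup>2) \<le> 2 * ?a j n + 2 * ?a (Suc j) n" for x
        unfolding N2_cong[OF G]
        by (rule order_trans[OF ac_sup[OF ac mG]]) (intro add_mono mult_left_mono N2I_le_N2, auto)
      then have "ennreal ((norm (G x))\<^sup>2) \<le> ennreal (enn2real (2 * ?a j n + 2 * ?a (Suc j) n))" for x
        using fin[of n] by simp
      then have "(norm (G x))\<^sup>2 \<le> enn2real (2 * ?a j n + 2 * ?a (Suc j) n)" for x by (simp add: ennreal_le_iff)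
      then have "norm (G x) \<le> sqrt (enn2real (2 * ?a j n + 2 * ?a (Suc j) n))" for x by (rule real_le_rsqrt)
      then show "AE x in lebesgue. norm (jet (u n) x j - jet w x j) \<le> sqrt (enn2real (2 * ?a j n + 2 * ?a (Suc j) n))"
        using G by (elim eventually_mono) simp
    qed
    then show ?thesis unfolding cB_def using XJ_measurable[OF U, of j] XJ_measurable[OF W, of j] XJ_bounded[OF W j] j k by auto
  qed
  moreover have "cT (\<lambda>n x. ev Eta (jet (u n) x)) (\<lambda>x. ev Eta (jet w x))"
  proof -
    have e: "in_L2 (\<lambda>x. ev Eta (jet (u n) x))" "in_L2 (\<lambda>x. ev Eta (jet w x))" for n
      using U[of n] W by (simp_all add: XJ_def del: ev.simps)
    have eq: "norm (ev Eta (jet (u n) x) - ev Eta (jet w x)) = norm ((cmod (u n x))\<^sup>2 - (cmod (w x))\<^sup>2)" for n x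
      unfolding ev_Eta of_real_diff[symmetric] norm_of_real by (simp add: eta_def abs_minus_commute)
    have "N2 (\<lambda>x. ev Eta (jet (u n) x) - ev Eta (jet w x)) = ennreal ((L2_norm (\<lambda>x. (cmod (u n x))\<^sup>2 - (cmod (w x))\<^sup>2))\<^sup>2)" for n
      using L2_norm_N2[OF in_L2_diff[OF e(1)[of n] e(2)]] unfolding L2_norm_def eq .
    moreover have "(\<lambda>n. L2_norm (\<lambda>x. (cmod (u n x))\<^sup>2 - (cmod (w x))\<^sup>2)) \<longlonglongrightarrow> 0"
      by (rule tendsto_sandwich[OF _ _ tendsto_const D0]) (auto simp: L2_norm_nonneg parts)
    then have "(\<lambda>n. ennreal ((L2_norm (\<lambda>x. (cmod (u n x))\<^sup>2 - (cmod (w x))\<^sup>2))\<^sup>2)) \<longlonglongrightarrow> ennreal (0\<^sup>2)"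
      by (intro tendsto_ennrealI tendsto_power)
    ultimately show ?thesis using e unfolding cT_def in_L2_def by (simp del: ev.simps)
  qed
  ultimately show ?thesis unfolding jconv_def by blast
qed

text \<open>Continuity is defined by a punctured limit, but a sequence of times may hit its limit,
  so the value there matters. The chosen derivatives of the zero function vanish only almost
  everywhere.\<close>

lemma X_dist_self:
  shows "X_dist k u u = 0"
proof -
  let ?z = "\<lambda>x::real. 0::complex"
  have 1: "has_weak_deriv 1 ?z (\<partial>\<^bsup>1\<^esup> ?z)" "AE x in lebesgue. \<partial>\<^bsup>1\<^esup> ?z x = 0"
    using weak_deriv_eq[OF weak_deriv_0[of 1]] by auto
  have z: "L2_norm f = 0" if "has_weak_deriv j h f" "AE x in lebesgue. f x = 0" for f h :: "real \<Rightarrow> complex" and j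
  proof -
    have "L2_norm f = L2_norm ?z"
      using that by (intro L2_norm_cong) (auto simp: has_weak_deriv_def intro: L1_loc_measurable)
    then show ?thesis by (simp add: L2_norm_def)
  qed
  have "L2_norm (\<partial>\<^bsup>j\<^esup> (\<partial>\<^bsup>1\<^esup> ?z)) = 0" for j
    using weak_deriv_eq[OF weak_deriv_shift[OF 1(1) weak_deriv_0[of "1 + j"]]] by (intro z) auto
  then have "sobolev_norm (k - 1) (\<partial>\<^bsup>1\<^esup> ?z) = 0"
    using z[OF 1] by (simp add: sobolev_norm_def)
  moreover have "Linf_norm ?z = 0"
    by (simp add: Linf_norm_def esssup_const zero_ereal_def[symmetric])
  ultimately show ?thesis by (simp add: X_dist_def L2_norm_def)
qed

lemma X_continuous_conv:
  assumes c: "X_continuous k \<Psi>" and k: "1 \<le> k" and s: "s \<longlonglongrightarrow> t"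
  shows "jconv k (\<lambda>n. jet (\<Psi> (s n))) (jet (\<Psi> t))"
proof (rule X_dist_conv)
  have "isCont (\<lambda>s. X_dist k (\<Psi> s) (\<Psi> t)) t"
    using c by (simp add: X_continuous_def isCont_def X_dist_self)
  from isCont_tendsto_compose[OF this s] show "(\<lambda>n. X_dist k (\<Psi> (s n)) (\<Psi> t)) \<longlonglongrightarrow> 0"
    by (simp add: X_dist_self)
qed (use c k in \<open>auto simp: X_continuous_def\<close>)

lemma nl_ev: "nl u y = ev nlin (jet u y)"
  by (simp add: nl_def nlin_def jet_def)

lemma continuous_on_sequential:
  fixes f :: "real \<Rightarrow> 'a::metric_space"
  assumes "\<And>s t. s \<longlonglongrightarrow> t \<Longrightarrow> (\<lambda>n. f (s n)) \<longlonglongrightarrow> f t"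
  shows "continuous_on A f"
  using assms by (intro continuous_at_imp_continuous_on ballI) (simp add: continuous_at_sequentially o_def)

text \<open>Testing with \<theta>(t) \<rho>(x - y) turns the equation on the plane into a weak
  derivative in t of the convolution at a fixed x. The convolution and this derivative are
  continuous in t, so the derivative is classical.\<close>

lemma GP_time_derivative:
  assumes c: "X_continuous k \<Psi>" and gp: "GP_equation \<Psi>" and k: "1 \<le> k" and \<rho>: "test_function \<rho>"
  shows "((\<lambda>t. cnv (\<Psi> t) \<rho> x) has_vector_derivative
     \<i> * (cnv (\<Psi> t) ((deriv ^^ 2) \<rho>) x - cnv (nl (\<Psi> t)) \<rho> x)) (at t)"
proof -
  have l: "\<Psi> t \<in> L1_loc" for t using c by (auto simp: X_continuous_def X_def)
  have conv: "(\<lambda>n. cnv (\<Psi> (s n)) \<sigma> x) \<longlonglongrightarrow> cnv (\<Psi> t) \<sigma> x" "(\<lambda>n. cnv (nl (\<Psi> (s n))) \<sigma> x) \<longlonglongrightarrow> cnv (nl (\<Psi> t)) \<sigma> x"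
    if s: "s \<longlonglongrightarrow> t" and \<sigma>: "test_function \<sigma>" for s t \<sigma>
  proof -
    note j = X_continuous_conv[OF c k s]
    have "cB (\<lambda>n x. \<Psi> (s n) x) (\<Psi> t)" using j k by (auto simp: jconv_def jet_def)
    then show "(\<lambda>n. cnv (\<Psi> (s n)) \<sigma> x) \<longlonglongrightarrow> cnv (\<Psi> t) \<sigma> x"
      unfolding cnv_def by (intro conv_test test_reflect \<sigma>) simp
    have "cB (\<lambda>n x. nl (\<Psi> (s n)) x) (nl (\<Psi> t))"
      using ev_conv[OF j k, of nlin] k by (simp add: nl_ev[abs_def] nlin_def)
    then show "(\<lambda>n. cnv (nl (\<Psi> (s n))) \<sigma> x) \<longlonglongrightarrow> cnv (nl (\<Psi> t)) \<sigma> x"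
      unfolding cnv_def by (intro conv_test test_reflect \<sigma>) simp
  qed
  have lnl: "nl (\<Psi> t) \<in> L1_loc" for t
  proof -
    have "cB (\<lambda>n x. nl (\<Psi> t) x) (nl (\<Psi> t))"
      using ev_conv[OF X_continuous_conv[OF c k tendsto_const[of t]] k, of nlin] k by (simp add: nl_ev[abs_def] nlin_def)
    then show ?thesis by (rule conv_L1_loc[OF disjI1])
  qed
  let ?G = "\<lambda>t. cnv (\<Psi> t) \<rho> x" and ?G2 = "\<lambda>t. cnv (\<Psi> t) ((deriv ^^ 2) \<rho>) x" and ?K = "\<lambda>t. cnv (nl (\<Psi> t)) \<rho> x"
  have cG: "continuous_on UNIV ?G" "continuous_on UNIV ?G2" "continuous_on UNIV ?K"
    by (intro continuous_on_sequential conv \<rho> test_derivs; assumption)+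
  have cL: "continuous_on UNIV (\<lambda>t. \<i> * (?G2 t - ?K t))" by (intro continuous_intros cG)
  have "has_weak_deriv 1 ?G (\<lambda>t. \<i> * (?G2 t - ?K t))"
    unfolding has_weak_deriv_def
  proof (intro conjI allI impI L1_loc_continuous cG cL)
    fix \<theta> :: "real \<Rightarrow> real" assume \<theta>: "test_function \<theta>"
    let ?\<xi> = "\<lambda>y. \<rho> (x - y)"
    have \<xi>: "test_function ?\<xi>" by (rule test_reflect[OF \<rho>])
    have d2: "deriv (deriv ?\<xi>) = (\<lambda>y. (deriv ^^ 2) \<rho> (x - y))"
      using test_derivs_affine[OF \<rho>, of 2 x "-1"] by (simp add: numeral_2_eq_2)
    have p: "pd_t (\<lambda>p. \<theta> (fst p) * ?\<xi> (snd p)) (t, y) = deriv \<theta> t * \<rho> (x - y)"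
      "pd_x (pd_x (\<lambda>p. \<theta> (fst p) * ?\<xi> (snd p))) (t, y) = \<theta> t * (deriv ^^ 2) \<rho> (x - y)" for t y
      using pd_tensor[OF test_Ck[OF \<theta>] test_Ck[OF \<xi>]] pd_tensor[OF test_Ck[OF \<theta>] test_Ck[OF test_deriv[OF \<xi>]]]
      by (simp_all add: d2)
    have i: "integrable lebesgue (\<lambda>y. \<rho> (x - y) *\<^sub>R \<Psi> t y)" "integrable lebesgue (\<lambda>y. (deriv ^^ 2) \<rho> (x - y) *\<^sub>R \<Psi> t y)" for t
      by (intro cnv_integrable l \<rho> test_derivs)+
    have "(LINT y|lebesgue. - (\<i> * \<Psi> t y * of_real (deriv \<theta> t * \<rho> (x - y))) + \<Psi> t y * of_real (\<theta> t * (deriv ^^ 2) \<rho> (x - y)))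
       = (LINT y|lebesgue. (- \<i> * of_real (deriv \<theta> t)) * (\<rho> (x - y) *\<^sub>R \<Psi> t y) + of_real (\<theta> t) * ((deriv ^^ 2) \<rho> (x - y) *\<^sub>R \<Psi> t y))" for t
      by (intro Bochner_Integration.integral_cong refl) (simp add: scaleR_conv_of_real algebra_simps)
    also have "\<dots> t = (- \<i> * of_real (deriv \<theta> t)) * ?G t + of_real (\<theta> t) * ?G2 t" for t
      using Bochner_Integration.integral_add[OF integrable_mult_right[OF i(1)[of t]] integrable_mult_right[OF i(2)[of t]]]
      unfolding cnv_def by (simp only: integral_mult_right_zero)
    finally have L: "(LINT y|lebesgue. - (\<i> * \<Psi> t y * of_real (deriv \<theta> t * \<rho> (x - y))) + \<Psi> t y * of_real (\<theta> t * (deriv ^^ 2) \<rho> (x - y)))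
       = - \<i> * (deriv \<theta> t *\<^sub>R ?G t) + \<theta> t *\<^sub>R ?G2 t" for t by (simp add: scaleR_conv_of_real algebra_simps)
    have "(LINT y|lebesgue. \<Psi> t y * of_real ((cmod (\<Psi> t y))\<^sup>2 - 1) * of_real (\<theta> t * \<rho> (x - y)))
      = (LINT y|lebesgue. of_real (\<theta> t) * (\<rho> (x - y) *\<^sub>R nl (\<Psi> t) y))" for t
      by (intro Bochner_Integration.integral_cong refl)
        (simp add: nl_def scaleR_conv_of_real algebra_simps flip: complex_norm_square)
    then have R: "(LINT y|lebesgue. \<Psi> t y * of_real ((cmod (\<Psi> t y))\<^sup>2 - 1) * of_real (\<theta> t * \<rho> (x - y))) = \<theta> t *\<^sub>R ?K t" for t
      by (simp add: cnv_def scaleR_conv_of_real)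
    have "(LINT t|lebesgue. - \<i> * (deriv \<theta> t *\<^sub>R ?G t) + \<theta> t *\<^sub>R ?G2 t) = (LINT t|lebesgue. \<theta> t *\<^sub>R ?K t)"
      using gp[unfolded GP_equation_def, rule_format, OF test_tensor[OF \<theta> \<xi>]]
      unfolding p fst_conv snd_conv L R .
    moreover have i2: "integrable lebesgue (\<lambda>t. deriv \<theta> t *\<^sub>R ?G t)" "integrable lebesgue (\<lambda>t. \<theta> t *\<^sub>R ?G2 t)" "integrable lebesgue (\<lambda>t. \<theta> t *\<^sub>R ?K t)"
      by (intro L1_loc_test_integrable L1_loc_continuous cG \<theta> test_deriv)+
    ultimately have e: "- \<i> * (LINT t|lebesgue. deriv \<theta> t *\<^sub>R ?G t) + (LINT t|lebesgue. \<theta> t *\<^sub>R ?G2 t) = (LINT t|lebesgue. \<theta> t *\<^sub>R ?K t)"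
      using Bochner_Integration.integral_add[OF integrable_mult_right[OF i2(1), of "- \<i>"] i2(2)]
      by (simp only: integral_mult_right_zero)
    have "(LINT t|lebesgue. \<theta> t *\<^sub>R (\<i> * (?G2 t - ?K t))) = (LINT t|lebesgue. \<i> * (\<theta> t *\<^sub>R ?G2 t) - \<i> * (\<theta> t *\<^sub>R ?K t))"
      by (intro Bochner_Integration.integral_cong refl) (simp add: scaleR_conv_of_real algebra_simps)
    also have "\<dots> = \<i> * ((LINT t|lebesgue. \<theta> t *\<^sub>R ?G2 t) - (LINT t|lebesgue. \<theta> t *\<^sub>R ?K t))"
      using Bochner_Integration.integral_diff[OF integrable_mult_right[OF i2(2), of \<i>] integrable_mult_right[OF i2(3), of \<i>]]
      by (simp only: integral_mult_right_zero right_diff_distrib)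
    also have "\<dots> = \<i> * (\<i> * (LINT t|lebesgue. deriv \<theta> t *\<^sub>R ?G t))"
      unfolding e[symmetric] by (simp add: algebra_simps)
    finally show "(LINT t|lebesgue. (deriv ^^ 1) \<theta> t *\<^sub>R ?G t) = (-1) ^ 1 *\<^sub>R (LINT t|lebesgue. \<theta> t *\<^sub>R (\<i> * (?G2 t - ?K t)))"
      by (simp add: mult.assoc[symmetric])
  qed
  from weak_deriv_continuous[OF this cG(1) cL] show ?thesis .
qed

section \<open>Behaviour at spatial infinity\<close>

lemma cnv_bound:
  assumes \<rho>: "test_function \<rho>"
  obtains C where "\<And>(w :: real \<Rightarrow> 'a::euclidean_space) d x. w \<in> borel_measurable lebesgue \<Longrightarrow>
    (AE y in lebesgue. norm (w y) \<le> d) \<Longrightarrow> 0 \<le> d \<Longrightarrow> norm (cnv w \<rho> x) \<le> C * d"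
proof -
  obtain R B where R: "0 < R" "\<And>x. R < \<bar>x\<bar> \<Longrightarrow> \<rho> x = 0" and B: "0 < B" "\<And>x. \<bar>\<rho> x\<bar> \<le> B"
    using \<rho> by (metis test_functionE test_bounded)
  have "norm (cnv w \<rho> x) \<le> (2 * R * B) * d"
    if [measurable]: "w \<in> borel_measurable lebesgue" and w: "AE y in lebesgue. norm (w y) \<le> d" and d: "0 \<le> d" for w :: "real \<Rightarrow> 'a" and d x
  proof -
    have l: "w \<in> L1_loc" by (rule L1_loc_bounded[OF that(1) w])
    have "ennreal (norm (cnv w \<rho> x)) \<le> (\<integral>\<^sup>+y. ennreal (norm (\<rho> (x - y) *\<^sub>R w y)) \<partial>lebesgue)"
      unfolding cnv_def by (rule integral_norm_bound_ennreal[OF cnv_integrable[OF l \<rho>]])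
    also have "\<dots> \<le> (\<integral>\<^sup>+y. ennreal (B * d) * indicator {x - R..x + R} y \<partial>lebesgue)"
    proof (rule nn_integral_mono_AE, use w in eventually_elim)
      case (elim y)
      show ?case
      proof (cases "y \<in> {x - R..x + R}")
        case True
        then show ?thesis using elim B(2)[of "x - y"] B(1) by (auto intro!: ennreal_leI mult_mono)
      next
        case False
        then have "R < \<bar>x - y\<bar>" by auto
        then show ?thesis by (simp add: R)
      qed
    qed
    also have "\<dots> = ennreal (B * d) * ennreal (x + R - (x - R))"
      using emeasure_lebesgue_Icc[of "x - R" "x + R"] R(1) by (subst nn_integral_cmult) (auto simp del: emeasure_completion)
    also have "\<dots> = ennreal ((2 * R * B) * d)"
      using R(1) B(1) d by (simp add: ennreal_mult[symmetric] algebra_simps)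
    finally show ?thesis using R(1) B(1) d by (subst (asm) ennreal_le_iff) auto
  qed
  then show thesis by (rule that)
qed

text \<open>Uniform convergence of the functions combines with continuity of the limiting
  convolution. For a solution this gives joint continuity in t and x.\<close>

lemma cB_cnv_joint:
  assumes f: "cB f F" and \<rho>: "test_function \<rho>" and x: "xs \<longlonglongrightarrow> x"
  shows "(\<lambda>n. cnv (f n) \<rho> (xs n)) \<longlonglongrightarrow> cnv F \<rho> x"
proof -
  obtain M d where M: "0 \<le> M" "\<And>n. AE x in lebesgue. norm (f n x) \<le> M" "AE x in lebesgue. norm (F x) \<le> M"
    "d \<longlonglongrightarrow> 0" "\<And>n. 0 \<le> d n" "\<And>n. AE x in lebesgue. norm (f n x - F x) \<le> d n"
    by (rule cB_E[OF f], rule that)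
  note m[measurable] = cB_measurable[OF f]
  have l: "f n \<in> L1_loc" "F \<in> L1_loc" for n by (rule L1_loc_bounded[OF m(1) M(2)]) (rule L1_loc_bounded[OF m(2) M(3)])
  obtain C where C: "\<And>(w::real \<Rightarrow> complex) d x. w \<in> borel_measurable lebesgue \<Longrightarrow> (AE y in lebesgue. norm (w y) \<le> d) \<Longrightarrow> 0 \<le> d \<Longrightarrow> norm (cnv w \<rho> x) \<le> C * d"
    by (rule cnv_bound[OF \<rho>], rule that)
  have b: "norm (cnv (\<lambda>y. f n y - F y) \<rho> (xs n)) \<le> C * d n" for n
    by (rule C[OF _ M(6,5)]) measurable
  have "(\<lambda>n. C * d n) \<longlonglongrightarrow> 0" using tendsto_mult_left[OF M(4), of C] by simp
  then have "(\<lambda>n. cnv (\<lambda>y. f n y - F y) \<rho> (xs n)) \<longlonglongrightarrow> 0"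
    by (rule Lim_null_comparison[OF always_eventually[OF allI[OF b]]])
  moreover have "(\<lambda>n. cnv F \<rho> (xs n)) \<longlonglongrightarrow> cnv F \<rho> x"
    using cnv_continuous[OF l(2) \<rho>, of UNIV] x
    by (intro isCont_tendsto_compose[of _ "cnv F \<rho>"]) (simp_all add: continuous_on_eq_continuous_at)
  ultimately have "(\<lambda>n. cnv (\<lambda>y. f n y - F y) \<rho> (xs n) + cnv F \<rho> (xs n)) \<longlonglongrightarrow> 0 + cnv F \<rho> x"
    by (rule tendsto_add)
  then show ?thesis by (simp add: cnv_diff[OF l \<rho>])
qed

lemma N2I_tendsto_0:
  assumes f: "in_L2 f" and x: "filterlim (\<lambda>n. \<bar>xs n\<bar>) at_top sequentially"
  shows "(\<lambda>n. N2I f (xs n - r) (xs n + r)) \<longlonglongrightarrow> 0"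
proof -
  have [measurable]: "f \<in> borel_measurable lebesgue" using f by (simp add: in_L2_def)
  have "(\<lambda>n. \<integral>\<^sup>+y. ennreal ((norm (f y))\<^sup>2) * indicator {xs n - r..xs n + r} y \<partial>lebesgue) \<longlonglongrightarrow> nn_integral lebesgue (\<lambda>y::real. 0)"
  proof (rule nn_integral_dominated_convergence[where w="\<lambda>y. ennreal ((norm (f y))\<^sup>2)"])
    show "(\<integral>\<^sup>+y. ennreal ((norm (f y))\<^sup>2) \<partial>lebesgue) < \<infinity>" using f by (simp add: in_L2_iff N2_def)
    show "AE y in lebesgue. ennreal ((norm (f y))\<^sup>2) * indicator {xs n - r..xs n + r} y \<le> ennreal ((norm (f y))\<^sup>2)" for n
      by (rule AE_I2) (simp add: indicator_def)
    show "AE y in lebesgue. (\<lambda>n. ennreal ((norm (f y))\<^sup>2) * indicator {xs n - r..xs n + r} y) \<longlonglongrightarrow> 0"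
    proof (rule AE_I2, rule tendsto_eventually)
      fix y
      have "\<forall>\<^sub>F n in sequentially. \<bar>y\<bar> + \<bar>r\<bar> < \<bar>xs n\<bar>" using x by (simp add: filterlim_at_top_dense)
      then show "\<forall>\<^sub>F n in sequentially. ennreal ((norm (f y))\<^sup>2) * indicator {xs n - r..xs n + r} y = 0"
        by eventually_elim (auto simp: indicator_def)
    qed
  qed measurable
  then show ?thesis by (simp add: N2I_def)
qed

text \<open>The function moves together with the window: its L2 distance to the limit tends to 0,
  and the fixed limit has little mass far out.\<close>

lemma N2I_varying_tendsto_0:
  assumes f: "cT f F" and x: "filterlim (\<lambda>n. \<bar>xs n\<bar>) at_top sequentially"
  shows "(\<lambda>n. N2I (f n) (xs n - r) (xs n + r)) \<longlonglongrightarrow> 0"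
proof (rule ennreal_tendsto_0_le)
  note [measurable] = cT_measurable[OF f]
  have F: "in_L2 F" using f by (simp add: cT_def)
  have "(\<lambda>n. 2 * N2 (\<lambda>x. f n x - F x) + 2 * N2I F (xs n - r) (xs n + r)) \<longlonglongrightarrow> 2 * 0 + 2 * 0"
    using f by (intro tendsto_add ennreal_tendsto_cmult N2I_tendsto_0[OF F x]) (auto simp: cT_def)
  then show "(\<lambda>n. 2 * N2 (\<lambda>x. f n x - F x) + 2 * N2I F (xs n - r) (xs n + r)) \<longlonglongrightarrow> 0" by simp
  fix n
  have "N2I (f n) (xs n - r) (xs n + r) \<le> 2 * N2I (\<lambda>x. f n x - F x) (xs n - r) (xs n + r) + 2 * N2I F (xs n - r) (xs n + r)"
    using N2I_add[of "\<lambda>x. f n x - F x" F] by simp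
  also have "\<dots> \<le> 2 * N2 (\<lambda>x. f n x - F x) + 2 * N2I F (xs n - r) (xs n + r)"
    by (intro add_mono mult_left_mono N2I_le_N2) auto
  finally show "N2I (f n) (xs n - r) (xs n + r) \<le> 2 * N2 (\<lambda>x. f n x - F x) + 2 * N2I F (xs n - r) (xs n + r)" .
qed

text \<open>Cauchy-Schwarz on the window [x - 1, x + 1] of length 2, whence the constant 2
  B^2.\<close>

lemma cnv_local_L2:
  fixes f :: "real \<Rightarrow> complex"
  assumes f: "f \<in> L1_loc" and \<rho>: "test_function \<rho>"  "\<And>y. 1 < \<bar>y\<bar> \<Longrightarrow> \<rho> y = 0" and B: "\<And>y. \<bar>\<rho> y\<bar> \<le> B"
  shows "ennreal ((norm (cnv f \<rho> x))\<^sup>2) \<le> ennreal (2 * B\<^sup>2) * N2I f (x - 1) (x + 1)"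
proof -
  have [measurable]: "f \<in> borel_measurable lebesgue" by (rule L1_loc_measurable[OF f])
  have B0: "0 \<le> B" using B[of 0] by linarith
  have "ennreal (norm (cnv f \<rho> x)) \<le> (\<integral>\<^sup>+y. ennreal (norm (\<rho> (x - y) *\<^sub>R f y)) \<partial>lebesgue)"
    unfolding cnv_def by (rule integral_norm_bound_ennreal[OF cnv_integrable[OF f \<rho>(1)]])
  also have "\<dots> \<le> (\<integral>\<^sup>+y. ennreal (B * indicator {x-1..x+1} y) * (ennreal (norm (f y)) * indicator {x-1..x+1} y) \<partial>lebesgue)"
  proof (rule nn_integral_mono)
    fix y
    show "ennreal (norm (\<rho> (x - y) *\<^sub>R f y)) \<le> ennreal (B * indicator {x-1..x+1} y) * (ennreal (norm (f y)) * indicator {x-1..x+1} y)"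
    proof (cases "y \<in> {x-1..x+1}")
      case True
      then show ?thesis using B[of "x - y"] B0 by (auto simp: ennreal_mult[symmetric] intro!: ennreal_leI mult_right_mono)
    next
      case False
      then have "1 < \<bar>x - y\<bar>" by auto
      then show ?thesis by (simp add: \<rho>)
    qed
  qed
  finally have "(ennreal (norm (cnv f \<rho> x)))\<^sup>2 \<le> (\<integral>\<^sup>+y. ennreal (B * indicator {x-1..x+1} y) * (ennreal (norm (f y)) * indicator {x-1..x+1} y) \<partial>lebesgue)\<^sup>2"
    by (rule power_mono) simp
  also have "\<dots> \<le> (\<integral>\<^sup>+y. (ennreal (B * indicator {x-1..x+1} y))\<^sup>2 \<partial>lebesgue) * (\<integral>\<^sup>+y. (ennreal (norm (f y)) * indicator {x-1..x+1} y)\<^sup>2 \<partial>lebesgue)"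
    by (rule Cauchy_Schwarz_nn_integral) measurable
  also have "(\<integral>\<^sup>+y. (ennreal (norm (f y)) * indicator {x-1..x+1} y)\<^sup>2 \<partial>lebesgue) = N2I f (x - 1) (x + 1)"
    unfolding N2I_def by (intro nn_integral_cong) (auto simp: indicator_def ennreal_power)
  also have "(\<integral>\<^sup>+y. (ennreal (B * indicator {x-1..x+1} y))\<^sup>2 \<partial>lebesgue) = (\<integral>\<^sup>+y. ennreal (B\<^sup>2) * indicator {x-1..x+1} y \<partial>lebesgue)"
    using B0 by (intro nn_integral_cong) (auto simp: indicator_def ennreal_power)
  also have "\<dots> = ennreal (B\<^sup>2) * ennreal (x + 1 - (x - 1))"
    using emeasure_lebesgue_Icc[of "x - 1" "x + 1"] by (subst nn_integral_cmult) (auto simp del: emeasure_completion)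
  also have "\<dots> = ennreal (2 * B\<^sup>2)" by (subst ennreal_mult[symmetric]) (auto simp: mult.commute)
  finally show ?thesis by (simp add: ennreal_power)
qed

lemma deriv_support:
  assumes "test_function \<rho>" "\<And>y. r < \<bar>y\<bar> \<Longrightarrow> \<rho> y = (0::real)" "r < \<bar>y\<bar>"
  shows "(deriv ^^ j) \<rho> y = 0"
  using assms(3)
proof (induction j arbitrary: y)
  case (Suc j)
  have o: "open {y. r < \<bar>y\<bar>}" by (intro open_Collect_less continuous_intros)
  have "((deriv ^^ j) \<rho> has_real_derivative 0) (at y)"
    by (rule has_field_derivative_transform_within_open[OF DERIV_const o]) (use Suc in auto)
  then show ?case by (simp add: DERIV_imp_deriv)
qed (use assms in simp)

text \<open>The mollified value a at x is compared with the function at y in [x, x + 1], and the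
  result is averaged over y. The difference is controlled by the local mass of the derivative, and
  what remains is \<eta> at y.\<close>

lemma eta_mollified_bound:
  assumes Z: "XJ k Z" and k: "1 \<le> k" and M: "AE x in lebesgue. norm (Z x 0) \<le> M"
  shows "ennreal ((norm (ev Eta (jetm (\<lambda>y. Z y 0) n x)))\<^sup>2)
    \<le> 2 * N2I (\<lambda>y. ev Eta (Z y)) (x - 3) (x + 3) + ennreal (16 * M\<^sup>2) * N2I (\<lambda>y. Z y 1) (x - 3) (x + 3)"
proof -
  have "AE y::real in lebesgue. 0 \<le> M" using M by eventually_elim (use norm_ge_zero order_trans in blast)
  then have M0: "0 \<le> M" by (rule AE_lebesgue_const)
  note t = mollifierD(1)[OF is_mollifier_mol]
  have k0: "0 < k" using k by simp
  obtain F where F: "AE x in lebesgue. Z x 0 = F x" and ac: "ac F (\<lambda>x. Z x 1)" using XJ_ac[OF Z k0] by auto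
  have mZ: "(\<lambda>x. Z x 0) \<in> borel_measurable lebesgue" using k by (intro XJ_measurable[OF Z]) auto
  have me: "(\<lambda>x. ev Eta (Z x)) \<in> borel_measurable lebesgue" using Z by (simp add: XJ_def in_L2_def del: ev.simps)
  have mF: "F \<in> borel_measurable lebesgue" by (rule borel_measurable_AE[OF mZ F])
  have lF: "F \<in> L1_loc" by (rule L1_loc_cong_AE[OF XJ_L1_loc[OF Z] mF F]) (use k in auto)
  define a where "a = cnv F (mol n) x"
  have ja: "jetm (\<lambda>y. Z y 0) n x 0 = a" by (simp add: jetm_def a_def cnv_cong_AE[OF mZ mF F t])
  have "AE y in lebesgue. norm (F y - 0) \<le> M" using M F by eventually_elim simp
  from norm_cnv_le[OF mF this is_mollifier_mol] have aM: "norm a \<le> M" by (simp add: a_def)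
  define A where "A = N2I (\<lambda>y. Z y 1) (x - 3) (x + 3)"
  \<comment> \<open>The kernel sees z within 1 of x, so |z - y| <= 2, and the window of radius 2
    about y lies in [x - 3, x + 3].\<close>
  have d: "ennreal ((norm (a - F y))\<^sup>2) \<le> 2 * A" if y: "y \<in> {x..x+1}" for y
  proof -
    note \<rho> = mollifierD[OF is_mollifier_mol[of n]]
    have "ennreal ((norm (a - F y))\<^sup>2) \<le> (\<integral>\<^sup>+z. ennreal ((norm (F z - F y))\<^sup>2) * ennreal (mol n (x - z)) \<partial>lebesgue)"
      unfolding a_def by (rule mollifier_Jensen[OF lF is_mollifier_mol])
    also have "\<dots> \<le> (\<integral>\<^sup>+z. (2 * A) * ennreal (mol n (x - z)) \<partial>lebesgue)"
    proof (rule nn_integral_mono)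
      fix z
      show "ennreal ((norm (F z - F y))\<^sup>2) * ennreal (mol n (x - z)) \<le> (2 * A) * ennreal (mol n (x - z))"
      proof (cases "1 < \<bar>x - z\<bar>")
        case True then show ?thesis using mol_support by simp
      next
        case False
        then have "\<bar>z - y\<bar> \<le> 2" using y by auto
        from ac_bound[OF ac this] have "ennreal ((norm (F z - F y))\<^sup>2) \<le> 2 * N2I (\<lambda>x. Z x 1) (y - 2) (y + 2)" by simp
        also have "\<dots> \<le> 2 * A" unfolding A_def using y by (intro mult_left_mono N2I_mono) auto
        finally show ?thesis by (rule mult_right_mono) simp
      qed
    qed
    also have "\<dots> = 2 * A"
      using \<rho>(4) test_measurable[OF test_reflect[OF \<rho>(1), of x]] by (subst nn_integral_cmult) auto
    finally show ?thesis .
  qed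
  have one: "(\<integral>\<^sup>+y. c * indicator {x..x+1} y \<partial>lebesgue) = c" for c :: ennreal
    using emeasure_lebesgue_Icc[of x "x+1"] by (subst nn_integral_cmult) (auto simp del: emeasure_completion)
  have "ennreal ((norm (1 - a * cnj a))\<^sup>2) = (\<integral>\<^sup>+y. ennreal ((norm (1 - a * cnj a))\<^sup>2) * indicator {x..x+1} y \<partial>lebesgue)"
    by (rule one[symmetric])
  also have "\<dots> \<le> (\<integral>\<^sup>+y. 2 * (ennreal ((norm (ev Eta (Z y)))\<^sup>2) * indicator {x..x+1} y) + (ennreal (16 * M\<^sup>2) * A) * indicator {x..x+1} y \<partial>lebesgue)"
  proof (rule nn_integral_mono_AE, use F M in eventually_elim)
    case (elim y)
    show ?case
    proof (cases "y \<in> {x..x+1}")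
      case True
      have FM: "norm (F y) \<le> M" using elim by simp
      have "norm ((1 - a * cnj a) - (1 - F y * cnj (F y))) \<le> (norm a + norm (F y)) * norm (a - F y)"
        by (rule eta_diff_le)
      also have "\<dots> \<le> (2 * M) * norm (a - F y)" using aM FM by (intro mult_right_mono) auto
      finally have "(norm ((1 - a * cnj a) - (1 - F y * cnj (F y))))\<^sup>2 \<le> ((2 * M) * norm (a - F y))\<^sup>2"
        by (rule power_mono) simp
      moreover have "(norm (1 - a * cnj a))\<^sup>2 \<le> 2 * (norm (1 - F y * cnj (F y)))\<^sup>2 + 2 * (norm ((1 - a * cnj a) - (1 - F y * cnj (F y))))\<^sup>2"
        using norm_add_sq_le[of "1 - F y * cnj (F y)" "(1 - a * cnj a) - (1 - F y * cnj (F y))"] by simp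
      \<comment> \<open>Doubling (2 M)^2 gives 8 M^2; the bound 2 A of the squared difference turns
        this into the constant 16 M^2.\<close>
      ultimately have "(norm (1 - a * cnj a))\<^sup>2 \<le> 2 * (norm (ev Eta (Z y)))\<^sup>2 + (8 * M\<^sup>2) * (norm (a - F y))\<^sup>2"
        using elim by (simp add: power_mult_distrib)
      then have "ennreal ((norm (1 - a * cnj a))\<^sup>2) \<le> ennreal (2 * (norm (ev Eta (Z y)))\<^sup>2 + (8 * M\<^sup>2) * (norm (a - F y))\<^sup>2)"
        by (rule ennreal_leI)
      also have "\<dots> = 2 * ennreal ((norm (ev Eta (Z y)))\<^sup>2) + ennreal (8 * M\<^sup>2) * ennreal ((norm (a - F y))\<^sup>2)"
        by (simp add: ennreal_plus ennreal_mult' del: ev.simps)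
      also have "\<dots> \<le> 2 * ennreal ((norm (ev Eta (Z y)))\<^sup>2) + ennreal (8 * M\<^sup>2) * (2 * A)"
        by (intro add_left_mono mult_left_mono d True) simp
      also have "ennreal (8 * M\<^sup>2) * (2 * A) = (ennreal (8 * M\<^sup>2) * ennreal 2) * A" by (simp add: mult.assoc)
      also have "ennreal (8 * M\<^sup>2) * ennreal 2 = ennreal (16 * M\<^sup>2)" by (subst ennreal_mult[symmetric]) auto
      finally show ?thesis using True by (simp del: ev.simps)
    qed simp
  qed
  also have "\<dots> = 2 * N2I (\<lambda>y. ev Eta (Z y)) x (x + 1) + ennreal (16 * M\<^sup>2) * A"
    using me by (subst nn_integral_add) (simp_all add: one nn_integral_cmult N2I_def del: ev.simps)
  also have "\<dots> \<le> 2 * N2I (\<lambda>y. ev Eta (Z y)) (x - 3) (x + 3) + ennreal (16 * M\<^sup>2) * A"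
    by (intro add_mono mult_left_mono N2I_mono) auto
  finally show ?thesis by (simp add: ja A_def)
qed

lemma ennreal_norm_sq_tendsto_0:
  assumes "g \<longlonglongrightarrow> 0" "\<And>n. ennreal ((norm (f n))\<^sup>2) \<le> g n"
  shows "f \<longlonglongrightarrow> (0::complex)"
proof -
  have "(\<lambda>n. ennreal ((norm (f n))\<^sup>2)) \<longlonglongrightarrow> ennreal 0" using ennreal_tendsto_0_le[OF assms] by simp
  then have "(\<lambda>n. (norm (f n))\<^sup>2) \<longlonglongrightarrow> 0"
    by (subst (asm) tendsto_ennreal_iff) auto
  then show ?thesis by (simp add: tendsto_norm_zero_iff)
qed

text \<open>Functions and points vary together, because the flux has to be small uniformly over an
  interval of times.\<close>

lemma jetm_vanishes:
  assumes W: "\<And>m. XJ k (W m)" and k: "1 \<le> k" and c: "jconv k W Z"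
    and x: "filterlim (\<lambda>m. \<bar>xs m\<bar>) at_top sequentially" and p: "van p"
  shows "(\<lambda>m. ev p (jetm (\<lambda>y. W m y 0) n (xs m))) \<longlonglongrightarrow> 0"
proof -
  note t = mollifierD(1)[OF is_mollifier_mol[of n]]
  have cB0: "cB (\<lambda>m y. W m y 0) (\<lambda>y. Z y 0)" and cT1: "cT (\<lambda>m y. W m y 1) (\<lambda>y. Z y 1)"
    and cE: "cT (\<lambda>m y. ev Eta (W m y)) (\<lambda>y. ev Eta (Z y))"
    using c k by (auto simp: jconv_def)
  obtain M where M: "0 \<le> M" "\<And>m. AE y in lebesgue. norm (W m y 0) \<le> M" by (rule cB_E[OF cB0], rule that)
  have l: "(\<lambda>y. W m y 0) \<in> L1_loc" "(\<lambda>y. W m y 1) \<in> L1_loc" for m using k by (auto intro!: XJ_L1_loc[OF W])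
  have z: "(\<lambda>m. jetm (\<lambda>y. W m y 0) n (xs m) j) \<longlonglongrightarrow> 0" if j: "1 \<le> j" for j
  proof -
    obtain i where i: "j = Suc i" using j by (cases j) auto
    have ti: "test_function ((deriv ^^ i) (mol n))" by (rule test_derivs[OF t])
    obtain B where B: "\<And>y. \<bar>(deriv ^^ i) (mol n) y\<bar> \<le> B" using test_bounded[OF ti] by metis
    have w: "has_weak_deriv 1 (\<lambda>y. W m y 0) (\<lambda>y. W m y 1)" for m using W[of m] k by (auto simp: XJ_def)
    \<comment> \<open>One derivative goes to the function, which puts it in L2; the remaining i stay
      on the kernel.\<close>
    have "jetm (\<lambda>y. W m y 0) n (xs m) j = cnv (\<lambda>y. W m y 1) ((deriv ^^ i) (mol n)) (xs m)" for m
      using weak_deriv_cnv[OF w ti, of m "xs m"] by (simp add: jetm_def i)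
    moreover have "(\<lambda>m. cnv (\<lambda>y. W m y 1) ((deriv ^^ i) (mol n)) (xs m)) \<longlonglongrightarrow> 0"
    proof (rule ennreal_norm_sq_tendsto_0)
      have "(\<lambda>m. ennreal (2 * B\<^sup>2) * N2I (\<lambda>y. W m y 1) (xs m - 1) (xs m + 1)) \<longlonglongrightarrow> ennreal (2 * B\<^sup>2) * 0"
        by (intro ennreal_tendsto_cmult N2I_varying_tendsto_0[OF cT1 x]) simp
      then show "(\<lambda>m. ennreal (2 * B\<^sup>2) * N2I (\<lambda>y. W m y 1) (xs m - 1) (xs m + 1)) \<longlonglongrightarrow> 0" by simp
      show "ennreal ((norm (cnv (\<lambda>y. W m y 1) ((deriv ^^ i) (mol n)) (xs m)))\<^sup>2) \<le> ennreal (2 * B\<^sup>2) * N2I (\<lambda>y. W m y 1) (xs m - 1) (xs m + 1)" for m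
        by (rule cnv_local_L2[OF l(2) ti deriv_support[OF t mol_support] B])
    qed
    ultimately show ?thesis by simp
  qed
  have e: "(\<lambda>m. ev Eta (jetm (\<lambda>y. W m y 0) n (xs m))) \<longlonglongrightarrow> 0"
  proof (rule ennreal_norm_sq_tendsto_0)
    have "(\<lambda>m. 2 * N2I (\<lambda>y. ev Eta (W m y)) (xs m - 3) (xs m + 3) + ennreal (16 * M\<^sup>2) * N2I (\<lambda>y. W m y 1) (xs m - 3) (xs m + 3)) \<longlonglongrightarrow> 2 * 0 + ennreal (16 * M\<^sup>2) * 0"
      by (intro tendsto_add ennreal_tendsto_cmult N2I_varying_tendsto_0[OF cT1 x] N2I_varying_tendsto_0[OF cE x]) auto
    then show "(\<lambda>m. 2 * N2I (\<lambda>y. ev Eta (W m y)) (xs m - 3) (xs m + 3) + ennreal (16 * M\<^sup>2) * N2I (\<lambda>y. W m y 1) (xs m - 3) (xs m + 3)) \<longlonglongrightarrow> 0" by simp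
  qed (rule eta_mollified_bound[OF W k M(2)])
  have "Bseq (\<lambda>m. jetm (\<lambda>y. W m y 0) n (xs m) j)" for j
  proof (cases "j = 0")
    case True
    have "norm (jetm (\<lambda>y. W m y 0) n (xs m) 0 - 0) \<le> M" for m
      unfolding jetm_def funpow_0 using M(2)[of m]
      by (intro norm_cnv_le[OF L1_loc_measurable[OF l(1)] _ is_mollifier_mol]) simp
    then show ?thesis using True by (intro BseqI'[of _ M]) simp
  next
    case False
    then have "1 \<le> j" by simp
    from convergent_imp_Bseq[OF convergentI[OF z[OF this]]] show ?thesis .
  qed
  from ev_van[OF this z e, where p=p] p show ?thesis by blast
qed

section \<open>Conservation of functionals with a flux identity\<close>

lemma jetm_time_derivative:
  assumes c: "X_continuous k \<Psi>" and gp: "GP_equation \<Psi>" and k: "1 \<le> k"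
  shows "((\<lambda>t. jetm (\<Psi> t) n x j) has_vector_derivative
    flow (jetm (\<Psi> t) n x) j + commutator (\<Psi> t) n x j) (at t)"
proof -
  note \<rho> = test_derivs[OF mollifierD(1)[OF is_mollifier_mol[of n]], of j]
  have "(deriv ^^ 2) ((deriv ^^ j) (mol n)) = (deriv ^^ (j + 2)) (mol n)"
    by (simp add: numeral_2_eq_2)
  then have "((\<lambda>t. jetm (\<Psi> t) n x j) has_vector_derivative \<i> * (jetm (\<Psi> t) n x (j + 2) - jetm (nl (\<Psi> t)) n x j)) (at t)"
    using GP_time_derivative[OF c gp k \<rho>, of x t] unfolding jetm_def by (simp only:)
  then show ?thesis
    by (rule has_vector_derivative_eq_rhs) (simp add: flow_def commutator_def algebra_simps)
qed

lemma jetm_joint_continuous: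
  assumes c: "X_continuous k \<Psi>" and k: "1 \<le> k"
  shows "continuous_on UNIV (\<lambda>q. jetm (\<Psi> (fst q)) n (snd q) j)"
    and "continuous_on UNIV (\<lambda>q. jetm (nl (\<Psi> (fst q))) n (snd q) j)"
proof -
  note \<rho> = test_derivs[OF mollifierD(1)[OF is_mollifier_mol[of n]], of j]
  have *: "(\<lambda>m. jetm (\<Psi> (fst (q m))) n (snd (q m)) j) \<longlonglongrightarrow> jetm (\<Psi> (fst p)) n (snd p) j"
    "(\<lambda>m. jetm (nl (\<Psi> (fst (q m)))) n (snd (q m)) j) \<longlonglongrightarrow> jetm (nl (\<Psi> (fst p))) n (snd p) j"
    if q: "q \<longlonglongrightarrow> p" for q and p :: "real \<times> real"
  proof -
    note cv = X_continuous_conv[OF c k tendsto_fst[OF q]]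
    have 1: "cB (\<lambda>m. \<Psi> (fst (q m))) (\<Psi> (fst p))" using cv k by (auto simp: jconv_def jet_def)
    have 2: "cB (\<lambda>m. nl (\<Psi> (fst (q m)))) (nl (\<Psi> (fst p)))"
      using ev_conv[OF cv k, of nlin] k by (simp add: nl_ev[abs_def] nlin_def)
    show "(\<lambda>m. jetm (\<Psi> (fst (q m))) n (snd (q m)) j) \<longlonglongrightarrow> jetm (\<Psi> (fst p)) n (snd p) j"
      "(\<lambda>m. jetm (nl (\<Psi> (fst (q m)))) n (snd (q m)) j) \<longlonglongrightarrow> jetm (nl (\<Psi> (fst p))) n (snd p) j"
      unfolding jetm_def by (rule cB_cnv_joint[OF 1 \<rho> tendsto_snd[OF q]], rule cB_cnv_joint[OF 2 \<rho> tendsto_snd[OF q]])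
  qed
  show "continuous_on UNIV (\<lambda>q. jetm (\<Psi> (fst q)) n (snd q) j)"
    and "continuous_on UNIV (\<lambda>q. jetm (nl (\<Psi> (fst q))) n (snd q) j)"
    by (intro continuous_at_imp_continuous_on ballI, simp add: continuous_at_sequentially o_def *)+
qed

lemma commutator_joint_continuous:
  assumes c: "X_continuous k \<Psi>" and k: "1 \<le> k"
  shows "continuous_on UNIV (\<lambda>q. commutator (\<Psi> (fst q)) n (snd q) j)"
  unfolding commutator_def using jetm_joint_continuous(2)[OF c k, of n j]
  by (intro continuous_intros continuous_on_ev jetm_joint_continuous(1)[OF c k])

lemma vr_commutator_continuous:
  assumes c: "X_continuous k \<Psi>" and k: "1 \<le> k"
  shows "continuous_on A (\<lambda>x. vr p (jetm (\<Psi> t) n x) (commutator (\<Psi> t) n x))"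
proof -
  have 1: "continuous_on UNIV (\<lambda>q. vr p (jetm (\<Psi> (fst q)) n (snd q)) (commutator (\<Psi> (fst q)) n (snd q)))"
    by (intro continuous_on_vr jetm_joint_continuous[OF c k] commutator_joint_continuous[OF c k])
  have 2: "continuous_on A (\<lambda>x. (t, x))" by (intro continuous_intros)
  show ?thesis using continuous_on_compose2[OF 1 2] by simp
qed

text \<open>On a bounded interval, joint continuity allows differentiation under the integral. The
  exact part of the time derivative integrates to boundary values of the flux, and the variation in
  the direction of the commutator remains.\<close>

lemma truncated_balance:
  assumes c: "X_continuous k \<Psi>" and gp: "GP_equation \<Psi>" and k: "1 \<le> k" and R: "0 \<le> R"
    and cert: "\<And>z. vr p z (flow z) = ev (Dx q) z"
  shows "((\<lambda>t. integral {-R..R} (\<lambda>x. ev p (jetm (\<Psi> t) n x))) has_vector_derivative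
    ev q (jetm (\<Psi> t) n R) - ev q (jetm (\<Psi> t) n (-R))
      + integral {-R..R} (\<lambda>x. vr p (jetm (\<Psi> t) n x) (commutator (\<Psi> t) n x))) (at t)"
proof -
  let ?z = "\<lambda>t. jetm (\<Psi> t) n"
  let ?c = "\<lambda>t. commutator (\<Psi> t) n"
  have l: "\<Psi> t \<in> L1_loc" for t using c by (auto simp: X_continuous_def X_def)
  have d: "((\<lambda>t. ev p (?z t x)) has_vector_derivative ev (Dx q) (?z t x) + vr p (?z t x) (?c t x)) (at t within UNIV)" for t x
    using ev_has_vector_derivative[where z="\<lambda>t. ?z t x" and p=p and S=UNIV, OF jetm_time_derivative[OF c gp k]]
    unfolding vr_add cert .
  have cz: "continuous_on UNIV (\<lambda>q'. ev p' (?z (fst q') (snd q')))" for p'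
    by (intro continuous_on_ev jetm_joint_continuous[OF c k])
  have cv: "continuous_on UNIV (\<lambda>q'. vr p (?z (fst q') (snd q')) (?c (fst q') (snd q')))"
    by (intro continuous_on_vr jetm_joint_continuous[OF c k] commutator_joint_continuous[OF c k])
  have cx: "continuous_on A (\<lambda>x. ev p' (?z t x))" for p' A t
    by (intro continuous_on_ev jetm_continuous l)
  note cvx = vr_commutator_continuous[OF c k]
  have "((\<lambda>t. integral (cbox (-R) R) (\<lambda>x. ev p (?z t x))) has_vector_derivative
     integral (cbox (-R) R) (\<lambda>x. ev (Dx q) (?z t x) + vr p (?z t x) (?c t x))) (at t within UNIV)"
  proof (rule leibniz_rule_vector_derivative)
    show "continuous_on (UNIV \<times> cbox (-R) R) (\<lambda>(t, x). ev (Dx q) (?z t x) + vr p (?z t x) (?c t x))"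
      unfolding split_beta by (intro continuous_intros continuous_on_subset[OF cz] continuous_on_subset[OF cv]) auto
    show "(\<lambda>x. ev p (?z t x)) integrable_on cbox (-R) R" for t
      by (rule integrable_continuous) (rule cx)
  qed (use d in auto)
  also have "integral (cbox (-R) R) (\<lambda>x. ev (Dx q) (?z t x) + vr p (?z t x) (?c t x))
     = integral {-R..R} (\<lambda>x. ev (Dx q) (?z t x)) + integral {-R..R} (\<lambda>x. vr p (?z t x) (?c t x))"
    unfolding box_real by (intro Henstock_Kurzweil_Integration.integral_add integrable_continuous_real cx cvx)
  also have "integral {-R..R} (\<lambda>x. ev (Dx q) (?z t x)) = ev q (?z t R) - ev q (?z t (-R))"
  proof -
    have "((\<lambda>x. ev q (?z t x)) has_vector_derivative ev (Dx q) (?z t x)) (at x)" for x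
      unfolding vr_Dx[symmetric] by (rule ev_has_vector_derivative[OF jetm_has_derivative[OF l]])
    then have "((\<lambda>x. ev (Dx q) (?z t x)) has_integral (ev q (?z t R) - ev q (?z t (-R)))) {-R..R}"
      using R by (intro fundamental_theorem_of_calculus) (auto intro: has_vector_derivative_at_within)
    then show ?thesis by (rule integral_unique)
  qed
  finally show ?thesis by simp
qed

text \<open>Otherwise the flux would exceed e at certain times in the compact interval and at points
  tending to infinity. Along a subsequence the times converge, and then the flux at these points
  tends to 0.\<close>

lemma flux_uniformly_small:
  assumes c: "X_continuous k \<Psi>" and k: "1 \<le> k" and q: "van q" and e: "0 < e"
  shows "\<exists>R\<ge>real n. \<forall>\<tau>\<in>{a..b}. norm (ev q (jetm (\<Psi> \<tau>) n R)) \<le> e \<and> norm (ev q (jetm (\<Psi> \<tau>) n (-R))) \<le> e"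
proof (rule ccontr)
  assume neg: "\<not> ?thesis"
  have "\<exists>\<tau> x. \<tau> \<in> {a..b} \<and> \<bar>x\<bar> = real n + real m \<and> e < norm (ev q (jetm (\<Psi> \<tau>) n x))" for m
  proof -
    have "real n \<le> real n + real m" by simp
    then have "\<not> (\<forall>\<tau>\<in>{a..b}. norm (ev q (jetm (\<Psi> \<tau>) n (real n + real m))) \<le> e \<and> norm (ev q (jetm (\<Psi> \<tau>) n (-(real n + real m)))) \<le> e)"
      using neg by blast
    then obtain \<tau> where "\<tau> \<in> {a..b}" "e < norm (ev q (jetm (\<Psi> \<tau>) n (real n + real m))) \<or> e < norm (ev q (jetm (\<Psi> \<tau>) n (-(real n + real m))))"
      by (auto simp: not_le)
    then show ?thesis by (metis abs_of_nonneg abs_minus_cancel add_nonneg_nonneg of_nat_0_le_iff)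
  qed
  then obtain \<tau> x where *: "\<And>m. \<tau> m \<in> {a..b}" "\<And>m. \<bar>x m\<bar> = real n + real m" "\<And>m. e < norm (ev q (jetm (\<Psi> (\<tau> m)) n (x m)))"
    by metis
  obtain s r where s: "s \<in> {a..b}" "strict_mono r" "(\<tau> \<circ> r) \<longlonglongrightarrow> s"
    using compact_Icc[of a b] *(1) unfolding compact_def by meson
  have cv: "jconv k (\<lambda>m. jet (\<Psi> (\<tau> (r m)))) (jet (\<Psi> s))"
    using X_continuous_conv[OF c k s(3)] by (simp add: o_def)
  have "filterlim (\<lambda>m. real n + real m) at_top sequentially"
    by (intro filterlim_tendsto_add_at_top[OF tendsto_const filterlim_real_sequentially])
  then have "filterlim (\<lambda>m. \<bar>x (r m)\<bar>) at_top sequentially"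
    unfolding *(2) using filterlim_compose[OF _ filterlim_subseq[OF s(2)]] by blast
  from jetm_vanishes[OF X_XJ k cv this q, of n] c k
  have "(\<lambda>m. ev q (jetm (\<lambda>y. jet (\<Psi> (\<tau> (r m))) y 0) n (x (r m)))) \<longlonglongrightarrow> 0"
    by (simp add: X_continuous_def)
  then have "(\<lambda>m. norm (ev q (jetm (\<Psi> (\<tau> (r m))) n (x (r m))))) \<longlonglongrightarrow> 0"
    by (simp add: jet_def tendsto_norm_zero)
  then have "\<forall>\<^sub>F m in sequentially. norm (ev q (jetm (\<Psi> (\<tau> (r m))) n (x (r m)))) < e"
    using e by (rule order_tendstoD)
  then obtain m where "norm (ev q (jetm (\<Psi> (\<tau> (r m))) n (x (r m)))) < e" by (auto dest!: eventually_happens)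
  then show False using *(3)[of "r m"] by simp
qed

lemma cI_truncate:
  assumes f: "cI f F" and R: "filterlim R at_top sequentially"
  shows "cI (\<lambda>n x. indicator {-R n..R n} x * f n x) F"
proof -
  note [measurable] = cI_measurable[OF f]
  have F: "integrable lebesgue F" using f by (simp add: cI_def)
  have m: "(\<lambda>x. indicator {-R n..R n} x * f n x) \<in> borel_measurable lebesgue" for n by measurable
  have "(\<lambda>n. \<integral>\<^sup>+x. ennreal (norm (indicator {-R n..R n} x * F x - F x)) \<partial>lebesgue) \<longlonglongrightarrow> nn_integral lebesgue (\<lambda>x::real. 0)"
  proof (rule nn_integral_dominated_convergence[where w="\<lambda>x. ennreal (norm (F x))"])
    show "(\<integral>\<^sup>+x. ennreal (norm (F x)) \<partial>lebesgue) < \<infinity>" using F by (simp add: integrable_iff_N1 N1_def)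
    show "AE x in lebesgue. ennreal (norm (indicator {-R n..R n} x * F x - F x)) \<le> ennreal (norm (F x))" for n
      by (rule AE_I2) (simp add: indicator_def)
    show "AE x in lebesgue. (\<lambda>n. ennreal (norm (indicator {-R n..R n} x * F x - F x))) \<longlonglongrightarrow> 0"
    proof (rule AE_I2, rule tendsto_eventually)
      fix x
      have "\<forall>\<^sub>F n in sequentially. \<bar>x\<bar> < R n" using R by (simp add: filterlim_at_top_dense)
      then show "\<forall>\<^sub>F n in sequentially. ennreal (norm (indicator {-R n..R n} x * F x - F x)) = 0"
        by eventually_elim (auto simp: indicator_def abs_less_iff)
    qed
  qed measurable
  then have 1: "(\<lambda>n. N1 (\<lambda>x. indicator {-R n..R n} x * F x - F x)) \<longlonglongrightarrow> 0" by (simp add: N1_def)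
  have "(\<lambda>n. N1 (\<lambda>x. f n x - F x) + N1 (\<lambda>x. indicator {-R n..R n} x * F x - F x)) \<longlonglongrightarrow> 0 + 0"
    using f by (intro tendsto_add 1) (simp add: cI_def)
  then have 2: "(\<lambda>n. N1 (\<lambda>x. f n x - F x) + N1 (\<lambda>x. indicator {-R n..R n} x * F x - F x)) \<longlonglongrightarrow> 0" by simp
  have "(\<lambda>n. N1 (\<lambda>x. indicator {-R n..R n} x * f n x - F x)) \<longlonglongrightarrow> 0"
  proof (rule ennreal_tendsto_0_le[OF 2])
    fix n
    have "N1 (\<lambda>x. indicator {-R n..R n} x * f n x - F x) = N1 (\<lambda>x. indicator {-R n..R n} x * (f n x - F x) + (indicator {-R n..R n} x * F x - F x))"
      by (simp add: algebra_simps)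
    also have "\<dots> \<le> N1 (\<lambda>x. indicator {-R n..R n} x * (f n x - F x)) + N1 (\<lambda>x. indicator {-R n..R n} x * F x - F x)"
      by (rule N1_add) measurable
    also have "N1 (\<lambda>x. indicator {-R n..R n} x * (f n x - F x)) \<le> N1 (\<lambda>x. f n x - F x)"
      unfolding N1_def by (intro nn_integral_mono) (simp add: indicator_def)
    finally show "N1 (\<lambda>x. indicator {-R n..R n} x * f n x - F x) \<le> N1 (\<lambda>x. f n x - F x) + N1 (\<lambda>x. indicator {-R n..R n} x * F x - F x)"
      by (simp add: add_right_mono)
  qed
  then show ?thesis using F m by (simp add: cI_def)
qed

text \<open>The time selected for index m belongs to the kernel of index m, and renumbering a
  subsequence would break this pairing. Filling the gaps with the limit gives a full convergent
  sequence that agrees with \<tau> on the range of \<open>r\<close>.\<close>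

lemma tendsto_sparse:
  fixes \<tau> :: "nat \<Rightarrow> real"
  assumes r: "strict_mono (r :: nat \<Rightarrow> nat)" and l: "(\<lambda>n. \<tau> (r n)) \<longlonglongrightarrow> s"
  shows "(\<lambda>m. if m \<in> range r then \<tau> m else s) \<longlonglongrightarrow> s"
proof (rule metric_LIMSEQ_I)
  fix e :: real assume e: "0 < e"
  obtain N where N: "\<And>n. N \<le> n \<Longrightarrow> dist (\<tau> (r n)) s < e" using metric_LIMSEQ_D[OF l e] by blast
  have "dist (if m \<in> range r then \<tau> m else s) s < e" if "r N \<le> m" for m
  proof (cases "m \<in> range r")
    case True
    then obtain n where "m = r n" by blast
    then show ?thesis using N[of n] that r by (simp add: strict_mono_less_eq)
  qed (use e in simp)
  then show "\<exists>no. \<forall>m\<ge>no. dist (if m \<in> range r then \<tau> m else s) s < e" by blast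
qed

lemma integral_le_N1:
  assumes "continuous_on UNIV h"
  shows "ennreal (norm (integral {a..b} h)) \<le> N1 h"
proof -
  note s = L1_loc_set_integrable[OF L1_loc_continuous[OF assms], of a b]
  have "ennreal (norm (integral {a..b} h)) \<le> (\<integral>\<^sup>+x. ennreal (norm (indicator {a..b} x *\<^sub>R h x)) \<partial>lebesgue)"
    using integral_norm_bound_ennreal[OF s[unfolded set_integrable_def]] set_lebesgue_integral_eq_integral(2)[OF s]
    by (simp add: set_lebesgue_integral_def)
  also have "\<dots> \<le> N1 h" unfolding N1_def by (intro nn_integral_mono) (simp add: indicator_def)
  finally show ?thesis .
qed

definition functional :: "jp \<Rightarrow> (real \<Rightarrow> complex) \<Rightarrow> complex" where
  "functional p u = (LINT x|lebesgue. ev p (jet u x))"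

text \<open>The truncation radius is chosen after the mollification parameter, which makes the flux through
  its end points negligible. The mean value theorem evaluates the commutator term at a single time
  for each parameter, so that convergence along convergent sequences of times replaces uniform bounds.\<close>

lemma functional_conserved:
  assumes c: "X_continuous k \<Psi>" and gp: "GP_equation \<Psi>" and k: "2 \<le> k" "k \<le> 4"
    and p: "isI k p" and q: "van q" and cert: "\<And>z. vr p z (flow z) = ev (Dx q) z" and ab: "a < b"
  shows "functional p (\<Psi> b) = functional p (\<Psi> a)"
proof -
  have k1: "1 \<le> k" using k by simp
  have l: "\<Psi> t \<in> L1_loc" for t using c by (auto simp: X_continuous_def X_def)
  have X: "\<Psi> t \<in> X k" for t using c by (simp add: X_continuous_def)
  have j0: "(\<lambda>y. jet u y 0) = u" for u by (simp add: jet_def)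
  \<comment> \<open>The radius depends on n and is at least n: the flux through the end points tends
    to 0 while the intervals exhaust the line.\<close>
  have "\<forall>n. \<exists>R\<ge>real n. \<forall>\<tau>\<in>{a..b}. norm (ev q (jetm (\<Psi> \<tau>) n R)) \<le> 1 / (real n + 1) \<and> norm (ev q (jetm (\<Psi> \<tau>) n (-R))) \<le> 1 / (real n + 1)"
    by (intro allI flux_uniformly_small[OF c k1 q]) simp
  then obtain R where R: "\<And>n. real n \<le> R n"
    "\<And>n \<tau>. \<tau> \<in> {a..b} \<Longrightarrow> norm (ev q (jetm (\<Psi> \<tau>) n (R n))) \<le> 1 / (real n + 1)"
    "\<And>n \<tau>. \<tau> \<in> {a..b} \<Longrightarrow> norm (ev q (jetm (\<Psi> \<tau>) n (- R n))) \<le> 1 / (real n + 1)"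
    by metis
  have R0: "0 \<le> R n" for n using R(1)[of n] by linarith
  have Rlim: "filterlim R at_top sequentially"
    by (rule filterlim_at_top_mono[OF filterlim_real_sequentially]) (simp add: R(1))
  define f where "f n t = integral {- R n..R n} (\<lambda>x. ev p (jetm (\<Psi> t) n x))" for n t
  define h where "h n t x = vr p (jetm (\<Psi> t) n x) (commutator (\<Psi> t) n x)" for n t x
  have ch: "continuous_on UNIV (h n t)" for n t
    unfolding h_def by (rule vr_commutator_continuous[OF c k1])
  have "\<exists>\<tau>\<in>{a<..<b}. norm (f n b - f n a) \<le> (b - a) * (2 / (real n + 1) + norm (integral {- R n..R n} (h n \<tau>)))" for n
  proof -
    note d = truncated_balance[OF c gp k1 R0[of n] cert, of n, folded h_def, folded f_def]
    have "continuous_on {a..b} (f n)"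
      by (intro continuous_at_imp_continuous_on ballI has_vector_derivative_continuous[OF d])
    from mvt_general[OF ab this d[unfolded has_vector_derivative_def]]
    obtain \<tau> where \<tau>: "\<tau> \<in> {a<..<b}" and le: "norm (f n b - f n a)
       \<le> norm ((b - a) *\<^sub>R (ev q (jetm (\<Psi> \<tau>) n (R n)) - ev q (jetm (\<Psi> \<tau>) n (- R n)) + integral {- R n..R n} (h n \<tau>)))"
      by blast
    note le
    also have "norm ((b - a) *\<^sub>R (ev q (jetm (\<Psi> \<tau>) n (R n)) - ev q (jetm (\<Psi> \<tau>) n (- R n)) + integral {- R n..R n} (h n \<tau>)))
      = (b - a) * norm (ev q (jetm (\<Psi> \<tau>) n (R n)) - ev q (jetm (\<Psi> \<tau>) n (- R n)) + integral {- R n..R n} (h n \<tau>))"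
      using ab by simp
    also have "\<dots> \<le> (b - a) * ((1 / (real n + 1) + 1 / (real n + 1)) + norm (integral {- R n..R n} (h n \<tau>)))"
      using ab \<tau> by (intro mult_left_mono norm_triangle_mono order_trans[OF norm_triangle_ineq4 add_mono] R) auto
    finally show ?thesis using \<tau> by auto
  qed
  then obtain \<tau> where \<tau>: "\<And>n. \<tau> n \<in> {a<..<b}"
    "\<And>n. norm (f n b - f n a) \<le> (b - a) * (2 / (real n + 1) + norm (integral {- R n..R n} (h n (\<tau> n))))"
    by metis
  have "\<forall>n. \<tau> n \<in> {a..b}" using \<tau>(1) by (simp add: less_imp_le)
  then obtain s r where s: "strict_mono r" "(\<tau> \<circ> r) \<longlonglongrightarrow> s"
    using compact_Icc[of a b] unfolding compact_def by meson
  define \<sigma> where "\<sigma> m = (if m \<in> range r then \<tau> m else s)" for m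
  have "\<sigma> \<longlonglongrightarrow> s" unfolding \<sigma>_def by (rule tendsto_sparse[OF s(1)]) (use s(2) in \<open>simp add: o_def\<close>)
  note cv = X_continuous_conv[OF c k1 this]
  note XJ = X_XJ[OF X k1]
  \<comment> \<open>The directions tend to 0 in H^k, and the variation of the density in the
    direction 0 is 0.\<close>
  have "cI (\<lambda>m. h m (\<sigma> m)) (\<lambda>x. vr p (jet (\<Psi> s) x) (\<lambda>j. 0))"
    using vr_conv[OF jconv_jetm[OF XJ XJ cv k1] vconv_commutator[OF XJ XJ cv k] k1, of p] p
    unfolding j0 h_def by blast
  then have "(\<lambda>m. N1 (h m (\<sigma> m))) \<longlonglongrightarrow> 0" by (simp add: cI_def vr_0)
  then have "(\<lambda>n. N1 (h (r n) (\<sigma> (r n)))) \<longlonglongrightarrow> 0" using LIMSEQ_subseq_LIMSEQ[OF _ s(1)] by (simp add: o_def)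
  then have "(\<lambda>n. ennreal (norm (integral {- R (r n)..R (r n)} (h (r n) (\<tau> (r n)))))) \<longlonglongrightarrow> 0"
    by (rule ennreal_tendsto_0_le) (simp add: \<sigma>_def integral_le_N1[OF ch])
  then have "(\<lambda>n. norm (integral {- R (r n)..R (r n)} (h (r n) (\<tau> (r n))))) \<longlonglongrightarrow> 0"
    using tendsto_ennreal_iff[of "\<lambda>n. norm (integral {- R (r n)..R (r n)} (h (r n) (\<tau> (r n))))" sequentially 0] by simp
  moreover have "(\<lambda>n. 2 / (real (r n) + 1)) \<longlonglongrightarrow> 0"
    using LIMSEQ_subseq_LIMSEQ[OF tendsto_mult_left[OF is_mollifier_mol_tendsto, of 2] s(1)] by (simp add: o_def)
  ultimately have "(\<lambda>n. (b - a) * (2 / (real (r n) + 1) + norm (integral {- R (r n)..R (r n)} (h (r n) (\<tau> (r n)))))) \<longlonglongrightarrow> (b - a) * (0 + 0)"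
    by (intro tendsto_mult tendsto_add tendsto_const)
  then have "(\<lambda>n. f (r n) b - f (r n) a) \<longlonglongrightarrow> 0"
    by (intro Lim_null_comparison[OF always_eventually[OF allI[OF \<tau>(2)]]]) simp
  moreover have "(\<lambda>n. f n t) \<longlonglongrightarrow> functional p (\<Psi> t)" for t
  proof -
    have "cI (\<lambda>n x. ev p (jetm (\<Psi> t) n x)) (\<lambda>x. ev p (jet (\<Psi> t) x))"
      using ev_conv[OF jconv_jetm[OF XJ XJ XJ_jconv_const[OF XJ k1] k1, of t] k1, of p] p unfolding j0 by blast
    from cI_tendsto_integral[OF cI_truncate[OF this Rlim]]
    have "(\<lambda>n. LINT x|lebesgue. indicator {- R n..R n} x * ev p (jetm (\<Psi> t) n x)) \<longlonglongrightarrow> functional p (\<Psi> t)" by (simp add: functional_def)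
    moreover have "(LINT x|lebesgue. indicator {- R n..R n} x * ev p (jetm (\<Psi> t) n x)) = f n t" for n
    proof -
      have "continuous_on UNIV (\<lambda>x. ev p (jetm (\<Psi> t) n x))" by (intro continuous_on_ev jetm_continuous l)
      note set_lebesgue_integral_eq_integral(2)[OF L1_loc_set_integrable[OF L1_loc_continuous[OF this]], of "- R n" "R n"]
      moreover have "indicator {- R n..R n} x * ev p (jetm (\<Psi> t) n x) = indicator {- R n..R n} x *\<^sub>R ev p (jetm (\<Psi> t) n x)" for x
        by (simp add: indicator_def)
      ultimately show ?thesis by (simp add: f_def set_lebesgue_integral_def)
    qed
    ultimately show ?thesis by simp
  qed
  then have "(\<lambda>n. f (r n) b - f (r n) a) \<longlonglongrightarrow> functional p (\<Psi> b) - functional p (\<Psi> a)"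
    using LIMSEQ_subseq_LIMSEQ[OF _ s(1)] by (intro tendsto_diff) (auto simp: o_def)
  ultimately have "functional p (\<Psi> b) - functional p (\<Psi> a) = 0" using LIMSEQ_unique by blast
  then show ?thesis by simp
qed

section \<open>Densities and fluxes\<close>

primrec cj :: "jp \<Rightarrow> jp" where
  "cj (U j) = V j"
| "cj (V j) = U j"
| "cj Eta = Eta"
| "cj (K c) = K (cnj c)"
| "cj (p \<oplus> q) = cj p \<oplus> cj q"
| "cj (p \<otimes> q) = cj p \<otimes> cj q"

text \<open>This evaluates to - 2 Im p, as befits the flux of a real density; only one monomial of
  each conjugate pair is listed.\<close>

definition conj_diff :: "jp \<Rightarrow> jp" where
  "conj_diff p = K \<i> \<otimes> (p \<oplus> K (-1) \<otimes> cj p)"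

text \<open>This evaluates to 2 \<i> Re p and matches the densities of the momenta, which are purely
  imaginary after division by \<i>.\<close>

definition conj_sum :: "jp \<Rightarrow> jp" where
  "conj_sum p = K \<i> \<otimes> (p \<oplus> cj p)"

text \<open>The densities are those of \<open>E\<^sub>2, E\<^sub>3, E\<^sub>4\<close> and \<open>P\<^sub>2 / \<i>, P\<^sub>3 / \<i>, P\<^sub>4 / \<i>\<close>, multiplied by 4, 16, 16 and
  8, 16, 32 so that the coefficients are integers and no division has to be normalised.\<close>

definition dIm :: "nat \<Rightarrow> jp" where
  "dIm j = U (Suc j) \<otimes> V j \<oplus> K (-1) \<otimes> (U j \<otimes> V (Suc j))"

text \<open>Twice the real part of a product, so the coefficients - 7 * 16 in the fourth energy
  appear as - 56.\<close>

definition dRe :: "nat \<Rightarrow> nat \<Rightarrow> jp" where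
  "dRe j l = U j \<otimes> V l \<oplus> U l \<otimes> V j"

definition dE2 :: jp where
  "dE2 = K 2 \<otimes> (U 2 \<otimes> V 2) \<oplus> K (-6) \<otimes> (Eta \<otimes> (U 1 \<otimes> V 1))
    \<oplus> K 1 \<otimes> (Dx Eta \<otimes> Dx Eta) \<oplus> K (-1) \<otimes> (Eta \<otimes> (Eta \<otimes> Eta))"

definition dE3 :: jp where
  "dE3 = K 8 \<otimes> (U 3 \<otimes> V 3) \<oplus> K 4 \<otimes> (Dx (Dx Eta) \<otimes> Dx (Dx Eta))
    \<oplus> K 20 \<otimes> ((U 1 \<otimes> V 1) \<otimes> (U 1 \<otimes> V 1)) \<oplus> K 40 \<otimes> (Dx (Dx Eta) \<otimes> (U 1 \<otimes> V 1))
    \<oplus> K (-40) \<otimes> (Eta \<otimes> (U 2 \<otimes> V 2)) \<oplus> K (-20) \<otimes> (Eta \<otimes> (Dx Eta \<otimes> Dx Eta))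
    \<oplus> K 60 \<otimes> ((Eta \<otimes> Eta) \<otimes> (U 1 \<otimes> V 1)) \<oplus> K 5 \<otimes> ((Eta \<otimes> Eta) \<otimes> (Eta \<otimes> Eta))"

definition dE4 :: jp where
  "dE4 = K 8 \<otimes> (U 4 \<otimes> V 4) \<oplus> K 4 \<otimes> (Dx (Dx (Dx Eta)) \<otimes> Dx (Dx (Dx Eta)))
    \<oplus> K (-28) \<otimes> (Eta \<otimes> (Dx (Dx Eta) \<otimes> Dx (Dx Eta))) \<oplus> K (-56) \<otimes> (Eta \<otimes> (U 3 \<otimes> V 3))
    \<oplus> K 70 \<otimes> ((Eta \<otimes> Eta) \<otimes> (Dx Eta \<otimes> Dx Eta)) \<oplus> K 140 \<otimes> ((Eta \<otimes> Eta) \<otimes> (U 2 \<otimes> V 2))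
    \<oplus> K (-140) \<otimes> ((Dx Eta \<otimes> Dx Eta) \<otimes> (U 1 \<otimes> V 1))
    \<oplus> K (-56) \<otimes> ((U 1 \<otimes> V 1) \<otimes> (U 2 \<otimes> V 2))
    \<oplus> K (-56) \<otimes> (Dx (Dx Eta) \<otimes> dRe 1 3) \<oplus> K (-56) \<otimes> ((U 1 \<otimes> V 1) \<otimes> dRe 1 3)
    \<oplus> K (-280) \<otimes> ((Eta \<otimes> Dx (Dx Eta)) \<otimes> (U 1 \<otimes> V 1))
    \<oplus> K (-140) \<otimes> ((Eta \<otimes> (Eta \<otimes> Eta)) \<otimes> (U 1 \<otimes> V 1))
    \<oplus> K (-140) \<otimes> (Eta \<otimes> ((U 1 \<otimes> V 1) \<otimes> (U 1 \<otimes> V 1)))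
    \<oplus> K (-7) \<otimes> (Eta \<otimes> ((Eta \<otimes> Eta) \<otimes> (Eta \<otimes> Eta)))"

definition dP2 :: jp where
  "dP2 = K 2 \<otimes> dIm 1 \<oplus> K (-3) \<otimes> (Eta \<otimes> dIm 0)"

definition dP3 :: jp where
  "dP3 = K 4 \<otimes> dIm 2 \<oplus> K (-20) \<otimes> (Eta \<otimes> dIm 1) \<oplus> K 10 \<otimes> ((Eta \<otimes> Eta \<oplus> Eta) \<otimes> dIm 0)"

definition dP4 :: jp where
  "dP4 = K 8 \<otimes> dIm 3 \<oplus> K (-56) \<otimes> (Eta \<otimes> dIm 2) \<oplus> K 56 \<otimes> (Dx (Dx Eta) \<otimes> dIm 1)
    \<oplus> K 28 \<otimes> ((U 1 \<otimes> V 1) \<otimes> dIm 1) \<oplus> K 140 \<otimes> ((Eta \<otimes> Eta) \<otimes> dIm 1)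
    \<oplus> K (-35) \<otimes> ((Eta \<otimes> (Eta \<otimes> Eta) \<oplus> Eta \<otimes> Eta \<oplus> Eta) \<otimes> dIm 0)"

text \<open>The fluxes come from integrating the time derivative of the density, which is linear in the
  derivatives of highest order, successively in these derivatives. The part that depends on \<open>\<bar>\<Psi>\<bar>\<^sup>2\<close> only is
  written in powers of \<open>\<eta>\<close>, up to a constant, so that each term vanishes at infinity.\<close>

definition JE2 :: jp where
  "JE2 = conj_diff (
    K (-3) \<otimes> U 0 \<otimes> U 0 \<otimes> U 0 \<otimes> V 1 \<otimes> V 0 \<otimes> V 0
    \<oplus> K 6 \<otimes> U 0 \<otimes> U 0 \<otimes> V 1 \<otimes> V 0
    \<oplus> K (-2) \<otimes> U 0 \<otimes> U 0 \<otimes> V 2 \<otimes> V 1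
    \<oplus> K (-8) \<otimes> U 1 \<otimes> U 0 \<otimes> V 2 \<otimes> V 0
    \<oplus> K (-2) \<otimes> U 1 \<otimes> U 0 \<otimes> V 1 \<otimes> V 1 \<oplus> K (-3) \<otimes> U 0 \<otimes> V 1
    \<oplus> K 6 \<otimes> U 1 \<otimes> V 2 \<oplus> K (-2) \<otimes> U 2 \<otimes> V 3)"

text \<open>Terms equal to their own conjugates stand outside \<open>conj_sum\<close>, which would
  double them. In the fluxes of the energies such terms cancel.\<close>

definition JP2 :: jp where
  "JP2 = conj_sum (
    K 3 \<otimes> U 0 \<otimes> U 0 \<otimes> V 2 \<otimes> V 0 \<oplus> K (-3) \<otimes> U 0 \<otimes> V 2
    \<oplus> K 2 \<otimes> U 1 \<otimes> V 3)
    \<oplus> K \<i> \<otimes> (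
    K (-12) \<otimes> U 1 \<otimes> U 0 \<otimes> V 1 \<otimes> V 0 \<oplus> K 6 \<otimes> U 1 \<otimes> V 1
    \<oplus> K (-4) \<otimes> U 2 \<otimes> V 2 \<oplus> K (-3) \<otimes> Eta \<otimes> Eta
    \<oplus> K 2 \<otimes> Eta \<otimes> Eta \<otimes> Eta)"

definition JE3 :: jp where
  "JE3 = conj_diff (
    K (-20) \<otimes> U 0 \<otimes> U 0 \<otimes> U 0 \<otimes> U 0 \<otimes> V 1 \<otimes> V 0 \<otimes> V 0 \<otimes> V 0
    \<oplus> K 60 \<otimes> U 0 \<otimes> U 0 \<otimes> U 0 \<otimes> V 1 \<otimes> V 0 \<otimes> V 0
    \<oplus> K (-40) \<otimes> U 0 \<otimes> U 0 \<otimes> U 0 \<otimes> V 2 \<otimes> V 1 \<otimes> V 0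
    \<oplus> K 20 \<otimes> U 0 \<otimes> U 0 \<otimes> U 0 \<otimes> V 1 \<otimes> V 1 \<otimes> V 1
    \<oplus> K (-100) \<otimes> U 1 \<otimes> U 0 \<otimes> U 0 \<otimes> V 2 \<otimes> V 0 \<otimes> V 0
    \<oplus> K (-20) \<otimes> U 1 \<otimes> U 0 \<otimes> U 0 \<otimes> V 1 \<otimes> V 1 \<otimes> V 0
    \<oplus> K (-60) \<otimes> U 0 \<otimes> U 0 \<otimes> V 1 \<otimes> V 0
    \<oplus> K 40 \<otimes> U 0 \<otimes> U 0 \<otimes> V 2 \<otimes> V 1
    \<oplus> K (-8) \<otimes> U 0 \<otimes> U 0 \<otimes> V 3 \<otimes> V 2
    \<oplus> K 160 \<otimes> U 1 \<otimes> U 0 \<otimes> V 2 \<otimes> V 0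
    \<oplus> K 40 \<otimes> U 1 \<otimes> U 0 \<otimes> V 1 \<otimes> V 1
    \<oplus> K 24 \<otimes> U 1 \<otimes> U 0 \<otimes> V 3 \<otimes> V 1
    \<oplus> K (-16) \<otimes> U 1 \<otimes> U 0 \<otimes> V 2 \<otimes> V 2
    \<oplus> K (-48) \<otimes> U 2 \<otimes> U 0 \<otimes> V 3 \<otimes> V 0
    \<oplus> K (-24) \<otimes> U 2 \<otimes> U 0 \<otimes> V 2 \<otimes> V 1 \<oplus> K 20 \<otimes> U 0 \<otimes> V 1
    \<oplus> K 16 \<otimes> U 1 \<otimes> U 1 \<otimes> V 2 \<otimes> V 1 \<oplus> K (-60) \<otimes> U 1 \<otimes> V 2
    \<oplus> K 40 \<otimes> U 2 \<otimes> V 3 \<oplus> K (-8) \<otimes> U 3 \<otimes> V 4)"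

definition JP3 :: jp where
  "JP3 = conj_sum (
    K 10 \<otimes> U 0 \<otimes> U 0 \<otimes> U 0 \<otimes> V 2 \<otimes> V 0 \<otimes> V 0
    \<oplus> K (-30) \<otimes> U 0 \<otimes> U 0 \<otimes> V 2 \<otimes> V 0
    \<oplus> K 20 \<otimes> U 1 \<otimes> U 0 \<otimes> V 3 \<otimes> V 0
    \<oplus> K (-4) \<otimes> U 1 \<otimes> U 0 \<otimes> V 2 \<otimes> V 1
    \<oplus> K (-12) \<otimes> U 2 \<otimes> U 0 \<otimes> V 1 \<otimes> V 1 \<oplus> K 20 \<otimes> U 0 \<otimes> V 2
    \<oplus> K (-20) \<otimes> U 1 \<otimes> V 3 \<oplus> K 4 \<otimes> U 2 \<otimes> V 4)
    \<oplus> K \<i> \<otimes> (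
    K (-60) \<otimes> U 1 \<otimes> U 0 \<otimes> U 0 \<otimes> V 1 \<otimes> V 0 \<otimes> V 0
    \<oplus> K 120 \<otimes> U 1 \<otimes> U 0 \<otimes> V 1 \<otimes> V 0
    \<oplus> K (-40) \<otimes> U 2 \<otimes> U 0 \<otimes> V 2 \<otimes> V 0
    \<oplus> K (-4) \<otimes> U 1 \<otimes> U 1 \<otimes> V 1 \<otimes> V 1 \<oplus> K (-40) \<otimes> U 1 \<otimes> V 1
    \<oplus> K 40 \<otimes> U 2 \<otimes> V 2 \<oplus> K (-8) \<otimes> U 3 \<otimes> V 3
    \<oplus> K 10 \<otimes> Eta \<otimes> Eta \<oplus> K (-5) \<otimes> Eta \<otimes> Eta \<otimes> Eta \<otimes> Eta)"

definition JE4 :: jp where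
  "JE4 = conj_diff (

    K (-35) \<otimes> U 0 \<otimes> U 0 \<otimes> U 0 \<otimes> U 0 \<otimes> U 0 \<otimes> V 1 \<otimes> V 0 \<otimes> V 0 \<otimes> V 0 \<otimes> V 0
    \<oplus> K 140 \<otimes> U 0 \<otimes> U 0 \<otimes> U 0 \<otimes> U 0 \<otimes> V 1 \<otimes> V 0 \<otimes> V 0 \<otimes> V 0
    \<oplus> K (-140) \<otimes> U 0 \<otimes> U 0 \<otimes> U 0 \<otimes> U 0 \<otimes> V 2 \<otimes> V 1 \<otimes> V 0 \<otimes> V 0
    \<oplus> K 140 \<otimes> U 0 \<otimes> U 0 \<otimes> U 0 \<otimes> U 0 \<otimes> V 1 \<otimes> V 1 \<otimes> V 1 \<otimes> V 0
    \<oplus> K (-280) \<otimes> U 1 \<otimes> U 0 \<otimes> U 0 \<otimes> U 0 \<otimes> V 2 \<otimes> V 0 \<otimes> V 0 \<otimes> V 0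
    \<oplus> K (-210) \<otimes> U 0 \<otimes> U 0 \<otimes> U 0 \<otimes> V 1 \<otimes> V 0 \<otimes> V 0
    \<oplus> K 280 \<otimes> U 0 \<otimes> U 0 \<otimes> U 0 \<otimes> V 2 \<otimes> V 1 \<otimes> V 0
    \<oplus> K (-56) \<otimes> U 0 \<otimes> U 0 \<otimes> U 0 \<otimes> V 3 \<otimes> V 2 \<otimes> V 0
    \<oplus> K (-140) \<otimes> U 0 \<otimes> U 0 \<otimes> U 0 \<otimes> V 1 \<otimes> V 1 \<otimes> V 1
    \<oplus> K (-28) \<otimes> U 0 \<otimes> U 0 \<otimes> U 0 \<otimes> V 2 \<otimes> V 2 \<otimes> V 1
    \<oplus> K 700 \<otimes> U 1 \<otimes> U 0 \<otimes> U 0 \<otimes> V 2 \<otimes> V 0 \<otimes> V 0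
    \<oplus> K 140 \<otimes> U 1 \<otimes> U 0 \<otimes> U 0 \<otimes> V 1 \<otimes> V 1 \<otimes> V 0
    \<oplus> K 168 \<otimes> U 1 \<otimes> U 0 \<otimes> U 0 \<otimes> V 3 \<otimes> V 1 \<otimes> V 0
    \<oplus> K (-84) \<otimes> U 1 \<otimes> U 0 \<otimes> U 0 \<otimes> V 2 \<otimes> V 2 \<otimes> V 0
    \<oplus> K 196 \<otimes> U 1 \<otimes> U 0 \<otimes> U 0 \<otimes> V 2 \<otimes> V 1 \<otimes> V 1
    \<oplus> K (-196) \<otimes> U 2 \<otimes> U 0 \<otimes> U 0 \<otimes> V 3 \<otimes> V 0 \<otimes> V 0
    \<oplus> K (-224) \<otimes> U 2 \<otimes> U 0 \<otimes> U 0 \<otimes> V 2 \<otimes> V 1 \<otimes> V 0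
    \<oplus> K (-84) \<otimes> U 2 \<otimes> U 0 \<otimes> U 0 \<otimes> V 1 \<otimes> V 1 \<otimes> V 1
    \<oplus> K 140 \<otimes> U 0 \<otimes> U 0 \<otimes> V 1 \<otimes> V 0
    \<oplus> K (-140) \<otimes> U 0 \<otimes> U 0 \<otimes> V 2 \<otimes> V 1
    \<oplus> K 56 \<otimes> U 0 \<otimes> U 0 \<otimes> V 3 \<otimes> V 2
    \<oplus> K (-8) \<otimes> U 0 \<otimes> U 0 \<otimes> V 4 \<otimes> V 3
    \<oplus> K 504 \<otimes> U 1 \<otimes> U 1 \<otimes> U 0 \<otimes> V 2 \<otimes> V 1 \<otimes> V 0
    \<oplus> K (-28) \<otimes> U 1 \<otimes> U 1 \<otimes> U 0 \<otimes> V 1 \<otimes> V 1 \<otimes> V 1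
    \<oplus> K (-560) \<otimes> U 1 \<otimes> U 0 \<otimes> V 2 \<otimes> V 0
    \<oplus> K (-140) \<otimes> U 1 \<otimes> U 0 \<otimes> V 1 \<otimes> V 1
    \<oplus> K (-168) \<otimes> U 1 \<otimes> U 0 \<otimes> V 3 \<otimes> V 1
    \<oplus> K 112 \<otimes> U 1 \<otimes> U 0 \<otimes> V 2 \<otimes> V 2
    \<oplus> K (-80) \<otimes> U 1 \<otimes> U 0 \<otimes> V 4 \<otimes> V 2
    \<oplus> K (-24) \<otimes> U 1 \<otimes> U 0 \<otimes> V 3 \<otimes> V 3
    \<oplus> K 336 \<otimes> U 2 \<otimes> U 0 \<otimes> V 3 \<otimes> V 0
    \<oplus> K 168 \<otimes> U 2 \<otimes> U 0 \<otimes> V 2 \<otimes> V 1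
    \<oplus> K (-24) \<otimes> U 2 \<otimes> U 0 \<otimes> V 4 \<otimes> V 1
    \<oplus> K 8 \<otimes> U 2 \<otimes> U 0 \<otimes> V 3 \<otimes> V 2
    \<oplus> K (-64) \<otimes> U 3 \<otimes> U 0 \<otimes> V 4 \<otimes> V 0
    \<oplus> K (-32) \<otimes> U 3 \<otimes> U 0 \<otimes> V 3 \<otimes> V 1
    \<oplus> K (-8) \<otimes> U 3 \<otimes> U 0 \<otimes> V 2 \<otimes> V 2
    \<oplus> K 56 \<otimes> U 4 \<otimes> U 0 \<otimes> V 2 \<otimes> V 1 \<oplus> K (-35) \<otimes> U 0 \<otimes> V 1
    \<oplus> K (-112) \<otimes> U 1 \<otimes> U 1 \<otimes> V 2 \<otimes> V 1
    \<oplus> K (-56) \<otimes> U 1 \<otimes> U 1 \<otimes> V 4 \<otimes> V 1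
    \<oplus> K (-32) \<otimes> U 1 \<otimes> U 1 \<otimes> V 3 \<otimes> V 2
    \<oplus> K (-16) \<otimes> U 2 \<otimes> U 1 \<otimes> V 3 \<otimes> V 1
    \<oplus> K 40 \<otimes> U 2 \<otimes> U 1 \<otimes> V 2 \<otimes> V 2 \<oplus> K 140 \<otimes> U 1 \<otimes> V 2
    \<oplus> K (-140) \<otimes> U 2 \<otimes> V 3 \<oplus> K 56 \<otimes> U 3 \<otimes> V 4
    \<oplus> K (-8) \<otimes> U 4 \<otimes> V 5)"

definition JP4 :: jp where
  "JP4 = conj_sum (
    K 35 \<otimes> U 0 \<otimes> U 0 \<otimes> U 0 \<otimes> U 0 \<otimes> V 2 \<otimes> V 0 \<otimes> V 0 \<otimes> V 0
    \<oplus> K (-140) \<otimes> U 0 \<otimes> U 0 \<otimes> U 0 \<otimes> V 2 \<otimes> V 0 \<otimes> V 0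
    \<oplus> K 140 \<otimes> U 1 \<otimes> U 0 \<otimes> U 0 \<otimes> V 3 \<otimes> V 0 \<otimes> V 0
    \<oplus> K (-56) \<otimes> U 1 \<otimes> U 0 \<otimes> U 0 \<otimes> V 2 \<otimes> V 1 \<otimes> V 0
    \<oplus> K 140 \<otimes> U 1 \<otimes> U 0 \<otimes> U 0 \<otimes> V 1 \<otimes> V 1 \<otimes> V 1
    \<oplus> K (-168) \<otimes> U 2 \<otimes> U 0 \<otimes> U 0 \<otimes> V 1 \<otimes> V 1 \<otimes> V 0
    \<oplus> K 210 \<otimes> U 0 \<otimes> U 0 \<otimes> V 2 \<otimes> V 0
    \<oplus> K (-280) \<otimes> U 1 \<otimes> U 0 \<otimes> V 3 \<otimes> V 0
    \<oplus> K 56 \<otimes> U 1 \<otimes> U 0 \<otimes> V 2 \<otimes> V 1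
    \<oplus> K (-64) \<otimes> U 1 \<otimes> U 0 \<otimes> V 3 \<otimes> V 2
    \<oplus> K 56 \<otimes> U 2 \<otimes> U 0 \<otimes> V 4 \<otimes> V 0
    \<oplus> K 168 \<otimes> U 2 \<otimes> U 0 \<otimes> V 1 \<otimes> V 1
    \<oplus> K 48 \<otimes> U 2 \<otimes> U 0 \<otimes> V 3 \<otimes> V 1
    \<oplus> K 16 \<otimes> U 2 \<otimes> U 0 \<otimes> V 2 \<otimes> V 2
    \<oplus> K (-64) \<otimes> U 3 \<otimes> U 0 \<otimes> V 2 \<otimes> V 1 \<oplus> K (-105) \<otimes> U 0 \<otimes> V 2
    \<oplus> K (-36) \<otimes> U 1 \<otimes> U 1 \<otimes> V 3 \<otimes> V 1
    \<oplus> K (-40) \<otimes> U 1 \<otimes> U 1 \<otimes> V 2 \<otimes> V 2 \<oplus> K 140 \<otimes> U 1 \<otimes> V 3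
    \<oplus> K (-56) \<otimes> U 2 \<otimes> V 4 \<oplus> K 8 \<otimes> U 3 \<otimes> V 5)
    \<oplus> K \<i> \<otimes> (
    K (-280) \<otimes> U 1 \<otimes> U 0 \<otimes> U 0 \<otimes> U 0 \<otimes> V 1 \<otimes> V 0 \<otimes> V 0 \<otimes> V 0
    \<oplus> K 840 \<otimes> U 1 \<otimes> U 0 \<otimes> U 0 \<otimes> V 1 \<otimes> V 0 \<otimes> V 0
    \<oplus> K (-280) \<otimes> U 2 \<otimes> U 0 \<otimes> U 0 \<otimes> V 2 \<otimes> V 0 \<otimes> V 0
    \<oplus> K 224 \<otimes> U 1 \<otimes> U 1 \<otimes> U 0 \<otimes> V 1 \<otimes> V 1 \<otimes> V 0
    \<oplus> K (-840) \<otimes> U 1 \<otimes> U 0 \<otimes> V 1 \<otimes> V 0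
    \<oplus> K 560 \<otimes> U 2 \<otimes> U 0 \<otimes> V 2 \<otimes> V 0
    \<oplus> K (-112) \<otimes> U 3 \<otimes> U 0 \<otimes> V 3 \<otimes> V 0
    \<oplus> K 56 \<otimes> U 1 \<otimes> U 1 \<otimes> V 1 \<otimes> V 1
    \<oplus> K 64 \<otimes> U 2 \<otimes> U 1 \<otimes> V 2 \<otimes> V 1 \<oplus> K 210 \<otimes> U 1 \<otimes> V 1
    \<oplus> K (-280) \<otimes> U 2 \<otimes> V 2 \<oplus> K 112 \<otimes> U 3 \<otimes> V 3
    \<oplus> K (-16) \<otimes> U 4 \<otimes> V 4 \<oplus> K (-35) \<otimes> Eta \<otimes> Eta
    \<oplus> K 14 \<otimes> Eta \<otimes> Eta \<otimes> Eta \<otimes> Eta \<otimes> Eta)"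

section \<open>Verification of the flux identities\<close>

lemma flow_Suc: "flow z j = \<i> * (z (Suc (Suc j)) - ev ((Dx ^^ j) nlin) z)"
  by (simp add: flow_def)

lemmas jet_polynomial_simps = vr.simps ev.simps Dx.simps cj.simps conj_diff_def conj_sum_def flow_Suc nlin_def dRe_def dIm_def
  numeral_eq_Suc pred_numeral_simps One_nat_def BitM.simps funpow_simps_right funpow_0 o_apply id_apply
  complex_cnj_mult complex_cnj_diff complex_cnj_i complex_cnj_add complex_cnj_one complex_cnj_minus
  complex_cnj_zero complex_cnj_cnj complex_cnj_numeral complex_cnj_neg_numeral
  mult_zero_left mult_zero_right add_0_left add_0_right

text \<open>After unfolding, the entries of the jet and their conjugates behave as independent
  variables. Every term on both sides contains \<i> exactly once, so \<i> may be treated as an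
  indeterminate too, and a polynomial identity with integer coefficients remains.\<close>

lemma flux_identity_E2: "vr dE2 z (flow z) = ev (Dx JE2) z"
  unfolding dE2_def JE2_def by (simp only: jet_polynomial_simps) algebra

lemma flux_identity_P2: "vr dP2 z (flow z) = ev (Dx JP2) z"
  unfolding dP2_def JP2_def by (simp only: jet_polynomial_simps) algebra

lemma flux_identity_E3: "vr dE3 z (flow z) = ev (Dx JE3) z"
  unfolding dE3_def JE3_def by (simp only: jet_polynomial_simps) algebra

lemma flux_identity_P3: "vr dP3 z (flow z) = ev (Dx JP3) z"
  unfolding dP3_def JP3_def by (simp only: jet_polynomial_simps) algebra

lemma flux_identity_E4: "vr dE4 z (flow z) = ev (Dx JE4) z"
  unfolding dE4_def JE4_def by (simp only: jet_polynomial_simps) algebra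

lemma flux_identity_P4: "vr dP4 z (flow z) = ev (Dx JP4) z"
  unfolding dP4_def JP4_def by (simp only: jet_polynomial_simps) algebra

section \<open>The conserved functionals\<close>

lemma van_flux: "van JE2" "van JP2" "van JE3" "van JP3" "van JE4" "van JP4"
  by (simp_all add: JE2_def JP2_def JE3_def JP3_def JE4_def JP4_def conj_diff_def conj_sum_def)

lemma isI_density: "isI 2 dE2" "isI 2 dP2" "isI 3 dE3" "isI 3 dP3" "isI 4 dE4" "isI 4 dP4"
  by (simp_all add: dE2_def dP2_def dE3_def dP3_def dE4_def dP4_def dIm_def dRe_def numeral_eq_Suc)

lemma integrable_ev:
  assumes "u \<in> X k" "1 \<le> k" "isI k p"
  shows "integrable lebesgue (\<lambda>x. ev p (jet u x))"
  using ev_conv[OF XJ_jconv_const[OF X_XJ[OF assms(1,2)] assms(2)] assms(2), of p] assms(3) by (simp add: cI_def)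

lemma functional_Add:
  assumes "u \<in> X k" "1 \<le> k" "isI k p" "isI k q"
  shows "functional (p \<oplus> q) u = functional p u + functional q u"
  unfolding functional_def ev.simps
  by (rule Bochner_Integration.integral_add[OF integrable_ev[OF assms(1,2,3)] integrable_ev[OF assms(1,2,4)]])

lemma functional_K: "functional (K c \<otimes> p) u = c * functional p u"
  by (simp add: functional_def)

text \<open>A real integral of chosen derivatives meets a complex integral of a jet polynomial;
  measurability of \<open>r\<close> is inherited along the equality almost everywhere.\<close>

lemma functional_AE:
  assumes u: "u \<in> X k" "1 \<le> k" and p: "isI k p"
    and e: "AE x in lebesgue. complex_of_real (r x) = ev p (jet u x)"
  shows "complex_of_real (LINT x|lebesgue. r x) = functional p u"
proof -
  have m: "(\<lambda>x. ev p (jet u x)) \<in> borel_measurable lebesgue" by (intro borel_measurable_integrable integrable_ev[OF u p])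
  have "(\<lambda>x. complex_of_real (r x)) \<in> borel_measurable lebesgue"
    by (rule borel_measurable_AE[OF m]) (use e in eventually_elim, simp)
  then have "(LINT x|lebesgue. complex_of_real (r x)) = functional p u"
    unfolding functional_def by (intro integral_cong_AE m e)
  then show ?thesis by simp
qed

lemma weak_deriv_bounded_linear:
  assumes T: "bounded_linear T" and w: "has_weak_deriv j u v"
  shows "has_weak_deriv j (\<lambda>x. T (u x)) (\<lambda>x. T (v x))"
proof -
  have l: "(\<lambda>x. T (f x)) \<in> L1_loc" if "f \<in> L1_loc" for f
    using that unfolding L1_loc_def set_integrable_def
    by (auto simp: linear_cmul[OF bounded_linear.linear[OF T], symmetric] intro!: integrable_bounded_linear[OF T])
  have i: "(LINT x|lebesgue. \<phi> x *\<^sub>R T (f x)) = T (LINT x|lebesgue. \<phi> x *\<^sub>R f x)" if "f \<in> L1_loc" "test_function \<phi>" for f \<phi>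
    using integral_bounded_linear[OF T L1_loc_test_integrable[OF that]]
    by (simp add: linear_cmul[OF bounded_linear.linear[OF T]])
  show ?thesis
    using w l unfolding has_weak_deriv_def
    by (simp add: i test_derivs linear_cmul[OF bounded_linear.linear[OF T]])
qed

text \<open>The functionals contain chosen derivatives of \<eta>. Composing the chain rules of first
  order identifies them almost everywhere with the polynomials that \<open>Dx\<close>
  produces.\<close>

lemma weak_deriv_eta:
  assumes u: "u \<in> X k" "1 \<le> k" and j: "1 \<le> j"
    and p: "\<And>i. i < j \<Longrightarrow> isB k ((Dx ^^ i) Eta) \<or> isT k ((Dx ^^ i) Eta)" "isB k ((Dx ^^ j) Eta) \<or> isT k ((Dx ^^ j) Eta)"
  shows "AE x in lebesgue. complex_of_real (\<partial>\<^bsup>j\<^esup> (eta u) x) = ev ((Dx ^^ j) Eta) (jet u x)"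
proof -
  have "has_weak_deriv (Suc i) (\<lambda>x. ev Eta (jet u x)) (\<lambda>x. ev ((Dx ^^ Suc i) Eta) (jet u x))" if "i < j" for i
    using that
  proof (induction i)
    case 0
    then show ?case using XJ_poly[OF X_XJ[OF u] u(2), of Eta] p(1)[of 0] p(1)[of 1] p(2) by (cases "j = 1") auto
  next
    case (Suc i)
    have "has_weak_deriv 1 (\<lambda>x. ev ((Dx ^^ Suc i) Eta) (jet u x)) (\<lambda>x. ev ((Dx ^^ Suc (Suc i)) Eta) (jet u x))"
      using XJ_poly[OF X_XJ[OF u] u(2), of "(Dx ^^ Suc i) Eta"] p(1)[of "Suc i"] p(1)[of "Suc (Suc i)"] p(2) Suc.prems
      by (cases "j = Suc (Suc i)") auto
    from weak_deriv_comp[OF Suc.IH this] Suc.prems show ?case by simp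
  qed
  from this[of "j - 1"] j have w: "has_weak_deriv j (\<lambda>x. complex_of_real (eta u x)) (\<lambda>x. ev ((Dx ^^ j) Eta) (jet u x))"
    by (simp add: ev_Eta del: ev.simps)
  \<comment> \<open>The choice is made among real functions, the polynomial is complex: real parts
    give existence of a real derivative, which is then carried back to the complex numbers for the
    comparison.\<close>
  have "has_weak_deriv j (eta u) (\<lambda>x. Re (ev ((Dx ^^ j) Eta) (jet u x)))"
    using weak_deriv_bounded_linear[OF bounded_linear_Re w] by simp
  from weak_deriv_bounded_linear[OF bounded_linear_of_real weak_deriv_eq(1)[OF this]]
  have "has_weak_deriv j (\<lambda>x. complex_of_real (eta u x)) (\<lambda>x. complex_of_real (\<partial>\<^bsup>j\<^esup> (eta u) x))" .
  from weak_deriv_unique[OF this w] show ?thesis .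
qed

lemma functional_AE_K:
  assumes "u \<in> X k" "1 \<le> k" "isI k p"
    and "AE x in lebesgue. complex_of_real (r x) = c * ev p (jet u x)"
  shows "complex_of_real (LINT x|lebesgue. r x) = c * functional p u"
  using functional_AE[of u k "K c \<otimes> p" r] assms functional_K by simp

lemma isI_K: "isI k p \<Longrightarrow> isI k (K c \<otimes> p)"
  by simp

section \<open>Expressing the functionals through the densities\<close>

lemma cprod_i: "complex_of_real \<langle>\<i> * a, b\<rangle> = \<i> / 2 * (a * cnj b - b * cnj a)"
  by (simp add: complex_eq_iff cprod_def field_simps)

lemma cprod_re: "complex_of_real \<langle>a, b\<rangle> = 1 / 2 * (a * cnj b + b * cnj a)"
  by (simp add: complex_eq_iff cprod_def field_simps)

lemma cmod_square: "complex_of_real (cmod a) * complex_of_real (cmod a) = a * cnj a"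
  by (metis complex_norm_square power2_eq_square of_real_power)

lemma of_real_abs_square: "complex_of_real \<bar>d\<bar> * complex_of_real \<bar>d\<bar> = complex_of_real d * complex_of_real d"
  by (simp flip: of_real_mult)

lemma ev_dIm:
  "ev (dIm 0) (jet u x) = \<partial>\<^bsup>1\<^esup> u x * cnj (u x) - u x * cnj (\<partial>\<^bsup>1\<^esup> u x)"
  "ev (dIm 1) (jet u x) = \<partial>\<^bsup>2\<^esup> u x * cnj (\<partial>\<^bsup>1\<^esup> u x) - \<partial>\<^bsup>1\<^esup> u x * cnj (\<partial>\<^bsup>2\<^esup> u x)"
  "ev (dIm 2) (jet u x) = \<partial>\<^bsup>3\<^esup> u x * cnj (\<partial>\<^bsup>2\<^esup> u x) - \<partial>\<^bsup>2\<^esup> u x * cnj (\<partial>\<^bsup>3\<^esup> u x)"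
  "ev (dIm 3) (jet u x) = \<partial>\<^bsup>4\<^esup> u x * cnj (\<partial>\<^bsup>3\<^esup> u x) - \<partial>\<^bsup>3\<^esup> u x * cnj (\<partial>\<^bsup>4\<^esup> u x)"
  by (simp_all add: dIm_def jet_def numeral_eq_Suc)

lemma ev_dRe: "ev (dRe 1 3) (jet u x) = \<partial>\<^bsup>1\<^esup> u x * cnj (\<partial>\<^bsup>3\<^esup> u x) + \<partial>\<^bsup>3\<^esup> u x * cnj (\<partial>\<^bsup>1\<^esup> u x)"
  by (simp add: dRe_def jet_def)

lemma jet_numeral: "jet u x 1 = \<partial>\<^bsup>1\<^esup> u x" "jet u x (numeral n) = \<partial>\<^bsup>numeral n\<^esup> u x"
  by (simp_all add: jet_def)

lemma power_fourth: "(a::complex) ^ 4 = (a * a) * (a * a)"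
  by (simp add: power4_eq_xxxx mult.assoc)

lemma power_fifth: "(a::complex) ^ 5 = a * ((a * a) * (a * a))"
  by (simp add: eval_nat_numeral)

lemma Eta_class:
  assumes "2 \<le> k" "k \<le> 4" "i \<le> k"
  shows "isT k ((Dx ^^ i) Eta)"
proof -
  have "k = 2 \<or> k = 3 \<or> k = 4" "i = 0 \<or> i = 1 \<or> i = 2 \<or> i = 3 \<or> i = 4" using assms by auto
  then show ?thesis using assms(3) by (elim disjE; simp add: numeral_eq_Suc)
qed

lemma Dx_power: "(Dx ^^ 1) p = Dx p" "(Dx ^^ 2) p = Dx (Dx p)" "(Dx ^^ 3) p = Dx (Dx (Dx p))"
  by (simp_all add: numeral_eq_Suc)

lemma eta_jet:
  assumes "u \<in> X k" "2 \<le> k" "k \<le> 4" "1 \<le> j" "j \<le> k"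
  shows "AE x in lebesgue. complex_of_real (\<partial>\<^bsup>j\<^esup> (eta u) x) = ev ((Dx ^^ j) Eta) (jet u x)"
  by (rule weak_deriv_eta[OF assms(1)]) (use assms Eta_class in auto)

lemmas density_simps = ev.simps(1,2,5,6) ev_Eta ev_dIm ev_dRe jet_numeral cmod_square cprod_i
  of_real_mult of_real_power of_real_add of_real_abs_square power2_eq_square power3_eq_cube power_fourth power_fifth
  complex_cnj_mult complex_cnj_i

lemma E2_functional:
  assumes u: "u \<in> X 2"
  shows "4 * complex_of_real (E2 u) = functional dE2 u"
proof -
  \<comment> \<open>The derivatives of \<eta> are identified only almost everywhere; the other
    factors are jet entries by definition.\<close>
  have e: "AE x in lebesgue. complex_of_real (\<partial>\<^bsup>1\<^esup> (eta u) x) = ev (Dx Eta) (jet u x)"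
    by (intro AE_conjI eta_jet[OF u, of 1, unfolded Dx_power]) auto
  \<comment> \<open>Each term is integrable by itself, which allows the integral of the density to
    be split.\<close>
  have i: "isI 2 (U 2 \<otimes> V 2)"
    "isI 2 (Eta \<otimes> (U 1 \<otimes> V 1))"
    "isI 2 (Dx Eta \<otimes> Dx Eta)"
    "isI 2 (Eta \<otimes> (Eta \<otimes> Eta))"
    by (simp_all add: dIm_def dRe_def)
  have t: "complex_of_real (LINT x|lebesgue. (cmod (\<partial>\<^bsup>2\<^esup> u x))\<^sup>2) = functional (U 2 \<otimes> V 2) u"
    "complex_of_real (LINT x|lebesgue. eta u x * (cmod (\<partial>\<^bsup>1\<^esup> u x))\<^sup>2) = functional (Eta \<otimes> (U 1 \<otimes> V 1)) u"
    "complex_of_real (LINT x|lebesgue. (\<partial>\<^bsup>1\<^esup> (eta u) x)\<^sup>2) = functional (Dx Eta \<otimes> Dx Eta) u"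
    "complex_of_real (LINT x|lebesgue. eta u x ^ 3) = functional (Eta \<otimes> (Eta \<otimes> Eta)) u"
    subgoal by (rule functional_AE[OF u _ i(1)], simp, rule eventually_mono[OF e], simp only: density_simps; thin_tac "_", algebra)
    subgoal by (rule functional_AE[OF u _ i(2)], simp, rule eventually_mono[OF e], simp only: density_simps; thin_tac "_", algebra)
    subgoal by (rule functional_AE[OF u _ i(3)], simp, rule eventually_mono[OF e], simp only: density_simps; thin_tac "_", algebra)
    subgoal by (rule functional_AE[OF u _ i(4)], simp, rule eventually_mono[OF e], simp only: density_simps; thin_tac "_", algebra)
    done
  show ?thesis
    unfolding E2_def dE2_def Let_def
    by (simp only: functional_Add[OF u] isI.simps(5) isI_K i one_le_numeral simp_thms functional_K t of_real_add of_real_diff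
      of_real_mult of_real_divide of_real_numeral of_real_1 of_real_minus; algebra)
qed

text \<open>Each pairing with \<i> is \<i> / 2 times the antisymmetric expression
  \<open>dIm\<close>; doubling the multiplier 4 to 8 absorbs the half and leaves one factor
  \<i>.\<close>

lemma P2_functional:
  assumes u: "u \<in> X 2"
  shows "8 * complex_of_real (P2 u) = \<i> * functional dP2 u"
proof -
  have i: "isI 2 (dIm 1)"
    "isI 2 ((Eta \<otimes> dIm 0))"
    by (simp_all add: dIm_def dRe_def)
  have t: "complex_of_real (LINT x|lebesgue. \<langle>\<i> * \<partial>\<^bsup>2\<^esup> u x, \<partial>\<^bsup>1\<^esup> u x\<rangle>) = \<i> / 2 * functional (dIm 1) u"
    "complex_of_real (LINT x|lebesgue. eta u x * \<langle>\<i> * \<partial>\<^bsup>1\<^esup> u x, u x\<rangle>) = \<i> / 2 * functional ((Eta \<otimes> dIm 0)) u"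
    subgoal by (rule functional_AE_K[OF u _ i(1)], simp, rule AE_I2, simp only: density_simps; thin_tac "_", algebra)
    subgoal by (rule functional_AE_K[OF u _ i(2)], simp, rule AE_I2, simp only: density_simps; thin_tac "_", algebra)
    done
  show ?thesis
    unfolding P2_def dP2_def Let_def
    by (simp only: functional_Add[OF u] isI.simps(5) isI_K i one_le_numeral simp_thms functional_K t of_real_add of_real_diff
      of_real_mult of_real_divide of_real_numeral of_real_1 of_real_minus; algebra)
qed

lemma E3_functional:
  assumes u: "u \<in> X 3"
  shows "16 * complex_of_real (E3 u) = functional dE3 u"
proof -
  have e: "AE x in lebesgue. complex_of_real (\<partial>\<^bsup>1\<^esup> (eta u) x) = ev (Dx Eta) (jet u x) \<and>
      complex_of_real (\<partial>\<^bsup>2\<^esup> (eta u) x) = ev (Dx (Dx Eta)) (jet u x)"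
    by (intro AE_conjI eta_jet[OF u, of 1, unfolded Dx_power] eta_jet[OF u, of 2, unfolded Dx_power]) auto
  have i: "isI 3 (U 3 \<otimes> V 3)"
    "isI 3 (Dx (Dx Eta) \<otimes> Dx (Dx Eta))"
    "isI 3 ((U 1 \<otimes> V 1) \<otimes> (U 1 \<otimes> V 1))"
    "isI 3 (Dx (Dx Eta) \<otimes> (U 1 \<otimes> V 1))"
    "isI 3 (Eta \<otimes> (U 2 \<otimes> V 2))"
    "isI 3 (Eta \<otimes> (Dx Eta \<otimes> Dx Eta))"
    "isI 3 ((Eta \<otimes> Eta) \<otimes> (U 1 \<otimes> V 1))"
    "isI 3 ((Eta \<otimes> Eta) \<otimes> (Eta \<otimes> Eta))"
    by (simp_all add: dIm_def dRe_def)
  have t: "complex_of_real (LINT x|lebesgue. (cmod (\<partial>\<^bsup>3\<^esup> u x))\<^sup>2) = functional (U 3 \<otimes> V 3) u"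
    "complex_of_real (LINT x|lebesgue. \<bar>\<partial>\<^bsup>2\<^esup> (eta u) x\<bar>\<^sup>2) = functional (Dx (Dx Eta) \<otimes> Dx (Dx Eta)) u"
    "complex_of_real (LINT x|lebesgue. cmod (\<partial>\<^bsup>1\<^esup> u x) ^ 4) = functional ((U 1 \<otimes> V 1) \<otimes> (U 1 \<otimes> V 1)) u"
    "complex_of_real (LINT x|lebesgue. \<partial>\<^bsup>2\<^esup> (eta u) x * (cmod (\<partial>\<^bsup>1\<^esup> u x))\<^sup>2) = functional (Dx (Dx Eta) \<otimes> (U 1 \<otimes> V 1)) u"
    "complex_of_real (LINT x|lebesgue. eta u x * (cmod (\<partial>\<^bsup>2\<^esup> u x))\<^sup>2) = functional (Eta \<otimes> (U 2 \<otimes> V 2)) u"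
    "complex_of_real (LINT x|lebesgue. eta u x * (\<partial>\<^bsup>1\<^esup> (eta u) x)\<^sup>2) = functional (Eta \<otimes> (Dx Eta \<otimes> Dx Eta)) u"
    "complex_of_real (LINT x|lebesgue. (eta u x)\<^sup>2 * (cmod (\<partial>\<^bsup>1\<^esup> u x))\<^sup>2) = functional ((Eta \<otimes> Eta) \<otimes> (U 1 \<otimes> V 1)) u"
    "complex_of_real (LINT x|lebesgue. eta u x ^ 4) = functional ((Eta \<otimes> Eta) \<otimes> (Eta \<otimes> Eta)) u"
    subgoal by (rule functional_AE[OF u _ i(1)], simp, rule eventually_mono[OF e], simp only: density_simps; thin_tac "_", algebra)
    subgoal by (rule functional_AE[OF u _ i(2)], simp, rule eventually_mono[OF e], simp only: density_simps; thin_tac "_", algebra)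
    subgoal by (rule functional_AE[OF u _ i(3)], simp, rule eventually_mono[OF e], simp only: density_simps; thin_tac "_", algebra)
    subgoal by (rule functional_AE[OF u _ i(4)], simp, rule eventually_mono[OF e], simp only: density_simps; thin_tac "_", algebra)
    subgoal by (rule functional_AE[OF u _ i(5)], simp, rule eventually_mono[OF e], simp only: density_simps; thin_tac "_", algebra)
    subgoal by (rule functional_AE[OF u _ i(6)], simp, rule eventually_mono[OF e], simp only: density_simps; thin_tac "_", algebra)
    subgoal by (rule functional_AE[OF u _ i(7)], simp, rule eventually_mono[OF e], simp only: density_simps; thin_tac "_", algebra)
    subgoal by (rule functional_AE[OF u _ i(8)], simp, rule eventually_mono[OF e], simp only: density_simps; thin_tac "_", algebra)
    done
  show ?thesis
    unfolding E3_def dE3_def Let_def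
    by (simp only: functional_Add[OF u] isI.simps(5) isI_K i one_le_numeral simp_thms functional_K t of_real_add of_real_diff
      of_real_mult of_real_divide of_real_numeral of_real_1 of_real_minus; algebra)
qed

lemma P3_functional:
  assumes u: "u \<in> X 3"
  shows "16 * complex_of_real (P3 u) = \<i> * functional dP3 u"
proof -
  have i: "isI 3 (dIm 2)"
    "isI 3 ((Eta \<otimes> dIm 1))"
    "isI 3 (((Eta \<otimes> Eta \<oplus> Eta) \<otimes> dIm 0))"
    by (simp_all add: dIm_def dRe_def)
  have t: "complex_of_real (LINT x|lebesgue. \<langle>\<i> * \<partial>\<^bsup>3\<^esup> u x, \<partial>\<^bsup>2\<^esup> u x\<rangle>) = \<i> / 2 * functional (dIm 2) u"
    "complex_of_real (LINT x|lebesgue. eta u x * \<langle>\<i> * \<partial>\<^bsup>2\<^esup> u x, \<partial>\<^bsup>1\<^esup> u x\<rangle>) = \<i> / 2 * functional ((Eta \<otimes> dIm 1)) u"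
    "complex_of_real (LINT x|lebesgue. ((eta u x)\<^sup>2 + eta u x) * \<langle>\<i> * \<partial>\<^bsup>1\<^esup> u x, u x\<rangle>) = \<i> / 2 * functional (((Eta \<otimes> Eta \<oplus> Eta) \<otimes> dIm 0)) u"
    subgoal by (rule functional_AE_K[OF u _ i(1)], simp, rule AE_I2, simp only: density_simps; thin_tac "_", algebra)
    subgoal by (rule functional_AE_K[OF u _ i(2)], simp, rule AE_I2, simp only: density_simps; thin_tac "_", algebra)
    subgoal by (rule functional_AE_K[OF u _ i(3)], simp, rule AE_I2, simp only: density_simps; thin_tac "_", algebra)
    done
  show ?thesis
    unfolding P3_def dP3_def Let_def
    by (simp only: functional_Add[OF u] isI.simps(5) isI_K i one_le_numeral simp_thms functional_K t of_real_add of_real_diff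
      of_real_mult of_real_divide of_real_numeral of_real_1 of_real_minus; algebra)
qed

lemma E4_functional:
  assumes u: "u \<in> X 4"
  shows "16 * complex_of_real (E4 u) = functional dE4 u"
proof -
  have e: "AE x in lebesgue. complex_of_real (\<partial>\<^bsup>1\<^esup> (eta u) x) = ev (Dx Eta) (jet u x) \<and>
      complex_of_real (\<partial>\<^bsup>2\<^esup> (eta u) x) = ev (Dx (Dx Eta)) (jet u x) \<and>
      complex_of_real (\<partial>\<^bsup>3\<^esup> (eta u) x) = ev (Dx (Dx (Dx Eta))) (jet u x)"
    by (intro AE_conjI eta_jet[OF u, of 1, unfolded Dx_power] eta_jet[OF u, of 2, unfolded Dx_power] eta_jet[OF u, of 3, unfolded Dx_power]) auto
  have i: "isI 4 (U 4 \<otimes> V 4)"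
    "isI 4 (Dx (Dx (Dx Eta)) \<otimes> Dx (Dx (Dx Eta)))"
    "isI 4 (Eta \<otimes> (Dx (Dx Eta) \<otimes> Dx (Dx Eta)))"
    "isI 4 (Eta \<otimes> (U 3 \<otimes> V 3))"
    "isI 4 ((Eta \<otimes> Eta) \<otimes> (Dx Eta \<otimes> Dx Eta))"
    "isI 4 ((Eta \<otimes> Eta) \<otimes> (U 2 \<otimes> V 2))"
    "isI 4 ((Dx Eta \<otimes> Dx Eta) \<otimes> (U 1 \<otimes> V 1))"
    "isI 4 ((U 1 \<otimes> V 1) \<otimes> (U 2 \<otimes> V 2))"
    "isI 4 ((Dx (Dx Eta) \<otimes> dRe 1 3))"
    "isI 4 (((U 1 \<otimes> V 1) \<otimes> dRe 1 3))"
    "isI 4 ((Eta \<otimes> Dx (Dx Eta)) \<otimes> (U 1 \<otimes> V 1))"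
    "isI 4 ((Eta \<otimes> (Eta \<otimes> Eta)) \<otimes> (U 1 \<otimes> V 1))"
    "isI 4 (Eta \<otimes> ((U 1 \<otimes> V 1) \<otimes> (U 1 \<otimes> V 1)))"
    "isI 4 (Eta \<otimes> ((Eta \<otimes> Eta) \<otimes> (Eta \<otimes> Eta)))"
    by (simp_all add: dIm_def dRe_def)
  have t: "complex_of_real (LINT x|lebesgue. (cmod (\<partial>\<^bsup>4\<^esup> u x))\<^sup>2) = functional (U 4 \<otimes> V 4) u"
    "complex_of_real (LINT x|lebesgue. \<bar>\<partial>\<^bsup>3\<^esup> (eta u) x\<bar>\<^sup>2) = functional (Dx (Dx (Dx Eta)) \<otimes> Dx (Dx (Dx Eta))) u"
    "complex_of_real (LINT x|lebesgue. eta u x * (\<partial>\<^bsup>2\<^esup> (eta u) x)\<^sup>2) = functional (Eta \<otimes> (Dx (Dx Eta) \<otimes> Dx (Dx Eta))) u"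
    "complex_of_real (LINT x|lebesgue. eta u x * (cmod (\<partial>\<^bsup>3\<^esup> u x))\<^sup>2) = functional (Eta \<otimes> (U 3 \<otimes> V 3)) u"
    "complex_of_real (LINT x|lebesgue. (eta u x)\<^sup>2 * (\<partial>\<^bsup>1\<^esup> (eta u) x)\<^sup>2) = functional ((Eta \<otimes> Eta) \<otimes> (Dx Eta \<otimes> Dx Eta)) u"
    "complex_of_real (LINT x|lebesgue. (eta u x)\<^sup>2 * (cmod (\<partial>\<^bsup>2\<^esup> u x))\<^sup>2) = functional ((Eta \<otimes> Eta) \<otimes> (U 2 \<otimes> V 2)) u"
    "complex_of_real (LINT x|lebesgue. (\<partial>\<^bsup>1\<^esup> (eta u) x)\<^sup>2 * (cmod (\<partial>\<^bsup>1\<^esup> u x))\<^sup>2) = functional ((Dx Eta \<otimes> Dx Eta) \<otimes> (U 1 \<otimes> V 1)) u"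
    "complex_of_real (LINT x|lebesgue. (cmod (\<partial>\<^bsup>1\<^esup> u x))\<^sup>2 * (cmod (\<partial>\<^bsup>2\<^esup> u x))\<^sup>2) = functional ((U 1 \<otimes> V 1) \<otimes> (U 2 \<otimes> V 2)) u"
    "complex_of_real (LINT x|lebesgue. \<partial>\<^bsup>2\<^esup> (eta u) x * \<langle>\<partial>\<^bsup>1\<^esup> u x, \<partial>\<^bsup>3\<^esup> u x\<rangle>) = 1 / 2 * functional ((Dx (Dx Eta) \<otimes> dRe 1 3)) u"
    "complex_of_real (LINT x|lebesgue. (cmod (\<partial>\<^bsup>1\<^esup> u x))\<^sup>2 * \<langle>\<partial>\<^bsup>1\<^esup> u x, \<partial>\<^bsup>3\<^esup> u x\<rangle>) = 1 / 2 * functional (((U 1 \<otimes> V 1) \<otimes> dRe 1 3)) u"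
    "complex_of_real (LINT x|lebesgue. eta u x * \<partial>\<^bsup>2\<^esup> (eta u) x * (cmod (\<partial>\<^bsup>1\<^esup> u x))\<^sup>2) = functional ((Eta \<otimes> Dx (Dx Eta)) \<otimes> (U 1 \<otimes> V 1)) u"
    "complex_of_real (LINT x|lebesgue. eta u x ^ 3 * (cmod (\<partial>\<^bsup>1\<^esup> u x))\<^sup>2) = functional ((Eta \<otimes> (Eta \<otimes> Eta)) \<otimes> (U 1 \<otimes> V 1)) u"
    "complex_of_real (LINT x|lebesgue. eta u x * cmod (\<partial>\<^bsup>1\<^esup> u x) ^ 4) = functional (Eta \<otimes> ((U 1 \<otimes> V 1) \<otimes> (U 1 \<otimes> V 1))) u"
    "complex_of_real (LINT x|lebesgue. eta u x ^ 5) = functional (Eta \<otimes> ((Eta \<otimes> Eta) \<otimes> (Eta \<otimes> Eta))) u"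
    subgoal by (rule functional_AE[OF u _ i(1)], simp, rule eventually_mono[OF e], simp only: density_simps; thin_tac "_", algebra)
    subgoal by (rule functional_AE[OF u _ i(2)], simp, rule eventually_mono[OF e], simp only: density_simps; thin_tac "_", algebra)
    subgoal by (rule functional_AE[OF u _ i(3)], simp, rule eventually_mono[OF e], simp only: density_simps; thin_tac "_", algebra)
    subgoal by (rule functional_AE[OF u _ i(4)], simp, rule eventually_mono[OF e], simp only: density_simps; thin_tac "_", algebra)
    subgoal by (rule functional_AE[OF u _ i(5)], simp, rule eventually_mono[OF e], simp only: density_simps; thin_tac "_", algebra)
    subgoal by (rule functional_AE[OF u _ i(6)], simp, rule eventually_mono[OF e], simp only: density_simps; thin_tac "_", algebra)
    subgoal by (rule functional_AE[OF u _ i(7)], simp, rule eventually_mono[OF e], simp only: density_simps; thin_tac "_", algebra)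
    subgoal by (rule functional_AE[OF u _ i(8)], simp, rule eventually_mono[OF e], simp only: density_simps; thin_tac "_", algebra)
    subgoal by (rule functional_AE_K[OF u _ i(9)], simp, rule eventually_mono[OF e], simp only: density_simps cprod_re; thin_tac "_", algebra)
    subgoal by (rule functional_AE_K[OF u _ i(10)], simp, rule eventually_mono[OF e], simp only: density_simps cprod_re; thin_tac "_", algebra)
    subgoal by (rule functional_AE[OF u _ i(11)], simp, rule eventually_mono[OF e], simp only: density_simps; thin_tac "_", algebra)
    subgoal by (rule functional_AE[OF u _ i(12)], simp, rule eventually_mono[OF e], simp only: density_simps; thin_tac "_", algebra)
    subgoal by (rule functional_AE[OF u _ i(13)], simp, rule eventually_mono[OF e], simp only: density_simps; thin_tac "_", algebra)
    subgoal by (rule functional_AE[OF u _ i(14)], simp, rule eventually_mono[OF e], simp only: density_simps; thin_tac "_", algebra)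
    done
  show ?thesis
    unfolding E4_def dE4_def Let_def
    by (simp only: functional_Add[OF u] isI.simps(5) isI_K i one_le_numeral simp_thms functional_K t of_real_add of_real_diff
      of_real_mult of_real_divide of_real_numeral of_real_1 of_real_minus; algebra)
qed

lemma P4_functional:
  assumes u: "u \<in> X 4"
  shows "32 * complex_of_real (P4 u) = \<i> * functional dP4 u"
proof -
  have e: "AE x in lebesgue. complex_of_real (\<partial>\<^bsup>1\<^esup> (eta u) x) = ev (Dx Eta) (jet u x) \<and>
      complex_of_real (\<partial>\<^bsup>2\<^esup> (eta u) x) = ev (Dx (Dx Eta)) (jet u x)"
    by (intro AE_conjI eta_jet[OF u, of 1, unfolded Dx_power] eta_jet[OF u, of 2, unfolded Dx_power]) auto
  have i: "isI 4 (dIm 3)"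
    "isI 4 ((Eta \<otimes> dIm 2))"
    "isI 4 ((Dx (Dx Eta) \<otimes> dIm 1))"
    "isI 4 (((U 1 \<otimes> V 1) \<otimes> dIm 1))"
    "isI 4 (((Eta \<otimes> Eta) \<otimes> dIm 1))"
    "isI 4 (((Eta \<otimes> (Eta \<otimes> Eta) \<oplus> Eta \<otimes> Eta \<oplus> Eta) \<otimes> dIm 0))"
    by (simp_all add: dIm_def dRe_def)
  have t: "complex_of_real (LINT x|lebesgue. \<langle>\<i> * \<partial>\<^bsup>4\<^esup> u x, \<partial>\<^bsup>3\<^esup> u x\<rangle>) = \<i> / 2 * functional (dIm 3) u"
    "complex_of_real (LINT x|lebesgue. eta u x * \<langle>\<i> * \<partial>\<^bsup>3\<^esup> u x, \<partial>\<^bsup>2\<^esup> u x\<rangle>) = \<i> / 2 * functional ((Eta \<otimes> dIm 2)) u"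
    "complex_of_real (LINT x|lebesgue. \<partial>\<^bsup>2\<^esup> (eta u) x * \<langle>\<i> * \<partial>\<^bsup>2\<^esup> u x, \<partial>\<^bsup>1\<^esup> u x\<rangle>) = \<i> / 2 * functional ((Dx (Dx Eta) \<otimes> dIm 1)) u"
    "complex_of_real (LINT x|lebesgue. (cmod (\<partial>\<^bsup>1\<^esup> u x))\<^sup>2 * \<langle>\<i> * \<partial>\<^bsup>2\<^esup> u x, \<partial>\<^bsup>1\<^esup> u x\<rangle>) = \<i> / 2 * functional (((U 1 \<otimes> V 1) \<otimes> dIm 1)) u"
    "complex_of_real (LINT x|lebesgue. (eta u x)\<^sup>2 * \<langle>\<i> * \<partial>\<^bsup>2\<^esup> u x, \<partial>\<^bsup>1\<^esup> u x\<rangle>) = \<i> / 2 * functional (((Eta \<otimes> Eta) \<otimes> dIm 1)) u"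
    "complex_of_real (LINT x|lebesgue. (eta u x ^ 3 + (eta u x)\<^sup>2 + eta u x) * \<langle>\<i> * \<partial>\<^bsup>1\<^esup> u x, u x\<rangle>) = \<i> / 2 * functional (((Eta \<otimes> (Eta \<otimes> Eta) \<oplus> Eta \<otimes> Eta \<oplus> Eta) \<otimes> dIm 0)) u"
    subgoal by (rule functional_AE_K[OF u _ i(1)], simp, rule eventually_mono[OF e], simp only: density_simps; thin_tac "_", algebra)
    subgoal by (rule functional_AE_K[OF u _ i(2)], simp, rule eventually_mono[OF e], simp only: density_simps; thin_tac "_", algebra)
    subgoal by (rule functional_AE_K[OF u _ i(3)], simp, rule eventually_mono[OF e], simp only: density_simps; thin_tac "_", algebra)
    subgoal by (rule functional_AE_K[OF u _ i(4)], simp, rule eventually_mono[OF e], simp only: density_simps; thin_tac "_", algebra)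
    subgoal by (rule functional_AE_K[OF u _ i(5)], simp, rule eventually_mono[OF e], simp only: density_simps; thin_tac "_", algebra)
    subgoal by (rule functional_AE_K[OF u _ i(6)], simp, rule eventually_mono[OF e], simp only: density_simps; thin_tac "_", algebra)
    done
  show ?thesis
    unfolding P4_def dP4_def Let_def
    by (simp only: functional_Add[OF u] isI.simps(5) isI_K i one_le_numeral simp_thms functional_K t of_real_add of_real_diff
      of_real_mult of_real_divide of_real_numeral of_real_1 of_real_minus; algebra)
qed

text \<open>Functions equal almost everywhere have the same set of weak derivatives, so the choice
  returns the very same function: the equality holds everywhere.\<close>

lemma weak_deriv_cong_AE:
  assumes "u \<in> L1_loc" "v \<in> L1_loc" "AE x in lebesgue. u x = v x"
  shows "\<partial>\<^bsup>j\<^esup> u = \<partial>\<^bsup>j\<^esup> v"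
proof -
  have "(LINT x|lebesgue. (deriv ^^ j) \<phi> x *\<^sub>R u x) = (LINT x|lebesgue. (deriv ^^ j) \<phi> x *\<^sub>R v x)" if "test_function \<phi>" for \<phi>
    using L1_loc_test_integrable[OF assms(1) test_derivs[OF that, of j]] L1_loc_test_integrable[OF assms(2) test_derivs[OF that, of j]]
    by (intro integral_cong_AE borel_measurable_integrable) (use assms(3) in \<open>auto elim: eventually_mono\<close>)
  then have "has_weak_deriv j u = has_weak_deriv j v"
    using assms(1,2) by (intro ext) (auto simp: has_weak_deriv_def)
  then show ?thesis by (simp add: weak_deriv_def)
qed

lemma functional_cong_AE:
  assumes u: "u \<in> X k" and v: "v \<in> X k" and k: "1 \<le> k" and p: "isI k p" and e: "AE x in lebesgue. u x = v x"
  shows "functional p u = functional p v"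
proof -
  have "\<partial>\<^bsup>j\<^esup> u = \<partial>\<^bsup>j\<^esup> v" for j
    using u v by (intro weak_deriv_cong_AE e) (auto simp: X_def)
  then have "u x = v x \<Longrightarrow> jet u x = jet v x" for x by (simp add: jet_def fun_eq_iff)
  then show ?thesis
    unfolding functional_def using e
    by (intro integral_cong_AE borel_measurable_integrable integrable_ev[OF u k p] integrable_ev[OF v k p])
      (auto elim: eventually_mono)
qed

lemma functional_solution:
  assumes \<Psi>\<^sub>0: "\<Psi>\<^sub>0 \<in> X k" and sol: "GP_solution k \<Psi>\<^sub>0 \<Psi>" and k: "2 \<le> k" "k \<le> 4"
    and p: "isI k p" "van q" "\<And>z. vr p z (flow z) = ev (Dx q) z"
  shows "functional p (\<Psi> t) = functional p \<Psi>\<^sub>0"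
proof -
  have c: "X_continuous k \<Psi>" and gp: "GP_equation \<Psi>" and ae: "AE x in lebesgue. \<Psi> 0 x = \<Psi>\<^sub>0 x"
    using sol by (auto simp: GP_solution_def)
  consider "0 < t" | "t < 0" | "t = 0" by linarith
  then have "functional p (\<Psi> t) = functional p (\<Psi> 0)"
  proof cases
    case 1
    then show ?thesis by (rule functional_conserved[OF c gp k p])
  next
    case 2
    then show ?thesis by (rule functional_conserved[OF c gp k p, symmetric])
  qed simp
  also have "\<dots> = functional p \<Psi>\<^sub>0"
    by (rule functional_cong_AE[OF _ \<Psi>\<^sub>0 _ p(1) ae]) (use c k in \<open>auto simp: X_continuous_def\<close>)
  finally show ?thesis .
qed

theorem theorem3p3:
  fixes k :: nat and \<Psi>\<^sub>0 :: "real \<Rightarrow> complex" and \<Psi> :: "real \<Rightarrow> real \<Rightarrow> complex" and t :: real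
  assumes "2 \<le> k" and "k \<le> 4"
    and "\<Psi>\<^sub>0 \<in> X k"
    and "GP_solution k \<Psi>\<^sub>0 \<Psi>"
  shows "GP_P k (\<Psi> t) = GP_P k \<Psi>\<^sub>0 \<and> GP_E k (\<Psi> t) = GP_E k \<Psi>\<^sub>0"
proof -
  have X: "\<Psi> t \<in> X k" using assms(4) by (simp add: GP_solution_def X_continuous_def)
  note conserved = functional_solution[OF assms(3,4,1,2)]
  consider "k = 2" | "k = 3" | "k = 4" using assms(1,2) by linarith
  then show ?thesis
  proof cases
    case 1
    have X': "\<Psi> t \<in> X 2" "\<Psi>\<^sub>0 \<in> X 2" using X assms(3) 1 by simp_all
    have "functional dP2 (\<Psi> t) = functional dP2 \<Psi>\<^sub>0"
      by (rule conserved[OF _ van_flux(2) flux_identity_P2]) (simp only: 1 isI_density)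
    then have "8 * complex_of_real (P2 (\<Psi> t)) = 8 * complex_of_real (P2 \<Psi>\<^sub>0)"
      by (simp only: P2_functional X')
    moreover have "functional dE2 (\<Psi> t) = functional dE2 \<Psi>\<^sub>0"
      by (rule conserved[OF _ van_flux(1) flux_identity_E2]) (simp only: 1 isI_density)
    then have "4 * complex_of_real (E2 (\<Psi> t)) = 4 * complex_of_real (E2 \<Psi>\<^sub>0)"
      by (simp only: E2_functional X')
    ultimately show ?thesis using 1 by (simp add: GP_P_def GP_E_def)
  next
    case 2
    have X': "\<Psi> t \<in> X 3" "\<Psi>\<^sub>0 \<in> X 3" using X assms(3) 2 by simp_all
    have "functional dP3 (\<Psi> t) = functional dP3 \<Psi>\<^sub>0"
      by (rule conserved[OF _ van_flux(4) flux_identity_P3]) (simp only: 2 isI_density)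
    then have "16 * complex_of_real (P3 (\<Psi> t)) = 16 * complex_of_real (P3 \<Psi>\<^sub>0)"
      by (simp only: P3_functional X')
    moreover have "functional dE3 (\<Psi> t) = functional dE3 \<Psi>\<^sub>0"
      by (rule conserved[OF _ van_flux(3) flux_identity_E3]) (simp only: 2 isI_density)
    then have "16 * complex_of_real (E3 (\<Psi> t)) = 16 * complex_of_real (E3 \<Psi>\<^sub>0)"
      by (simp only: E3_functional X')
    ultimately show ?thesis using 2 by (simp add: GP_P_def GP_E_def)
  next
    case 3
    have X': "\<Psi> t \<in> X 4" "\<Psi>\<^sub>0 \<in> X 4" using X assms(3) 3 by simp_all
    have "functional dP4 (\<Psi> t) = functional dP4 \<Psi>\<^sub>0"
      by (rule conserved[OF _ van_flux(6) flux_identity_P4]) (simp only: 3 isI_density)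
    then have "32 * complex_of_real (P4 (\<Psi> t)) = 32 * complex_of_real (P4 \<Psi>\<^sub>0)"
      by (simp only: P4_functional X')
    moreover have "functional dE4 (\<Psi> t) = functional dE4 \<Psi>\<^sub>0"
      by (rule conserved[OF _ van_flux(5) flux_identity_E4]) (simp only: 3 isI_density)
    then have "16 * complex_of_real (E4 (\<Psi> t)) = 16 * complex_of_real (E4 \<Psi>\<^sub>0)"
      by (simp only: E4_functional X')
    ultimately show ?thesis using 3 by (simp add: GP_P_def GP_E_def)
  qed
qed

end
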